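(* For $j=1,2$ let $k_j\in\{\mathbf R,\mathbf C\}$ and let $G_j$ be an adjoint Kac--Moody group of finite rank over $k_j$ which is generated by its root subgroups, endowed with the Kac--Peterson topology. Then every measurable homomorphism $\phi\colon G_1\to G_2$ is continuous.
   Context: Adjoint Kac--Moody groups over $k\in\{\mathbf R,\mathbf C\}$. Let $I$ be a finite set, $A=(a_{ij})_{i,j\in I}$ a generalized Cartan matrix, and $(I,A,\Lambda,(c_i),(h_i))$ a Kac--Moody root datum: $\Lambda$ is a free $\mathbf Z$-module of finite rank with dual $\Lambda^\vee$, $c_i\in\Lambda$, $h_i\in\Lambda^\vee$, $\langle c_j,h_i\rangle=a_{ij}$. Let $\mathfrak g$ be the corresponding Kac--Moody Lie algebra over $k$, generated by $\Lambda^\vee\otimes k$ and Chevalley generators $e_i,f_i$ (Serre relations, normalised by $[e_i,f_i]=-h_i$), with root space decomposition, Weyl group $W=\langle s_i\mid i\in I\rangle$ and set of real roots $\Phi^{re}=W\cdot\{\alpha_i\mid i\in I\}$; for $\gamma\in\Phi^{re}$ let $e_\gamma$ be a nonzero vector of the (one-dimensional) root space $\mathfrak g_\gamma$, with $e_{\alpha_i}=e_i$, $e_{-\alpha_i}=f_i$. The adjoint Kac--Moody group $G$ is the image, under the adjoint representation on $\mathfrak g$, of the Kac--Moody group over $k$ (in the sense of Tits) of this root datum. Concretely, it is the subgroup of $\mathrm{Aut}(\mathfrak g)$ generated by the root subgroups $U_\gamma=\{\exp(r\,\mathrm{ad}\,e_\gamma)\mid r\in k\}$, $\gamma\in\Phi^{re}$,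 and the torus $T$, the image of $\mathrm{Hom}(\Lambda,k^\times)$, where $t$ acts trivially on $\Lambda^\vee\otimes k$ and by the scalar $\prod_i t(c_i)^{n_i}$ on the root space of $\sum_i n_i\alpha_i$. It is assumed that the $U_\gamma$ generate $G$. Kac--Peterson topology: for $i\in I$, $X_i=\langle U_{\alpha_i},U_{-\alpha_i}\rangle$ is the image of $\mathrm{SL}(2,k)$ under the homomorphism sending $\begin{pmatrix}1&r\\0&1\end{pmatrix}$ to $\exp(r\,\mathrm{ad}\,e_i)$ and $\begin{pmatrix}1&0\\-r&1\end{pmatrix}$ to $\exp(r\,\mathrm{ad}\,f_i)$, endowed with its natural Lie group topology. The Kac--Peterson topology on $G$ is the finest topology such that for all $n\in\mathbf N$ and $i_1,\dots,i_n\in I$ the multiplication map $X_{i_1}\times\cdots\times X_{i_n}\to G$ is continuous (product topology on the source). Measurable homomorphism: a group homomorphism $\phi\colon G_1\to G_2$ such that for every Lie subgroup $L$ of $G_1$ (that is, a closed subgroup of $G_1$ which with the induced topology is a Lie group) and every open set $O\subseteq G_2$, the set $(\phi|_L)^{-1}(O)$ is Haar measurable in $L$. *)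

theory Defs
  imports
    "HOL-Analysis.Analysis"
    "HOL-Algebra.Bij"
    "HOL-Algebra.Generated_Groups"
begin

text \<open>
  Throughout, the ground field is a subset \<open>K\<close> of the complex numbers; in the end
  \<open>K\<close> is either \<open>\<real>\<close> or \<open>UNIV\<close>.
\<close>

section \<open>Final topologies\<close>

text \<open>
  The finest topology on \<open>S\<close> making every map \<open>f j\<close> from \<open>X j\<close> to \<open>S\<close> (\<open>j \<in> J\<close>) continuous;
  see \<open>continuous_map_final_topology\<close> and \<open>final_topology_finest\<close>.
\<close>

definition final_topology ::
    "'s set \<Rightarrow> 'j set \<Rightarrow> ('j \<Rightarrow> 'x topology) \<Rightarrow> ('j \<Rightarrow> 'x \<Rightarrow> 's) \<Rightarrow> 's topology" where
  "final_topology S J X f =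
     topology (\<lambda>U. U \<subseteq> S \<and> (\<forall>j\<in>J. openin (X j) {x \<in> topspace (X j). f j x \<in> U}))"

lemma openin_final_topology:
  "openin (final_topology S J X f) U \<longleftrightarrow>
     U \<subseteq> S \<and> (\<forall>j\<in>J. openin (X j) {x \<in> topspace (X j). f j x \<in> U})"
proof -
  let ?P = "\<lambda>U. U \<subseteq> S \<and> (\<forall>j\<in>J. openin (X j) {x \<in> topspace (X j). f j x \<in> U})"
  have "istopology ?P"
    unfolding istopology_def
  proof (rule conjI; intro allI impI conjI ballI)
    fix A B j assume A: "?P A" and B: "?P B" and j: "j \<in> J"
    have "{x \<in> topspace (X j). f j x \<in> A \<inter> B} =
          {x \<in> topspace (X j). f j x \<in> A} \<inter> {x \<in> topspace (X j). f j x \<in> B}" by auto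
    then show "openin (X j) {x \<in> topspace (X j). f j x \<in> A \<inter> B}"
      using A B j by auto
  next
    fix \<U> j assume U: "\<forall>A\<in>\<U>. ?P A" and j: "j \<in> J"
    have "{x \<in> topspace (X j). f j x \<in> \<Union>\<U>} =
          (\<Union>A\<in>\<U>. {x \<in> topspace (X j). f j x \<in> A})" by auto
    then show "openin (X j) {x \<in> topspace (X j). f j x \<in> \<Union>\<U>}"
      using U j by auto
  qed auto
  then show ?thesis
    by (simp add: final_topology_def)
qed

lemma topspace_final_topology:
  assumes "\<And>j. j \<in> J \<Longrightarrow> f j \<in> topspace (X j) \<rightarrow> S"
  shows "topspace (final_topology S J X f) = S"
proof -
  have "openin (final_topology S J X f) S"
    unfolding openin_final_topology
  proof (intro conjI ballI)
    fix j assume "j \<in> J"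
    with assms have "{x \<in> topspace (X j). f j x \<in> S} = topspace (X j)"
      by auto
    then show "openin (X j) {x \<in> topspace (X j). f j x \<in> S}"
      by simp
  qed simp
  moreover have "topspace (final_topology S J X f) \<subseteq> S"
    using openin_topspace[of "final_topology S J X f"] unfolding openin_final_topology ..
  ultimately show ?thesis
    by (simp add: openin_subset subset_antisym)
qed

lemma continuous_map_final_topology:
  assumes "\<And>j. j \<in> J \<Longrightarrow> f j \<in> topspace (X j) \<rightarrow> S" "j \<in> J"
  shows "continuous_map (X j) (final_topology S J X f) (f j)"
  using assms
  by (auto simp: continuous_map_def topspace_final_topology openin_final_topology)

lemma final_topology_finest:
  assumes "topspace T = S" "\<And>j. j \<in> J \<Longrightarrow> continuous_map (X j) T (f j)" "openin T U"
  shows "openin (final_topology S J X f) U"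
  using assms openin_subset[OF assms(3)]
  by (auto simp: continuous_map_def openin_final_topology)

section \<open>Lie algebras given by generators and relations\<close>

record 'v lie_algebra = "'v partial_object" +
  lzero :: 'v
  lplus :: "'v \<Rightarrow> 'v \<Rightarrow> 'v"
  lscale :: "complex \<Rightarrow> 'v \<Rightarrow> 'v"
  lbracket :: "'v \<Rightarrow> 'v \<Rightarrow> 'v"

datatype 'x lie_term =
    Gen 'x
  | Zero
  | Plus "'x lie_term" "'x lie_term"
  | Scale complex "'x lie_term"
  | Bracket "'x lie_term" "'x lie_term"

inductive_set lie_terms :: "complex set \<Rightarrow> 'x set \<Rightarrow> 'x lie_term set"
  for K :: "complex set" and X :: "'x set" where
  Gen: "x \<in> X \<Longrightarrow> Gen x \<in> lie_terms K X"
| Zero: "Zero \<in> lie_terms K X"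
| Plus: "s \<in> lie_terms K X \<Longrightarrow> t \<in> lie_terms K X \<Longrightarrow> Plus s t \<in> lie_terms K X"
| Scale: "a \<in> K \<Longrightarrow> t \<in> lie_terms K X \<Longrightarrow> Scale a t \<in> lie_terms K X"
| Bracket: "s \<in> lie_terms K X \<Longrightarrow> t \<in> lie_terms K X \<Longrightarrow> Bracket s t \<in> lie_terms K X"

text \<open>
  The least congruence on terms that contains the axioms of a Lie algebra over \<open>K\<close> and the
  defining relations \<open>R\<close>. The quotient is the Lie algebra over \<open>K\<close> presented by \<open>X\<close> and \<open>R\<close>.
\<close>

inductive lie_eq ::
    "complex set \<Rightarrow> 'x set \<Rightarrow> ('x lie_term \<times> 'x lie_term) set \<Rightarrow>
     'x lie_term \<Rightarrow> 'x lie_term \<Rightarrow> bool"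
  for K :: "complex set" and X :: "'x set" and R :: "('x lie_term \<times> 'x lie_term) set" where
  relation: "(s, t) \<in> R \<Longrightarrow> s \<in> lie_terms K X \<Longrightarrow> t \<in> lie_terms K X \<Longrightarrow> lie_eq K X R s t"
| refl: "t \<in> lie_terms K X \<Longrightarrow> lie_eq K X R t t"
| sym: "lie_eq K X R s t \<Longrightarrow> lie_eq K X R t s"
| trans: "lie_eq K X R s t \<Longrightarrow> lie_eq K X R t u \<Longrightarrow> lie_eq K X R s u"
| cong_plus: "lie_eq K X R s s' \<Longrightarrow> lie_eq K X R t t' \<Longrightarrow>
    lie_eq K X R (Plus s t) (Plus s' t')"
| cong_scale: "a \<in> K \<Longrightarrow> lie_eq K X R t t' \<Longrightarrow> lie_eq K X R (Scale a t) (Scale a t')"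
| cong_bracket: "lie_eq K X R s s' \<Longrightarrow> lie_eq K X R t t' \<Longrightarrow>
    lie_eq K X R (Bracket s t) (Bracket s' t')"
| plus_assoc: "s \<in> lie_terms K X \<Longrightarrow> t \<in> lie_terms K X \<Longrightarrow> u \<in> lie_terms K X \<Longrightarrow>
    lie_eq K X R (Plus (Plus s t) u) (Plus s (Plus t u))"
| plus_commute: "s \<in> lie_terms K X \<Longrightarrow> t \<in> lie_terms K X \<Longrightarrow>
    lie_eq K X R (Plus s t) (Plus t s)"
| plus_zero: "t \<in> lie_terms K X \<Longrightarrow> lie_eq K X R (Plus t Zero) t"
| plus_neg: "t \<in> lie_terms K X \<Longrightarrow> lie_eq K X R (Plus t (Scale (- 1) t)) Zero"
| scale_one: "t \<in> lie_terms K X \<Longrightarrow> lie_eq K X R (Scale 1 t) t"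
| scale_mult: "a \<in> K \<Longrightarrow> b \<in> K \<Longrightarrow> t \<in> lie_terms K X \<Longrightarrow>
    lie_eq K X R (Scale a (Scale b t)) (Scale (a * b) t)"
| scale_left: "a \<in> K \<Longrightarrow> b \<in> K \<Longrightarrow> t \<in> lie_terms K X \<Longrightarrow>
    lie_eq K X R (Scale (a + b) t) (Plus (Scale a t) (Scale b t))"
| scale_right: "a \<in> K \<Longrightarrow> s \<in> lie_terms K X \<Longrightarrow> t \<in> lie_terms K X \<Longrightarrow>
    lie_eq K X R (Scale a (Plus s t)) (Plus (Scale a s) (Scale a t))"
| bracket_plus_left: "s \<in> lie_terms K X \<Longrightarrow> t \<in> lie_terms K X \<Longrightarrow> u \<in> lie_terms K X \<Longrightarrow>
    lie_eq K X R (Bracket (Plus s t) u) (Plus (Bracket s u) (Bracket t u))"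
| bracket_plus_right: "s \<in> lie_terms K X \<Longrightarrow> t \<in> lie_terms K X \<Longrightarrow> u \<in> lie_terms K X \<Longrightarrow>
    lie_eq K X R (Bracket s (Plus t u)) (Plus (Bracket s t) (Bracket s u))"
| bracket_scale_left: "a \<in> K \<Longrightarrow> s \<in> lie_terms K X \<Longrightarrow> t \<in> lie_terms K X \<Longrightarrow>
    lie_eq K X R (Bracket (Scale a s) t) (Scale a (Bracket s t))"
| bracket_scale_right: "a \<in> K \<Longrightarrow> s \<in> lie_terms K X \<Longrightarrow> t \<in> lie_terms K X \<Longrightarrow>
    lie_eq K X R (Bracket s (Scale a t)) (Scale a (Bracket s t))"
| bracket_self: "t \<in> lie_terms K X \<Longrightarrow> lie_eq K X R (Bracket t t) Zero"
| jacobi: "s \<in> lie_terms K X \<Longrightarrow> t \<in> lie_terms K X \<Longrightarrow> u \<in> lie_terms K X \<Longrightarrow>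
    lie_eq K X R
      (Plus (Bracket s (Bracket t u))
        (Plus (Bracket t (Bracket u s)) (Bracket u (Bracket s t)))) Zero"

definition lie_class ::
    "complex set \<Rightarrow> 'x set \<Rightarrow> ('x lie_term \<times> 'x lie_term) set \<Rightarrow>
     'x lie_term \<Rightarrow> 'x lie_term set" where
  "lie_class K X R t = {s. lie_eq K X R t s}"

definition presented_lie_algebra ::
    "complex set \<Rightarrow> 'x set \<Rightarrow> ('x lie_term \<times> 'x lie_term) set \<Rightarrow>
     'x lie_term set lie_algebra" where
  "presented_lie_algebra K X R =
    \<lparr> carrier = lie_class K X R ` lie_terms K X,
      lzero = lie_class K X R Zero,
      lplus = (\<lambda>v w. \<Union>s\<in>v. \<Union>t\<in>w. lie_class K X R (Plus s t)),
      lscale = (\<lambda>a v. \<Union>s\<in>v. lie_class K X R (Scale a s)),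
      lbracket = (\<lambda>v w. \<Union>s\<in>v. \<Union>t\<in>w. lie_class K X R (Bracket s t)) \<rparr>"

definition lie_auts :: "complex set \<Rightarrow> 'v lie_algebra \<Rightarrow> ('v \<Rightarrow> 'v) set" where
  "lie_auts K L =
    {f \<in> Bij (carrier L).
       (\<forall>v\<in>carrier L. \<forall>w\<in>carrier L. f (lplus L v w) = lplus L (f v) (f w)) \<and>
       (\<forall>a\<in>K. \<forall>v\<in>carrier L. f (lscale L a v) = lscale L a (f v)) \<and>
       (\<forall>v\<in>carrier L. \<forall>w\<in>carrier L. f (lbracket L v w) = lbracket L (f v) (f w))}"

definition lie_aut_group :: "complex set \<Rightarrow> 'v lie_algebra \<Rightarrow> ('v \<Rightarrow> 'v) monoid" where
  "lie_aut_group K L = (BijGroup (carrier L)) \<lparr> carrier := lie_auts K L \<rparr>"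

primrec lsum :: "'v lie_algebra \<Rightarrow> (nat \<Rightarrow> 'v) \<Rightarrow> nat \<Rightarrow> 'v" where
  "lsum L f 0 = lzero L"
| "lsum L f (Suc n) = lplus L (lsum L f n) (f n)"

text \<open>
  \<open>exp (r ad x)\<close> for an ad-locally-nilpotent \<open>x\<close>: on \<open>v\<close> the exponential series stops at the
  first power of \<open>ad x\<close> annihilating \<open>v\<close>.
\<close>

definition exp_ad :: "'v lie_algebra \<Rightarrow> complex \<Rightarrow> 'v \<Rightarrow> 'v \<Rightarrow> 'v" where
  "exp_ad L r x =
    (\<lambda>v\<in>carrier L.
       lsum L (\<lambda>n. lscale L (r ^ n / fact n) ((lbracket L x ^^ n) v))
         (LEAST n. (lbracket L x ^^ n) v = lzero L))"

section \<open>Kac--Moody root data\<close>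

definition int_scale :: "int \<Rightarrow> 'l::ab_group_add \<Rightarrow> 'l" where
  "int_scale n x =
    (if 0 \<le> n then ((+) x ^^ nat n) 0 else - ((+) x ^^ nat (- n)) 0)"

lemma int_scale_0: "int_scale 0 x = 0"
  by (simp add: int_scale_def)

lemma int_scale_add1: "int_scale (n + 1) x = int_scale n x + x"
proof (cases "0 \<le> n")
  case True
  then have "nat (n + 1) = Suc (nat n)" by simp
  with True show ?thesis by (simp add: int_scale_def add.commute)
next
  case False
  then have "nat (- n) = Suc (nat (- (n + 1)))" by simp
  with False show ?thesis
    by (cases "n = - 1") (auto simp: int_scale_def)
qed

lemma int_scale_diff1: "int_scale (n - 1) x = int_scale n x - x"
  using int_scale_add1[of "n - 1" x] by (simp add: algebra_simps)

lemma int_scale_add_left: "int_scale (m + n) x = int_scale m x + int_scale n x"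
proof (induction n rule: int_induct[where k = 0])
  case base then show ?case by (simp add: int_scale_0)
next
  case (step1 i)
  then show ?case
    using int_scale_add1[of "m + i" x] by (simp add: int_scale_add1 add.assoc)
next
  case (step2 i)
  have "m + (i - 1) = (m + i) - 1" by simp
  then show ?case
    using step2 by (simp only: int_scale_diff1) (simp add: algebra_simps)
qed

lemma module_int_scale: "module (int_scale :: int \<Rightarrow> 'l::ab_group_add \<Rightarrow> 'l)"
proof
  fix n m :: int and x y :: 'l
  show "int_scale n (x + y) = int_scale n x + int_scale n y"
    by (induction n rule: int_induct[where k = 0])
       (simp_all add: int_scale_0 int_scale_add1 int_scale_diff1)
  show "int_scale (m + n) x = int_scale m x + int_scale n x"
    by (rule int_scale_add_left)
  show "int_scale m (int_scale n x) = int_scale (m * n) x"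
  proof (induction m rule: int_induct[where k = 0])
    case base then show ?case by (simp add: int_scale_0)
  next
    case (step1 i)
    have "(i + 1) * n = i * n + n" by (simp add: distrib_right)
    then have "int_scale ((i + 1) * n) x = int_scale (i * n) x + int_scale n x"
      by (simp only: int_scale_add_left)
    then show ?case using step1 by (simp add: int_scale_add1)
  next
    case (step2 i)
    have "i * n = (i - 1) * n + n" by (simp add: left_diff_distrib)
    then have "int_scale (i * n) x = int_scale ((i - 1) * n) x + int_scale n x"
      by (simp only: int_scale_add_left)
    then show ?case using step2 by (simp add: int_scale_diff1)
  qed
  show "int_scale 1 x = x"
    using int_scale_add1[of 0 x] by (simp add: int_scale_0)
qed

text \<open>
  The lattice \<open>\<Lambda>\<close> is the whole type \<open>'l\<close>; its dual consists of the additive maps from \<open>'l\<close>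
  to \<open>int\<close>, and the pairing is evaluation.
\<close>

definition free_of_finite_rank :: "'l::ab_group_add itself \<Rightarrow> bool" where
  "free_of_finite_rank _ \<longleftrightarrow>
    (\<exists>B :: 'l set. finite B \<and> \<not> module.dependent int_scale B \<and>
       module.span int_scale B = UNIV)"

definition dual_lattice :: "('l::ab_group_add \<Rightarrow> int) set" where
  "dual_lattice = {h. Modules.additive h}"

record ('i, 'l) root_datum =
  rd_index :: "'i set"
  rd_cartan :: "'i \<Rightarrow> 'i \<Rightarrow> int"
  rd_c :: "'i \<Rightarrow> 'l"
  rd_h :: "'i \<Rightarrow> 'l \<Rightarrow> int"

definition generalized_cartan_matrix :: "'i set \<Rightarrow> ('i \<Rightarrow> 'i \<Rightarrow> int) \<Rightarrow> bool" where
  "generalized_cartan_matrix I A \<longleftrightarrow>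
    (\<forall>i\<in>I. A i i = 2) \<and>
    (\<forall>i\<in>I. \<forall>j\<in>I. i \<noteq> j \<longrightarrow> A i j \<le> 0) \<and>
    (\<forall>i\<in>I. \<forall>j\<in>I. A i j = 0 \<longleftrightarrow> A j i = 0)"

definition kac_moody_root_datum :: "('i, 'l::ab_group_add) root_datum \<Rightarrow> bool" where
  "kac_moody_root_datum D \<longleftrightarrow>
    finite (rd_index D) \<and>
    generalized_cartan_matrix (rd_index D) (rd_cartan D) \<and>
    free_of_finite_rank TYPE('l) \<and>
    rd_h D ` rd_index D \<subseteq> dual_lattice \<and>
    (\<forall>i\<in>rd_index D. \<forall>j\<in>rd_index D. rd_h D i (rd_c D j) = rd_cartan D i j)"

section \<open>The Kac--Moody algebra\<close>

datatype ('i, 'l) km_gen = GenH "'l \<Rightarrow> int" | GenE 'i | GenF 'i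

definition km_gens :: "('i, 'l::ab_group_add) root_datum \<Rightarrow> ('i, 'l) km_gen set" where
  "km_gens D = GenH ` dual_lattice \<union> GenE ` rd_index D \<union> GenF ` rd_index D"

abbreviation tH :: "('l \<Rightarrow> int) \<Rightarrow> ('i, 'l) km_gen lie_term" where "tH h \<equiv> Gen (GenH h)"
abbreviation tE :: "'i \<Rightarrow> ('i, 'l) km_gen lie_term" where "tE i \<equiv> Gen (GenE i)"
abbreviation tF :: "'i \<Rightarrow> ('i, 'l) km_gen lie_term" where "tF i \<equiv> Gen (GenF i)"

text \<open>
  The first family makes \<open>h \<mapsto> GenH h\<close> additive on the dual lattice, so that the \<open>GenH h\<close> span
  a copy of the tensor product of the dual lattice with the ground field.
\<close>

definition km_relations ::
    "('i, 'l::ab_group_add) root_datum \<Rightarrow>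
     (('i, 'l) km_gen lie_term \<times> ('i, 'l) km_gen lie_term) set" where
  "km_relations D =
    {(tH (\<lambda>x. h x + h' x), Plus (tH h) (tH h')) | h h'. h \<in> dual_lattice \<and> h' \<in> dual_lattice} \<union>
    {(Bracket (tH h) (tH h'), Zero) | h h'. h \<in> dual_lattice \<and> h' \<in> dual_lattice} \<union>
    {(Bracket (tH h) (tE i), Scale (of_int (h (rd_c D i))) (tE i))
       | h i. h \<in> dual_lattice \<and> i \<in> rd_index D} \<union>
    {(Bracket (tH h) (tF i), Scale (- of_int (h (rd_c D i))) (tF i))
       | h i. h \<in> dual_lattice \<and> i \<in> rd_index D} \<union>
    {(Bracket (tE i) (tF i), Scale (- 1) (tH (rd_h D i))) | i. i \<in> rd_index D} \<union>
    {(Bracket (tE i) (tF j), Zero) | i j. i \<in> rd_index D \<and> j \<in> rd_index D \<and> i \<noteq> j} \<union>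
    {((Bracket (tE i) ^^ nat (1 - rd_cartan D i j)) (tE j), Zero)
       | i j. i \<in> rd_index D \<and> j \<in> rd_index D \<and> i \<noteq> j} \<union>
    {((Bracket (tF i) ^^ nat (1 - rd_cartan D i j)) (tF j), Zero)
       | i j. i \<in> rd_index D \<and> j \<in> rd_index D \<and> i \<noteq> j}"

type_synonym ('i, 'l) km_elt = "('i, 'l) km_gen lie_term set"

definition km_algebra ::
    "complex set \<Rightarrow> ('i, 'l::ab_group_add) root_datum \<Rightarrow> ('i, 'l) km_elt lie_algebra" where
  "km_algebra K D = presented_lie_algebra K (km_gens D) (km_relations D)"

definition km_class ::
    "complex set \<Rightarrow> ('i, 'l::ab_group_add) root_datum \<Rightarrow> ('i, 'l) km_gen lie_term \<Rightarrow>
     ('i, 'l) km_elt" where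
  "km_class K D = lie_class K (km_gens D) (km_relations D)"

definition chev_e where "chev_e K D i = km_class K D (tE i)"
definition chev_f where "chev_f K D i = km_class K D (tF i)"

section \<open>Roots and root spaces\<close>

text \<open>
  The root lattice is the free abelian group on the formal simple roots \<open>\<alpha>\<^sub>i\<close>; the \<open>c\<^sub>i\<close> need not
  be linearly independent, so roots are not identified with elements of \<open>\<Lambda>\<close>. An element
  \<open>\<Sum>i. n\<^sub>i \<alpha>\<^sub>i\<close> is encoded by the function \<open>i \<mapsto> n\<^sub>i\<close>.
\<close>

definition root_lattice :: "('i, 'l) root_datum \<Rightarrow> ('i \<Rightarrow> int) set" where
  "root_lattice D = {\<gamma>. \<forall>i. i \<notin> rd_index D \<longrightarrow> \<gamma> i = 0}"

definition simple_root :: "'i \<Rightarrow> 'i \<Rightarrow> int" where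
  "simple_root i = (\<lambda>j. if j = i then 1 else 0)"

text \<open>\<open>s\<^sub>i(\<alpha>\<^sub>j) = \<alpha>\<^sub>j - a\<^sub>i\<^sub>j \<alpha>\<^sub>i\<close>, extended linearly.\<close>

definition simple_reflection ::
    "('i, 'l) root_datum \<Rightarrow> 'i \<Rightarrow> ('i \<Rightarrow> int) \<Rightarrow> ('i \<Rightarrow> int)" where
  "simple_reflection D i =
    (\<lambda>\<gamma>\<in>root_lattice D. \<gamma>(i := \<gamma> i - (\<Sum>j\<in>rd_index D. rd_cartan D i j * \<gamma> j)))"

definition weyl_group :: "('i, 'l) root_datum \<Rightarrow> (('i \<Rightarrow> int) \<Rightarrow> ('i \<Rightarrow> int)) set" where
  "weyl_group D =
    generate (BijGroup (root_lattice D)) (simple_reflection D ` rd_index D)"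

definition real_roots :: "('i, 'l) root_datum \<Rightarrow> ('i \<Rightarrow> int) set" where
  "real_roots D = {w (simple_root i) | w i. w \<in> weyl_group D \<and> i \<in> rd_index D}"

text \<open>
  The grading of the Kac--Moody algebra by the root lattice: \<open>GenH\<close>, \<open>GenE i\<close>, \<open>GenF i\<close> have
  degrees \<open>0\<close>, \<open>\<alpha>\<^sub>i\<close>, \<open>-\<alpha>\<^sub>i\<close>. For a root \<open>\<gamma>\<close> its graded piece is the root space.
\<close>

inductive homogeneous :: "('i \<Rightarrow> int) \<Rightarrow> ('i, 'l) km_gen lie_term \<Rightarrow> bool" where
  "homogeneous (\<lambda>_. 0) (tH h)"
| "homogeneous (simple_root i) (tE i)"
| "homogeneous (\<lambda>j. - simple_root i j) (tF i)"
| "homogeneous \<gamma> Zero"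
| "homogeneous \<gamma> s \<Longrightarrow> homogeneous \<gamma> t \<Longrightarrow> homogeneous \<gamma> (Plus s t)"
| "homogeneous \<gamma> t \<Longrightarrow> homogeneous \<gamma> (Scale a t)"
| "homogeneous \<gamma> s \<Longrightarrow> homogeneous \<delta> t \<Longrightarrow> homogeneous (\<lambda>j. \<gamma> j + \<delta> j) (Bracket s t)"

definition root_space ::
    "complex set \<Rightarrow> ('i, 'l::ab_group_add) root_datum \<Rightarrow> ('i \<Rightarrow> int) \<Rightarrow> ('i, 'l) km_elt set" where
  "root_space K D \<gamma> =
    {km_class K D t | t. t \<in> lie_terms K (km_gens D) \<and> homogeneous \<gamma> t}"

text \<open>
  A choice of root vectors for the real roots, fixed on the simple roots and their negatives.
  The real root spaces are one-dimensional, so the root groups below do not depend on it.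
\<close>

definition root_vectors ::
    "complex set \<Rightarrow> ('i, 'l::ab_group_add) root_datum \<Rightarrow> ('i \<Rightarrow> int) \<Rightarrow> ('i, 'l) km_elt" where
  "root_vectors K D = (SOME e.
     (\<forall>\<gamma>\<in>real_roots D. e \<gamma> \<in> root_space K D \<gamma> \<and> e \<gamma> \<noteq> lzero (km_algebra K D)) \<and>
     (\<forall>i\<in>rd_index D. e (simple_root i) = chev_e K D i \<and>
        e (\<lambda>j. - simple_root i j) = chev_f K D i))"

section \<open>The adjoint Kac--Moody group\<close>

type_synonym ('i, 'l) km_map = "('i, 'l) km_elt \<Rightarrow> ('i, 'l) km_elt"

definition km_aut ::
    "complex set \<Rightarrow> ('i, 'l::ab_group_add) root_datum \<Rightarrow> ('i, 'l) km_map monoid" where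
  "km_aut K D = lie_aut_group K (km_algebra K D)"

definition root_subgroup ::
    "complex set \<Rightarrow> ('i, 'l::ab_group_add) root_datum \<Rightarrow> ('i \<Rightarrow> int) \<Rightarrow> ('i, 'l) km_map set" where
  "root_subgroup K D \<gamma> = {exp_ad (km_algebra K D) r (root_vectors K D \<gamma>) | r. r \<in> K}"

text \<open>
  The condition at \<open>\<gamma> = 0\<close> says that the torus acts trivially on the Cartan subalgebra. As the
  graded pieces span, the automorphism is determined by \<open>t\<close>.
\<close>

definition torus ::
    "complex set \<Rightarrow> ('i, 'l::ab_group_add) root_datum \<Rightarrow> ('i, 'l) km_map set" where
  "torus K D =
    {\<tau> \<in> carrier (km_aut K D).
       \<exists>t :: 'l \<Rightarrow> complex.
         (\<forall>x. t x \<in> K - {0}) \<and> (\<forall>x y. t (x + y) = t x * t y) \<and>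
         (\<forall>\<gamma>\<in>root_lattice D. \<forall>v\<in>root_space K D \<gamma>.
            \<tau> v = lscale (km_algebra K D) (\<Prod>i\<in>rd_index D. t (rd_c D i) powi \<gamma> i) v)}"

definition adjoint_km_group ::
    "complex set \<Rightarrow> ('i, 'l::ab_group_add) root_datum \<Rightarrow> ('i, 'l) km_map monoid" where
  "adjoint_km_group K D =
    (km_aut K D) \<lparr> carrier :=
       generate (km_aut K D) ((\<Union>\<gamma>\<in>real_roots D. root_subgroup K D \<gamma>) \<union> torus K D) \<rparr>"

definition generated_by_root_subgroups ::
    "complex set \<Rightarrow> ('i, 'l::ab_group_add) root_datum \<Rightarrow> bool" where
  "generated_by_root_subgroups K D \<longleftrightarrow>
    generate (adjoint_km_group K D) (\<Union>\<gamma>\<in>real_roots D. root_subgroup K D \<gamma>) =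
      carrier (adjoint_km_group K D)"

section \<open>The Kac--Peterson topology\<close>

definition SL2 :: "complex set \<Rightarrow> (complex ^ 2 ^ 2) monoid" where
  "SL2 K = \<lparr> carrier = {M. (\<forall>i j. M $ i $ j \<in> K) \<and> det M = 1}, mult = (\<lambda>A B. A ** B), one = mat 1 \<rparr>"

definition SL2_topology :: "complex set \<Rightarrow> (complex ^ 2 ^ 2) topology" where
  "SL2_topology K = subtopology euclidean (carrier (SL2 K))"

definition rank_one_subgroup ::
    "complex set \<Rightarrow> ('i, 'l::ab_group_add) root_datum \<Rightarrow> 'i \<Rightarrow> ('i, 'l) km_map set" where
  "rank_one_subgroup K D i =
    generate (adjoint_km_group K D)
      (root_subgroup K D (simple_root i) \<union> root_subgroup K D (\<lambda>j. - simple_root i j))"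

definition rank_one_hom ::
    "complex set \<Rightarrow> ('i, 'l::ab_group_add) root_datum \<Rightarrow> 'i \<Rightarrow>
     complex ^ 2 ^ 2 \<Rightarrow> ('i, 'l) km_map" where
  "rank_one_hom K D i = (THE \<psi>.
     \<psi> \<in> hom (SL2 K) (adjoint_km_group K D) \<and> \<psi> \<in> extensional (carrier (SL2 K)) \<and>
     (\<forall>r\<in>K. \<psi> (vector [vector [1, r], vector [0, 1]]) =
        exp_ad (km_algebra K D) r (chev_e K D i)) \<and>
     (\<forall>r\<in>K. \<psi> (vector [vector [1, 0], vector [- r, 1]]) =
        exp_ad (km_algebra K D) r (chev_f K D i)))"

text \<open>
  The Lie group topology of the image of \<open>SL(2,K)\<close> is the quotient topology.
\<close>

definition rank_one_topology ::
    "complex set \<Rightarrow> ('i, 'l::ab_group_add) root_datum \<Rightarrow> 'i \<Rightarrow> ('i, 'l) km_map topology" where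
  "rank_one_topology K D i =
    final_topology (rank_one_subgroup K D i) {()} (\<lambda>_. SL2_topology K) (\<lambda>_. rank_one_hom K D i)"

text \<open>
  A word \<open>is = [i\<^sub>1, \<dots>, i\<^sub>n]\<close> gives the multiplication map on
  \<open>X\<^bsub>i\<^sub>1\<^esub> \<times> \<dots> \<times> X\<^bsub>i\<^sub>n\<^esub>\<close>.
\<close>

definition kac_peterson_topology ::
    "complex set \<Rightarrow> ('i, 'l::ab_group_add) root_datum \<Rightarrow> ('i, 'l) km_map topology" where
  "kac_peterson_topology K D =
    final_topology (carrier (adjoint_km_group K D)) (lists (rd_index D))
      (\<lambda>is. product_topology (\<lambda>m. rank_one_topology K D (is ! m)) {..<length is})
      (\<lambda>is x. foldr (\<lambda>m g. x m \<otimes>\<^bsub>adjoint_km_group K D\<^esub> g) [0..<length is]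
                \<one>\<^bsub>adjoint_km_group K D\<^esub>)"

section \<open>Lie groups\<close>

text \<open>\<open>C\<^sup>k\<close> functions on an open subset \<open>U\<close> of \<open>n\<close>-space, by iterated partial derivatives.\<close>

primrec Ck :: "nat \<Rightarrow> nat \<Rightarrow> (nat \<Rightarrow> real) set \<Rightarrow> ((nat \<Rightarrow> real) \<Rightarrow> real) \<Rightarrow> bool" where
  "Ck n 0 U f \<longleftrightarrow> continuous_map (subtopology (Euclidean_space n) U) euclideanreal f"
| "Ck n (Suc k) U f \<longleftrightarrow>
     continuous_map (subtopology (Euclidean_space n) U) euclideanreal f \<and>
     (\<exists>f'. \<forall>i<n.
        (\<forall>x\<in>U. ((\<lambda>s. f (x(i := s))) has_real_derivative f' i x) (at (x i))) \<and> Ck n k U (f' i))"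

definition smooth_on ::
    "nat \<Rightarrow> nat \<Rightarrow> (nat \<Rightarrow> real) set \<Rightarrow> ((nat \<Rightarrow> real) \<Rightarrow> nat \<Rightarrow> real) \<Rightarrow> bool" where
  "smooth_on m n U f \<longleftrightarrow>
    openin (Euclidean_space m) U \<and> (\<forall>j<n. \<forall>k. Ck m k U (\<lambda>x. f x j))"

type_synonym 'a chart = "'a set \<times> ('a \<Rightarrow> nat \<Rightarrow> real)"

definition chart_on :: "nat \<Rightarrow> 'a topology \<Rightarrow> 'a chart \<Rightarrow> bool" where
  "chart_on n T = (\<lambda>(U, \<phi>).
    openin T U \<and> openin (Euclidean_space n) (\<phi> ` U) \<and>
    homeomorphic_map (subtopology T U) (subtopology (Euclidean_space n) (\<phi> ` U)) \<phi>)"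

definition smooth_atlas :: "nat \<Rightarrow> 'a topology \<Rightarrow> 'a chart set \<Rightarrow> bool" where
  "smooth_atlas n T A \<longleftrightarrow>
    (\<forall>c\<in>A. chart_on n T c) \<and> (\<Union>c\<in>A. fst c) = topspace T \<and>
    (\<forall>(U, \<phi>)\<in>A. \<forall>(V, \<psi>)\<in>A. smooth_on n n (\<phi> ` (U \<inter> V)) (\<lambda>x. \<psi> (inv_into U \<phi> x)))"

definition smooth_map ::
    "nat \<Rightarrow> 'a topology \<Rightarrow> 'a chart set \<Rightarrow> nat \<Rightarrow> 'b topology \<Rightarrow> 'b chart set \<Rightarrow>
     ('a \<Rightarrow> 'b) \<Rightarrow> bool" where
  "smooth_map m S A n T B f \<longleftrightarrow>
    continuous_map S T f \<and>
    (\<forall>(U, \<phi>)\<in>A. \<forall>(V, \<psi>)\<in>B.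
       smooth_on m n (\<phi> ` {x \<in> U. f x \<in> V}) (\<lambda>x. \<psi> (f (inv_into U \<phi> x))))"

definition prod_chart :: "nat \<Rightarrow> 'a chart \<Rightarrow> 'b chart \<Rightarrow> ('a \<times> 'b) chart" where
  "prod_chart n = (\<lambda>(U, \<phi>) (V, \<psi>).
    (U \<times> V, \<lambda>(x, y) k. if k < n then \<phi> x k else \<psi> y (k - n)))"

definition prod_atlas :: "nat \<Rightarrow> 'a chart set \<Rightarrow> 'b chart set \<Rightarrow> ('a \<times> 'b) chart set" where
  "prod_atlas n A B = {prod_chart n c d | c d. c \<in> A \<and> d \<in> B}"

definition lie_group :: "'a monoid \<Rightarrow> 'a topology \<Rightarrow> bool" where
  "lie_group L T \<longleftrightarrow>
    group L \<and> topspace T = carrier L \<and> Hausdorff_space T \<and> second_countable T \<and>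
    (\<exists>n A. smooth_atlas n T A \<and>
       smooth_map (n + n) (prod_topology T T) (prod_atlas n A A) n T A
         (\<lambda>(x, y). x \<otimes>\<^bsub>L\<^esub> y) \<and>
       smooth_map n T A n T A (\<lambda>x. inv\<^bsub>L\<^esub> x))"

definition lie_subgroup :: "'a set \<Rightarrow> 'a monoid \<Rightarrow> 'a topology \<Rightarrow> bool" where
  "lie_subgroup H G T \<longleftrightarrow>
    subgroup H G \<and> closedin T H \<and> lie_group (G \<lparr> carrier := H \<rparr>) (subtopology T H)"

section \<open>Haar measure and measurable homomorphisms\<close>

definition haar_measure :: "'a monoid \<Rightarrow> 'a topology \<Rightarrow> 'a measure \<Rightarrow> bool" where
  "haar_measure L T M \<longleftrightarrow>
    space M = carrier L \<and>
    sets M = sigma_sets (carrier L) {U. openin T U} \<and>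
    emeasure M (carrier L) \<noteq> 0 \<and>
    (\<forall>g\<in>carrier L. \<forall>A\<in>sets M. emeasure M ((\<lambda>x. g \<otimes>\<^bsub>L\<^esub> x) ` A) = emeasure M A) \<and>
    (\<forall>C. compactin T C \<longrightarrow> emeasure M C < \<infinity>) \<and>
    (\<forall>A\<in>sets M. emeasure M A = (INF U\<in>{U. openin T U \<and> A \<subseteq> U}. emeasure M U)) \<and>
    (\<forall>U. openin T U \<longrightarrow> emeasure M U = (SUP C\<in>{C. compactin T C \<and> C \<subseteq> U}. emeasure M C))"

text \<open>Haar measures are unique up to scaling, so the choice of \<open>M\<close> is immaterial.\<close>

definition haar_measurable :: "'a monoid \<Rightarrow> 'a topology \<Rightarrow> 'a set \<Rightarrow> bool" where
  "haar_measurable L T A \<longleftrightarrow> (\<exists>M. haar_measure L T M \<and> A \<in> sets (completion M))"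

definition measurable_hom ::
    "'a monoid \<Rightarrow> 'a topology \<Rightarrow> 'b monoid \<Rightarrow> 'b topology \<Rightarrow> ('a \<Rightarrow> 'b) \<Rightarrow> bool" where
  "measurable_hom G T G' T' \<phi> \<longleftrightarrow>
    \<phi> \<in> hom G G' \<and>
    (\<forall>L U. lie_subgroup L G T \<longrightarrow> openin T' U \<longrightarrow>
       haar_measurable (G \<lparr> carrier := L \<rparr>) (subtopology T L) {x \<in> L. \<phi> x \<in> U})"

end

theory Submission
  imports Defs
begin

text \<open>
  Restrict a measurable homomorphism to a one-parameter subgroup of a simple root group. This
  subgroup is closed in the Kac--Peterson topology and isomorphic to the real line, so its Haar
  measure is Lebesgue measure up to a factor. The target is a countable union of compact sets \<open>C\<close> with
  \<open>C\<^sup>-\<^sup>1 C\<close> inside a prescribed identity neighbourhood, images of boxes under words in its own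
  one-parameter subgroups; one of them has a preimage of positive measure, and Steinhaus' theorem
  makes the restriction continuous and locally bounded, meaning that small parameters go to a
  compact image of a box. The Kac--Peterson topology need not
  be jointly continuous under multiplication, but it is on products of such compact images. Hence
  the homomorphism is continuous along every word in the one-parameter subgroups, and such words
  test continuity on the whole group.

  The Hausdorff property and the closedness of one-parameter subgroups follow from the continuity of
  matrix coefficients in the adjoint representation. That the target is exhausted by words in simple
  root groups requires every real root vector to be conjugate to a simple one, where real root
  spaces are shown to be one-dimensional and nonzero.
\<close>

section \<open>Measure theory of the real line\<close>

text \<open>Measurability is tested on closed Lie subgroups only, and the whole group need not be
  one; lines are the smallest subgroups that still generate it. All parameters are real: over the
  complex numbers a root group is the product of two real lines, in the directions 1 and \<i>. One
  treatment thus covers both fields, and homomorphisms between groups over different fields. Much of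
  the length comes from objects that are specified rather than constructed. Root vectors are picked
  by \<open>SOME\<close> and the homomorphism from SL(2, K) by \<open>THE\<close>; nothing can be
  said about either before existence is proved. For root vectors this means that the Chevalley
  generators do not collapse in an algebra given by generators and relations, which takes an
  explicit module. For the homomorphism it means Steinberg's relations, hence the exact action of
  reflections and torus elements on generators. The adjoint torus is absorbed by the assumption that
  root groups generate. As the algebra may be infinite-dimensional, linear functionals take the
  place of coordinates.\<close>

lemma ex_nat_symmetric_bound: "\<exists>n::nat. - real n \<le> x \<and> x \<le> real n"
proof -
  obtain n :: nat where "\<bar>x\<bar> \<le> real n" using real_arch_simple by blast
  then have "- real n \<le> x \<and> x \<le> real n" by linarith
  then show ?thesis by blast
qed

text \<open>Integrate the indicator of x + y in A and y in [-1, 0] against M times Lebesgue measure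
  in both orders. Invariance of M makes the integral over x equal to M(A) for every fixed y. The
  substitution z = x + y turns the condition on y into x in [z, z + 1], a translate of the unit
  interval, which yields the other side.\<close>

lemma translation_invariant_real_measure:
  fixes M :: "real measure"
  assumes sets: "sets M = sets borel"
    and inv: "\<And>a A. A \<in> sets borel \<Longrightarrow> emeasure M ((+) a ` A) = emeasure M A"
    and fin: "\<And>a b. emeasure M {a..b} < \<infinity>"
    and A: "A \<in> sets borel"
  shows "emeasure M A = emeasure M {0..1} * emeasure lborel A"
proof -
  have sf: "sigma_finite_measure M"
  proof
    show "\<exists>A. countable A \<and> A \<subseteq> sets M \<and> \<Union> A = space M \<and> (\<forall>a\<in>A. emeasure M a \<noteq> \<infinity>)"
    proof (intro exI[of _ "range (\<lambda>n::nat. {- real n..real n})"] conjI)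
      have "\<exists>n::nat. - real n \<le> x \<and> x \<le> real n" for x :: real
        by (rule ex_nat_symmetric_bound)
      then show "\<Union> (range (\<lambda>n::nat. {- real n..real n})) = space M"
        using sets_eq_imp_space_eq[OF sets] by auto
      show "\<forall>a\<in>range (\<lambda>n::nat. {- real n..real n}). emeasure M a \<noteq> \<infinity>"
        using fin by (auto simp: less_top)
    qed (auto simp: sets)
  qed
  interpret sigma_finite_measure M by (rule sf)
  interpret pair_sigma_finite M lborel ..
  have [measurable_cong]: "sets M = sets borel" by (rule sets)
  have [measurable]: "A \<in> sets borel" by (rule A)
  have tr: "emeasure M ((\<lambda>x. x + y) -` B) = emeasure M B" if "B \<in> sets borel" for y B
  proof -
    have "(\<lambda>x. x + y) -` B = (+) (- y) ` B"
      by (auto simp: image_iff intro!: bexI[of _ "_ + y"])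
    then show ?thesis using inv[OF that, of "- y"] by (simp only:)
  qed
  let ?f = "\<lambda>x y. indicator A (x + y) * indicator {-1..0} y :: ennreal"
  have "emeasure M A = (\<integral>\<^sup>+y. emeasure M A * indicator {-1..0::real} y \<partial>lborel)"
    by (simp add: nn_integral_cmult)
  also have "\<dots> = (\<integral>\<^sup>+y. (\<integral>\<^sup>+x. ?f x y \<partial>M) \<partial>lborel)"
  proof (rule nn_integral_cong)
    fix y :: real
    have "(\<integral>\<^sup>+x. ?f x y \<partial>M) = (\<integral>\<^sup>+x. indicator ((\<lambda>x. x + y) -` A) x \<partial>M) * indicator {-1..0} y"
      by (subst nn_integral_multc[symmetric]) (auto simp: indicator_def)
    also have "(\<integral>\<^sup>+x. indicator ((\<lambda>x. x + y) -` A) x \<partial>M) = emeasure M ((\<lambda>x. x + y) -` A)"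
    proof (rule nn_integral_indicator)
      have "(\<lambda>x. x + y) -` A \<inter> space borel \<in> sets borel" by measurable
      then show "(\<lambda>x. x + y) -` A \<in> sets M" by (simp add: sets)
    qed
    finally show "emeasure M A * indicator {-1..0} y = (\<integral>\<^sup>+x. ?f x y \<partial>M)"
      using tr[OF A] by simp
  qed
  also have "\<dots> = (\<integral>\<^sup>+x. (\<integral>\<^sup>+y. ?f x y \<partial>lborel) \<partial>M)"
    by (rule Fubini') measurable
  also have "\<dots> = (\<integral>\<^sup>+x. (\<integral>\<^sup>+z. indicator A z * indicator {-1..0} (z - x) \<partial>lborel) \<partial>M)"
  proof (rule nn_integral_cong)
    fix x :: real
    have "(\<integral>\<^sup>+z. indicator A z * indicator {-1..0} (z - x) \<partial>lborel) =
       (\<integral>\<^sup>+z. indicator A z * indicator {-1..0} (z - x) \<partial>distr lborel borel ((+) x))"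
      by (simp add: lborel_distr_plus)
    also have "\<dots> = (\<integral>\<^sup>+y. indicator A (x + y) * indicator {-1..0} (x + y - x) \<partial>lborel)"
      by (rule nn_integral_distr) measurable
    finally show "(\<integral>\<^sup>+y. ?f x y \<partial>lborel) = (\<integral>\<^sup>+z. indicator A z * indicator {-1..0} (z - x) \<partial>lborel)"
      by simp
  qed
  also have "\<dots> = (\<integral>\<^sup>+z. (\<integral>\<^sup>+x. indicator A z * indicator {-1..0} (z - x) \<partial>M) \<partial>lborel)"
    by (rule Fubini'[symmetric]) measurable
  also have "\<dots> = (\<integral>\<^sup>+z. emeasure M {0..1} * indicator A z \<partial>lborel)"
  proof (rule nn_integral_cong)
    fix z :: real
    have "(\<integral>\<^sup>+x. indicator A z * indicator {-1..0} (z - x) \<partial>M) =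
      (\<integral>\<^sup>+x. indicator A z * indicator {z..z+1} x \<partial>M)"
      by (intro nn_integral_cong) (auto simp: indicator_def)
    also have "\<dots> = indicator A z * emeasure M {z..z+1}"
      by (subst nn_integral_cmult) (auto simp: sets)
    also have "{z..z+1} = (+) z ` {0..1}" by (simp add: add.commute)
    finally show "(\<integral>\<^sup>+x. indicator A z * indicator {-1..0} (z - x) \<partial>M) = emeasure M {0..1} * indicator A z"
      using inv[of "{0..1}" z] by (simp add: mult.commute)
  qed
  also have "\<dots> = emeasure M {0..1} * emeasure lborel A"
    by (simp add: nn_integral_cmult)
  finally show ?thesis .
qed

text \<open>A compact subset C of positive measure lies in an open set V of measure less than 3/2
  times that of C. If t is smaller than the distance from C to the complement of V, then C and C + t
  both lie in V and are too large to be disjoint there.\<close>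

lemma Steinhaus_real:
  fixes E :: "real set"
  assumes E: "E \<in> sets lebesgue" and pos: "E \<notin> null_sets lebesgue"
  shows "\<exists>d>0. \<forall>t. \<bar>t\<bar> < d \<longrightarrow> (\<exists>x\<in>E. x + t \<in> E)"
proof -
  \<comment> \<open>The set may have infinite measure, so a bounded piece that is not null is cut
    out.\<close>
  have "\<exists>n::nat. E \<inter> {- real n..real n} \<notin> null_sets lebesgue"
  proof (rule ccontr)
    assume "\<not> ?thesis"
    then have "(\<Union>n::nat. E \<inter> {- real n..real n}) \<in> null_sets lebesgue"
      by (intro null_sets_UN) auto
    moreover have "(\<Union>n::nat. E \<inter> {- real n..real n}) = E"
    proof -
      have "\<exists>n::nat. - real n \<le> x \<and> x \<le> real n" for x :: real
        by (rule ex_nat_symmetric_bound)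
      then show ?thesis by auto
    qed
    ultimately show False using pos by simp
  qed
  then obtain n :: nat where n: "E \<inter> {- real n..real n} \<notin> null_sets lebesgue" by blast
  let ?S = "E \<inter> {- real n..real n}"
  have S: "?S \<in> sets lebesgue" using E by auto
  have Sl: "?S \<in> lmeasurable"
    by (rule bounded_set_imp_lmeasurable) (use S in \<open>auto intro: bounded_subset[OF bounded_closed_interval]\<close>)
  define m where "m = measure lebesgue ?S"
  have m: "m > 0"
    using n Sl unfolding m_def
    by (simp add: negligible_iff_null_sets[symmetric] negligible_iff_measure zero_less_measure_iff)
  \<comment> \<open>Any tolerance below \<open>m\<close> would do: \<open>C\<close> has to keep
    positive measure.\<close>
  obtain C where C: "closed C" "C \<subseteq> ?S" "?S - C \<in> lmeasurable" "emeasure lebesgue (?S - C) < ennreal (m/4)"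
    using sets_lebesgue_inner_closed[OF S, of "m/4"] m by auto
  have cC: "compact C"
    using C by (meson bounded_Int bounded_closed_interval bounded_subset compact_eq_bounded_closed)
  have Cl: "C \<in> lmeasurable" using cC by (rule lmeasurable_compact)
  have mC: "measure lebesgue C > 0"
  proof -
    have "measure lebesgue (?S - C) = m - measure lebesgue C"
      unfolding m_def using Sl Cl C(2) by (intro measurable_measure_Diff) auto
    moreover have "measure lebesgue (?S - C) < m/4"
      using C(3,4) m by (simp add: emeasure_eq_measure2 ennreal_less_iff)
    ultimately show ?thesis using m by linarith
  qed
  obtain V where V: "open V" "C \<subseteq> V" "V - C \<in> lmeasurable"
      "emeasure lebesgue (V - C) < ennreal (measure lebesgue C / 2)"
    using sets_lebesgue_outer_open[of C "measure lebesgue C / 2"] Cl mC by auto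
  have VC: "V = C \<union> (V - C)" using V(2) by blast
  have Vl: "V \<in> lmeasurable" by (subst VC, rule fmeasurable.Un[OF Cl V(3)])
  have "measure lebesgue (V - C) < measure lebesgue C / 2"
    using V(3,4) mC by (simp add: emeasure_eq_measure2 ennreal_less_iff)
  moreover have "measure lebesgue (V - C) = measure lebesgue V - measure lebesgue C"
    using Vl Cl V(2) by (intro measurable_measure_Diff) auto
  ultimately have mV: "measure lebesgue V < measure lebesgue C + measure lebesgue C / 2" by linarith
  have "\<exists>d>0. \<forall>x\<in>C. \<forall>y\<in>- V. d \<le> dist x y"
    by (rule separate_compact_closed) (use cC V in auto)
  then obtain d where d: "d > 0" "\<And>x y. x \<in> C \<Longrightarrow> y \<notin> V \<Longrightarrow> d \<le> dist x y" by auto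
  show ?thesis
  proof (intro exI conjI allI impI)
    show "d > 0" by fact
    fix t :: real assume t: "\<bar>t\<bar> < d"
    let ?Ct = "(+) t ` C"
    have sub: "?Ct \<subseteq> V"
    proof clarify
      fix x assume "x \<in> C" then show "t + x \<in> V"
        using d(2)[of x "t + x"] t by (force simp: dist_real_def)
    qed
    show "\<exists>x\<in>E. x + t \<in> E"
    proof (rule ccontr)
      assume "\<not> ?thesis"
      then have disj: "C \<inter> ?Ct = {}" using C(2) by (auto simp: add.commute)
      have Ctl: "?Ct \<in> lmeasurable" using Cl measurable_translation by blast
      have "measure lebesgue (C \<union> ?Ct) = measure lebesgue C + measure lebesgue ?Ct"
        using Cl Ctl disj by (subst measure_Un2) (auto simp: Diff_triv Int_commute)
      moreover have "measure lebesgue ?Ct = measure lebesgue C" by (rule measure_translation)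
      moreover have "measure lebesgue (C \<union> ?Ct) \<le> measure lebesgue V"
        using Cl Ctl V Vl sub by (intro measure_mono_fmeasurable) auto
      ultimately show False using mV mC by linarith
    qed
  qed
qed

section \<open>Groups generated by one-parameter subgroups\<close>

text \<open>The parameter is an infinite sequence of which only the first \<open>length w\<close>
  entries are read. Words of all lengths thereby share one parameter space, with its product
  topology.\<close>

primrec word :: "('a, 'b) monoid_scheme \<Rightarrow> ('j \<Rightarrow> real \<Rightarrow> 'a) \<Rightarrow> 'j list \<Rightarrow> (nat \<Rightarrow> real) \<Rightarrow> 'a" where
  "word G u [] x = \<one>\<^bsub>G\<^esub>"
| "word G u (j # w) x = u j (x 0) \<otimes>\<^bsub>G\<^esub> word G u w (\<lambda>n. x (Suc n))"

lemma word_cong: "(\<And>n. n < length w \<Longrightarrow> x n = y n) \<Longrightarrow> word G u w x = word G u w y"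
proof (induction w arbitrary: x y)
  case (Cons j w)
  have "x 0 = y 0" using Cons.prems[of 0] by simp
  moreover have "word G u w (\<lambda>n. x (Suc n)) = word G u w (\<lambda>n. y (Suc n))"
    by (rule Cons.IH) (use Cons.prems in auto)
  ultimately show ?case by simp
qed simp

text \<open>Matches concatenation of words: \<open>m\<close> is the length of the first word, and
  the entries of \<open>x\<close> from \<open>m\<close> on are dropped.\<close>

definition join :: "nat \<Rightarrow> (nat \<Rightarrow> 'c) \<Rightarrow> (nat \<Rightarrow> 'c) \<Rightarrow> nat \<Rightarrow> 'c" where
  "join m x y = (\<lambda>n. if n < m then x n else y (n - m))"

lemma continuous_on_join [continuous_intros]:
  fixes f g :: "'z::topological_space \<Rightarrow> nat \<Rightarrow> 'c::topological_space"
  assumes "continuous_on S f" "continuous_on S g"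
  shows "continuous_on S (\<lambda>z. join m (f z) (g z))"
proof (rule continuous_on_coordinatewise_then_product)
  fix i
  show "continuous_on S (\<lambda>z. join m (f z) (g z) i)"
    using continuous_on_product_then_coordinatewise[OF assms(1)]
      continuous_on_product_then_coordinatewise[OF assms(2)]
    by (cases "i < m") (simp_all add: join_def)
qed

lemma compact_countable_box:
  fixes a b :: "nat \<Rightarrow> real"
  shows "compact {x. \<forall>n. x n \<in> {a n..b n}}"
proof -
  have "compactin (product_topology (\<lambda>i. euclidean) UNIV) (PiE UNIV (\<lambda>n. {a n..b n}))"
    by (simp add: compactin_PiE)
  then have "compact (PiE UNIV (\<lambda>n. {a n..b n}))"
    unfolding euclidean_product_topology by simp
  moreover have "PiE UNIV (\<lambda>n. {a n..b n}) = {x. \<forall>n. x n \<in> {a n..b n}}"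
    by (auto simp: PiE_def)
  ultimately show ?thesis by simp
qed

locale one_param_words = group G for G :: "'a monoid" (structure) +
  fixes J :: "'j set" and u :: "'j \<Rightarrow> real \<Rightarrow> 'a"
  assumes u_closed: "j \<in> J \<Longrightarrow> u j r \<in> carrier G"
    and u_add: "j \<in> J \<Longrightarrow> u j (r + s) = u j r \<otimes> u j s"
begin

lemma word_closed: "w \<in> lists J \<Longrightarrow> word G u w x \<in> carrier G"
  by (induction w arbitrary: x) (auto intro: u_closed)

lemma word_append:
  "v \<in> lists J \<Longrightarrow> w \<in> lists J \<Longrightarrow>
    word G u (v @ w) x = word G u v x \<otimes> word G u w (\<lambda>n. x (n + length v))"
  by (induction v arbitrary: x) (simp_all add: word_closed u_closed m_assoc)

lemma word_join:
  assumes "v \<in> lists J" "w \<in> lists J"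
  shows "word G u (v @ w) (join (length v) x y) = word G u v x \<otimes> word G u w y"
proof -
  have "word G u v (join (length v) x y) = word G u v x"
    by (rule word_cong) (simp add: join_def)
  moreover have "(\<lambda>n. join (length v) x y (n + length v)) = y" by (simp add: join_def)
  ultimately show ?thesis by (simp add: word_append assms)
qed

lemma u_zero: "j \<in> J \<Longrightarrow> u j 0 = \<one>"
  using u_add[of j 0 0] u_closed[of j 0] by simp

lemma inv_u: "j \<in> J \<Longrightarrow> inv (u j r) = u j (- r)"
  using u_add[of j "- r" r] by (intro inv_equality) (simp_all add: u_zero u_closed)

text \<open>The truncated subtraction reverses the indices below \<open>length w\<close>; beyond
  them its value is meaningless, but the word does not read those entries.\<close>

lemma inv_word:
  "w \<in> lists J \<Longrightarrow> inv (word G u w x) = word G u (rev w) (\<lambda>n. - x (length w - 1 - n))"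
proof (induction w arbitrary: x)
  case (Cons j w)
  then have j: "j \<in> J" and w: "w \<in> lists J" by auto
  have "inv (word G u (j # w) x) = word G u (rev w) (\<lambda>n. - x (Suc (length w - 1 - n))) \<otimes> u j (- x 0)"
    using Cons.IH[OF w] by (simp add: inv_mult_group u_closed j word_closed w inv_u)
  also have "word G u (rev w) (\<lambda>n. - x (Suc (length w - 1 - n))) = word G u (rev w) (\<lambda>n. - x (length w - n))"
    by (rule word_cong) (simp add: Suc_diff_Suc)
  moreover have "word G u (rev w @ [j]) (\<lambda>n. - x (length w - n)) =
      word G u (rev w) (\<lambda>n. - x (length w - n)) \<otimes> u j (- x 0)"
    using word_append[of "rev w" "[j]"] w j by (simp add: in_lists_conv_set u_closed)
  ultimately show ?case by simp
qed simp

end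

text \<open>The Kac--Peterson topology as it is seen through words: the final topology for all word
  maps. Joint continuity of multiplication is not assumed. Its place is taken by two consequences of
  the word description, continuity of left translations and continuity of products on compact images
  of words.\<close>

locale one_param_group = one_param_words G J u for G :: "'a monoid" (structure) and J :: "'j set" and u +
  fixes T :: "'a topology"
  assumes countable_J: "countable J"
    and generated: "g \<in> carrier G \<Longrightarrow> \<exists>w\<in>lists J. \<exists>x. g = word G u w x"
    and openin_iff: "openin T U \<longleftrightarrow> U \<subseteq> carrier G \<and> (\<forall>w\<in>lists J. open {x. word G u w x \<in> U})"
    and Hausdorff: "Hausdorff_space T"
begin

lemma topspace_T: "topspace T = carrier G"
proof
  show "topspace T \<subseteq> carrier G" using openin_iff openin_topspace by blast
  have "openin T (carrier G)" by (auto simp: openin_iff word_closed)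
  then show "carrier G \<subseteq> topspace T" by (rule openin_subset)
qed

lemma word_continuous: "w \<in> lists J \<Longrightarrow> continuous_map euclidean T (word G u w)"
  by (auto simp: continuous_map_def topspace_T word_closed openin_iff)

text \<open>If \<open>g\<close> is itself a word, then translating by \<open>g\<close> means
  freezing the first block of parameters in a longer word, which is a continuous operation on
  parameters.\<close>

lemma left_translation_open:
  assumes "g \<in> carrier G" "openin T U"
  shows "openin T {h \<in> carrier G. g \<otimes> h \<in> U}"
proof -
  obtain v y where v: "v \<in> lists J" "g = word G u v y" using generated[OF assms(1)] by blast
  have "open {x. word G u w x \<in> {h \<in> carrier G. g \<otimes> h \<in> U}}" if w: "w \<in> lists J" for w
  proof -
    have "{x. word G u w x \<in> {h \<in> carrier G. g \<otimes> h \<in> U}} =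
        (\<lambda>x. join (length v) y x) -` {x. word G u (v @ w) x \<in> U}"
      using v w by (auto simp: word_join word_closed)
    also have "open \<dots>"
    proof (rule open_vimage)
      show "open {x. word G u (v @ w) x \<in> U}" using assms(2) v w by (simp add: openin_iff)
      show "continuous_on UNIV (join (length v) y)" by (intro continuous_intros)
    qed
    finally show ?thesis .
  qed
  then show ?thesis by (auto simp: openin_iff)
qed

text \<open>Relative compactness together with a witness: the word lets multiplication over such a
  set be lifted to concatenation of parameters.\<close>

definition word_bounded :: "'a set \<Rightarrow> bool" where
  "word_bounded S \<longleftrightarrow> (\<exists>w\<in>lists J. \<exists>X. compact X \<and> S \<subseteq> word G u w ` X)"

lemma word_bounded_subset: "word_bounded S \<Longrightarrow> S' \<subseteq> S \<Longrightarrow> word_bounded S'"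
  unfolding word_bounded_def by (meson subset_trans)

lemma word_bounded_singleton: "g \<in> carrier G \<Longrightarrow> word_bounded {g}"
  using generated[of g] unfolding word_bounded_def by (metis compact_sing image_insert image_empty subset_refl)

lemma word_bounded_mult:
  assumes "word_bounded S" "word_bounded S'"
  shows "word_bounded {g \<otimes> h | g h. g \<in> S \<and> h \<in> S'}"
proof -
  obtain v X where v: "v \<in> lists J" "compact X" "S \<subseteq> word G u v ` X"
    using assms(1) unfolding word_bounded_def by blast
  obtain w Y where w: "w \<in> lists J" "compact Y" "S' \<subseteq> word G u w ` Y"
    using assms(2) unfolding word_bounded_def by blast
  show ?thesis unfolding word_bounded_def
  proof (intro bexI exI conjI)
    show "compact ((\<lambda>z. join (length v) (fst z) (snd z)) ` (X \<times> Y))"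
      by (intro compact_continuous_image continuous_intros compact_Times v w)
    show "v @ w \<in> lists J" using v w by simp
    show "{g \<otimes> h |g h. g \<in> S \<and> h \<in> S'} \<subseteq>
        word G u (v @ w) ` (\<lambda>z. join (length v) (fst z) (snd z)) ` (X \<times> Y)"
    proof clarify
      fix g h assume "g \<in> S" "h \<in> S'"
      then obtain x y where "x \<in> X" "g = word G u v x" "y \<in> Y" "h = word G u w y" using v w by blast
      then show "g \<otimes> h \<in> word G u (v @ w) ` (\<lambda>z. join (length v) (fst z) (snd z)) ` (X \<times> Y)"
        using v w by (intro image_eqI[OF _ image_eqI[OF HOL.refl]]) (auto simp: word_join)
    qed
  qed
qed

lemma word_bounded_inv:
  assumes "word_bounded S"
  shows "word_bounded (m_inv G ` S)"
proof -
  obtain v X where v: "v \<in> lists J" "compact X" "S \<subseteq> word G u v ` X"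
    using assms(1) unfolding word_bounded_def by blast
  show ?thesis unfolding word_bounded_def
  proof (intro bexI exI conjI)
    show "compact ((\<lambda>x n. - x (length v - 1 - n)) ` X)"
      by (intro compact_continuous_image continuous_intros continuous_on_coordinatewise_then_product v
          continuous_on_subset[OF continuous_on_product_coordinates]) auto
    show "rev v \<in> lists J" using v by (simp add: in_lists_conv_set)
    show "m_inv G ` S \<subseteq> word G u (rev v) ` (\<lambda>x n. - x (length v - 1 - n)) ` X"
    proof clarify
      fix g assume "g \<in> S"
      then obtain x where "x \<in> X" "g = word G u v x" using v by blast
      then show "inv g \<in> word G u (rev v) ` (\<lambda>x n. - x (length v - 1 - n)) ` X"
        using v by (intro image_eqI[OF _ image_eqI[OF HOL.refl]]) (auto simp: inv_word)
    qed
  qed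
qed

text \<open>A continuous map from a compact space onto a Hausdorff space is a quotient map. Applied
  to the product of the two word maps, this allows continuity to be checked on parameters, where
  multiplication is a longer word. Compactness is essential, since a product of quotient maps need
  not be a quotient map.\<close>

lemma mult_continuous_on_compact:
  assumes v: "v \<in> lists J" and X: "compact X" and w: "w \<in> lists J" and Y: "compact Y"
  shows "continuous_map
    (prod_topology (subtopology T (word G u v ` X)) (subtopology T (word G u w ` Y))) T (\<lambda>(g, h). g \<otimes> h)"
proof -
  let ?C = "subtopology T (word G u v ` X)" and ?D = "subtopology T (word G u w ` Y)"
  let ?X = "top_of_set X" and ?Y = "top_of_set Y"
  let ?q = "\<lambda>(x, y). (word G u v x, word G u w y)"
  have C: "topspace ?C = word G u v ` X" and D: "topspace ?D = word G u w ` Y"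
    using v w by (auto simp: topspace_T intro!: word_closed)
  have cont: "continuous_map ?X ?C (word G u v)" "continuous_map ?Y ?D (word G u w)"
    using word_continuous[OF v] word_continuous[OF w]
    by (auto simp: continuous_map_in_subtopology intro: continuous_map_from_subtopology)
  have "quotient_map (prod_topology ?X ?Y) (prod_topology ?C ?D) ?q"
  proof (rule continuous_imp_quotient_map)
    show "continuous_map (prod_topology ?X ?Y) (prod_topology ?C ?D) ?q"
      using continuous_map_prod_top cont by blast
    show "compact_space (prod_topology ?X ?Y)"
      unfolding compact_space_prod_topology using X Y by (auto simp: compact_space_subtopology)
    show "Hausdorff_space (prod_topology ?C ?D)"
      by (simp add: Hausdorff_space_prod_topology Hausdorff_space_subtopology Hausdorff)
    show "?q ` topspace (prod_topology ?X ?Y) = topspace (prod_topology ?C ?D)"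
      unfolding topspace_prod_topology C D by (force simp: image_iff)
  qed
  moreover have "continuous_map (prod_topology ?X ?Y) T ((\<lambda>(g, h). g \<otimes> h) \<circ> ?q)"
  proof -
    have "continuous_map (prod_topology ?X ?Y) euclidean (\<lambda>z. join (length v) (fst z) (snd z))"
      unfolding subtopology_Times[symmetric]
      by (simp, intro continuous_intros)
    then have "continuous_map (prod_topology ?X ?Y) T (word G u (v @ w) \<circ> (\<lambda>z. join (length v) (fst z) (snd z)))"
      by (rule continuous_map_compose) (use v w in \<open>auto intro!: word_continuous\<close>)
    moreover have "word G u (v @ w) \<circ> (\<lambda>z. join (length v) (fst z) (snd z)) = (\<lambda>(g, h). g \<otimes> h) \<circ> ?q"
      by (auto simp: fun_eq_iff word_join v w)
    ultimately show ?thesis by simp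
  qed
  ultimately show ?thesis by (rule continuous_compose_quotient_map)
qed

text \<open>Continuity of two factors does not imply continuity of their product in
  \<open>T\<close>. Strengthened by local boundedness, the property passes to products.\<close>

definition locally_word_bounded :: "('z::topological_space \<Rightarrow> 'a) \<Rightarrow> bool" where
  "locally_word_bounded f \<longleftrightarrow> continuous_map euclidean T f \<and> (\<forall>z. \<exists>V. open V \<and> z \<in> V \<and> word_bounded (f ` V))"

lemma locally_word_bounded_compose:
  assumes f: "locally_word_bounded f" and g: "continuous_on UNIV g"
  shows "locally_word_bounded (\<lambda>x. f (g x))"
  unfolding locally_word_bounded_def
proof (intro conjI allI)
  have "continuous_map euclidean T (f \<circ> g)"
    by (rule continuous_map_compose[of _ euclidean]) (use f g in \<open>auto simp: locally_word_bounded_def\<close>)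
  then show "continuous_map euclidean T (\<lambda>x. f (g x))" by (simp add: o_def)
  fix x
  obtain V where V: "open V" "g x \<in> V" "word_bounded (f ` V)"
    using f unfolding locally_word_bounded_def by blast
  show "\<exists>V. open V \<and> x \<in> V \<and> word_bounded ((\<lambda>x. f (g x)) ` V)"
  proof (intro exI conjI)
    show "open (g -` V)" by (rule open_vimage[OF V(1) g])
    show "word_bounded ((\<lambda>x. f (g x)) ` (g -` V))" by (rule word_bounded_subset[OF V(3)]) auto
  qed (use V in auto)
qed

lemma locally_word_bounded_const: "g \<in> carrier G \<Longrightarrow> locally_word_bounded (\<lambda>_. g)"
  unfolding locally_word_bounded_def
  by (auto simp: topspace_T image_constant_conv intro!: exI[of _ UNIV] word_bounded_singleton)

text \<open>Near a point the pair of values moves in a product of two compact images of words, on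
  which multiplication is continuous; continuity is a local property of the source.\<close>

lemma locally_word_bounded_mult:
  fixes f g :: "'z::topological_space \<Rightarrow> 'a"
  assumes f: "locally_word_bounded f" and g: "locally_word_bounded g"
  shows "locally_word_bounded (\<lambda>z. f z \<otimes> g z)"
proof -
  have fc: "f z \<in> carrier G" "g z \<in> carrier G" for z
    using f g by (auto simp: locally_word_bounded_def continuous_map_def topspace_T)
  have loc: "\<exists>V. open V \<and> z \<in> V \<and> word_bounded ((\<lambda>z. f z \<otimes> g z) ` V) \<and>
      continuous_map (top_of_set V) T (\<lambda>z. f z \<otimes> g z)" for z
  proof -
    obtain V where V: "open V" "z \<in> V" "word_bounded (f ` V)" using f unfolding locally_word_bounded_def by blast
    obtain W where W: "open W" "z \<in> W" "word_bounded (g ` W)" using g unfolding locally_word_bounded_def by blast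
    let ?O = "V \<inter> W"
    obtain v X where v: "v \<in> lists J" "compact X" "f ` V \<subseteq> word G u v ` X"
      using V(3) unfolding word_bounded_def by blast
    obtain w Y where w: "w \<in> lists J" "compact Y" "g ` W \<subseteq> word G u w ` Y"
      using W(3) unfolding word_bounded_def by blast
    have "continuous_map (top_of_set ?O) (prod_topology (subtopology T (word G u v ` X)) (subtopology T (word G u w ` Y))) (\<lambda>z. (f z, g z))"
      using f g v(3) w(3) unfolding locally_word_bounded_def
      by (auto simp: continuous_map_paired continuous_map_in_subtopology intro: continuous_map_from_subtopology)
    from continuous_map_compose[OF this mult_continuous_on_compact[OF v(1,2) w(1,2)]]
    have c: "continuous_map (top_of_set ?O) T (\<lambda>z. f z \<otimes> g z)" by (simp add: o_def)
    have "word_bounded {a \<otimes> b | a b. a \<in> f ` V \<and> b \<in> g ` W}"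
      by (rule word_bounded_mult[OF V(3) W(3)])
    then have "word_bounded ((\<lambda>z. f z \<otimes> g z) ` ?O)"
      by (rule word_bounded_subset) auto
    with c V W show ?thesis by (intro exI[of _ ?O]) auto
  qed
  have "continuous_map euclidean T (\<lambda>z. f z \<otimes> g z)"
    unfolding continuous_map_def
  proof (intro conjI allI impI)
    fix U assume U: "openin T U"
    have "open {z. f z \<otimes> g z \<in> U}"
    proof (subst open_subopen, clarify)
      fix z assume z: "f z \<otimes> g z \<in> U"
      obtain V where V: "open V" "z \<in> V" "continuous_map (top_of_set V) T (\<lambda>z. f z \<otimes> g z)" using loc by blast
      have "openin (top_of_set V) {x \<in> topspace (top_of_set V). f x \<otimes> g x \<in> U}"
        by (rule openin_continuous_map_preimage[OF V(3) U])
      then have "open {x \<in> V. f x \<otimes> g x \<in> U}" using V(1) by (simp add: openin_open_eq)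
      with V z show "\<exists>T. open T \<and> z \<in> T \<and> T \<subseteq> {z. f z \<otimes> g z \<in> U}"
        by (intro exI[of _ "{x \<in> V. f x \<otimes> g x \<in> U}"]) auto
    qed
    then show "openin euclidean {x \<in> topspace euclidean. f x \<otimes> g x \<in> U}" by simp
  qed (use fc in \<open>auto simp: topspace_T\<close>)
  with loc show ?thesis unfolding locally_word_bounded_def by meson
qed

text \<open>Rational endpoints make the cover by small compact sets countable.\<close>

definition rat_box :: "real list \<Rightarrow> real list \<Rightarrow> (nat \<Rightarrow> real) set" where
  "rat_box as bs = {x. \<forall>n. x n \<in> {(if n < length as then as ! n else 0)..(if n < length bs then bs ! n else 0)}}"

lemma compact_rat_box: "compact (rat_box as bs)"
  unfolding rat_box_def by (rule compact_countable_box)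

text \<open>The map sending (x, y) to the inverse of \<open>word G u w x\<close> times
  \<open>word G u w y\<close> is again a word map, for \<open>rev w @ w\<close>, hence continuous,
  and it takes the value one on the diagonal. A small box around the parameters of \<open>g\<close>
  therefore has its quotients in \<open>U\<close>.\<close>

lemma small_compact_cover:
  assumes U: "openin T U" "\<one> \<in> U" and g: "g \<in> carrier G"
  shows "\<exists>w\<in>lists J. \<exists>as\<in>lists \<rat>. \<exists>bs\<in>lists \<rat>. g \<in> word G u w ` rat_box as bs \<and>
    (\<forall>h\<in>word G u w ` rat_box as bs. \<forall>h'\<in>word G u w ` rat_box as bs. inv h \<otimes> h' \<in> U)"
proof -
  obtain w p0 where w: "w \<in> lists J" and gp0: "g = word G u w p0" using generated[OF g] by blast
  define N where "N = length w"
  \<comment> \<open>\<open>rat_box\<close> forces every coordinate beyond its lists to be 0, so the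
    entries that the word does not read are reset to 0 to let \<open>p\<close> lie in the
    box.\<close>
  define p where "p = (\<lambda>n. if n < N then p0 n else 0)"
  have gp: "g = word G u w p" unfolding gp0 by (rule word_cong) (simp add: p_def N_def)
  define Q where "Q = (\<lambda>(x :: nat \<Rightarrow> real, y). join N (\<lambda>n. - x (N - 1 - n)) y)"
  have Q: "word G u (rev w @ w) (Q (x, y)) = inv (word G u w x) \<otimes> word G u w y" for x y
    using word_join[of "rev w" w "\<lambda>n. - x (N - 1 - n)" y] w
    by (simp add: Q_def inv_word N_def in_lists_conv_set)
  have Qc: "continuous_on UNIV Q"
    unfolding Q_def split_beta
    by (rule continuous_on_join, rule continuous_on_coordinatewise_then_product)
      (intro continuous_on_minus continuous_on_product_then_coordinatewise[OF continuous_on_fst[OF continuous_on_id]]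
         continuous_on_snd continuous_on_id)+
  have rw: "rev w @ w \<in> lists J" using w by (simp add: in_lists_conv_set)
  have "open (Q -` {z. word G u (rev w @ w) z \<in> U})"
    using U rw by (intro open_vimage[OF _ Qc]) (simp add: openin_iff del: append_in_lists_conv)
  moreover have "(p, p) \<in> Q -` {z. word G u (rev w @ w) z \<in> U}"
    using U Q[of p p] w by (simp add: word_closed)
  ultimately obtain A B where AB: "open A" "open B" "p \<in> A" "p \<in> B" "A \<times> B \<subseteq> Q -` {z. word G u (rev w @ w) z \<in> U}"
    by (rule open_prod_elim) auto
  have "openin (product_topology (\<lambda>i. euclidean) UNIV) (A \<inter> B)"
    unfolding euclidean_product_topology using AB by (simp add: open_Int)
  from product_topology_open_contains_basis[OF this, of p] AB
  obtain X where X: "\<And>i. p i \<in> X i" "\<And>i. open (X i)" "PiE UNIV X \<subseteq> A \<inter> B"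
    by (auto simp: PiE_def Pi_def)
  have "\<exists>a\<in>\<rat>. \<exists>b\<in>\<rat>. p i \<in> {a..b} \<and> {a..b} \<subseteq> X i" for i
  proof -
    obtain e where e: "e > 0" "\<And>y. \<bar>y - p i\<bar> < e \<Longrightarrow> y \<in> X i"
      using X(1,2) by (metis open_real)
    obtain a where a: "a \<in> \<rat>" "p i - e < a" "a < p i" using Rats_dense_in_real[of "p i - e" "p i"] e by auto
    obtain b where b: "b \<in> \<rat>" "p i < b" "b < p i + e" using Rats_dense_in_real[of "p i" "p i + e"] e by auto
    have "{a..b} \<subseteq> X i" using a b by (auto intro!: e(2))
    with a b show ?thesis by (intro bexI[of _ a] bexI[of _ b]) auto
  qed
  then obtain a b where ab: "\<And>i. a i \<in> \<rat>" "\<And>i. b i \<in> \<rat>" "\<And>i. p i \<in> {a i..b i}" "\<And>i. {a i..b i} \<subseteq> X i"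
    by metis
  \<comment> \<open>Only the first \<open>N\<close> intervals are recorded. In all other coordinates
    a point of the box agrees with \<open>p\<close>, which lies in the neighbourhood anyway.\<close>
  let ?as = "map a [0..<N]" and ?bs = "map b [0..<N]"
  have sub: "rat_box ?as ?bs \<subseteq> A \<inter> B"
  proof
    fix x assume x: "x \<in> rat_box ?as ?bs"
    have "x i \<in> X i" for i
    proof (cases "i < N")
      case True
      have "x i \<in> {(if i < length ?as then ?as ! i else 0)..(if i < length ?bs then ?bs ! i else 0)}"
        using x unfolding rat_box_def by blast
      then have "x i \<in> {a i..b i}" using True by simp
      then show ?thesis using ab(4) by blast
    next
      case False
      have "x i \<in> {(if i < length ?as then ?as ! i else 0)..(if i < length ?bs then ?bs ! i else 0)}"
        using x unfolding rat_box_def by blast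
      then have "x i = p i" using False by (simp add: p_def)
      then show ?thesis using X(1) by simp
    qed
    then show "x \<in> A \<inter> B" using X(3) by (auto simp: PiE_def Pi_def)
  qed
  have "p n \<in> {(if n < length ?as then ?as ! n else 0)..(if n < length ?bs then ?bs ! n else 0)}" for n
    using ab(3)[of n] by (auto simp: p_def)
  then have pin: "p \<in> rat_box ?as ?bs"
    unfolding rat_box_def by blast
  show ?thesis
  proof (intro bexI conjI ballI)
    show "g \<in> word G u w ` rat_box ?as ?bs" using gp pin by blast
    show "?as \<in> lists \<rat>" "?bs \<in> lists \<rat>" using ab by auto
    show "w \<in> lists J" by (rule w)
    fix h h' assume "h \<in> word G u w ` rat_box ?as ?bs" "h' \<in> word G u w ` rat_box ?as ?bs"
    then obtain x y where xy: "x \<in> rat_box ?as ?bs" "h = word G u w x" "y \<in> rat_box ?as ?bs" "h' = word G u w y"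
      by blast
    then have "(x, y) \<in> A \<times> B" using sub by blast
    then show "inv h \<otimes> h' \<in> U" using AB(5) Q[of x y] xy by auto
  qed
qed

text \<open>
  Steinhaus: one of countably many compact sets \<open>C\<close> with \<open>C\<^sup>-\<^sup>1 C \<subseteq> U\<close> has a non-null preimage.
\<close>

lemma measurable_one_param:
  fixes \<theta> :: "real \<Rightarrow> 'a"
  assumes add: "\<And>r s. \<theta> (r + s) = \<theta> r \<otimes> \<theta> s"
    and cl: "\<And>r. \<theta> r \<in> carrier G"
    and meas: "\<And>U. openin T U \<Longrightarrow> {r. \<theta> r \<in> U} \<in> sets lebesgue"
    and U: "openin T U" "\<one> \<in> U"
  shows "\<exists>d>0. \<exists>S. word_bounded S \<and> S \<subseteq> U \<and> (\<forall>t. \<bar>t\<bar> < d \<longrightarrow> \<theta> t \<in> S)"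
proof -
  define I where "I = {(w, as, bs). w \<in> lists J \<and> as \<in> lists \<rat> \<and> bs \<in> lists \<rat> \<and>
    (\<forall>h\<in>word G u w ` rat_box as bs. \<forall>h'\<in>word G u w ` rat_box as bs. inv h \<otimes> h' \<in> U)}"
  define C where "C = (\<lambda>(w, as, bs). word G u w ` rat_box as bs)"
  have cI: "countable I"
  proof (rule countable_subset)
    show "I \<subseteq> lists J \<times> lists \<rat> \<times> lists \<rat>" unfolding I_def by blast
    show "countable (lists J \<times> lists (\<rat> :: real set) \<times> lists (\<rat> :: real set))"
      by (intro countable_SIGMA countable_lists countable_J countable_rat)
  qed
  have cover: "(\<Union>i\<in>I. {r. \<theta> r \<in> C i}) = UNIV"
  proof -
    have "\<exists>i\<in>I. \<theta> r \<in> C i" for r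
    proof -
      obtain w as bs where "w \<in> lists J" "as \<in> lists \<rat>" "bs \<in> lists \<rat>" "\<theta> r \<in> word G u w ` rat_box as bs"
        "\<forall>h\<in>word G u w ` rat_box as bs. \<forall>h'\<in>word G u w ` rat_box as bs. inv h \<otimes> h' \<in> U"
        using small_compact_cover[OF U cl[of r]] by blast
      then have "(w, as, bs) \<in> I" "\<theta> r \<in> C (w, as, bs)" unfolding I_def C_def by auto
      then show ?thesis by blast
    qed
    then show ?thesis by blast
  qed
  \<comment> \<open>Compact sets are closed in a Hausdorff space, so measurability of preimages of
    open sets applies to their complements.\<close>
  have Cm: "{r. \<theta> r \<in> C i} \<in> sets lebesgue" if "i \<in> I" for i
  proof -
    obtain w as bs where i: "i = (w, as, bs)" by (cases i)
    have w: "w \<in> lists J" using that unfolding I_def i by blast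
    have "compactin T (C i)"
      unfolding C_def i prod.case
      by (rule image_compactin[OF _ word_continuous[OF w]]) (simp add: compact_rat_box)
    then have "closedin T (C i)" by (rule compactin_imp_closedin[OF Hausdorff])
    then have "openin T (carrier G - C i)" by (simp add: closedin_def topspace_T)
    then have "{r. \<theta> r \<in> carrier G - C i} \<in> sets lebesgue" by (rule meas)
    then have "- {r. \<theta> r \<in> carrier G - C i} \<in> sets lebesgue" by (rule Compl_in_sets_lebesgue[THEN iffD2])
    moreover have "- {r. \<theta> r \<in> carrier G - C i} = {r. \<theta> r \<in> C i}" using cl by auto
    ultimately show ?thesis by simp
  qed
  \<comment> \<open>Countably many null sets cannot cover the line.\<close>
  have "\<exists>i\<in>I. {r. \<theta> r \<in> C i} \<notin> null_sets lebesgue"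
  proof (rule ccontr)
    assume "\<not> ?thesis"
    then have "(\<Union>i\<in>I. {r. \<theta> r \<in> C i}) \<in> null_sets lebesgue"
      by (intro null_sets_UN' cI) auto
    then have "(UNIV :: real set) \<in> null_sets lebesgue" using cover by simp
    then show False by (simp add: null_sets_def)
  qed
  then obtain i where i: "i \<in> I" "{r. \<theta> r \<in> C i} \<notin> null_sets lebesgue" by blast
  obtain d where d: "d > 0" "\<And>t. \<bar>t\<bar> < d \<Longrightarrow> \<exists>x\<in>{r. \<theta> r \<in> C i}. x + t \<in> {r. \<theta> r \<in> C i}"
    using Steinhaus_real[OF Cm[OF i(1)] i(2)] by meson
  obtain w as bs where w1: "i = (w, as, bs)" by (cases i)
  have w: "i = (w, as, bs)" "w \<in> lists J" using i(1) w1 unfolding I_def by auto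
  have good: "inv h \<otimes> h' \<in> U" if "h \<in> C i" "h' \<in> C i" for h h'
    using i(1) that unfolding w1 I_def C_def by blast
  have bC: "word_bounded (C i)"
    unfolding word_bounded_def using w compact_rat_box by (auto simp: C_def intro!: bexI[of _ w])
  show ?thesis
  proof (intro exI conjI allI impI)
    show "d > 0" by (rule d(1))
    show "word_bounded {g \<otimes> h | g h. g \<in> m_inv G ` C i \<and> h \<in> C i}"
      by (intro word_bounded_mult word_bounded_inv bC)
    show "{g \<otimes> h | g h. g \<in> m_inv G ` C i \<and> h \<in> C i} \<subseteq> U" using good by auto
    fix t :: real assume "\<bar>t\<bar> < d"
    then obtain x where x: "\<theta> x \<in> C i" "\<theta> (x + t) \<in> C i" using d(2) by blast
    \<comment> \<open>A small shift t is a difference of two parameters that land in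
      \<open>C i\<close>, so its image is a quotient of two elements of \<open>C i\<close>.\<close>
    have "inv (\<theta> x) \<otimes> \<theta> (x + t) = \<theta> t"
      by (simp add: add cl m_assoc[symmetric])
    then show "\<theta> t \<in> {g \<otimes> h | g h. g \<in> m_inv G ` C i \<and> h \<in> C i}" using x by force
  qed
qed

text \<open>Continuity at a parameter \<open>r0\<close> is continuity at 0 for the neighbourhood
  translated by \<theta>(r0), which is open because left translations are continuous. Boundedness
  near a point comes from the same argument with the whole group as neighbourhood.\<close>

lemma measurable_one_param_locally_word_bounded:
  fixes \<theta> :: "real \<Rightarrow> 'a"
  assumes add: "\<And>r s. \<theta> (r + s) = \<theta> r \<otimes> \<theta> s"
    and cl: "\<And>r. \<theta> r \<in> carrier G"
    and meas: "\<And>U. openin T U \<Longrightarrow> {r. \<theta> r \<in> U} \<in> sets lebesgue"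
  shows "locally_word_bounded \<theta>"
  unfolding locally_word_bounded_def
proof (intro conjI allI)
  have eq: "\<theta> r = \<theta> r0 \<otimes> \<theta> (r - r0)" for r r0 using add[of r0 "r - r0"] by simp
  show "continuous_map euclidean T \<theta>"
    unfolding continuous_map_def
  proof (intro conjI allI impI)
    fix U assume U: "openin T U"
    have "open {r. \<theta> r \<in> U}"
      unfolding open_real
    proof clarify
      fix r0 assume r0: "\<theta> r0 \<in> U"
      let ?V = "{h \<in> carrier G. \<theta> r0 \<otimes> h \<in> U}"
      have V: "openin T ?V" "\<one> \<in> ?V"
        using r0 by (auto intro: left_translation_open cl U simp: cl)
      obtain d S where "d > 0" "S \<subseteq> ?V" "\<And>t. \<bar>t\<bar> < d \<Longrightarrow> \<theta> t \<in> S"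
        using measurable_one_param[OF add cl meas V] by meson
      then have "\<theta> r \<in> U" if "\<bar>r - r0\<bar> < d" for r using eq[of r r0] that by fastforce
      with \<open>d > 0\<close> show "\<exists>e>0. \<forall>x'. \<bar>x' - r0\<bar> < e \<longrightarrow> x' \<in> {r. \<theta> r \<in> U}" by auto
    qed
    then show "openin euclidean {x \<in> topspace euclidean. \<theta> x \<in> U}" by simp
  qed (auto simp: cl topspace_T)
  fix z :: real
  have T: "openin T (carrier G)" "\<one> \<in> carrier G" using openin_topspace[of T] by (auto simp: topspace_T)
  obtain d S where d: "d > 0" "word_bounded S" "\<And>t. \<bar>t\<bar> < d \<Longrightarrow> \<theta> t \<in> S"
    using measurable_one_param[OF add cl meas T] by meson
  have "word_bounded (\<theta> ` ball z d)"
  proof (rule word_bounded_subset[OF word_bounded_mult[OF word_bounded_singleton[OF cl[of z]] d(2)]])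
    show "\<theta> ` ball z d \<subseteq> {g \<otimes> h |g h. g \<in> {\<theta> z} \<and> h \<in> S}"
    proof clarify
      fix r assume "r \<in> ball z d"
      then have "\<theta> (r - z) \<in> S" by (intro d(3)) (simp add: dist_real_def abs_minus_commute)
      then show "\<exists>g h. \<theta> r = g \<otimes> h \<and> g \<in> {\<theta> z} \<and> h \<in> S" using eq[of r z] by blast
    qed
  qed
  then show "\<exists>V. open V \<and> z \<in> V \<and> word_bounded (\<theta> ` V)"
    using d(1) by (intro exI[of _ "ball z d"]) auto
qed

end

section \<open>Closed one-parameter subgroups as Lie groups\<close>

text \<open>The coordinate expressions that occur for a line are the identity, negation and the sum
  of two coordinates, all of this form. The induction closes because partial derivatives are
  constant, and constants are the case of vanishing slopes.\<close>

lemma Ck_affine: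
  assumes n: "n \<ge> 1" and m: "b = 0 \<or> n \<ge> 2"
  shows "Ck n k (topspace (Euclidean_space n)) (\<lambda>x. a * x 0 + b * x 1 + c)"
  using m
proof (induction k arbitrary: a b c)
  have cont: "continuous_map (subtopology (Euclidean_space n) (topspace (Euclidean_space n))) euclideanreal
      (\<lambda>x. a * x 0 + b * x 1 + c)" for a b c
    unfolding Euclidean_space_def
    by (intro continuous_map_from_subtopology)
      (auto simp: euclidean_product_topology intro!: continuous_intros continuous_on_product_then_coordinatewise[OF continuous_on_id])
  {
    case 0
    show ?case using cont by simp
  next
    case (Suc k)
    let ?f' = "\<lambda>i x. (if i = 0 then a else if i = 1 then b else (0::real))"
    have der: "((\<lambda>s. a * (x(i := s)) 0 + b * (x(i := s)) 1 + c) has_real_derivative ?f' i x) (at (x i))"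
      for i :: nat and x :: "nat \<Rightarrow> real"
      by (auto intro!: derivative_eq_intros)
    have const: "Ck n k (topspace (Euclidean_space n)) (\<lambda>x. d)" for d
      using Suc.IH[of 0 0 d] by simp
    have "Ck n k (topspace (Euclidean_space n)) (?f' i)" for i by (rule const)
    then show ?case using cont der by (auto intro!: exI[of _ ?f'])
  }
qed

text \<open>Expressions in charts agree with affine maps only on sequences vanishing from index
  \<open>n\<close> on. The partial derivatives up to order \<open>k\<close> do not see more, because
  changing a coordinate below \<open>n\<close> stays inside that set.\<close>

lemma Ck_cong:
  assumes eq: "\<And>x. x \<in> topspace (Euclidean_space n) \<Longrightarrow> f x = g x"
    and f: "Ck n k (topspace (Euclidean_space n)) f"
  shows "Ck n k (topspace (Euclidean_space n)) g"
proof -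
  let ?E = "topspace (Euclidean_space n)"
  have cont: "continuous_map (subtopology (Euclidean_space n) ?E) euclideanreal g"
    if "continuous_map (subtopology (Euclidean_space n) ?E) euclideanreal f"
    using that by (rule continuous_map_eq) (use eq in auto)
  have upd: "x(i := s) \<in> ?E" if "x \<in> ?E" "i < n" for x i s
    using that by (auto simp: topspace_Euclidean_space)
  show ?thesis
  proof (cases k)
    case (Suc k')
    obtain f' where f': "\<And>i x. i < n \<Longrightarrow> x \<in> ?E \<Longrightarrow> ((\<lambda>s. f (x(i := s))) has_real_derivative f' i x) (at (x i))"
      "\<And>i. i < n \<Longrightarrow> Ck n k' ?E (f' i)"
      using f unfolding Suc by auto
    have "((\<lambda>s. g (x(i := s))) has_real_derivative f' i x) (at (x i))" if "i < n" "x \<in> ?E" for i x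
    proof -
      have "(\<lambda>s. g (x(i := s))) = (\<lambda>s. f (x(i := s)))" using eq[OF upd[OF that(2,1)]] by auto
      then show ?thesis using f'(1)[OF that] by simp
    qed
    then show ?thesis using f'(2) cont f unfolding Suc by auto
  qed (use cont f in auto)
qed

lemma smooth_on_affine:
  assumes "n \<ge> 1" "b = 0 \<or> n \<ge> 2"
    and eq: "\<And>x. x \<in> topspace (Euclidean_space n) \<Longrightarrow> f x 0 = a * x 0 + b * x 1 + c"
  shows "smooth_on n 1 (topspace (Euclidean_space n)) f"
  unfolding smooth_on_def
  by (auto intro!: Ck_cong[OF _ Ck_affine[OF assms(1,2)]] simp: eq)

context one_param_group begin

text \<open>The function \<rho> is a continuous inverse of the parametrization, defined on all of
  the group; it serves as a global coordinate on the subgroup.\<close>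

definition closed_one_param :: "'j \<Rightarrow> bool" where
  "closed_one_param j \<longleftrightarrow> closedin T (range (u j)) \<and>
    (\<exists>\<rho>. continuous_map T euclideanreal \<rho> \<and> (\<forall>r. \<rho> (u j r) = r))"

context
  fixes j \<rho>
  assumes j: "j \<in> J" and closed: "closedin T (range (u j))"
    and cont: "continuous_map T euclideanreal \<rho>" and \<rho>: "\<And>r. \<rho> (u j r) = r"
begin

lemma u_continuous: "continuous_map euclideanreal T (u j)"
proof -
  have "continuous_map euclideanreal euclidean (\<lambda>r (n::nat). r)"
    by (simp add: continuous_on_coordinatewise_then_product)
  from continuous_map_compose[OF this word_continuous[of "[j]"]] j
  have "continuous_map euclideanreal T (word G u [j] \<circ> (\<lambda>r n. r))" by simp
  moreover have "word G u [j] \<circ> (\<lambda>r n. r) = u j" using j by (auto simp: u_closed fun_eq_iff)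
  ultimately show ?thesis by simp
qed

lemma range_subgroup: "subgroup (range (u j)) G"
proof (rule subgroupI)
  show "inv a \<in> range (u j)" if "a \<in> range (u j)" for a using that j by (auto simp: inv_u)
  show "a \<otimes> b \<in> range (u j)" if "a \<in> range (u j)" "b \<in> range (u j)" for a b
    using that j by (auto simp: u_add[symmetric])
qed (use j u_closed in auto)

lemma topspace_range: "topspace (subtopology T (range (u j))) = range (u j)"
  using j by (auto simp: topspace_T u_closed)

abbreviation line_chart :: "'a \<Rightarrow> nat \<Rightarrow> real" where
  "line_chart \<equiv> (\<lambda>g k. if k = 0 then \<rho> g else 0)"

lemma line_chart_image: "line_chart ` range (u j) = topspace (Euclidean_space 1)"
proof -
  have "x \<in> line_chart ` range (u j)" if "x \<in> topspace (Euclidean_space 1)" for x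
    using that by (intro image_eqI[of _ _ "u j (x 0)"]) (auto simp: topspace_Euclidean_space \<rho> fun_eq_iff)
  then show ?thesis by (auto simp: topspace_Euclidean_space)
qed

lemma line_chart_inv:
  assumes "x \<in> topspace (Euclidean_space 1)"
  shows "inv_into (range (u j)) line_chart x = u j (x 0)"
proof -
  have "inj_on line_chart (range (u j))"
  proof (rule inj_onI, clarify)
    fix r s assume eq: "line_chart (u j r) = line_chart (u j s)"
    show "u j r = u j s" using fun_cong[OF eq, of 0] by (simp add: \<rho>)
  qed
  moreover have "line_chart (u j (x 0)) = x"
    using assms by (auto simp: topspace_Euclidean_space \<rho> fun_eq_iff)
  ultimately show ?thesis by (intro inv_into_f_eq) auto
qed

lemma homeomorphic_line_chart:
  "homeomorphic_map (subtopology T (range (u j))) (Euclidean_space 1) line_chart"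
proof -
  have "homeomorphic_maps (subtopology T (range (u j))) (Euclidean_space 1) line_chart (\<lambda>x. u j (x 0))"
    unfolding homeomorphic_maps_def
  proof (intro conjI ballI)
    show "continuous_map (subtopology T (range (u j))) (Euclidean_space 1) line_chart"
      unfolding Euclidean_space_def continuous_map_in_subtopology continuous_map_componentwise_UNIV
    proof (intro conjI allI)
      fix k show "continuous_map (subtopology T (range (u j))) euclideanreal (\<lambda>g. if k = 0 then \<rho> g else 0)"
        by (cases "k = 0") (auto intro: continuous_map_from_subtopology cont)
    qed auto
    have "continuous_map (Euclidean_space 1) euclideanreal (\<lambda>x. x 0)"
      unfolding Euclidean_space_def
      by (intro continuous_map_from_subtopology continuous_map_product_projection) auto
    from continuous_map_compose[OF this u_continuous]
    show "continuous_map (Euclidean_space 1) (subtopology T (range (u j))) (\<lambda>x. u j (x 0))"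
      by (simp add: continuous_map_in_subtopology o_def image_subset_iff)
    show "u j (line_chart g 0) = g" if "g \<in> topspace (subtopology T (range (u j)))" for g
      using that by (auto simp: topspace_range \<rho>)
    show "line_chart (u j (x 0)) = x" if "x \<in> topspace (Euclidean_space 1)" for x
      using that by (auto simp: topspace_Euclidean_space \<rho> fun_eq_iff)
  qed
  then show ?thesis using homeomorphic_maps_map by blast
qed

lemma second_countable_Euclidean_space: "second_countable (Euclidean_space n)"
proof -
  have "second_countable (euclidean :: (nat \<Rightarrow> real) topology)"
    using second_countable_def[of "euclidean :: (nat \<Rightarrow> real) topology"]
      ex_countable_basis[where 'a="nat \<Rightarrow> real"]
    by (metis open_openin topological_basisE topological_basis_open)
  then show ?thesis
    unfolding Euclidean_space_def euclidean_product_topology by (rule second_countable_subtopology)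
qed

text \<open>The coordinate \<rho> gives an atlas with one global chart. In it multiplication is
  addition of reals and inversion is negation, both affine.\<close>

lemma lie_subgroup_range: "lie_subgroup (range (u j)) G T"
proof -
  let ?L = "range (u j)" and ?A = "{(range (u j), line_chart)}"
  let ?T = "subtopology T (range (u j))"
  have usub: "?L \<subseteq> topspace T" using j by (auto simp: topspace_T u_closed)
  have grp: "group (G \<lparr>carrier := ?L\<rparr>)"
    using range_subgroup subgroup_imp_group by blast
  have inv: "inv\<^bsub>G \<lparr>carrier := ?L\<rparr>\<^esub> (u j r) = u j (- r)" for r
    using m_inv_consistent[OF range_subgroup, of "u j r"] j by (simp add: inv_u)
  have sc: "second_countable ?T"
    using homeomorphic_space_second_countability[OF homeomorphic_map_imp_homeomorphic_space[OF homeomorphic_line_chart]]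
      second_countable_Euclidean_space by blast
  have sid: "smooth_on 1 1 (topspace (Euclidean_space 1)) (\<lambda>x. line_chart (inv_into ?L line_chart x))"
    by (rule smooth_on_affine[of _ 0 _ 1 0]) (auto simp: line_chart_inv \<rho>)
  have at: "smooth_atlas 1 ?T ?A"
    unfolding smooth_atlas_def chart_on_def
  proof (intro conjI ballI)
    fix c assume "c \<in> ?A"
    then have c: "c = (?L, line_chart)" by simp
    show "case c of (U, \<phi>) \<Rightarrow> openin ?T U \<and> openin (Euclidean_space 1) (\<phi> ` U) \<and>
      homeomorphic_map (subtopology ?T U) (subtopology (Euclidean_space 1) (\<phi> ` U)) \<phi>"
      unfolding c prod.case line_chart_image
      using homeomorphic_line_chart openin_topspace[of ?T, unfolded topspace_range]
      by (simp add: subtopology_subtopology subtopology_topspace)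
  next
    show "(\<Union>c\<in>?A. fst c) = topspace ?T" using usub by auto
  next
    fix c assume "c \<in> ?A"
    then have c: "c = (?L, line_chart)" by simp
    show "case c of (U, \<phi>) \<Rightarrow> \<forall>(V, \<psi>)\<in>?A. smooth_on 1 1 (\<phi> ` (U \<inter> V)) (\<lambda>x. \<psi> (inv_into U \<phi> x))"
      unfolding c using sid by (simp add: line_chart_image)
  qed
  have sm: "smooth_map (1 + 1) (prod_topology ?T ?T) (prod_atlas 1 ?A ?A) 1 ?T ?A
         (\<lambda>(x, y). x \<otimes>\<^bsub>G \<lparr>carrier := ?L\<rparr>\<^esub> y)"
  proof -
    \<comment> \<open>The product chart for \<open>n = 1\<close>: entry 0 holds the parameter of the
      first factor, entry 1 that of the second.\<close>
    let ?\<Phi> = "\<lambda>(x, y) k. if k = 0 then line_chart x k else line_chart y (k - 1)"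
    have e2: "?\<Phi> (u j (x 0), u j (x 1)) = x" if x: "x \<in> topspace (Euclidean_space 2)" for x
    proof (rule ext)
      fix k :: nat
      consider "k = 0" | "k = 1" | "k \<ge> 2" by linarith
      then show "?\<Phi> (u j (x 0), u j (x 1)) k = x k"
        using x by cases (auto simp: \<rho> topspace_Euclidean_space)
    qed
    have im: "?\<Phi> ` (?L \<times> ?L) = topspace (Euclidean_space 2)"
    proof -
      have "x \<in> ?\<Phi> ` (?L \<times> ?L)" if "x \<in> topspace (Euclidean_space 2)" for x
        by (rule image_eqI[of x ?\<Phi> "(u j (x 0), u j (x 1))"]) (use e2[OF that] in \<open>auto simp only: mem_Sigma_iff rangeI\<close>)
      then show ?thesis by (auto simp: topspace_Euclidean_space)
    qed
    have inj: "inj_on ?\<Phi> (?L \<times> ?L)"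
    proof (rule inj_onI, clarify)
      fix r s r' s' assume eq: "(\<lambda>k. if k = 0 then line_chart (u j r) k else line_chart (u j s) (k - 1)) =
        (\<lambda>k. if k = 0 then line_chart (u j r') k else line_chart (u j s') (k - 1))"
      from fun_cong[OF eq, of 0] fun_cong[OF eq, of 1] show "u j r = u j r' \<and> u j s = u j s'" by (simp add: \<rho>)
    qed
    have invp: "inv_into (?L \<times> ?L) ?\<Phi> x = (u j (x 0), u j (x 1))" if "x \<in> topspace (Euclidean_space 2)" for x
      by (rule inv_into_f_eq[OF inj _ e2[OF that]]) auto
    have sp: "smooth_on (1 + 1) 1 (topspace (Euclidean_space 2))
        (\<lambda>x. line_chart ((\<lambda>(x, y). x \<otimes> y) (inv_into (?L \<times> ?L) ?\<Phi> x)))"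
      unfolding one_add_one
      by (rule smooth_on_affine[of _ 1 _ 1 0]) (use j in \<open>auto simp: invp[simplified] u_add[symmetric] \<rho>\<close>)
    have c: "continuous_map (prod_topology ?T ?T) ?T (\<lambda>(x, y). x \<otimes> y)"
    proof -
      have "continuous_map (prod_topology ?T ?T) euclideanreal (\<lambda>z. \<rho> (fst z) + \<rho> (snd z))"
        by (intro continuous_map_add continuous_map_compose[OF continuous_map_fst, unfolded o_def]
          continuous_map_compose[OF continuous_map_snd, unfolded o_def] continuous_map_from_subtopology cont)
      from continuous_map_compose[OF this u_continuous]
      have "continuous_map (prod_topology ?T ?T) ?T (\<lambda>z. u j (\<rho> (fst z) + \<rho> (snd z)))"
        by (simp add: continuous_map_in_subtopology o_def image_subset_iff)
      then show ?thesis
        by (rule continuous_map_eq) (use j in \<open>auto simp: \<rho> u_add u_closed\<close>)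
    qed
    have mc: "{z \<in> ?L \<times> ?L. (case z of (x, y) \<Rightarrow> x \<otimes> y) \<in> ?L} = ?L \<times> ?L"
      using j by (auto simp: u_add[symmetric])
    show ?thesis
      unfolding smooth_map_def prod_atlas_def prod_chart_def
      using c sp by (simp add: mc im[simplified])
  qed
  have si: "smooth_map 1 ?T ?A 1 ?T ?A (\<lambda>x. inv\<^bsub>G \<lparr>carrier := ?L\<rparr>\<^esub> x)"
  proof -
    have c: "continuous_map ?T ?T (\<lambda>x. inv\<^bsub>G \<lparr>carrier := ?L\<rparr>\<^esub> x)"
    proof -
      have "continuous_map ?T euclideanreal (\<lambda>z. - \<rho> z)"
        by (intro continuous_map_minus continuous_map_from_subtopology cont)
      from continuous_map_compose[OF this u_continuous]
      have "continuous_map ?T ?T (\<lambda>z. u j (- \<rho> z))"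
        by (simp add: continuous_map_in_subtopology o_def image_subset_iff)
      then show ?thesis
        by (rule continuous_map_eq) (auto simp: \<rho> inv)
    qed
    have ic: "{x \<in> ?L. inv\<^bsub>G \<lparr>carrier := ?L\<rparr>\<^esub> x \<in> ?L} = ?L"
      by (auto simp: inv)
    have "smooth_on 1 1 (topspace (Euclidean_space 1))
        (\<lambda>x. line_chart (inv\<^bsub>G \<lparr>carrier := ?L\<rparr>\<^esub> (inv_into ?L line_chart x)))"
      by (rule smooth_on_affine[of _ 0 _ "-1" 0]) (auto simp: line_chart_inv inv \<rho>)
    then show ?thesis
      unfolding smooth_map_def using c by (simp add: ic line_chart_image)
  qed
  have "lie_group (G \<lparr>carrier := ?L\<rparr>) ?T"
    unfolding lie_group_def using grp Hausdorff_space_subtopology[OF Hausdorff, of ?L] sc at sm si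
    by (intro conjI exI[of _ 1] exI[of _ ?A]) (simp_all add: Int_absorb1[OF usub])
  then show ?thesis unfolding lie_subgroup_def using range_subgroup closed by simp
qed

text \<open>Transported to the line by \<rho>, a Haar measure is translation invariant and finite on
  compact intervals, hence a multiple of Lebesgue measure. Since the multiple is not zero, null sets
  correspond to null sets, and membership in the completion becomes Lebesgue measurability.\<close>

lemma haar_measurable_imp_lebesgue:
  assumes hm: "haar_measurable (G \<lparr>carrier := range (u j)\<rparr>) (subtopology T (range (u j))) A"
  shows "{r. u j r \<in> A} \<in> sets lebesgue"
proof -
  let ?L = "range (u j)" and ?T = "subtopology T (range (u j))"
  obtain M where M: "haar_measure (G \<lparr>carrier := ?L\<rparr>) ?T M" and A: "A \<in> sets (completion M)"
    using hm unfolding haar_measurable_def by blast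
  note M' = M[unfolded haar_measure_def]
  have sp: "space M = ?L" using M' by simp
  have sM: "sets M = sigma_sets ?L {U. openin ?T U}" using M' by simp
  have nz: "emeasure M ?L \<noteq> 0" using M' by simp
  have inv: "emeasure M ((\<lambda>x. g \<otimes> x) ` B) = emeasure M B" if "g \<in> ?L" "B \<in> sets M" for g B
  proof -
    have "\<forall>g\<in>carrier (G\<lparr>carrier := ?L\<rparr>). \<forall>A\<in>sets M.
        emeasure M ((\<lambda>x. g \<otimes>\<^bsub>G\<lparr>carrier := ?L\<rparr>\<^esub> x) ` A) = emeasure M A" using M' by blast
    then show ?thesis using that by auto
  qed
  have fin: "emeasure M C < \<infinity>" if "compactin ?T C" for C using M' that by blast
  have um: "u j \<in> measurable borel M"
  proof (rule measurable_sigma_sets[OF sM])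
    show "{U. openin ?T U} \<subseteq> Pow ?L" using openin_subset[of ?T] by auto
    show "u j \<in> space borel \<rightarrow> ?L" by auto
    fix U assume "U \<in> {U. openin ?T U}"
    then have "openin ?T U" by simp
    moreover have "continuous_map euclideanreal ?T (u j)"
      using u_continuous by (simp add: continuous_map_in_subtopology)
    ultimately have "openin euclidean {x \<in> topspace euclidean. u j x \<in> U}"
      using openin_continuous_map_preimage by blast
    then show "u j -` U \<inter> space borel \<in> sets borel" by (simp add: vimage_def)
  qed
  have \<rho>m: "\<rho> \<in> measurable M borel"
  proof (rule borel_measurableI)
    fix S :: "real set" assume "open S"
    then have "openin euclideanreal S" by simp
    moreover have "continuous_map ?T euclideanreal \<rho>" by (intro continuous_map_from_subtopology cont)
    ultimately have "openin ?T {x \<in> topspace ?T. \<rho> x \<in> S}"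
      by (intro openin_continuous_map_preimage)
    moreover have "{x \<in> topspace ?T. \<rho> x \<in> S} = \<rho> -` S \<inter> space M"
      using j by (auto simp: sp topspace_T u_closed)
    ultimately show "\<rho> -` S \<inter> space M \<in> sets M" by (simp add: sM sigma_sets.Basic)
  qed
  define N where "N = distr M borel \<rho>"
  have N: "emeasure N B = emeasure M (u j ` B)" if "B \<in> sets borel" for B
  proof -
    have "\<rho> -` B \<inter> space M = u j ` B" by (auto simp: sp \<rho>)
    then show ?thesis unfolding N_def using that \<rho>m by (simp add: emeasure_distr)
  qed
  have uB: "u j ` B \<in> sets M" if "B \<in> sets borel" for B
  proof -
    have "\<rho> -` B \<inter> space M = u j ` B" by (auto simp: sp \<rho>)
    then show ?thesis using measurable_sets[OF \<rho>m that] by simp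
  qed
  have eq: "emeasure N B = emeasure N {0..1} * emeasure lborel B" if B: "B \<in> sets borel" for B
  proof (rule translation_invariant_real_measure)
    show "emeasure N ((+) a ` B) = emeasure N B" if "B \<in> sets borel" for a B
    proof -
      have "(+) a ` B = (\<lambda>x. x - a) -` B" by (force simp: image_iff)
      moreover have "(\<lambda>x. x - a) -` B \<inter> space borel \<in> sets borel"
        using that by (intro measurable_sets[of _ borel borel]) auto
      ultimately have aB: "(+) a ` B \<in> sets borel" by simp
      have "u j ` (+) a ` B = (\<lambda>x. u j a \<otimes> x) ` u j ` B"
        using j by (simp add: image_image u_add)
      then show ?thesis using inv[OF _ uB[OF that], of "u j a"] N[OF aB] N[OF that] by simp
    qed
    show "emeasure N {a..b} < \<infinity>" for a b
    proof -
      have "compactin ?T (u j ` {a..b})"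
        by (rule image_compactin[of euclidean]) (use u_continuous in \<open>auto simp: continuous_map_in_subtopology\<close>)
      then show ?thesis using fin N by auto
    qed
  qed (use B in \<open>auto simp: N_def\<close>)
  \<comment> \<open>Without this the measure could vanish identically, and its null sets would say
    nothing about Lebesgue measure.\<close>
  have c0: "emeasure N {0..1} \<noteq> 0"
  proof
    assume "emeasure N {0..1} = 0"
    then have "emeasure N UNIV = 0" using eq[of UNIV] by simp
    then show False using N[of UNIV] nz by simp
  qed
  obtain S N' Z where A: "A = S \<union> N'" "N' \<subseteq> Z" "Z \<in> null_sets M" "S \<in> sets M"
    using A by (rule sets_completionE) auto
  have bor: "{r. u j r \<in> B} \<in> sets borel" if "B \<in> sets M" for B
    using measurable_sets[OF um that] by (simp add: vimage_def)
  have null: "{r. u j r \<in> Z} \<in> null_sets lborel"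
  proof (rule null_setsI)
    have Z: "Z \<in> sets M" using A(3) by auto
    then have "Z \<subseteq> ?L" using sets.sets_into_space sp by blast
    then have "u j ` {r. u j r \<in> Z} = Z" by auto
    then have "emeasure N {r. u j r \<in> Z} = 0" using N[OF bor[OF Z]] A(3) by auto
    then show "emeasure lborel {r. u j r \<in> Z} = 0" using eq[OF bor[OF Z]] c0 by simp
    show "{r. u j r \<in> Z} \<in> sets lborel" using bor[OF Z] by simp
  qed
  have "{r. u j r \<in> S} \<union> {r. u j r \<in> N'} \<in> sets lebesgue"
    using bor[OF A(4)] A(2) by (intro sets_completionI[OF HOL.refl _ null]) auto
  moreover have "{r. u j r \<in> A} = {r. u j r \<in> S} \<union> {r. u j r \<in> N'}" using A(1) by auto
  ultimately show ?thesis by simp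
qed

end

end

theorem measurable_hom_continuous:
  assumes G1: "one_param_group G1 J1 u1 T1" and G2: "one_param_group G2 J2 u2 T2"
    and closed: "\<And>j. j \<in> J1 \<Longrightarrow> one_param_group.closed_one_param u1 T1 j"
    and \<phi>: "measurable_hom G1 T1 G2 T2 \<phi>"
  shows "continuous_map T1 T2 \<phi>"
proof -
  interpret A: one_param_group G1 J1 u1 T1 by fact
  interpret B: one_param_group G2 J2 u2 T2 by fact
  have hom: "\<phi> \<in> hom G1 G2" using \<phi> by (simp add: measurable_hom_def)
  have one: "B.locally_word_bounded (\<lambda>r. \<phi> (u1 j r))" if j: "j \<in> J1" for j
  proof (rule B.measurable_one_param_locally_word_bounded)
    show "\<phi> (u1 j (r + s)) = \<phi> (u1 j r) \<otimes>\<^bsub>G2\<^esub> \<phi> (u1 j s)" for r s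
      using hom j by (simp add: A.u_add A.u_closed hom_mult)
    show "\<phi> (u1 j r) \<in> carrier G2" for r using hom j by (simp add: A.u_closed hom_in_carrier)
    fix U assume U: "openin T2 U"
    obtain \<rho> where \<rho>: "closedin T1 (range (u1 j))" "continuous_map T1 euclideanreal \<rho>" "\<And>r. \<rho> (u1 j r) = r"
      using closed[OF j] unfolding A.closed_one_param_def by blast
    have "haar_measurable (G1 \<lparr>carrier := range (u1 j)\<rparr>) (subtopology T1 (range (u1 j))) {x \<in> range (u1 j). \<phi> x \<in> U}"
      using \<phi> A.lie_subgroup_range[OF j \<rho>] U unfolding measurable_hom_def by blast
    from A.haar_measurable_imp_lebesgue[OF j \<rho> this]
    show "{r. \<phi> (u1 j r) \<in> U} \<in> sets lebesgue" by simp
  qed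
  \<comment> \<open>Local boundedness is part of the induction hypothesis, since continuity along
    the shorter word alone would not survive multiplication by one more letter.\<close>
  have words: "B.locally_word_bounded (\<lambda>x. \<phi> (word G1 u1 w x))" if "w \<in> lists J1" for w
    using that
  proof (induction w)
    case Nil
    have "group_hom G1 G2 \<phi>" using hom by (simp add: group_hom_def group_hom_axioms_def A.is_group B.is_group)
    then show ?case using B.locally_word_bounded_const[OF B.one_closed] by (simp add: group_hom.hom_one)
  next
    case (Cons j w)
    then have jw: "j \<in> J1" "w \<in> lists J1" by auto
    have "B.locally_word_bounded (\<lambda>x. \<phi> (u1 j (x (0::nat))) \<otimes>\<^bsub>G2\<^esub> \<phi> (word G1 u1 w (\<lambda>n. x (Suc n))))"
    proof (rule B.locally_word_bounded_mult)
      show "B.locally_word_bounded (\<lambda>x. \<phi> (u1 j (x (0::nat))))"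
        using one[OF jw(1)] by (rule B.locally_word_bounded_compose) (rule continuous_on_product_coordinates)
      show "B.locally_word_bounded (\<lambda>x. \<phi> (word G1 u1 w (\<lambda>n. x (Suc n))))"
        using Cons.IH by (rule B.locally_word_bounded_compose)
          (intro continuous_on_coordinatewise_then_product continuous_on_product_coordinates)
    qed
    then show ?case using hom jw by (simp add: hom_mult A.u_closed A.word_closed)
  qed
  show ?thesis
    unfolding continuous_map_def
  proof (intro conjI allI impI)
    show "\<phi> \<in> topspace T1 \<rightarrow> topspace T2"
      using hom by (auto simp: A.topspace_T B.topspace_T hom_in_carrier)
    fix U assume U: "openin T2 U"
    have "open {x. word G1 u1 w x \<in> {g \<in> carrier G1. \<phi> g \<in> U}}" if w: "w \<in> lists J1" for w
    proof -
      have "openin euclidean {x \<in> topspace euclidean. \<phi> (word G1 u1 w x) \<in> U}"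
        using words[OF w] U unfolding B.locally_word_bounded_def by (intro openin_continuous_map_preimage) auto
      then show ?thesis using A.word_closed[OF w] by simp
    qed
    then show "openin T1 {x \<in> topspace T1. \<phi> x \<in> U}"
      by (auto simp: A.topspace_T A.openin_iff)
  qed
qed

section \<open>Lie algebras\<close>

locale lie_alg =
  fixes K :: "complex set" and L :: "'v lie_algebra"
  assumes K: "K \<in> {\<real>, UNIV}"
    and zero_closed: "lzero L \<in> carrier L"
    and plus_closed: "v \<in> carrier L \<Longrightarrow> w \<in> carrier L \<Longrightarrow> lplus L v w \<in> carrier L"
    and scale_closed: "a \<in> K \<Longrightarrow> v \<in> carrier L \<Longrightarrow> lscale L a v \<in> carrier L"
    and br_closed: "v \<in> carrier L \<Longrightarrow> w \<in> carrier L \<Longrightarrow> lbracket L v w \<in> carrier L"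
    and plus_assoc: "v \<in> carrier L \<Longrightarrow> w \<in> carrier L \<Longrightarrow> x \<in> carrier L \<Longrightarrow>
      lplus L (lplus L v w) x = lplus L v (lplus L w x)"
    and plus_comm: "v \<in> carrier L \<Longrightarrow> w \<in> carrier L \<Longrightarrow> lplus L v w = lplus L w v"
    and plus_zero: "v \<in> carrier L \<Longrightarrow> lplus L v (lzero L) = v"
    and plus_neg: "v \<in> carrier L \<Longrightarrow> lplus L v (lscale L (-1) v) = lzero L"
    and scale_one: "v \<in> carrier L \<Longrightarrow> lscale L 1 v = v"
    and scale_scale: "a \<in> K \<Longrightarrow> b \<in> K \<Longrightarrow> v \<in> carrier L \<Longrightarrow> lscale L a (lscale L b v) = lscale L (a * b) v"
    and scale_left: "a \<in> K \<Longrightarrow> b \<in> K \<Longrightarrow> v \<in> carrier L \<Longrightarrow>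
      lscale L (a + b) v = lplus L (lscale L a v) (lscale L b v)"
    and scale_right: "a \<in> K \<Longrightarrow> v \<in> carrier L \<Longrightarrow> w \<in> carrier L \<Longrightarrow>
      lscale L a (lplus L v w) = lplus L (lscale L a v) (lscale L a w)"
    and br_plus_left: "v \<in> carrier L \<Longrightarrow> w \<in> carrier L \<Longrightarrow> x \<in> carrier L \<Longrightarrow>
      lbracket L (lplus L v w) x = lplus L (lbracket L v x) (lbracket L w x)"
    and br_plus_right: "v \<in> carrier L \<Longrightarrow> w \<in> carrier L \<Longrightarrow> x \<in> carrier L \<Longrightarrow>
      lbracket L v (lplus L w x) = lplus L (lbracket L v w) (lbracket L v x)"
    and br_scale_left: "a \<in> K \<Longrightarrow> v \<in> carrier L \<Longrightarrow> w \<in> carrier L \<Longrightarrow>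
      lbracket L (lscale L a v) w = lscale L a (lbracket L v w)"
    and br_scale_right: "a \<in> K \<Longrightarrow> v \<in> carrier L \<Longrightarrow> w \<in> carrier L \<Longrightarrow>
      lbracket L v (lscale L a w) = lscale L a (lbracket L v w)"
    and br_self: "v \<in> carrier L \<Longrightarrow> lbracket L v v = lzero L"
    and jacobi: "v \<in> carrier L \<Longrightarrow> w \<in> carrier L \<Longrightarrow> x \<in> carrier L \<Longrightarrow>
      lplus L (lbracket L v (lbracket L w x))
        (lplus L (lbracket L w (lbracket L x v)) (lbracket L x (lbracket L v w))) = lzero L"
begin

lemma K_simps [simp]:
  "0 \<in> K" "1 \<in> K" "numeral n \<in> K" "a \<in> K \<Longrightarrow> - a \<in> K" "a \<in> K \<Longrightarrow> b \<in> K \<Longrightarrow> a + b \<in> K"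
  "a \<in> K \<Longrightarrow> b \<in> K \<Longrightarrow> a - b \<in> K" "a \<in> K \<Longrightarrow> b \<in> K \<Longrightarrow> a * b \<in> K" "a \<in> K \<Longrightarrow> b \<in> K \<Longrightarrow> a / b \<in> K"
  "a \<in> K \<Longrightarrow> inverse a \<in> K" "a \<in> K \<Longrightarrow> a ^ k \<in> K" "of_nat k \<in> K" "of_int i \<in> K" "fact k \<in> K"
  using K by (auto simp: fact_in_Reals)

lemmas closed [simp] = zero_closed plus_closed scale_closed br_closed

text \<open>
  Identities in the algebra, a record, are checked against functionals: this turns \<open>lsum\<close> into sums of
  complex numbers, to which the library applies.
\<close>

definition dual :: "('v \<Rightarrow> complex) set" where
  "dual = {\<xi>. (\<forall>v\<in>carrier L. \<forall>w\<in>carrier L. \<xi> (lplus L v w) = \<xi> v + \<xi> w) \<and>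
     (\<forall>a\<in>K. \<forall>v\<in>carrier L. \<xi> (lscale L a v) = a * \<xi> v)}"

lemma dual_plus: "\<xi> \<in> dual \<Longrightarrow> v \<in> carrier L \<Longrightarrow> w \<in> carrier L \<Longrightarrow> \<xi> (lplus L v w) = \<xi> v + \<xi> w"
  by (simp add: dual_def)

lemma dual_scale: "\<xi> \<in> dual \<Longrightarrow> a \<in> K \<Longrightarrow> v \<in> carrier L \<Longrightarrow> \<xi> (lscale L a v) = a * \<xi> v"
  by (simp add: dual_def)

lemma plus_left_comm:
  "v \<in> carrier L \<Longrightarrow> w \<in> carrier L \<Longrightarrow> x \<in> carrier L \<Longrightarrow> lplus L v (lplus L w x) = lplus L w (lplus L v x)"
  using plus_assoc[of v w x] plus_assoc[of w v x] plus_comm[of v w] by simp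

lemma scale_zero: assumes "v \<in> carrier L" shows "lscale L 0 v = lzero L"
  using scale_left[of 1 "-1" v] assms by (simp add: scale_one plus_neg)

lemma scale_zero_right [simp]: assumes "a \<in> K" shows "lscale L a (lzero L) = lzero L"
  using scale_scale[of a 0 "lzero L"] assms by (simp add: scale_zero)

lemma dual_zero: "\<xi> \<in> dual \<Longrightarrow> \<xi> (lzero L) = 0"
  using dual_scale[of \<xi> 0 "lzero L"] by (simp add: scale_zero)

lemmas dual_simps = dual_plus dual_scale dual_zero

lemma zero_plus: "v \<in> carrier L \<Longrightarrow> lplus L (lzero L) v = v"
  by (simp add: plus_comm plus_zero)

lemma minus_plus_cancel:
  assumes "v \<in> carrier L" "y \<in> carrier L"
  shows "lplus L (lscale L (-1) v) (lplus L v y) = y"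
proof -
  have "lplus L (lscale L (-1) v) v = lzero L" using assms by (simp add: plus_comm[of _ v] plus_neg)
  then show ?thesis using assms by (simp add: plus_assoc[symmetric] zero_plus)
qed

lemma plus_cancel:
  assumes "v \<in> carrier L" "w \<in> carrier L" "x \<in> carrier L" "lplus L v w = lplus L v x" shows "w = x"
proof -
  have "lplus L (lscale L (-1) v) (lplus L v w) = lplus L (lscale L (-1) v) (lplus L v x)" using assms(4) by simp
  then show ?thesis using minus_plus_cancel[OF assms(1)] assms(2,3) by metis
qed

definition lsubspace :: "'v set \<Rightarrow> bool" where
  "lsubspace S \<longleftrightarrow> S \<subseteq> carrier L \<and> lzero L \<in> S \<and> (\<forall>v\<in>S. \<forall>w\<in>S. lplus L v w \<in> S) \<and> (\<forall>a\<in>K. \<forall>v\<in>S. lscale L a v \<in> S)"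

text \<open>By Zorn's lemma there is a subspace M maximal among those that avoid v. It is a
  complement of the line spanned by v, and the coefficient along v is the functional sought.\<close>

lemma dual_nonzero:
  assumes v: "v \<in> carrier L" "v \<noteq> lzero L"
  shows "\<exists>\<xi>\<in>dual. \<xi> v \<noteq> 0"
proof -
  let ?P = "{S. lsubspace S \<and> v \<notin> S}"
  have "\<exists>M\<in>?P. \<forall>X\<in>?P. M \<subseteq> X \<longrightarrow> X = M"
  proof (rule subset_Zorn_nonempty)
    have "lsubspace {lzero L}" by (auto simp: lsubspace_def plus_zero)
    then show "?P \<noteq> {}" using v by blast
    fix C assume C: "C \<noteq> {}" "subset.chain ?P C"
    then have mem: "S \<subseteq> carrier L \<and> lzero L \<in> S" "\<And>a b. a \<in> S \<Longrightarrow> b \<in> S \<Longrightarrow> lplus L a b \<in> S"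
       "\<And>a b. a \<in> K \<Longrightarrow> b \<in> S \<Longrightarrow> lscale L a b \<in> S" "v \<notin> S" if "S \<in> C" for S
      using that unfolding subset.chain_def lsubspace_def by blast+
    have ch: "S \<subseteq> S' \<or> S' \<subseteq> S" if "S \<in> C" "S' \<in> C" for S S'
      using C that unfolding subset.chain_def by blast
    have "lplus L a b \<in> \<Union>C" if ab: "a \<in> \<Union>C" "b \<in> \<Union>C" for a b
    proof -
      obtain S S' where S: "S \<in> C" "a \<in> S" "S' \<in> C" "b \<in> S'" using ab by blast
      show ?thesis
      proof (cases "S \<subseteq> S'")
        case True
        then have "lplus L a b \<in> S'" using S mem(2)[of S' a b] by blast
        then show ?thesis using S by blast
      next
        case False
        then have "S' \<subseteq> S" using ch S by blast
        then have "lplus L a b \<in> S" using S mem(2)[of S a b] by blast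
        then show ?thesis using S by blast
      qed
    qed
    moreover have "\<Union>C \<subseteq> carrier L" using mem(1) by blast
    moreover have "lzero L \<in> \<Union>C"
    proof -
      obtain S where "S \<in> C" using C(1) by blast
      then show ?thesis using mem(1)[of S] by blast
    qed
    moreover have "v \<notin> \<Union>C" using mem(4) by blast
    moreover have "lscale L a b \<in> \<Union>C" if "a \<in> K" "b \<in> \<Union>C" for a b using that mem(3) by blast
    ultimately show "\<Union>C \<in> ?P" unfolding lsubspace_def mem_Collect_eq by (intro conjI ballI)
  qed
  then obtain M where M: "lsubspace M" "v \<notin> M" and max: "\<And>X. lsubspace X \<Longrightarrow> v \<notin> X \<Longrightarrow> M \<subseteq> X \<Longrightarrow> X = M"
    by blast
  have Mc: "M \<subseteq> carrier L" "lzero L \<in> M" "\<And>a b. a \<in> M \<Longrightarrow> b \<in> M \<Longrightarrow> lplus L a b \<in> M"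
    "\<And>a b. a \<in> K \<Longrightarrow> b \<in> M \<Longrightarrow> lscale L a b \<in> M"
    using M unfolding lsubspace_def by auto
  have ex: "\<exists>a\<in>K. \<exists>m\<in>M. x = lplus L m (lscale L a v)" if x: "x \<in> carrier L" for x
  proof (cases "x \<in> M")
    case True
    then show ?thesis using v x by (intro bexI[of _ 0] bexI[of _ x]) (auto simp: scale_zero plus_zero)
  next
    case False
    let ?X = "{lplus L m (lscale L a x) | m a. m \<in> M \<and> a \<in> K}"
    have "lsubspace ?X"
      unfolding lsubspace_def
    proof (intro conjI ballI)
      show "?X \<subseteq> carrier L" using Mc x by auto
      show "lzero L \<in> ?X" using Mc x
        by (auto intro!: exI[of _ "lzero L"] exI[of _ 0] simp: scale_zero plus_zero)
      fix p assume "p \<in> ?X"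
      then obtain m a where p: "p = lplus L m (lscale L a x)" "m \<in> M" "a \<in> K" by blast
      have mc: "m \<in> carrier L" using p Mc by blast
      {
        fix q assume "q \<in> ?X"
        then obtain n b where q: "q = lplus L n (lscale L b x)" "n \<in> M" "b \<in> K" by blast
        have nc: "n \<in> carrier L" using q Mc by blast
        have "lplus L p q = lplus L (lplus L m n) (lscale L (a + b) x)"
          using p q x mc nc by (simp add: scale_left plus_assoc plus_left_comm)
        moreover have "lplus L m n \<in> M" "a + b \<in> K" using p q Mc by auto
        ultimately show "lplus L p q \<in> ?X" by blast
      }
      fix c assume c: "c \<in> K"
      have "lscale L c p = lplus L (lscale L c m) (lscale L (c * a) x)"
        using p x mc c by (simp add: scale_right scale_scale)
      moreover have "lscale L c m \<in> M" "c * a \<in> K" using p c Mc by auto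
      ultimately show "lscale L c p \<in> ?X" by blast
    qed
    moreover have "M \<subseteq> ?X"
    proof
      fix m assume "m \<in> M"
      moreover then have "m = lplus L m (lscale L 0 x)" using Mc x by (auto simp: scale_zero plus_zero)
      ultimately show "m \<in> ?X" by (metis (mono_tags, lifting) K_simps(1) mem_Collect_eq)
    qed
    moreover have "x \<in> ?X" using Mc x
      by (auto intro!: exI[of _ "lzero L"] exI[of _ 1] simp: scale_one zero_plus)
    \<comment> \<open>Adjoining \<open>x\<close> to \<open>M\<close> destroys the avoidance of
      \<open>v\<close>. The resulting expression for \<open>v\<close> can be solved for
      \<open>x\<close>, because its coefficient is not zero.\<close>
    ultimately have "v \<in> ?X" using max[of ?X] False by blast
    then obtain m a where p: "v = lplus L m (lscale L a x)" "m \<in> M" "a \<in> K" by blast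
    have mc: "m \<in> carrier L" using p Mc by blast
    have a0: "a \<noteq> 0"
    proof
      assume "a = 0"
      then have "v = m" using p x mc by (simp add: scale_zero plus_zero)
      then show False using M p by simp
    qed
    have "lplus L (lscale L (- (1 / a)) m) (lscale L (1 / a) v) = x"
      using p(3) x mc a0 unfolding p(1)
      by (simp add: scale_right scale_scale plus_assoc[symmetric] scale_left[symmetric] scale_zero zero_plus scale_one)
    moreover have "lscale L (- (1 / a)) m \<in> M" using p Mc by simp
    moreover have "1 / a \<in> K" using p by simp
    ultimately show ?thesis by blast
  qed
  \<comment> \<open>Two different coefficients would put a nonzero multiple of \<open>v\<close> into
    \<open>M\<close>.\<close>
  have uniq: "a = b" if "a \<in> K" "b \<in> K" "m \<in> M" "n \<in> M" "lplus L m (lscale L a v) = lplus L n (lscale L b v)" for a b m n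
  proof (rule ccontr)
    assume ab: "a \<noteq> b"
    have mn: "m \<in> carrier L" "n \<in> carrier L" using that Mc by auto
    have "lplus L (lplus L m (lscale L a v)) (lscale L (-b) v) =
        lplus L (lplus L n (lscale L b v)) (lscale L (-b) v)" using that by simp
    moreover have "lplus L (lplus L n (lscale L b v)) (lscale L (-b) v) = n"
      using that(1,2) mn v by (simp add: plus_assoc scale_left[symmetric] scale_zero plus_zero)
    moreover have "lplus L (lplus L m (lscale L a v)) (lscale L (-b) v) = lplus L m (lscale L (a - b) v)"
      using that(1,2) mn v by (simp add: plus_assoc scale_left[symmetric])
    ultimately have "lplus L m (lscale L (a - b) v) = n" by simp
    then have "lscale L (a - b) v = lplus L (lscale L (-1) m) n"
      using minus_plus_cancel[of m "lscale L (a - b) v"] that mn v by simp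
    then have "lscale L (a - b) v \<in> M" using Mc that by simp
    then have "lscale L (1 / (a - b)) (lscale L (a - b) v) \<in> M" using Mc that by simp
    then show False using M that ab v by (simp add: scale_scale scale_one)
  qed
  define \<xi> where "\<xi> x = (SOME a. a \<in> K \<and> (\<exists>m\<in>M. x = lplus L m (lscale L a v)))" for x
  have eqI: "\<xi> x = a" if "x = lplus L m (lscale L a v)" "a \<in> K" "m \<in> M" for x a m
    unfolding \<xi>_def by (rule some_equality) (use that uniq in blast)+
  have "\<xi> \<in> dual"
    unfolding dual_def
  proof (rule CollectI, intro conjI ballI)
    fix x assume x: "x \<in> carrier L"
    obtain a m where am: "x = lplus L m (lscale L a v)" "a \<in> K" "m \<in> M" using ex[OF x] by blast
    have mc: "m \<in> carrier L" using am Mc by blast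
    {
      fix y assume y: "y \<in> carrier L"
      obtain b n where bn: "y = lplus L n (lscale L b v)" "b \<in> K" "n \<in> M" using ex[OF y] by blast
      have nc: "n \<in> carrier L" using bn Mc by blast
      have "lplus L x y = lplus L (lplus L m n) (lscale L (a + b) v)"
        using am bn v mc nc by (simp add: scale_left plus_assoc plus_left_comm)
      then have "\<xi> (lplus L x y) = a + b" using am(2,3) bn(2,3) Mc by (intro eqI[of _ "lplus L m n"]) auto
      then show "\<xi> (lplus L x y) = \<xi> x + \<xi> y" using eqI[OF am] eqI[OF bn] by simp
    }
    fix c assume c: "c \<in> K"
    have "lscale L c x = lplus L (lscale L c m) (lscale L (c * a) v)"
      using am v mc c by (simp add: scale_right scale_scale)
    then have "\<xi> (lscale L c x) = c * a" using am(2,3) c Mc by (intro eqI[of _ "lscale L c m"]) auto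
    then show "\<xi> (lscale L c x) = c * \<xi> x" using eqI[OF am] by simp
  qed
  moreover have "\<xi> v = 1" using v Mc by (intro eqI[of _ "lzero L"]) (auto simp: zero_plus scale_one)
  ultimately show ?thesis by (intro bexI[of _ \<xi>]) auto
qed

lemma eqI_dual:
  assumes v: "v \<in> carrier L" and w: "w \<in> carrier L" and eq: "\<And>\<xi>. \<xi> \<in> dual \<Longrightarrow> \<xi> v = \<xi> w"
  shows "v = w"
proof (rule ccontr)
  assume "v \<noteq> w"
  have "lplus L v (lscale L (-1) w) \<noteq> lzero L"
  proof
    assume "lplus L v (lscale L (-1) w) = lzero L"
    then have "lplus L (lscale L (-1) w) v = lplus L (lscale L (-1) w) w"
      using v w by (simp add: plus_comm[of "lscale L (-1) w"] plus_neg)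
    then show False using plus_cancel[of "lscale L (-1) w" v w] \<open>v \<noteq> w\<close> v w by simp
  qed
  then obtain \<xi> where "\<xi> \<in> dual" "\<xi> (lplus L v (lscale L (-1) w)) \<noteq> 0"
    using dual_nonzero[of "lplus L v (lscale L (-1) w)"] v w by auto
  then show False using eq[of \<xi>] v w by (simp add: dual_simps[of \<xi>])
qed

lemma dual_br_right: "\<xi> \<in> dual \<Longrightarrow> x \<in> carrier L \<Longrightarrow> (\<lambda>v. \<xi> (lbracket L x v)) \<in> dual"
  by (auto simp: dual_def br_plus_right br_scale_right)

lemma dual_br_left: "\<xi> \<in> dual \<Longrightarrow> x \<in> carrier L \<Longrightarrow> (\<lambda>v. \<xi> (lbracket L v x)) \<in> dual"
  by (auto simp: dual_def br_plus_left br_scale_left)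

lemma br_zero [simp]:
  assumes "x \<in> carrier L"
  shows "lbracket L x (lzero L) = lzero L" "lbracket L (lzero L) x = lzero L"
  using br_scale_right[of 0 x "lzero L"] br_scale_left[of 0 "lzero L" x] assms by (simp_all add: scale_zero)

lemma dual_br_anti:
  assumes \<xi>: "\<xi> \<in> dual" "x \<in> carrier L" "y \<in> carrier L"
  shows "\<xi> (lbracket L x y) = - \<xi> (lbracket L y x)"
proof -
  have "\<xi> (lbracket L (lplus L x y) (lplus L x y)) = 0" using assms by (simp add: br_self dual_zero[OF \<xi>(1)] del: br_plus_left)
  moreover have "\<xi> (lbracket L (lplus L x y) (lplus L x y)) = \<xi> (lbracket L x y) + \<xi> (lbracket L y x)"
    using assms by (simp add: br_plus_left br_plus_right br_self[of x] br_self[of y] dual_simps[OF \<xi>(1)])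
  ultimately show ?thesis by (simp add: eq_neg_iff_add_eq_0)
qed

lemma br_anti: "x \<in> carrier L \<Longrightarrow> y \<in> carrier L \<Longrightarrow> lbracket L x y = lscale L (-1) (lbracket L y x)"
  by (rule eqI_dual) (simp_all add: dual_br_anti[of _ x y] dual_scale)

lemma dual_jacobi:
  assumes \<xi>: "\<xi> \<in> dual" "x \<in> carrier L" "y \<in> carrier L" "z \<in> carrier L"
  shows "\<xi> (lbracket L x (lbracket L y z)) =
    \<xi> (lbracket L (lbracket L x y) z) + \<xi> (lbracket L y (lbracket L x z))"
proof -
  have "\<xi> (lbracket L x (lbracket L y z)) + (\<xi> (lbracket L y (lbracket L z x)) + \<xi> (lbracket L z (lbracket L x y))) = 0"
    using arg_cong[OF jacobi, of x y z \<xi>] assms by (simp add: dual_simps[OF \<xi>(1)])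
  moreover have "\<xi> (lbracket L y (lbracket L z x)) = - \<xi> (lbracket L y (lbracket L x z))"
    using assms by (simp add: br_anti[of z x] br_scale_right dual_simps[OF \<xi>(1)])
  moreover have "\<xi> (lbracket L z (lbracket L x y)) = - \<xi> (lbracket L (lbracket L x y) z)"
    using assms by (simp add: dual_br_anti[OF \<xi>(1), of z])
  ultimately show ?thesis by (simp add: algebra_simps add_eq_0_iff)
qed

lemma jacobi_left:
  assumes "x \<in> carrier L" "y \<in> carrier L" "z \<in> carrier L"
  shows "lbracket L x (lbracket L y z) = lplus L (lbracket L (lbracket L x y) z) (lbracket L y (lbracket L x z))"
proof (rule eqI_dual)
  fix \<xi> assume "\<xi> \<in> dual"
  then show "\<xi> (lbracket L x (lbracket L y z)) = \<xi> (lplus L (lbracket L (lbracket L x y) z) (lbracket L y (lbracket L x z)))"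
    using assms by (simp add: dual_jacobi[of \<xi> x y z] dual_plus[of \<xi>])
qed (use assms in auto)

section \<open>Exponentials of locally nilpotent elements\<close>

abbreviation adp :: "nat \<Rightarrow> 'v \<Rightarrow> 'v \<Rightarrow> 'v" where
  "adp n x v \<equiv> (lbracket L x ^^ n) v"

lemma adp_closed [simp]: "x \<in> carrier L \<Longrightarrow> v \<in> carrier L \<Longrightarrow> adp n x v \<in> carrier L"
  by (induction n) auto

lemma adp_zero [simp]: "x \<in> carrier L \<Longrightarrow> adp n x (lzero L) = lzero L"
  by (induction n) auto

lemma adp_mono: "adp n x v = lzero L \<Longrightarrow> n \<le> m \<Longrightarrow> x \<in> carrier L \<Longrightarrow> adp m x v = lzero L"
proof -
  assume "adp n x v = lzero L" "n \<le> m" and x: "x \<in> carrier L"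
  moreover then have "adp m x v = adp (m - n) x (adp n x v)"
    using funpow_add[of "m - n" n "lbracket L x"] by simp
  ultimately show ?thesis by simp
qed

lemma dual_adp: "\<xi> \<in> dual \<Longrightarrow> x \<in> carrier L \<Longrightarrow> (\<lambda>v. \<xi> (adp n x v)) \<in> dual"
proof (induction n arbitrary: \<xi>)
  case (Suc n)
  show ?case using Suc.IH[OF dual_br_right[OF Suc.prems] Suc.prems(2)] by simp
qed (simp add: eta_contract_eq)

lemma adp_plus:
  "x \<in> carrier L \<Longrightarrow> v \<in> carrier L \<Longrightarrow> w \<in> carrier L \<Longrightarrow> adp n x (lplus L v w) = lplus L (adp n x v) (adp n x w)"
  by (induction n) (auto simp: br_plus_right)

lemma adp_scale:
  "x \<in> carrier L \<Longrightarrow> a \<in> K \<Longrightarrow> v \<in> carrier L \<Longrightarrow> adp n x (lscale L a v) = lscale L a (adp n x v)"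
  by (induction n) (auto simp: br_scale_right)

definition locally_nilpotent :: "'v \<Rightarrow> bool" where
  "locally_nilpotent x \<longleftrightarrow> x \<in> carrier L \<and> (\<forall>v\<in>carrier L. \<exists>n. adp n x v = lzero L)"

lemma lsum_closed:
  "(\<And>n. n < N \<Longrightarrow> f n \<in> carrier L) \<Longrightarrow> lsum L f N \<in> carrier L"
  by (induction N) auto

lemma dual_lsum:
  assumes \<xi>: "\<xi> \<in> dual" and "\<And>n. n < N \<Longrightarrow> f n \<in> carrier L"
  shows "\<xi> (lsum L f N) = (\<Sum>n<N. \<xi> (f n))"
  using assms(2) by (induction N) (auto simp: dual_simps[OF \<xi>] lsum_closed)

lemma locally_nilpotent_closed [simp]: "locally_nilpotent x \<Longrightarrow> x \<in> carrier L"
  by (simp add: locally_nilpotent_def)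

lemma exp_ad_closed [simp]:
  "r \<in> K \<Longrightarrow> x \<in> carrier L \<Longrightarrow> v \<in> carrier L \<Longrightarrow> exp_ad L r x v \<in> carrier L"
  by (auto simp: exp_ad_def intro!: lsum_closed)

text \<open>The series in \<open>exp_ad\<close> stops at the least annihilating power. Terms beyond
  it vanish, so any later cut-off \<open>N\<close> gives the same value and several vectors can
  share one.\<close>

lemma dual_exp_ad:
  assumes \<xi>: "\<xi> \<in> dual" and r: "r \<in> K" and x: "x \<in> carrier L" and v: "v \<in> carrier L"
    and N: "adp N x v = lzero L"
  shows "\<xi> (exp_ad L r x v) = (\<Sum>n<N. r ^ n / fact n * \<xi> (adp n x v))"
proof -
  let ?M = "LEAST n. adp n x v = lzero L"
  have M: "adp ?M x v = lzero L" "?M \<le> N" using N by (auto intro: LeastI Least_le)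
  have "\<xi> (exp_ad L r x v) = (\<Sum>n<?M. r ^ n / fact n * \<xi> (adp n x v))"
    using r x v by (simp add: exp_ad_def dual_lsum[OF \<xi>] dual_scale[OF \<xi>])
  also have "\<dots> = (\<Sum>n<N. r ^ n / fact n * \<xi> (adp n x v))"
  proof (rule sum.mono_neutral_left)
    show "\<forall>i\<in>{..<N} - {..<?M}. r ^ i / fact i * \<xi> (adp i x v) = 0"
    proof
      fix i assume "i \<in> {..<N} - {..<?M}"
      then have "adp i x v = lzero L" using adp_mono[OF M(1), of i] x by auto
      then show "r ^ i / fact i * \<xi> (adp i x v) = 0" by (simp add: dual_zero[OF \<xi>])
    qed
  qed (use M in auto)
  finally show ?thesis .
qed

lemma exp_ad_adp_dual:
  assumes \<xi>: "\<xi> \<in> dual" and r: "r \<in> K" and x: "x \<in> carrier L" and y: "y \<in> carrier L" and v: "v \<in> carrier L"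
    and N: "adp N x v = lzero L"
  shows "\<xi> (adp k y (exp_ad L r x v)) = (\<Sum>n<N. r ^ n / fact n * \<xi> (adp k y (adp n x v)))"
  using dual_exp_ad[OF dual_adp[OF \<xi> y] r x v N] .

text \<open>Written as an infinite series, the exponential carries no cut-off depending on
  \<open>v\<close>. Linearity then follows from uniqueness of limits.\<close>

lemma exp_ad_sums:
  assumes \<xi>: "\<xi> \<in> dual" and r: "r \<in> K" and x: "locally_nilpotent x" and v: "v \<in> carrier L"
  shows "(\<lambda>n. r ^ n / fact n * \<xi> (adp n x v)) sums \<xi> (exp_ad L r x v)"
proof -
  obtain N where N: "adp N x v = lzero L" using x v unfolding locally_nilpotent_def by blast
  have xc: "x \<in> carrier L" using x by simp
  have "(\<lambda>n. r ^ n / fact n * \<xi> (adp n x v)) sums (\<Sum>n<N. r ^ n / fact n * \<xi> (adp n x v))"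
  proof (rule sums_finite)
    fix n assume "n \<notin> {..<N}"
    then have "adp n x v = lzero L" using adp_mono[OF N, of n] xc by auto
    then show "r ^ n / fact n * \<xi> (adp n x v) = 0" by (simp add: dual_zero[OF \<xi>])
  qed simp
  then show ?thesis using dual_exp_ad[OF \<xi> r xc v N] by simp
qed

lemma exp_ad_plus:
  assumes r: "r \<in> K" and x: "locally_nilpotent x" and v: "v \<in> carrier L" and w: "w \<in> carrier L"
  shows "exp_ad L r x (lplus L v w) = lplus L (exp_ad L r x v) (exp_ad L r x w)"
proof (rule eqI_dual)
  fix \<xi> assume \<xi>: "\<xi> \<in> dual"
  have "(\<lambda>n. r ^ n / fact n * \<xi> (adp n x (lplus L v w))) sums (\<xi> (exp_ad L r x v) + \<xi> (exp_ad L r x w))"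
    using sums_add[OF exp_ad_sums[OF \<xi> r x v] exp_ad_sums[OF \<xi> r x w]] x v w
    by (simp add: adp_plus dual_plus[OF \<xi>] algebra_simps)
  moreover have "(\<lambda>n. r ^ n / fact n * \<xi> (adp n x (lplus L v w))) sums \<xi> (exp_ad L r x (lplus L v w))"
    by (rule exp_ad_sums[OF \<xi> r x]) (use v w in simp)
  ultimately show "\<xi> (exp_ad L r x (lplus L v w)) = \<xi> (lplus L (exp_ad L r x v) (exp_ad L r x w))"
    using sums_unique2 r x v w by (simp add: dual_plus[OF \<xi>]) blast
qed (use assms in auto)

lemma exp_ad_scale:
  assumes r: "r \<in> K" and x: "locally_nilpotent x" and v: "v \<in> carrier L" and a: "a \<in> K"
  shows "exp_ad L r x (lscale L a v) = lscale L a (exp_ad L r x v)"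
proof (rule eqI_dual)
  fix \<xi> assume \<xi>: "\<xi> \<in> dual"
  have "(\<lambda>n. r ^ n / fact n * \<xi> (adp n x (lscale L a v))) sums (a * \<xi> (exp_ad L r x v))"
    using sums_mult[OF exp_ad_sums[OF \<xi> r x v], of a] x v a
    by (simp add: adp_scale dual_scale[OF \<xi>] algebra_simps)
  moreover have "(\<lambda>n. r ^ n / fact n * \<xi> (adp n x (lscale L a v))) sums \<xi> (exp_ad L r x (lscale L a v))"
    by (rule exp_ad_sums[OF \<xi> r x]) (use v a in simp)
  ultimately show "\<xi> (exp_ad L r x (lscale L a v)) = \<xi> (lscale L a (exp_ad L r x v))"
    using sums_unique2 r x v a by (simp add: dual_scale[OF \<xi>]) blast
qed (use assms in auto)

text \<open>Both series are cut at the same \<open>N\<close>. In the double sum the terms with total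
  degree at least \<open>N\<close> vanish; summing the remaining triangle along its diagonals gives
  the binomial theorem.\<close>

lemma exp_ad_add:
  assumes r: "r \<in> K" and s: "s \<in> K" and x: "locally_nilpotent x" and v: "v \<in> carrier L"
  shows "exp_ad L (r + s) x v = exp_ad L r x (exp_ad L s x v)"
proof (rule eqI_dual)
  fix \<xi> assume \<xi>: "\<xi> \<in> dual"
  have xc: "x \<in> carrier L" using x by simp
  obtain N where N: "adp N x v = lzero L" using x v unfolding locally_nilpotent_def by blast
  let ?c = "\<lambda>n. \<xi> (adp n x v)"
  have c0: "?c n = 0" if "n \<ge> N" for n using adp_mono[OF N that xc] by (simp add: dual_zero[OF \<xi>])
  \<comment> \<open>The outer exponential needs a cut-off for its own argument. The same
    \<open>N\<close> works because all terms of that argument are powers of \<open>ad x\<close>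
    applied to \<open>v\<close>.\<close>
  have "adp N x (exp_ad L s x v) = lzero L"
  proof (rule eqI_dual)
    fix \<eta> assume \<eta>: "\<eta> \<in> dual"
    have "\<eta> (adp N x (adp n x v)) = 0" for n
      using adp_mono[OF N, of "N + n"] xc by (simp add: funpow_add dual_zero[OF \<eta>])
    then show "\<eta> (adp N x (exp_ad L s x v)) = \<eta> (lzero L)"
      by (simp add: exp_ad_adp_dual[OF \<eta> s xc xc v N] dual_zero[OF \<eta>])
  qed (use s xc v in auto)
  from dual_exp_ad[OF \<xi> r xc _ this]
  have "\<xi> (exp_ad L r x (exp_ad L s x v)) = (\<Sum>k<N. r ^ k / fact k * (\<Sum>n<N. s ^ n / fact n * ?c (k + n)))"
    using s xc v by (simp add: exp_ad_adp_dual[OF \<xi> s xc xc v N] funpow_add)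
  also have "\<dots> = (\<Sum>k<N. \<Sum>n<N. r ^ k / fact k * (s ^ n / fact n) * ?c (k + n))"
    by (simp add: sum_distrib_left mult.assoc)
  also have "\<dots> = (\<Sum>(k, n)\<in>{..<N} \<times> {..<N}. r ^ k / fact k * (s ^ n / fact n) * ?c (k + n))"
    by (simp add: sum.cartesian_product)
  also have "\<dots> = (\<Sum>(k, n)\<in>{(k, n). k + n < N}. r ^ k / fact k * (s ^ n / fact n) * ?c (k + n))"
  proof (rule sum.mono_neutral_right)
    show "\<forall>i\<in>{..<N} \<times> {..<N} - {(k, n). k + n < N}.
        (case i of (k, n) \<Rightarrow> r ^ k / fact k * (s ^ n / fact n) * ?c (k + n)) = 0"
    proof
      fix i assume "i \<in> {..<N} \<times> {..<N} - {(k, n). k + n < N}"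
      then obtain k n where "i = (k, n)" "N \<le> k + n" by (cases i) auto
      then show "(case i of (k, n) \<Rightarrow> r ^ k / fact k * (s ^ n / fact n) * ?c (k + n)) = 0"
        by (simp add: c0)
    qed
  qed auto
  also have "\<dots> = (\<Sum>m<N. \<Sum>k\<le>m. r ^ k / fact k * (s ^ (m - k) / fact (m - k)) * ?c m)"
    by (subst sum.triangle_reindex) simp
  also have "\<dots> = (\<Sum>m<N. (r + s) ^ m / fact m * ?c m)"
  proof (rule sum.cong[OF HOL.refl])
    fix m
    have "(\<Sum>k\<le>m. r ^ k / fact k * (s ^ (m - k) / fact (m - k))) = (r + s) ^ m / fact m"
      unfolding binomial_ring sum_divide_distrib
      by (intro sum.cong) (auto simp: binomial_fact field_simps)
    then show "(\<Sum>k\<le>m. r ^ k / fact k * (s ^ (m - k) / fact (m - k)) * ?c m) = (r + s) ^ m / fact m * ?c m"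
      by (simp only: sum_distrib_right[symmetric])
  qed
  finally show "\<xi> (exp_ad L (r + s) x v) = \<xi> (exp_ad L r x (exp_ad L s x v))"
    using dual_exp_ad[OF \<xi> _ xc v N, of "r + s"] r s by simp
qed (use assms in auto)

lemma exp_ad_0: "x \<in> carrier L \<Longrightarrow> locally_nilpotent x \<Longrightarrow> v \<in> carrier L \<Longrightarrow> exp_ad L 0 x v = v"
proof (rule eqI_dual)
  fix \<xi> assume \<xi>: "\<xi> \<in> dual" and x: "locally_nilpotent x" and v: "v \<in> carrier L"
  have "(\<lambda>n. 0 ^ n / fact n * \<xi> (adp n x v)) sums (\<Sum>n\<in>{0}. 0 ^ n / fact n * \<xi> (adp n x v))"
    by (rule sums_finite) auto
  then have "(\<lambda>n. 0 ^ n / fact n * \<xi> (adp n x v)) sums \<xi> v" by simp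
  then show "\<xi> (exp_ad L 0 x v) = \<xi> v" using exp_ad_sums[OF \<xi> _ x v, of 0] sums_unique2 K_simps(1) by blast
qed auto

text \<open>Iterated Leibniz rule for the derivation \<open>ad x\<close>, by Pascal's rule. The
  functional is arbitrary in the induction because one bracket is absorbed into it at every
  step.\<close>

lemma dual_leibniz:
  assumes "\<xi> \<in> dual" and x: "x \<in> carrier L" and v: "v \<in> carrier L" and w: "w \<in> carrier L"
  shows "\<xi> (adp n x (lbracket L v w)) =
    (\<Sum>k\<le>n. of_nat (n choose k) * \<xi> (lbracket L (adp k x v) (adp (n - k) x w)))"
  using assms(1)
proof (induction n arbitrary: \<xi>)
  case (Suc n)
  let ?t = "\<lambda>k l. \<xi> (lbracket L (adp k x v) (adp l x w))"
  have "\<xi> (adp (Suc n) x (lbracket L v w)) =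
      (\<Sum>k\<le>n. of_nat (n choose k) * \<xi> (lbracket L x (lbracket L (adp k x v) (adp (n - k) x w))))"
    using Suc.IH[OF dual_br_right[OF Suc.prems x]] by simp
  also have "\<dots> = (\<Sum>k\<le>n. of_nat (n choose k) * (?t (Suc k) (n - k) + ?t k (Suc (n - k))))"
  proof (rule sum.cong[OF HOL.refl])
    fix k
    show "of_nat (n choose k) * \<xi> (lbracket L x (lbracket L (adp k x v) (adp (n - k) x w))) =
        of_nat (n choose k) * (?t (Suc k) (n - k) + ?t k (Suc (n - k)))"
      using dual_jacobi[OF Suc.prems x, of "adp k x v" "adp (n - k) x w"] x v w by simp
  qed
  also have "\<dots> = (\<Sum>k\<le>n. of_nat (n choose k) * ?t (Suc k) (n - k)) + (\<Sum>k\<le>n. of_nat (n choose k) * ?t k (Suc n - k))"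
    by (simp add: algebra_simps sum.distrib Suc_diff_le)
  also have "(\<Sum>k\<le>n. of_nat (n choose k) * ?t k (Suc n - k)) =
      ?t 0 (Suc n) + (\<Sum>k<n. of_nat (n choose Suc k) * ?t (Suc k) (n - k))"
    by (subst sum.atMost_shift) simp
  also have "(\<Sum>k<n. of_nat (n choose Suc k) * ?t (Suc k) (n - k)) = (\<Sum>k\<le>n. of_nat (n choose Suc k) * ?t (Suc k) (n - k))"
    by (simp add: lessThan_Suc_atMost[symmetric])
  also have "(\<Sum>k\<le>n. of_nat (n choose k) * ?t (Suc k) (n - k)) + (?t 0 (Suc n) + (\<Sum>k\<le>n. of_nat (n choose Suc k) * ?t (Suc k) (n - k)))
     = ?t 0 (Suc n) + (\<Sum>k\<le>n. of_nat (Suc n choose Suc k) * ?t (Suc k) (n - k))"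
    by (simp add: sum.distrib algebra_simps)
  also have "\<dots> = (\<Sum>k\<le>Suc n. of_nat (Suc n choose k) * ?t k (Suc n - k))"
    unfolding sum.atMost_Suc_shift by simp
  finally show ?case .
qed simp

text \<open>In each term of the Leibniz formula of order m + n, the first factor has received at
  least m brackets or the second at least n.\<close>

lemma adp_br_zero:
  assumes x: "x \<in> carrier L" and v: "v \<in> carrier L" and w: "w \<in> carrier L"
    and "adp m x v = lzero L" "adp n x w = lzero L"
  shows "adp (m + n) x (lbracket L v w) = lzero L"
proof (rule eqI_dual)
  fix \<xi> assume \<xi>: "\<xi> \<in> dual"
  have "\<xi> (lbracket L (adp k x v) (adp (m + n - k) x w)) = 0" for k
  proof (cases "m \<le> k")
    case True
    then have "adp k x v = lzero L" using adp_mono assms by blast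
    then show ?thesis using x w by (simp add: dual_zero[OF \<xi>])
  next
    case False
    then have "n \<le> m + n - k" by simp
    then have "adp (m + n - k) x w = lzero L" using adp_mono assms by blast
    then show ?thesis using x v by (simp add: dual_zero[OF \<xi>])
  qed
  then show "\<xi> (adp (m + n) x (lbracket L v w)) = \<xi> (lzero L)"
    by (simp add: dual_leibniz[OF \<xi> x v w] dual_zero[OF \<xi>])
qed (use assms in auto)

text \<open>The exponential of a derivation respects the bracket: m! divided into the Leibniz
  coefficient leaves 1/(k! (m - k)!), which is the coefficient in the product of the two
  series.\<close>

lemma exp_ad_br:
  assumes r: "r \<in> K" and x: "locally_nilpotent x" and v: "v \<in> carrier L" and w: "w \<in> carrier L"
  shows "exp_ad L r x (lbracket L v w) = lbracket L (exp_ad L r x v) (exp_ad L r x w)"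
proof (rule eqI_dual)
  fix \<xi> assume \<xi>: "\<xi> \<in> dual"
  have xc: "x \<in> carrier L" using x by simp
  obtain M where M: "adp M x v = lzero L" using x v unfolding locally_nilpotent_def by blast
  obtain M' where M': "adp M' x w = lzero L" using x w unfolding locally_nilpotent_def by blast
  define N where "N = M + M'"
  have N: "adp N x v = lzero L" "adp N x w = lzero L" "adp N x (lbracket L v w) = lzero L"
    using adp_mono[OF M, of N] adp_mono[OF M', of N] adp_br_zero[OF xc v w M M'] xc by (auto simp: N_def)
  let ?t = "\<lambda>k l. \<xi> (lbracket L (adp k x v) (adp l x w))"
  have t0: "?t k l = 0" if "k + l \<ge> N" for k l
  proof (cases "k \<ge> M")
    case True
    then have "adp k x v = lzero L" using adp_mono M xc by blast
    then show ?thesis using xc w by (simp add: dual_zero[OF \<xi>])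
  next
    case False
    then have "M' \<le> l" using that by (simp add: N_def)
    then have "adp l x w = lzero L" using adp_mono M' xc by blast
    then show ?thesis using xc v by (simp add: dual_zero[OF \<xi>])
  qed
  have "\<xi> (lbracket L (exp_ad L r x v) (exp_ad L r x w)) =
      (\<Sum>k<N. r ^ k / fact k * \<xi> (lbracket L (adp k x v) (exp_ad L r x w)))"
    using dual_exp_ad[OF dual_br_left[OF \<xi>] r xc v N(1), of "exp_ad L r x w"] r xc w by simp
  also have "\<dots> = (\<Sum>k<N. r ^ k / fact k * (\<Sum>l<N. r ^ l / fact l * ?t k l))"
    using xc v by (intro sum.cong HOL.refl arg_cong2[where f = "(*)"] dual_exp_ad[OF dual_br_right[OF \<xi>] r xc w N(2)]) simp_all
  also have "\<dots> = (\<Sum>k<N. \<Sum>l<N. r ^ k / fact k * (r ^ l / fact l) * ?t k l)"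
    by (simp add: sum_distrib_left mult.assoc)
  also have "\<dots> = (\<Sum>(k, l)\<in>{..<N} \<times> {..<N}. r ^ k / fact k * (r ^ l / fact l) * ?t k l)"
    by (simp add: sum.cartesian_product)
  also have "\<dots> = (\<Sum>(k, l)\<in>{(k, l). k + l < N}. r ^ k / fact k * (r ^ l / fact l) * ?t k l)"
  proof (rule sum.mono_neutral_right)
    show "\<forall>i\<in>{..<N} \<times> {..<N} - {(k, n). k + n < N}.
        (case i of (k, n) \<Rightarrow> r ^ k / fact k * (r ^ n / fact n) * ?t k n) = 0"
    proof
      fix i assume "i \<in> {..<N} \<times> {..<N} - {(k, n). k + n < N}"
      then obtain k n where "i = (k, n)" "N \<le> k + n" by (cases i) auto
      then show "(case i of (k, n) \<Rightarrow> r ^ k / fact k * (r ^ n / fact n) * ?t k n) = 0"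
        by (simp add: t0)
    qed
  qed auto
  also have "\<dots> = (\<Sum>m<N. \<Sum>k\<le>m. r ^ k / fact k * (r ^ (m - k) / fact (m - k)) * ?t k (m - k))"
    by (rule sum.triangle_reindex)
  also have "\<dots> = (\<Sum>m<N. r ^ m / fact m * \<xi> (adp m x (lbracket L v w)))"
  proof (rule sum.cong[OF HOL.refl])
    fix m
    have "r ^ k / fact k * (r ^ (m - k) / fact (m - k)) * ?t k (m - k) =
        r ^ m / fact m * (of_nat (m choose k) * ?t k (m - k))" if "k \<le> m" for k
    proof -
      have "r ^ k * r ^ (m - k) = r ^ m" using that by (simp add: power_add[symmetric])
      then have "r ^ k / fact k * (r ^ (m - k) / fact (m - k)) = r ^ m / fact m * of_nat (m choose k)"
        using that by (simp add: binomial_fact)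
      then show ?thesis by simp
    qed
    then show "(\<Sum>k\<le>m. r ^ k / fact k * (r ^ (m - k) / fact (m - k)) * ?t k (m - k)) = r ^ m / fact m * \<xi> (adp m x (lbracket L v w))"
      by (simp add: dual_leibniz[OF \<xi> xc v w] sum_distrib_left)
  qed
  also have "\<dots> = \<xi> (exp_ad L r x (lbracket L v w))"
    using v w xc by (simp add: dual_exp_ad[OF \<xi> r xc _ N(3)])
  finally show "\<xi> (exp_ad L r x (lbracket L v w)) = \<xi> (lbracket L (exp_ad L r x v) (exp_ad L r x w))" by simp
qed (use assms in auto)

lemma exp_ad_minus:
  assumes "r \<in> K" "locally_nilpotent x" "v \<in> carrier L"
  shows "exp_ad L r x (exp_ad L (- r) x v) = v" "exp_ad L (- r) x (exp_ad L r x v) = v"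
  using exp_ad_add[of r "- r" x v] exp_ad_add[of "- r" r x v] exp_ad_0[of x v] assms by auto

lemma exp_ad_extensional: "exp_ad L r x \<in> extensional (carrier L)"
  by (simp add: exp_ad_def)

lemma exp_ad_aut:
  assumes r: "r \<in> K" and x: "locally_nilpotent x"
  shows "exp_ad L r x \<in> lie_auts K L"
proof -
  have "bij_betw (exp_ad L r x) (carrier L) (carrier L)"
    by (rule bij_betw_byWitness[where f' = "exp_ad L (- r) x"]) (use assms exp_ad_minus in auto)
  then show ?thesis
    using assms unfolding lie_auts_def Bij_def
    by (auto simp: exp_ad_extensional exp_ad_plus exp_ad_scale exp_ad_br)
qed

end

section \<open>Automorphisms and conjugation of exponentials\<close>

definition (in lie_alg) autG :: "('v \<Rightarrow> 'v) monoid" where "autG = lie_aut_group K L"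

context lie_alg begin

lemma autG_carrier [simp]: "carrier autG = lie_auts K L"
  by (simp add: autG_def lie_aut_group_def)

lemma aut_closed [simp]: "\<sigma> \<in> lie_auts K L \<Longrightarrow> v \<in> carrier L \<Longrightarrow> \<sigma> v \<in> carrier L"
  by (auto simp: lie_auts_def Bij_def bij_betw_def)

lemma aut_plus: "\<sigma> \<in> lie_auts K L \<Longrightarrow> v \<in> carrier L \<Longrightarrow> w \<in> carrier L \<Longrightarrow> \<sigma> (lplus L v w) = lplus L (\<sigma> v) (\<sigma> w)"
  by (simp add: lie_auts_def)

lemma aut_scale: "\<sigma> \<in> lie_auts K L \<Longrightarrow> a \<in> K \<Longrightarrow> v \<in> carrier L \<Longrightarrow> \<sigma> (lscale L a v) = lscale L a (\<sigma> v)"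
  by (simp add: lie_auts_def)

lemma aut_br: "\<sigma> \<in> lie_auts K L \<Longrightarrow> v \<in> carrier L \<Longrightarrow> w \<in> carrier L \<Longrightarrow> \<sigma> (lbracket L v w) = lbracket L (\<sigma> v) (\<sigma> w)"
  by (simp add: lie_auts_def)

lemma aut_zero: "\<sigma> \<in> lie_auts K L \<Longrightarrow> \<sigma> (lzero L) = lzero L"
  using aut_scale[of \<sigma> 0 "lzero L"] by (simp add: scale_zero)

lemma aut_ext: "\<sigma> \<in> lie_auts K L \<Longrightarrow> \<tau> \<in> lie_auts K L \<Longrightarrow> (\<And>v. v \<in> carrier L \<Longrightarrow> \<sigma> v = \<tau> v) \<Longrightarrow> \<sigma> = \<tau>"
  by (rule extensionalityI[of _ "carrier L"]) (auto simp: lie_auts_def Bij_def)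

lemma autG_mult [simp]:
  "\<sigma> \<in> lie_auts K L \<Longrightarrow> \<tau> \<in> lie_auts K L \<Longrightarrow> \<sigma> \<otimes>\<^bsub>autG\<^esub> \<tau> = compose (carrier L) \<sigma> \<tau>"
  by (simp add: autG_def lie_aut_group_def BijGroup_def lie_auts_def)

lemma autG_mult_apply:
  "\<sigma> \<in> lie_auts K L \<Longrightarrow> \<tau> \<in> lie_auts K L \<Longrightarrow> v \<in> carrier L \<Longrightarrow> (\<sigma> \<otimes>\<^bsub>autG\<^esub> \<tau>) v = \<sigma> (\<tau> v)"
  by (simp add: compose_def)

lemma autG_one: "\<one>\<^bsub>autG\<^esub> = (\<lambda>v\<in>carrier L. v)"
  by (simp add: autG_def lie_aut_group_def BijGroup_def)

lemma subgroup_auts: "subgroup (lie_auts K L) (BijGroup (carrier L))"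
proof (rule group.subgroupI[OF group_BijGroup])
  show "lie_auts K L \<subseteq> carrier (BijGroup (carrier L))" by (auto simp: lie_auts_def BijGroup_def)
  have "(\<lambda>v\<in>carrier L. v) \<in> lie_auts K L" by (auto simp: lie_auts_def id_Bij)
  then show "lie_auts K L \<noteq> {}" by blast
next
  fix \<sigma> assume \<sigma>: "\<sigma> \<in> lie_auts K L"
  then have B: "\<sigma> \<in> Bij (carrier L)" by (simp add: lie_auts_def)
  have bij: "bij_betw \<sigma> (carrier L) (carrier L)" using B by (simp add: Bij_def)
  let ?\<tau> = "inv_into (carrier L) \<sigma>"
  have \<tau>: "?\<tau> v \<in> carrier L" "\<sigma> (?\<tau> v) = v" if "v \<in> carrier L" for v
    using bij that by (auto simp: bij_betw_def inv_into_into f_inv_into_f)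
  have inj: "v = w" if "v \<in> carrier L" "w \<in> carrier L" "\<sigma> v = \<sigma> w" for v w
    using bij that by (auto simp: bij_betw_def inj_on_def)
  have "?\<tau> (lplus L v w) = lplus L (?\<tau> v) (?\<tau> w)" if "v \<in> carrier L" "w \<in> carrier L" for v w
    by (rule inj) (use that \<tau> \<sigma> in \<open>auto simp: aut_plus\<close>)
  moreover have "?\<tau> (lbracket L v w) = lbracket L (?\<tau> v) (?\<tau> w)" if "v \<in> carrier L" "w \<in> carrier L" for v w
    by (rule inj) (use that \<tau> \<sigma> in \<open>auto simp: aut_br\<close>)
  moreover have "?\<tau> (lscale L a v) = lscale L a (?\<tau> v)" if "a \<in> K" "v \<in> carrier L" for a v
    by (rule inj) (use that \<tau> \<sigma> in \<open>auto simp: aut_scale\<close>)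
  ultimately have "(\<lambda>v\<in>carrier L. ?\<tau> v) \<in> lie_auts K L"
    unfolding lie_auts_def using restrict_inv_into_Bij[OF B] by auto
  then show "inv\<^bsub>BijGroup (carrier L)\<^esub> \<sigma> \<in> lie_auts K L" using inv_BijGroup[OF B] by simp
  fix \<tau> assume \<tau>: "\<tau> \<in> lie_auts K L"
  then have "\<tau> \<in> Bij (carrier L)" by (simp add: lie_auts_def)
  with B have "\<sigma> \<otimes>\<^bsub>BijGroup (carrier L)\<^esub> \<tau> = compose (carrier L) \<sigma> \<tau>" "compose (carrier L) \<sigma> \<tau> \<in> Bij (carrier L)"
    by (auto simp: BijGroup_def compose_Bij)
  then show "\<sigma> \<otimes>\<^bsub>BijGroup (carrier L)\<^esub> \<tau> \<in> lie_auts K L"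
    unfolding lie_auts_def mem_Collect_eq
    by (auto simp: compose_def aut_plus[OF \<sigma>] aut_plus[OF \<tau>] aut_br[OF \<sigma>] aut_br[OF \<tau>]
        aut_scale[OF \<sigma>] aut_scale[OF \<tau>] aut_closed[OF \<tau>])
qed

lemma group_autG: "group autG"
  unfolding autG_def lie_aut_group_def
  using subgroup.subgroup_is_group[OF subgroup_auts group_BijGroup] .

sublocale A: group autG by (rule group_autG)

lemma aut_exp_ad:
  assumes \<sigma>: "\<sigma> \<in> lie_auts K L" and r: "r \<in> K" and x: "locally_nilpotent x" and v: "v \<in> carrier L"
  shows "\<sigma> (exp_ad L r x v) = exp_ad L r (\<sigma> x) (\<sigma> v)"
proof (rule eqI_dual)
  have xc: "x \<in> carrier L" using x by simp
  have ad: "\<sigma> (adp n x v) = adp n (\<sigma> x) (\<sigma> v)" for n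
    using xc v \<sigma> by (induction n) (auto simp: aut_br)
  obtain N where N: "adp N x v = lzero L" using x v unfolding locally_nilpotent_def by blast
  then have N': "adp N (\<sigma> x) (\<sigma> v) = lzero L" using ad[of N] \<sigma> by (simp add: aut_zero)
  fix \<xi> assume \<xi>: "\<xi> \<in> dual"
  have d: "(\<lambda>v. \<xi> (\<sigma> v)) \<in> dual"
    using \<sigma> unfolding dual_def by (auto simp: aut_plus aut_scale dual_plus[OF \<xi>] dual_scale[OF \<xi>])
  show "\<xi> (\<sigma> (exp_ad L r x v)) = \<xi> (exp_ad L r (\<sigma> x) (\<sigma> v))"
    using dual_exp_ad[OF d r xc v N] dual_exp_ad[OF \<xi> r _ _ N'] \<sigma> xc v by (simp add: ad)
qed (use assms in auto)

text \<open>An automorphism carries powers of \<open>ad x\<close> to powers of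
  \<open>ad (\<sigma> x)\<close>. Through this the root group of an arbitrary real root is reached
  from that of a simple one.\<close>

lemma exp_ad_conj:
  assumes \<sigma>: "\<sigma> \<in> lie_auts K L" and r: "r \<in> K" and x: "locally_nilpotent x"
  shows "locally_nilpotent (\<sigma> x)"
    "\<sigma> \<otimes>\<^bsub>autG\<^esub> exp_ad L r x \<otimes>\<^bsub>autG\<^esub> inv\<^bsub>autG\<^esub> \<sigma> = exp_ad L r (\<sigma> x)"
proof -
  have xc: "x \<in> carrier L" using x by simp
  have \<sigma>': "inv\<^bsub>autG\<^esub> \<sigma> \<in> lie_auts K L" using A.inv_closed[of \<sigma>] \<sigma> by simp
  have inv: "\<sigma> ((inv\<^bsub>autG\<^esub> \<sigma>) v) = v" if "v \<in> carrier L" for v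
    using autG_mult_apply[OF \<sigma> \<sigma>' that] A.r_inv[of \<sigma>] \<sigma> that by (simp add: autG_one del: autG_mult)
  have ad: "\<sigma> (adp n x v) = adp n (\<sigma> x) (\<sigma> v)" if "v \<in> carrier L" for n v
    using xc that \<sigma> by (induction n) (auto simp: aut_br)
  show ln: "locally_nilpotent (\<sigma> x)"
    unfolding locally_nilpotent_def
  proof (intro conjI ballI)
    fix v assume v: "v \<in> carrier L"
    have v': "(inv\<^bsub>autG\<^esub> \<sigma>) v \<in> carrier L" using v \<sigma>' by simp
    then obtain n where "adp n x ((inv\<^bsub>autG\<^esub> \<sigma>) v) = lzero L" using x unfolding locally_nilpotent_def by blast
    then have "adp n (\<sigma> x) v = lzero L" using ad[OF v', of n] inv[OF v] aut_zero[OF \<sigma>] by simp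
    then show "\<exists>n. adp n (\<sigma> x) v = lzero L" by blast
  qed (use xc \<sigma> in simp)
  have e: "exp_ad L r x \<in> lie_auts K L" "exp_ad L r (\<sigma> x) \<in> lie_auts K L" using exp_ad_aut r x ln by auto
  have se: "\<sigma> \<otimes>\<^bsub>autG\<^esub> exp_ad L r x \<in> lie_auts K L" using A.m_closed[of \<sigma> "exp_ad L r x"] \<sigma> e by simp
  show "\<sigma> \<otimes>\<^bsub>autG\<^esub> exp_ad L r x \<otimes>\<^bsub>autG\<^esub> inv\<^bsub>autG\<^esub> \<sigma> = exp_ad L r (\<sigma> x)"
  proof (rule aut_ext)
    show "\<sigma> \<otimes>\<^bsub>autG\<^esub> exp_ad L r x \<otimes>\<^bsub>autG\<^esub> inv\<^bsub>autG\<^esub> \<sigma> \<in> lie_auts K L"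
      using A.m_closed[of "\<sigma> \<otimes>\<^bsub>autG\<^esub> exp_ad L r x" "inv\<^bsub>autG\<^esub> \<sigma>"] se \<sigma>' by simp
    fix v assume v: "v \<in> carrier L"
    show "(\<sigma> \<otimes>\<^bsub>autG\<^esub> exp_ad L r x \<otimes>\<^bsub>autG\<^esub> inv\<^bsub>autG\<^esub> \<sigma>) v = exp_ad L r (\<sigma> x) v"
      using autG_mult_apply[OF se \<sigma>' v] autG_mult_apply[OF \<sigma> e(1), of "(inv\<^bsub>autG\<^esub> \<sigma>) v"] \<sigma>' v
        aut_exp_ad[OF \<sigma> r x, of "(inv\<^bsub>autG\<^esub> \<sigma>) v"] inv[OF v] by (simp del: autG_mult)
  qed (rule e)
qed

text \<open>A scalar on the vector is a scalar on the parameter, so a one-dimensional root space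
  determines its root group.\<close>

lemma exp_ad_scale_vector:
  assumes r: "r \<in> K" and a: "a \<in> K" and x: "locally_nilpotent x"
  shows "locally_nilpotent (lscale L a x)" "exp_ad L r (lscale L a x) = exp_ad L (r * a) x"
proof -
  have xc: "x \<in> carrier L" using x by simp
  have ad: "adp n (lscale L a x) v = lscale L (a ^ n) (adp n x v)" if "v \<in> carrier L" for n v
    using that xc a by (induction n) (auto simp: scale_one br_scale_left br_scale_right scale_scale mult.commute)
  show ln: "locally_nilpotent (lscale L a x)"
    unfolding locally_nilpotent_def
  proof (intro conjI ballI)
    fix v assume v: "v \<in> carrier L"
    then obtain n where "adp n x v = lzero L" using x unfolding locally_nilpotent_def by blast
    then show "\<exists>n. adp n (lscale L a x) v = lzero L" using ad[OF v, of n] a by auto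
  qed (use xc a in simp)
  show "exp_ad L r (lscale L a x) = exp_ad L (r * a) x"
  proof (rule aut_ext)
    fix v assume v: "v \<in> carrier L"
    show "exp_ad L r (lscale L a x) v = exp_ad L (r * a) x v"
    proof (rule eqI_dual)
      fix \<xi> assume \<xi>: "\<xi> \<in> dual"
      have "(\<lambda>n. r ^ n / fact n * \<xi> (adp n (lscale L a x) v)) = (\<lambda>n. (r * a) ^ n / fact n * \<xi> (adp n x v))"
        using v xc a by (simp add: ad dual_scale[OF \<xi>] power_mult_distrib fun_eq_iff)
      then show "\<xi> (exp_ad L r (lscale L a x) v) = \<xi> (exp_ad L (r * a) x v)"
        using exp_ad_sums[OF \<xi> r ln v] exp_ad_sums[OF \<xi> _ x v, of "r * a"] r a sums_unique2 by auto
    qed (use r a xc v in auto)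
  qed (use exp_ad_aut r a x ln in auto)
qed

lemma exp_ad_fix:
  assumes r: "r \<in> K" and x: "x \<in> carrier L" and v: "v \<in> carrier L" and "lbracket L x v = lzero L"
  shows "exp_ad L r x v = v"
proof (rule eqI_dual)
  fix \<xi> assume \<xi>: "\<xi> \<in> dual"
  show "\<xi> (exp_ad L r x v) = \<xi> v"
    using dual_exp_ad[OF \<xi> r x v, of 1] assms by simp
qed (use assms in auto)

lemma exp_ad_2:
  assumes r: "r \<in> K" and x: "x \<in> carrier L" and v: "v \<in> carrier L" and z: "lbracket L x (lbracket L x v) = lzero L"
  shows "exp_ad L r x v = lplus L v (lscale L r (lbracket L x v))"
proof (rule eqI_dual)
  fix \<xi> assume \<xi>: "\<xi> \<in> dual"
  show "\<xi> (exp_ad L r x v) = \<xi> (lplus L v (lscale L r (lbracket L x v)))"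
    using dual_exp_ad[OF \<xi> r x v, of 2] assms by (simp add: numeral_2_eq_2 dual_simps[OF \<xi>])
qed (use assms in auto)

lemma exp_ad_3:
  assumes r: "r \<in> K" and x: "x \<in> carrier L" and v: "v \<in> carrier L"
    and z: "lbracket L x (lbracket L x (lbracket L x v)) = lzero L"
  shows "exp_ad L r x v = lplus L v (lplus L (lscale L r (lbracket L x v)) (lscale L (r\<^sup>2 / 2) (lbracket L x (lbracket L x v))))"
proof (rule eqI_dual)
  fix \<xi> assume \<xi>: "\<xi> \<in> dual"
  show "\<xi> (exp_ad L r x v) = \<xi> (lplus L v (lplus L (lscale L r (lbracket L x v)) (lscale L (r\<^sup>2 / 2) (lbracket L x (lbracket L x v)))))"
    using dual_exp_ad[OF \<xi> r x v, of 3] assms by (simp add: numeral_3_eq_3 dual_simps[OF \<xi>] power2_eq_square)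
qed (use assms in auto)

end

section \<open>Relations between exponentials of an \<open>sl\<^sub>2\<close>-triple\<close>

locale sl2_rel = lie_alg K L for K :: "complex set" and L :: "'v lie_algebra" +
  fixes e f h :: 'v
  assumes e_closed [simp]: "e \<in> carrier L" and f_closed [simp]: "f \<in> carrier L" and h_closed [simp]: "h \<in> carrier L"
    and ef: "lbracket L e f = lscale L (-1) h"
    and he: "lbracket L h e = lscale L 2 e"
    and hf: "lbracket L h f = lscale L (-2) f"
begin

lemma eh: "lbracket L e h = lscale L (-2) e"
  using br_anti[of e h] by (simp add: he scale_scale)

lemma fh: "lbracket L f h = lscale L 2 f"
  using br_anti[of f h] by (simp add: hf scale_scale)

lemma fe: "lbracket L f e = h"
  using br_anti[of f e] by (simp add: ef scale_scale scale_one)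

lemma ee: "lbracket L e e = lzero L" and ff: "lbracket L f f = lzero L"
  by (simp_all add: br_self)

context
  fixes m :: nat and v0
  assumes v0 [simp]: "v0 \<in> carrier L" and fv0: "lbracket L f v0 = lzero L"
    and hv0: "lbracket L h v0 = lscale L (- of_nat m) v0"
begin

lemma h_string: "lbracket L h (adp k e v0) = lscale L (2 * of_nat k - of_nat m) (adp k e v0)"
proof (induction k)
  case (Suc k)
  have "lbracket L h (adp (Suc k) e v0) = lplus L (lbracket L (lbracket L h e) (adp k e v0)) (lbracket L e (lbracket L h (adp k e v0)))"
    by (simp add: jacobi_left[of h e])
  also have "\<dots> = lplus L (lscale L 2 (adp (Suc k) e v0)) (lscale L (2 * of_nat k - of_nat m) (adp (Suc k) e v0))"
    by (simp add: he Suc br_scale_left br_scale_right)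
  also have "\<dots> = lscale L (2 * of_nat (Suc k) - of_nat m) (adp (Suc k) e v0)"
    by (simp add: scale_left[symmetric] algebra_simps)
  finally show ?case .
qed (simp add: hv0)

text \<open>Since [f, e] = h, moving f past one more e adds the weight 2(k + 1) - m of the vector
  passed. Summing these weights gives the factor (k + 1)(m - k) with a minus sign; its zero at k = m
  is what matters.\<close>

lemma f_string: "lbracket L f (adp (Suc k) e v0) = lscale L (- (of_nat (Suc k) * (of_nat m - of_nat k))) (adp k e v0)"
proof (induction k)
  case 0
  show ?case by (simp add: jacobi_left[of f e] fe fv0 hv0 plus_zero)
next
  case (Suc k)
  have "lbracket L f (adp (Suc (Suc k)) e v0) =
      lplus L (lbracket L (lbracket L f e) (adp (Suc k) e v0)) (lbracket L e (lbracket L f (adp (Suc k) e v0)))"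
    by (simp add: jacobi_left[of f e])
  also have "\<dots> = lplus L (lscale L (2 * of_nat (Suc k) - of_nat m) (adp (Suc k) e v0))
      (lscale L (- (of_nat (Suc k) * (of_nat m - of_nat k))) (adp (Suc k) e v0))"
    unfolding fe h_string Suc by (simp add: br_scale_right)
  also have "\<dots> = lscale L (- (of_nat (Suc (Suc k)) * (of_nat m - of_nat (Suc k)))) (adp (Suc k) e v0)"
    by (subst scale_left[symmetric]) (simp_all add: algebra_simps)
  finally show ?case .
qed

lemma f_string_top: "lbracket L f (adp (Suc m) e v0) = lzero L"
  using f_string[of m] by (simp add: scale_zero)

end

end

locale sl2_triple = sl2_rel K L e f h for K :: "complex set" and L :: "'v lie_algebra" and e f h +
  assumes e_nilpotent: "locally_nilpotent e" and f_nilpotent: "locally_nilpotent f"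
begin

text \<open>Exchanging e and f negates h. Each result on strings of e is thus also one on strings of
  f.\<close>

lemma swap: "sl2_triple K L f e (lscale L (-1) h)"
  by unfold_locales
    (simp_all add: e_nilpotent f_nilpotent fe scale_scale scale_one br_scale_left hf he)

definition X :: "complex \<Rightarrow> 'v \<Rightarrow> 'v" where "X t = exp_ad L t e"
definition Y :: "complex \<Rightarrow> 'v \<Rightarrow> 'v" where "Y t = exp_ad L t f"
text \<open>Lift of the reflection: with \<open>Y r\<close> corresponding to the lower triangular
  matrix with entry -r, this is the matrix with rows (0, t) and (-1/t, 0). Accordingly
  \<open>H t\<close> corresponds to the diagonal matrix with entries t and 1/t.\<close>

definition W :: "complex \<Rightarrow> 'v \<Rightarrow> 'v" where "W t = X t \<otimes>\<^bsub>autG\<^esub> (Y (1 / t) \<otimes>\<^bsub>autG\<^esub> X t)"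
definition H :: "complex \<Rightarrow> 'v \<Rightarrow> 'v" where "H t = W t \<otimes>\<^bsub>autG\<^esub> W (-1)"

lemma X_aut [simp]: "t \<in> K \<Longrightarrow> X t \<in> lie_auts K L" and Y_aut [simp]: "t \<in> K \<Longrightarrow> Y t \<in> lie_auts K L"
  by (simp_all add: X_def Y_def exp_ad_aut e_nilpotent f_nilpotent)

lemma mult_aut: "\<sigma> \<in> lie_auts K L \<Longrightarrow> \<tau> \<in> lie_auts K L \<Longrightarrow> \<sigma> \<otimes>\<^bsub>autG\<^esub> \<tau> \<in> lie_auts K L"
  using A.m_closed[of \<sigma> \<tau>] by simp

lemma W_aut [simp]: "t \<in> K \<Longrightarrow> W t \<in> lie_auts K L"
  unfolding W_def by (intro mult_aut) auto

lemma H_aut [simp]: "t \<in> K \<Longrightarrow> H t \<in> lie_auts K L"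
  unfolding H_def by (intro mult_aut) auto

lemma W_apply: "t \<in> K \<Longrightarrow> v \<in> carrier L \<Longrightarrow> W t v = X t (Y (1 / t) (X t v))"
  unfolding W_def by (simp add: autG_mult_apply mult_aut del: autG_mult)

lemma H_apply: "t \<in> K \<Longrightarrow> v \<in> carrier L \<Longrightarrow> H t v = W t (W (-1) v)"
  unfolding H_def by (simp add: autG_mult_apply del: autG_mult)

lemma X_add: "r \<in> K \<Longrightarrow> s \<in> K \<Longrightarrow> X (r + s) = X r \<otimes>\<^bsub>autG\<^esub> X s"
proof (rule aut_ext)
  assume r: "r \<in> K" and s: "s \<in> K"
  show "X (r + s) \<in> lie_auts K L" using r s by simp
  show "X r \<otimes>\<^bsub>autG\<^esub> X s \<in> lie_auts K L" using r s by (intro mult_aut) auto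
  fix v assume v: "v \<in> carrier L"
  show "X (r + s) v = (X r \<otimes>\<^bsub>autG\<^esub> X s) v"
    unfolding autG_mult_apply[OF X_aut[OF r] X_aut[OF s] v] unfolding X_def
    by (rule exp_ad_add[OF r s e_nilpotent v])
qed

lemma Y_add: "r \<in> K \<Longrightarrow> s \<in> K \<Longrightarrow> Y (r + s) = Y r \<otimes>\<^bsub>autG\<^esub> Y s"
proof (rule aut_ext)
  assume r: "r \<in> K" and s: "s \<in> K"
  show "Y (r + s) \<in> lie_auts K L" using r s by simp
  show "Y r \<otimes>\<^bsub>autG\<^esub> Y s \<in> lie_auts K L" using r s by (intro mult_aut) auto
  fix v assume v: "v \<in> carrier L"
  show "Y (r + s) v = (Y r \<otimes>\<^bsub>autG\<^esub> Y s) v"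
    unfolding autG_mult_apply[OF Y_aut[OF r] Y_aut[OF s] v] unfolding Y_def
    by (rule exp_ad_add[OF r s f_nilpotent v])
qed

lemma X_minus: "t \<in> K \<Longrightarrow> v \<in> carrier L \<Longrightarrow> X t (X (- t) v) = v"
  by (simp add: X_def exp_ad_minus e_nilpotent)

lemma Y_minus: "t \<in> K \<Longrightarrow> v \<in> carrier L \<Longrightarrow> Y t (Y (- t) v) = v"
  by (simp add: Y_def exp_ad_minus f_nilpotent)

lemma W_minus: "t \<in> K \<Longrightarrow> v \<in> carrier L \<Longrightarrow> W t (W (- t) v) = v"
  using Y_minus[of "1 / t"] by (simp add: W_apply X_minus)

lemma X_weight:
  assumes t: "t \<in> K" "a \<in> K" and v: "v \<in> carrier L" and "lbracket L e v = lscale L a e"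
  shows "X t v = lplus L v (lscale L (t * a) e)"
  unfolding X_def using assms by (subst exp_ad_2) (simp_all add: br_scale_right ee scale_scale)

lemma Y_weight:
  assumes t: "t \<in> K" "a \<in> K" and v: "v \<in> carrier L" and "lbracket L f v = lscale L a f"
  shows "Y t v = lplus L v (lscale L (t * a) f)"
  unfolding Y_def using assms by (subst exp_ad_2) (simp_all add: br_scale_right ff scale_scale)

lemma X_e: "t \<in> K \<Longrightarrow> X t e = e" and Y_f: "t \<in> K \<Longrightarrow> Y t f = f"
  unfolding X_def Y_def by (simp_all add: exp_ad_fix ee ff)

lemma X_h: "t \<in> K \<Longrightarrow> X t h = lplus L h (lscale L (- 2 * t) e)"
  using X_weight[of t "-2" h] by (simp add: eh mult.commute)

lemma X_f: "t \<in> K \<Longrightarrow> X t f = lplus L f (lplus L (lscale L (- t) h) (lscale L (t\<^sup>2) e))"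
  unfolding X_def by (subst exp_ad_3) (simp_all add: ef eh br_scale_right scale_scale ee)

lemma Y_e: "t \<in> K \<Longrightarrow> Y t e = lplus L e (lplus L (lscale L t h) (lscale L (t\<^sup>2) f))"
  unfolding Y_def by (subst exp_ad_3) (simp_all add: fe fh br_scale_right scale_scale ff)

lemma W_e:
  assumes t: "t \<in> K" "t \<noteq> 0" shows "W t e = lscale L (1 / t\<^sup>2) f"
proof -
  have X: "X t \<in> lie_auts K L" using t by simp
  have "W t e = X t (lplus L e (lplus L (lscale L (1 / t) h) (lscale L ((1 / t)\<^sup>2) f)))"
    using t by (simp add: W_apply X_e Y_e)
  also have "\<dots> = lplus L e (lplus L (lscale L (1 / t) (lplus L h (lscale L (- 2 * t) e)))
      (lscale L ((1 / t)\<^sup>2) (lplus L f (lplus L (lscale L (- t) h) (lscale L (t\<^sup>2) e)))))"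
    using t by (simp add: aut_plus[OF X] aut_scale[OF X] X_e X_h X_f)
  also have "\<dots> = lscale L (1 / t\<^sup>2) f"
  proof (rule eqI_dual)
    fix \<xi> assume \<xi>: "\<xi> \<in> dual"
    show "\<xi> (lplus L e (lplus L (lscale L (1 / t) (lplus L h (lscale L (- 2 * t) e)))
      (lscale L ((1 / t)\<^sup>2) (lplus L f (lplus L (lscale L (- t) h) (lscale L (t\<^sup>2) e)))))) = \<xi> (lscale L (1 / t\<^sup>2) f)"
      using t by (simp add: dual_simps[OF \<xi>] field_simps power2_eq_square)
  qed (use t in auto)
  finally show ?thesis .
qed

lemma W_f:
  assumes t: "t \<in> K" "t \<noteq> 0" shows "W t f = lscale L (t\<^sup>2) e"
proof -
  have W: "W t \<in> lie_auts K L" using t by simp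
  \<comment> \<open>\<open>W (- t)\<close> inverts \<open>W t\<close> and sends e to a multiple of
    f, so the value on f comes out of the one on e.\<close>
  have "e = W t (W (- t) e)" using W_minus[of t e] t by simp
  also have "\<dots> = lscale L (1 / t\<^sup>2) (W t f)" using t W_e[of "- t"] by (simp add: aut_scale[OF W])
  finally have "lscale L (t\<^sup>2) e = lscale L (t\<^sup>2) (lscale L (1 / t\<^sup>2) (W t f))" by simp
  then show ?thesis using t by (simp add: scale_scale scale_one aut_closed[OF W])
qed

text \<open>The hypotheses fit an element v of the Cartan subalgebra with value a on the root. The
  outcome is the reflection v - a h, for every t.\<close>

lemma W_weight:
  assumes t: "t \<in> K" "t \<noteq> 0" and a: "a \<in> K" and v: "v \<in> carrier L"
    and ev: "lbracket L e v = lscale L (- a) e" and fv: "lbracket L f v = lscale L a f"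
  shows "W t v = lplus L v (lscale L (- a) h)"
proof -
  have X: "X t \<in> lie_auts K L" using t by simp
  have Y: "Y (1 / t) \<in> lie_auts K L" using t by simp
  have "W t v = X t (Y (1 / t) (lplus L v (lscale L (t * - a) e)))"
    using t a v ev X_weight[of t "- a" v] by (simp add: W_apply)
  also have "\<dots> = X t (lplus L (lplus L v (lscale L (1 / t * a) f)) (lscale L (t * - a) (lplus L e (lplus L (lscale L (1 / t) h) (lscale L ((1 / t)\<^sup>2) f)))))"
    using t a v fv Y_weight[of "1 / t" a v] by (simp add: aut_plus[OF Y] aut_scale[OF Y] Y_e)
  also have "\<dots> = lplus L (lplus L (lplus L v (lscale L (t * - a) e)) (lscale L (1 / t * a) (lplus L f (lplus L (lscale L (- t) h) (lscale L (t\<^sup>2) e)))))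
      (lscale L (t * - a) (lplus L e (lplus L (lscale L (1 / t) (lplus L h (lscale L (- 2 * t) e)))
       (lscale L ((1 / t)\<^sup>2) (lplus L f (lplus L (lscale L (- t) h) (lscale L (t\<^sup>2) e)))))))"
    using t a v ev X_weight[of t "- a" v] by (simp add: aut_plus[OF X] aut_scale[OF X] X_e X_h X_f)
  also have "\<dots> = lplus L v (lscale L (- a) h)"
  proof (rule eqI_dual)
    fix \<xi> assume \<xi>: "\<xi> \<in> dual"
    show "\<xi> (lplus L (lplus L (lplus L v (lscale L (t * - a) e)) (lscale L (1 / t * a) (lplus L f (lplus L (lscale L (- t) h) (lscale L (t\<^sup>2) e)))))
      (lscale L (t * - a) (lplus L e (lplus L (lscale L (1 / t) (lplus L h (lscale L (- 2 * t) e)))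
       (lscale L ((1 / t)\<^sup>2) (lplus L f (lplus L (lscale L (- t) h) (lscale L (t\<^sup>2) e)))))))) = \<xi> (lplus L v (lscale L (- a) h))"
      using t a v by (simp add: dual_simps[OF \<xi>] field_simps power2_eq_square)
  qed (use t a v in auto)
  finally show ?thesis .
qed

lemma W_conj_X:
  assumes t: "t \<in> K" "t \<noteq> 0" and r: "r \<in> K"
  shows "W t \<otimes>\<^bsub>autG\<^esub> X r = Y (r / t\<^sup>2) \<otimes>\<^bsub>autG\<^esub> W t"
proof -
  have W: "W t \<in> carrier autG" "X r \<in> carrier autG" "Y (r / t\<^sup>2) \<in> carrier autG" using t r by auto
  have "W t \<otimes>\<^bsub>autG\<^esub> X r \<otimes>\<^bsub>autG\<^esub> inv\<^bsub>autG\<^esub> W t = Y (r / t\<^sup>2)"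
    using exp_ad_conj(2)[of "W t" r e] exp_ad_scale_vector(2)[of r "1 / t\<^sup>2" f] t r
    by (simp add: e_nilpotent f_nilpotent W_e X_def Y_def del: autG_mult)
  then have "Y (r / t\<^sup>2) \<otimes>\<^bsub>autG\<^esub> W t = W t \<otimes>\<^bsub>autG\<^esub> X r \<otimes>\<^bsub>autG\<^esub> inv\<^bsub>autG\<^esub> W t \<otimes>\<^bsub>autG\<^esub> W t" by (simp del: autG_mult)
  also have "\<dots> = W t \<otimes>\<^bsub>autG\<^esub> X r" using W by (simp add: A.m_assoc del: autG_mult autG_carrier)
  finally show ?thesis by simp
qed

text \<open>Conjugation gives \<open>W t\<close> times \<open>X t\<close> equal to
  \<open>Y (1 / t)\<close> times \<open>W t\<close>; insert the definition of \<open>W\<close> on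
  the right and cancel the last factor. In this form e and f have exchanged roles.\<close>

lemma W_swap:
  assumes t: "t \<in> K" "t \<noteq> 0"
  shows "W t = Y (1 / t) \<otimes>\<^bsub>autG\<^esub> (X t \<otimes>\<^bsub>autG\<^esub> Y (1 / t))"
proof -
  have c: "W t \<in> carrier autG" "X t \<in> carrier autG" "Y (1 / t) \<in> carrier autG" using t by auto
  have "W t \<otimes>\<^bsub>autG\<^esub> X t = Y (t / t\<^sup>2) \<otimes>\<^bsub>autG\<^esub> W t" by (rule W_conj_X) (use t in auto)
  also have "t / t\<^sup>2 = 1 / t" using t by (simp add: power2_eq_square)
  finally have "W t \<otimes>\<^bsub>autG\<^esub> X t = Y (1 / t) \<otimes>\<^bsub>autG\<^esub> (X t \<otimes>\<^bsub>autG\<^esub> Y (1 / t)) \<otimes>\<^bsub>autG\<^esub> X t"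
    using c by (simp add: W_def A.m_assoc del: autG_mult autG_carrier)
  then show ?thesis using c by (simp del: autG_mult autG_carrier)
qed

section \<open>Reflections and torus elements on a finite string\<close>

context
  fixes m :: nat and v0
  assumes v0 [simp]: "v0 \<in> carrier L" and fv0: "lbracket L f v0 = lzero L"
    and hv0: "lbracket L h v0 = lscale L (- of_nat m) v0"
begin

lemma f_power_string:
  assumes "j + l \<le> m"
  shows "adp l f (adp (j + l) e v0) =
    lscale L ((-1) ^ l * (fact (j + l) / fact j) * (fact (m - j) / fact (m - j - l))) (adp j e v0)"
  using assms
proof (induction l arbitrary: j)
  case 0
  then show ?case by (simp add: scale_one)
next
  case (Suc l)
  have "adp (Suc l) f (adp (j + Suc l) e v0) = lbracket L f (adp l f (adp (Suc j + l) e v0))" by simp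
  also have "\<dots> = lscale L ((-1) ^ l * (fact (Suc j + l) / fact (Suc j)) * (fact (m - Suc j) / fact (m - Suc j - l)))
     (lbracket L f (adp (Suc j) e v0))"
    by (subst Suc.IH) (use Suc.prems in \<open>auto simp: br_scale_right simp del: funpow.simps\<close>)
  also have "\<dots> = lscale L ((-1) ^ l * (fact (Suc j + l) / fact (Suc j)) * (fact (m - Suc j) / fact (m - Suc j - l)) *
      (- (of_nat (Suc j) * (of_nat m - of_nat j)))) (adp j e v0)"
    unfolding f_string[OF v0 fv0 hv0] by (simp add: scale_scale del: fact_Suc of_nat_Suc)
  also have "(-1) ^ l * (fact (Suc j + l) / fact (Suc j)) * (fact (m - Suc j) / fact (m - Suc j - l)) *
      (- (of_nat (Suc j) * (of_nat m - of_nat j))) =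
      ((-1) ^ Suc l * (fact (j + Suc l) / fact j) * (fact (m - j) / fact (m - j - Suc l)) :: complex)"
  proof -
    have mj: "m - j = Suc (m - Suc j)" using Suc.prems by simp
    have fm: "(fact (m - j) :: complex) = (of_nat m - of_nat j) * fact (m - Suc j)"
      unfolding mj fact_Suc using Suc.prems by (simp add: of_nat_diff)
    have "m - Suc j - l = m - j - Suc l" by simp
    then show ?thesis unfolding fm by (simp add: fact_Suc[of j] field_simps del: of_nat_Suc)
  qed
  finally show ?case .
qed

lemma f_power_string_zero: "k < l \<Longrightarrow> adp l f (adp k e v0) = lzero L" if "k \<le> m" for k l
proof -
  assume kl: "k < l"
  have "adp k f (adp (0 + k) e v0) = lscale L ((-1) ^ k * (fact (0 + k) / fact 0) * (fact (m - 0) / fact (m - 0 - k))) (adp 0 e v0)"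
    by (rule f_power_string) (use that in simp)
  then have "adp (Suc k) f (adp k e v0) = lzero L" by (simp add: br_scale_right fv0)
  then show ?thesis using adp_mono kl by (metis Suc_leI f_closed)
qed

text \<open>The reflection carries the lowest vector of the string to a multiple of the highest one.
  After expanding both exponentials, every intermediate vector has an alternating sum of binomial
  coefficients as its coefficient. The remaining factor \<open>X t\<close> fixes the top
  vector.\<close>

lemma W_string:
  assumes t: "t \<in> K" "t \<noteq> 0" and top: "adp (Suc m) e v0 = lzero L"
  shows "W t v0 = lscale L (t ^ m / fact m) (adp m e v0)"
proof -
  have YX: "Y (1 / t) (X t v0) = lscale L (t ^ m / fact m) (adp m e v0)"
  proof (rule eqI_dual)
    fix \<xi> assume \<xi>: "\<xi> \<in> dual"
    let ?s = "1 / t"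
    have s: "?s \<in> K" using t by simp
    have ad: "\<eta> (adp l f (X t v0)) = (\<Sum>k<Suc m. t ^ k / fact k * \<eta> (adp l f (adp k e v0)))" if \<eta>: "\<eta> \<in> dual" for \<eta> l
      unfolding X_def by (rule exp_ad_adp_dual[OF \<eta>]) (use t top in auto)
    have "adp (Suc m) f (X t v0) = lzero L"
    proof (rule eqI_dual)
      fix \<eta> assume \<eta>: "\<eta> \<in> dual"
      have "\<eta> (adp (Suc m) f (adp k e v0)) = 0" if "k < Suc m" for k
        using f_power_string_zero[of k "Suc m"] that by (simp add: dual_zero[OF \<eta>] del: funpow.simps)
      then show "\<eta> (adp (Suc m) f (X t v0)) = \<eta> (lzero L)"
        unfolding ad[OF \<eta>] by (simp add: dual_zero[OF \<eta>] del: funpow.simps)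
    qed (use t in \<open>auto simp: aut_closed[OF X_aut] simp del: funpow.simps\<close>)
    from dual_exp_ad[OF \<xi> s f_closed _ this]
    have "\<xi> (Y ?s (X t v0)) = (\<Sum>l<Suc m. ?s ^ l / fact l * (\<Sum>k<Suc m. t ^ k / fact k * \<xi> (adp l f (adp k e v0))))"
      unfolding Y_def using t by (simp add: ad[OF \<xi>] aut_closed[OF X_aut] del: funpow.simps sum.lessThan_Suc)
    also have "\<dots> = (\<Sum>l<Suc m. \<Sum>k<Suc m. ?s ^ l / fact l * (t ^ k / fact k) * \<xi> (adp l f (adp k e v0)))"
      by (simp only: sum_distrib_left mult.assoc)
    also have "\<dots> = (\<Sum>(l, k)\<in>{..<Suc m} \<times> {..<Suc m}. ?s ^ l / fact l * (t ^ k / fact k) * \<xi> (adp l f (adp k e v0)))"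
      by (simp only: sum.cartesian_product)
    also have "\<dots> = (\<Sum>(l, k)\<in>{(l, k). l \<le> k \<and> k \<le> m}. ?s ^ l / fact l * (t ^ k / fact k) * \<xi> (adp l f (adp k e v0)))"
    proof (rule sum.mono_neutral_right)
      show "\<forall>i\<in>{..<Suc m} \<times> {..<Suc m} - {(l, k). l \<le> k \<and> k \<le> m}.
          (case i of (l, k) \<Rightarrow> ?s ^ l / fact l * (t ^ k / fact k) * \<xi> (adp l f (adp k e v0))) = 0"
      proof
        fix i assume "i \<in> {..<Suc m} \<times> {..<Suc m} - {(l, k). l \<le> k \<and> k \<le> m}"
        then obtain l k where "i = (l, k)" "k < l" "k \<le> m" by (cases i) auto
        then show "(case i of (l, k) \<Rightarrow> ?s ^ l / fact l * (t ^ k / fact k) * \<xi> (adp l f (adp k e v0))) = 0"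
          by (simp add: f_power_string_zero dual_zero[OF \<xi>])
      qed
    qed auto
    \<comment> \<open>Collect by the position j = k - l reached after k steps up and l steps down;
      the powers of t and 1/t combine to the exponent j.\<close>
    also have "\<dots> = (\<Sum>(j, l)\<in>(SIGMA j:{..m}. {..m - j}). t ^ j / fact j * \<xi> (adp j e v0) * (of_nat (m - j choose l) * (-1) ^ l))"
    proof (rule sum.reindex_bij_witness[where i = "\<lambda>(j, l). (l, j + l)" and j = "\<lambda>(l, k). (k - l, l)"])
      fix a assume "a \<in> {(l, k). l \<le> k \<and> k \<le> m}"
      then obtain l k where a: "a = (l, k)" "l \<le> k" "k \<le> m" by auto
      define j where "j = k - l"
      have k: "k = j + l" "j + l \<le> m" using a by (auto simp: j_def)
      have "?s ^ l * t ^ (j + l) = t ^ j" using t by (simp add: power_add power_divide)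
      moreover have "of_nat (m - j choose l) = (fact (m - j) / (fact l * fact (m - j - l)) :: complex)"
        using k(2) by (intro binomial_fact) simp
      moreover have "a / b * (c / d) * (g * (d / p) * (q / r)) = a * c / p * (q / (b * r) * g)"
        if "d \<noteq> 0" for a b c d g p q r :: complex using that by (simp add: ac_simps)
      ultimately have eq: "?s ^ l / fact l * (t ^ (j + l) / fact (j + l)) *
          ((-1) ^ l * (fact (j + l) / fact j) * (fact (m - j) / fact (m - j - l))) =
          t ^ j / fact j * (of_nat (m - j choose l) * (-1) ^ l)"
        by (simp only: fact_nonzero not_False_eq_True)
      have "?s ^ l / fact l * (t ^ k / fact k) * \<xi> (adp l f (adp k e v0)) =
        (?s ^ l / fact l * (t ^ (j + l) / fact (j + l)) *
          ((-1) ^ l * (fact (j + l) / fact j) * (fact (m - j) / fact (m - j - l)))) * \<xi> (adp j e v0)"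
        unfolding k(1) f_power_string[OF k(2)] by (simp only: dual_scale[OF \<xi>] K_simps adp_closed e_closed v0 mult.assoc)
      also have "\<dots> = t ^ j / fact j * \<xi> (adp j e v0) * (of_nat (m - j choose l) * (-1) ^ l)"
        unfolding eq by (simp only: ac_simps)
      finally show "(case (case a of (l, k) \<Rightarrow> (k - l, l)) of (j, l) \<Rightarrow> t ^ j / fact j * \<xi> (adp j e v0) * (of_nat (m - j choose l) * (-1) ^ l)) =
          (case a of (l, k) \<Rightarrow> ?s ^ l / fact l * (t ^ k / fact k) * \<xi> (adp l f (adp k e v0)))"
        unfolding a(1) prod.case j_def by (simp only:)
    qed auto
    also have "\<dots> = (\<Sum>j\<le>m. t ^ j / fact j * \<xi> (adp j e v0) * (\<Sum>l\<le>m - j. of_nat (m - j choose l) * (-1) ^ l))"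
      by (simp add: sum.Sigma[symmetric] sum_distrib_left)
    also have "\<dots> = (\<Sum>j\<le>m. t ^ j / fact j * \<xi> (adp j e v0) * (if j = m then 1 else 0))"
    proof (rule sum.cong[OF HOL.refl])
      fix j assume "j \<in> {..m}"
      \<comment> \<open>This is (1 - 1) to the power m - j, so only the top of the string
        survives.\<close>
      have "(\<Sum>l\<le>m - j. of_nat (m - j choose l) * (-1) ^ l) = (((-1) + 1) ^ (m - j) :: complex)"
        unfolding binomial_ring by simp
      also have "\<dots> = (if j = m then 1 else 0)" using \<open>j \<in> {..m}\<close> by auto
      finally show "t ^ j / fact j * \<xi> (adp j e v0) * (\<Sum>l\<le>m - j. of_nat (m - j choose l) * (-1) ^ l) =
          t ^ j / fact j * \<xi> (adp j e v0) * (if j = m then 1 else 0)" by simp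
    qed
    also have "\<dots> = t ^ m / fact m * \<xi> (adp m e v0)"
      by (subst sum.remove[of _ m]) auto
    finally show "\<xi> (Y ?s (X t v0)) = \<xi> (lscale L (t ^ m / fact m) (adp m e v0))"
      using t by (simp add: dual_scale[OF \<xi>])
  qed (use t in \<open>auto intro!: aut_closed[OF X_aut] aut_closed[OF Y_aut]\<close>)
  have X: "X t \<in> lie_auts K L" using t by simp
  have "X t (adp m e v0) = adp m e v0"
    unfolding X_def using t top by (intro exp_ad_fix) auto
  then show ?thesis using t by (simp add: W_apply YX aut_scale[OF X])
qed

text \<open>The action of \<open>W t\<close> on the top vector is read off from the fact that
  \<open>W t\<close> undoes \<open>W (- t)\<close> on the bottom one, without expanding exponentials
  again.\<close>

lemma H_string:
  assumes t: "t \<in> K" "t \<noteq> 0" and top: "adp (Suc m) e v0 = lzero L"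
  shows "H t v0 = lscale L ((1 / t) ^ m) v0"
proof -
  have W: "W t \<in> lie_auts K L" using t by simp
  have "v0 = W t (W (- t) v0)" using W_minus[of t v0] t by simp
  also have "\<dots> = lscale L ((- t) ^ m / fact m) (W t (adp m e v0))"
    using W_string[of "- t"] t top by (simp add: aut_scale[OF W] del: funpow.simps)
  finally have "lscale L (fact m / (- t) ^ m) v0 = lscale L (fact m / (- t) ^ m) (lscale L ((- t) ^ m / fact m) (W t (adp m e v0)))" by simp
  then have Wm: "W t (adp m e v0) = lscale L (fact m / (- t) ^ m) v0"
    using t by (simp add: scale_scale scale_one aut_closed[OF W])
  have "H t v0 = lscale L ((-1) ^ m / fact m) (W t (adp m e v0))"
    using W_string[of "-1"] t top by (simp add: H_apply aut_scale[OF W] del: funpow.simps)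
  also have "\<dots> = lscale L ((1 / t) ^ m) v0"
    unfolding Wm using t by (simp add: scale_scale power_minus[of t] power_divide)
  finally show ?thesis .
qed

end

end

section \<open>Presentation of \<open>SL(2, K)\<close>\<close>

definition mat2 :: "complex \<Rightarrow> complex \<Rightarrow> complex \<Rightarrow> complex \<Rightarrow> complex ^ 2 ^ 2" where
  "mat2 a b c d = vector [vector [a, b], vector [c, d]]"

lemma mat2_nth [simp]:
  "mat2 a b c d $ 1 $ 1 = a" "mat2 a b c d $ 1 $ 2 = b" "mat2 a b c d $ 2 $ 1 = c" "mat2 a b c d $ 2 $ 2 = d"
  by (simp_all add: mat2_def)

lemma mat2_eqI: "M $ 1 $ 1 = a \<Longrightarrow> M $ 1 $ 2 = b \<Longrightarrow> M $ 2 $ 1 = c \<Longrightarrow> M $ 2 $ 2 = d \<Longrightarrow> M = mat2 a b c d"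
  by (simp add: vec_eq_iff forall_2)

lemma mat2_eq_iff [simp]: "mat2 a b c d = mat2 a' b' c' d' \<longleftrightarrow> a = a' \<and> b = b' \<and> c = c' \<and> d = d'"
  by (simp add: vec_eq_iff forall_2)

lemma mat2_mult [simp]:
  "mat2 a b c d ** mat2 a' b' c' d' = mat2 (a * a' + b * c') (a * b' + b * d') (c * a' + d * c') (c * b' + d * d')"
  by (rule mat2_eqI) (simp_all add: matrix_matrix_mult_def sum_2)

lemma mat2_one: "mat 1 = mat2 1 0 0 1"
  by (rule mat2_eqI) (simp_all add: mat_def)

lemma mat2_SL2: "mat2 a b c d \<in> carrier (SL2 K) \<longleftrightarrow> a \<in> K \<and> b \<in> K \<and> c \<in> K \<and> d \<in> K \<and> a * d - b * c = 1"
  by (auto simp: SL2_def det_2 forall_2)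

lemma SL2_cases:
  assumes "M \<in> carrier (SL2 K)"
  obtains a b c d where "M = mat2 a b c d" "a \<in> K" "b \<in> K" "c \<in> K" "d \<in> K" "a * d - b * c = 1"
proof -
  have "M = mat2 (M $ 1 $ 1) (M $ 1 $ 2) (M $ 2 $ 1) (M $ 2 $ 2)" by (rule mat2_eqI) simp_all
  then show ?thesis using that assms mat2_SL2[of "M $ 1 $ 1" "M $ 1 $ 2" "M $ 2 $ 1" "M $ 2 $ 2" K] by metis
qed

lemma SL2_mult [simp]: "M \<otimes>\<^bsub>SL2 K\<^esub> N = M ** N"
  by (simp add: SL2_def)

text \<open>Besides showing that unipotent matrices generate, this decomposition has entries
  depending continuously on the matrix where c is not zero. That will supply local coordinates for
  the topology.\<close>

lemma SL2_big_cell: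
  assumes det: "a * d - b * c = 1" and c: "c \<noteq> 0"
  shows "mat2 a b c d = mat2 1 ((a - 1) / c) 0 1 ** (mat2 1 0 c 1 ** mat2 1 ((d - 1) / c) 0 1)"
proof -
  have m: "mat2 1 p 0 1 ** (mat2 1 0 c 1 ** mat2 1 q 0 1) = mat2 (1 + p * c) (p * c * q + q + p) c (c * q + 1)" for p q
    by (simp add: algebra_simps)
  define p where "p = (a - 1) / c"
  define q where "q = (d - 1) / c"
  have pc: "p * c = a - 1" and cq: "c * q = d - 1" using c by (simp_all add: p_def q_def)
  have "(p * c * q + q + p) * c = (a - 1) * (c * q) + c * q + p * c" unfolding pc[symmetric] by (simp add: algebra_simps)
  also have "\<dots> = b * c" unfolding pc cq using det by (simp add: algebra_simps)
  finally have e: "p * c * q + q + p = b" using c by simp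
  have e': "1 + p * c = a" "c * q + 1 = d" using pc cq by simp_all
  have "mat2 a b c d = mat2 1 p 0 1 ** (mat2 1 0 c 1 ** mat2 1 q 0 1)"
    unfolding m e e' by (rule HOL.refl)
  then show "mat2 a b c d = mat2 1 ((a - 1) / c) 0 1 ** (mat2 1 0 c 1 ** mat2 1 ((d - 1) / c) 0 1)"
    by (simp only: p_def q_def)
qed

lemma SL2_mult_closed:
  assumes K: "K \<in> {\<real>, UNIV}" and A: "A \<in> carrier (SL2 K)" and B: "B \<in> carrier (SL2 K)"
  shows "A ** B \<in> carrier (SL2 K)"
proof -
  have Kc: "\<And>a b. a \<in> K \<Longrightarrow> b \<in> K \<Longrightarrow> a + b \<in> K" "\<And>a b. a \<in> K \<Longrightarrow> b \<in> K \<Longrightarrow> a * b \<in> K" using K by auto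
  obtain a b c d where A': "A = mat2 a b c d" "a \<in> K" "b \<in> K" "c \<in> K" "d \<in> K" "a * d - b * c = 1"
    using A by (rule SL2_cases)
  obtain a' b' c' d' where B': "B = mat2 a' b' c' d'" "a' \<in> K" "b' \<in> K" "c' \<in> K" "d' \<in> K" "a' * d' - b' * c' = 1"
    using B by (rule SL2_cases)
  have "(a * a' + b * c') * (c * b' + d * d') - (a * b' + b * d') * (c * a' + d * c') = (a * d - b * c) * (a' * d' - b' * c')"
    by (simp add: algebra_simps)
  then show ?thesis using A' B' Kc by (simp add: mat2_SL2)
qed

lemma SL2_induct:
  assumes K: "K \<in> {\<real>, UNIV}" and M: "M \<in> carrier (SL2 K)"
    and x: "\<And>r. r \<in> K \<Longrightarrow> P (mat2 1 r 0 1)" and y: "\<And>r. r \<in> K \<Longrightarrow> P (mat2 1 0 r 1)"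
    and mult: "\<And>A B. A \<in> carrier (SL2 K) \<Longrightarrow> B \<in> carrier (SL2 K) \<Longrightarrow> P A \<Longrightarrow> P B \<Longrightarrow> P (A ** B)"
  shows "P M"
proof -
  have Kc: "0 \<in> K" "1 \<in> K" "-1 \<in> K" "\<And>a b. a \<in> K \<Longrightarrow> b \<in> K \<Longrightarrow> a + b \<in> K" "\<And>a b. a \<in> K \<Longrightarrow> b \<in> K \<Longrightarrow> a - b \<in> K"
    "\<And>a b. a \<in> K \<Longrightarrow> b \<in> K \<Longrightarrow> a / b \<in> K" using K by auto
  have big: "P (mat2 a b c d)" if "a \<in> K" "b \<in> K" "c \<in> K" "d \<in> K" "a * d - b * c = 1" "c \<noteq> 0" for a b c d
  proof -
    have "mat2 a b c d = mat2 1 ((a - 1) / c) 0 1 ** (mat2 1 0 c 1 ** mat2 1 ((d - 1) / c) 0 1)"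
      by (rule SL2_big_cell[OF that(5,6)])
    moreover have "P (mat2 1 ((a - 1) / c) 0 1 ** (mat2 1 0 c 1 ** mat2 1 ((d - 1) / c) 0 1))"
    proof (rule mult)
      show "P (mat2 1 0 c 1 ** mat2 1 ((d - 1) / c) 0 1)"
        by (rule mult) (use that Kc in \<open>auto simp: mat2_SL2 intro!: x y\<close>)
      show "mat2 1 0 c 1 ** mat2 1 ((d - 1) / c) 0 1 \<in> carrier (SL2 K)"
        using that Kc by (simp add: mat2_SL2)
    qed (use that Kc in \<open>auto simp: mat2_SL2 intro!: x y\<close>)
    ultimately show ?thesis by simp
  qed
  from M obtain a b c d where M: "M = mat2 a b c d" "a \<in> K" "b \<in> K" "c \<in> K" "d \<in> K" "a * d - b * c = 1"
    by (rule SL2_cases)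
  show ?thesis
  proof (cases "c = 0")
    case False then show ?thesis using big M by simp
  next
    case True
    have "a \<noteq> 0" using M(6) True by auto
    \<comment> \<open>A lower unipotent factor moves the nonzero entry a into the lower left corner,
      so that the second factor lies in the big cell.\<close>
    have "M = mat2 1 0 (-1) 1 ** mat2 a b a (b + d)" using True M(1) by simp
    moreover have "P (mat2 1 0 (-1) 1 ** mat2 a b a (b + d))"
      by (rule mult) (use M True Kc \<open>a \<noteq> 0\<close> in \<open>auto simp: mat2_SL2 algebra_simps intro!: y big\<close>)
    ultimately show ?thesis by simp
  qed
qed

text \<open>
  Steinberg's relations for \<open>SL(2, K)\<close>. By the Bruhat decomposition they suffice to construct a
  homomorphism from \<open>SL(2, K)\<close>.
\<close>

locale sl2_group = group G for G (structure) +
  fixes K :: "complex set" and x y :: "complex \<Rightarrow> 'a"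
  assumes K: "K \<in> {\<real>, UNIV}"
    and x_closed [simp]: "r \<in> K \<Longrightarrow> x r \<in> carrier G" and y_closed [simp]: "r \<in> K \<Longrightarrow> y r \<in> carrier G"
    and x_add: "r \<in> K \<Longrightarrow> s \<in> K \<Longrightarrow> x (r + s) = x r \<otimes> x s"
    and y_add: "r \<in> K \<Longrightarrow> s \<in> K \<Longrightarrow> y (r + s) = y r \<otimes> y s"
    and w_x: "t \<in> K \<Longrightarrow> t \<noteq> 0 \<Longrightarrow> r \<in> K \<Longrightarrow>
      x t \<otimes> (y (- 1 / t) \<otimes> x t) \<otimes> x r = y (- r / t\<^sup>2) \<otimes> (x t \<otimes> (y (- 1 / t) \<otimes> x t))"
    and h_mult': "s \<in> K \<Longrightarrow> t \<in> K \<Longrightarrow> s \<noteq> 0 \<Longrightarrow> t \<noteq> 0 \<Longrightarrow>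
      (x (s * t) \<otimes> (y (- 1 / (s * t)) \<otimes> x (s * t))) \<otimes> (x (- 1) \<otimes> (y 1 \<otimes> x (- 1))) =
      (x s \<otimes> (y (- 1 / s) \<otimes> x s)) \<otimes> (x (- 1) \<otimes> (y 1 \<otimes> x (- 1))) \<otimes>
      ((x t \<otimes> (y (- 1 / t) \<otimes> x t)) \<otimes> (x (- 1) \<otimes> (y 1 \<otimes> x (- 1))))"
begin

lemma Ks [simp]:
  "0 \<in> K" "1 \<in> K" "a \<in> K \<Longrightarrow> - a \<in> K" "a \<in> K \<Longrightarrow> b \<in> K \<Longrightarrow> a + b \<in> K" "a \<in> K \<Longrightarrow> b \<in> K \<Longrightarrow> a - b \<in> K"
  "a \<in> K \<Longrightarrow> b \<in> K \<Longrightarrow> a * b \<in> K" "a \<in> K \<Longrightarrow> b \<in> K \<Longrightarrow> a / b \<in> K" "a \<in> K \<Longrightarrow> a ^ k \<in> K"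
  using K by auto

definition w :: "complex \<Rightarrow> 'a" where "w t = x t \<otimes> (y (- 1 / t) \<otimes> x t)"
definition h :: "complex \<Rightarrow> 'a" where "h t = w t \<otimes> w (-1)"

lemma w_closed [simp]: "t \<in> K \<Longrightarrow> w t \<in> carrier G" by (simp add: w_def)
lemma h_closed [simp]: "t \<in> K \<Longrightarrow> h t \<in> carrier G" by (simp add: h_def)

lemma h_mult: "s \<in> K \<Longrightarrow> t \<in> K \<Longrightarrow> s \<noteq> 0 \<Longrightarrow> t \<noteq> 0 \<Longrightarrow> h (s * t) = h s \<otimes> h t"
  using h_mult'[of s t] by (simp add: h_def w_def)

lemma x_0: "x 0 = \<one>" using x_add[of 0 0] by simp
lemma y_0: "y 0 = \<one>" using y_add[of 0 0] by simp

lemma x_cancel: "r \<in> K \<Longrightarrow> x (- r) \<otimes> x r = \<one>" "r \<in> K \<Longrightarrow> x r \<otimes> x (- r) = \<one>"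
  using x_add[of "- r" r] x_add[of r "- r"] by (simp_all add: x_0)

lemma y_cancel: "r \<in> K \<Longrightarrow> y (- r) \<otimes> y r = \<one>" "r \<in> K \<Longrightarrow> y r \<otimes> y (- r) = \<one>"
  using y_add[of "- r" r] y_add[of r "- r"] by (simp_all add: y_0)

lemma x_cancel_left: "r \<in> K \<Longrightarrow> g \<in> carrier G \<Longrightarrow> x (- r) \<otimes> (x r \<otimes> g) = g" "r \<in> K \<Longrightarrow> g \<in> carrier G \<Longrightarrow> x r \<otimes> (x (- r) \<otimes> g) = g"
  by (simp_all add: m_assoc[symmetric] x_cancel)

lemma y_cancel_left: "r \<in> K \<Longrightarrow> g \<in> carrier G \<Longrightarrow> y (- r) \<otimes> (y r \<otimes> g) = g" "r \<in> K \<Longrightarrow> g \<in> carrier G \<Longrightarrow> y r \<otimes> (y (- r) \<otimes> g) = g"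
  by (simp_all add: m_assoc[symmetric] y_cancel)

lemma w_cancel: "t \<in> K \<Longrightarrow> w t \<otimes> w (- t) = \<one>"
  using y_cancel_left(1)[of "1 / t"] by (simp add: w_def m_assoc x_cancel_left x_cancel)

lemma w_cancel_left: "t \<in> K \<Longrightarrow> g \<in> carrier G \<Longrightarrow> w t \<otimes> (w (- t) \<otimes> g) = g"
  by (simp add: m_assoc[symmetric] w_cancel)

lemma w_x': "t \<in> K \<Longrightarrow> t \<noteq> 0 \<Longrightarrow> r \<in> K \<Longrightarrow> w t \<otimes> x r = y (- r / t\<^sup>2) \<otimes> w t"
  using w_x by (simp add: w_def)

lemma w_y:
  assumes t: "t \<in> K" "t \<noteq> 0" and s: "s \<in> K"
  shows "w t \<otimes> y s = x (- (t\<^sup>2 * s)) \<otimes> w t"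
proof -
  have "w (- t) \<otimes> x (- (t\<^sup>2 * s)) = y s \<otimes> w (- t)"
    using w_x'[of "- t" "- (t\<^sup>2 * s)"] t s by (simp add: power2_eq_square)
  then have "w t \<otimes> (w (- t) \<otimes> x (- (t\<^sup>2 * s))) \<otimes> w t = w t \<otimes> (y s \<otimes> w (- t)) \<otimes> w t" by simp
  moreover have "w (- t) \<otimes> w t = \<one>" using w_cancel[of "- t"] t by simp
  ultimately show ?thesis using t s by (simp add: w_cancel_left m_assoc)
qed

lemma w_h: "t \<in> K \<Longrightarrow> w t = h t \<otimes> w 1"
  using w_cancel[of "-1"] by (simp add: h_def m_assoc)

lemma h_x:
  assumes a: "a \<in> K" "a \<noteq> 0" and q: "q \<in> K"
  shows "h a \<otimes> x q = x (a\<^sup>2 * q) \<otimes> h a"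
proof -
  have "h a \<otimes> x q = w a \<otimes> (w (-1) \<otimes> x q)" using a q by (simp add: h_def m_assoc)
  also have "\<dots> = w a \<otimes> y (- q) \<otimes> w (-1)" using w_x'[of "-1" q] a q by (simp add: m_assoc)
  also have "\<dots> = x (a\<^sup>2 * q) \<otimes> h a" using w_y[of a "- q"] a q by (simp add: h_def m_assoc)
  finally show ?thesis .
qed

lemma h_1: "h 1 = \<one>" by (simp add: h_def w_cancel)

lemma h_inv: "t \<in> K \<Longrightarrow> t \<noteq> 0 \<Longrightarrow> inv (h t) = h (1 / t)"
  using h_mult[of "1 / t" t] by (intro inv_equality) (simp_all add: h_1)

lemma w_inv: "t \<in> K \<Longrightarrow> inv (w t) = w (- t)"
  using w_cancel[of "- t"] by (intro inv_equality) simp_all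

lemma w_minus: "t \<in> K \<Longrightarrow> t \<noteq> 0 \<Longrightarrow> w (- t) = h t \<otimes> w (-1)"
proof -
  assume t: "t \<in> K" "t \<noteq> 0"
  have "w (- t) = h t \<otimes> h (-1) \<otimes> w 1" using w_h[of "- t"] h_mult[of t "-1"] t by simp
  also have "\<dots> = h t \<otimes> w (-1)" using t w_cancel[of "-1"] by (simp add: h_def[of "-1"] m_assoc)
  finally show ?thesis .
qed

lemma w1_h:
  assumes t: "t \<in> K" "t \<noteq> 0" shows "w 1 \<otimes> h t = h (1 / t) \<otimes> w 1"
proof -
  have "h (1 / t) = w 1 \<otimes> w (- t)"
    using t by (simp add: h_inv[symmetric] h_def[of t] inv_mult_group w_inv)
  then have "h (1 / t) \<otimes> w 1 = w 1 \<otimes> (h t \<otimes> w (-1)) \<otimes> w 1" using w_minus[OF t] by simp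
  also have "\<dots> = w 1 \<otimes> h t" using t w_cancel[of "-1"] by (simp add: m_assoc)
  finally show ?thesis by simp
qed

text \<open>The square of w(1) is h(-1), so h absorbs the product of two reflections. This keeps
  Bruhat forms closed under left multiplication by w(1).\<close>

lemma w1_w:
  assumes t: "t \<in> K" "t \<noteq> 0" shows "w 1 \<otimes> w t = h (- 1 / t)"
proof -
  have "w 1 \<otimes> w 1 = inv (h (-1))" by (simp add: h_def inv_mult_group w_inv)
  then have w11: "w 1 \<otimes> w 1 = h (-1)" by (simp add: h_inv)
  have "w 1 \<otimes> w t = h (1 / t) \<otimes> (w 1 \<otimes> w 1)"
    using t w1_h[OF t] by (simp add: w_h[of t] m_assoc[symmetric])
  also have "\<dots> = h (- 1 / t)" using h_mult[of "1 / t" "-1"] t by (simp add: w11)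
  finally show ?thesis .
qed

lemma w_mult_h:
  assumes t: "t \<in> K" "t \<noteq> 0" and s: "s \<in> K" "s \<noteq> 0" shows "w t \<otimes> h s = w (t / s)"
proof -
  have "w t \<otimes> h s = h t \<otimes> (w 1 \<otimes> h s)" using t s by (simp add: w_h[of t] m_assoc)
  also have "\<dots> = h (t / s) \<otimes> w 1" using t s h_mult[of t "1 / s"] by (simp add: w1_h m_assoc)
  finally show ?thesis using w_h[of "t / s"] t s by simp
qed

lemma y_w:
  assumes s: "s \<in> K" "s \<noteq> 0" shows "y s = x (1 / s) \<otimes> (w (- 1 / s) \<otimes> x (1 / s))"
  using s x_cancel[of "1 / s"] by (simp add: w_def m_assoc x_cancel_left)

text \<open>Bruhat normal form: an upper triangular matrix is h(a) x(b/a), any other is x(a/c)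
  w(-1/c) x(d/c). The entries determine every factor, so the definition needs no choice and only
  multiplicativity remains.\<close>

definition \<psi> :: "complex ^ 2 ^ 2 \<Rightarrow> 'a" where
  "\<psi> M = (let a = M $ 1 $ 1; b = M $ 1 $ 2; c = M $ 2 $ 1; d = M $ 2 $ 2 in
     if c = 0 then h a \<otimes> x (b / a) else x (a / c) \<otimes> (w (- 1 / c) \<otimes> x (d / c)))"

lemma \<psi>_mat2: "\<psi> (mat2 a b c d) = (if c = 0 then h a \<otimes> x (b / a) else x (a / c) \<otimes> (w (- 1 / c) \<otimes> x (d / c)))"
  by (simp add: \<psi>_def)

lemma \<psi>_closed: "M \<in> carrier (SL2 K) \<Longrightarrow> \<psi> M \<in> carrier G"
  by (elim SL2_cases) (auto simp: \<psi>_mat2)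

lemma \<psi>_x: "r \<in> K \<Longrightarrow> \<psi> (mat2 1 r 0 1) = x r"
  by (simp add: \<psi>_mat2 h_1)

lemma \<psi>_y: "r \<in> K \<Longrightarrow> \<psi> (mat2 1 0 r 1) = y r"
  by (simp add: \<psi>_mat2 h_1 x_0 y_0 y_w)

lemma \<psi>_x_mult:
  assumes r: "r \<in> K" and M: "M \<in> carrier (SL2 K)"
  shows "\<psi> (mat2 1 r 0 1 ** M) = x r \<otimes> \<psi> M"
  using M
proof (rule SL2_cases)
  fix a b c d assume M: "M = mat2 a b c d" and k: "a \<in> K" "b \<in> K" "c \<in> K" "d \<in> K" and det: "a * d - b * c = 1"
  show ?thesis
  proof (cases "c = 0")
    case True
    have a0: "a \<noteq> 0" using det True by auto
    then have d: "d = 1 / a" using det True by (simp add: field_simps)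
    have "h a \<otimes> x ((b + r * d) / a) = h a \<otimes> (x (r / a\<^sup>2) \<otimes> x (b / a))"
      using k r a0 x_add[of "r / a\<^sup>2" "b / a"] by (simp add: d add_divide_distrib power2_eq_square add.commute)
    also have "\<dots> = x r \<otimes> (h a \<otimes> x (b / a))"
      using k r a0 h_x[of a "r / a\<^sup>2"] by (simp add: m_assoc[symmetric])
    finally show ?thesis using True by (simp add: M \<psi>_mat2)
  next
    case False
    have "x ((a + r * c) / c) = x r \<otimes> x (a / c)" using x_add[of r "a / c"] k r False by (simp add: add_divide_distrib add.commute)
    then show ?thesis using False k r by (simp add: M \<psi>_mat2 m_assoc)
  qed
qed

text \<open>Multiplication by w(1) makes -a the new lower left entry, so the type of the normal form
  depends on whether a and c vanish. The interesting case is the third: both matrices lie in the big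
  cell.\<close>

lemma \<psi>_w_mult:
  assumes M: "M \<in> carrier (SL2 K)"
  shows "\<psi> (mat2 0 1 (-1) 0 ** M) = w 1 \<otimes> \<psi> M"
  using M
proof (rule SL2_cases)
  fix a b c d assume M: "M = mat2 a b c d" and k: "a \<in> K" "b \<in> K" "c \<in> K" "d \<in> K" and det: "a * d - b * c = 1"
  consider "c = 0" | "c \<noteq> 0" "a = 0" | "c \<noteq> 0" "a \<noteq> 0" by blast
  then show ?thesis
  proof cases
    case 1
    have a0: "a \<noteq> 0" using det 1 by auto
    have "w 1 \<otimes> (h a \<otimes> x (b / a)) = w (1 / a) \<otimes> x (b / a)"
      using k a0 w1_h[of a] w_h[of "1 / a"] by (simp add: m_assoc[symmetric])
    then show ?thesis using 1 a0 k by (simp add: M \<psi>_mat2 x_0)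
  next
    case 2
    have "w 1 \<otimes> (w (- 1 / c) \<otimes> x (d / c)) = h c \<otimes> x (d / c)"
      using k 2 w1_w[of "- 1 / c"] by (simp add: m_assoc[symmetric])
    then show ?thesis using 2 k by (simp add: M \<psi>_mat2 x_0)
  next
    case 3
    let ?x' = "x (- 1 / (a * c))"
    have "w 1 \<otimes> (x (a / c) \<otimes> (w (- 1 / c) \<otimes> x (d / c))) = y (- a / c) \<otimes> (w 1 \<otimes> w (- 1 / c)) \<otimes> x (d / c)"
      using k 3 w_x'[of 1 "a / c"] by (simp add: m_assoc[symmetric])
    also have "\<dots> = y (- a / c) \<otimes> h c \<otimes> x (d / c)" using k 3 w1_w[of "- 1 / c"] by simp
    \<comment> \<open>The lower unipotent element is rewritten in Bruhat form. Afterwards h(c) is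
      moved to the left until it merges with the reflection, and the two upper unipotent factors are
      added.\<close>
    also have "y (- a / c) = x (- c / a) \<otimes> (w (c / a) \<otimes> x (- c / a))"
      using y_w[of "- a / c"] k 3 by simp
    also have "x (- c / a) \<otimes> (w (c / a) \<otimes> x (- c / a)) \<otimes> h c \<otimes> x (d / c) =
        x (- c / a) \<otimes> (w (c / a) \<otimes> (x (- c / a) \<otimes> h c) \<otimes> x (d / c))" using k 3 by (simp add: m_assoc)
    also have "x (- c / a) \<otimes> h c = h c \<otimes> ?x'"
      using h_x[of c "- 1 / (a * c)"] k 3 by (simp add: power2_eq_square)
    also have "w (c / a) \<otimes> (h c \<otimes> ?x') \<otimes> x (d / c) = (w (c / a) \<otimes> h c) \<otimes> (?x' \<otimes> x (d / c))"
      using k 3 by (simp add: m_assoc)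
    also have "w (c / a) \<otimes> h c = w (1 / a)" using w_mult_h[of "c / a" c] k 3 by simp
    also have "?x' \<otimes> x (d / c) = x (b / a)"
    proof -
      have "- 1 / (a * c) + d / c = b / a" using det 3 by (simp add: field_simps)
      then show ?thesis using x_add[of "- 1 / (a * c)" "d / c"] k by simp
    qed
    finally show ?thesis using 3 k by (simp add: M \<psi>_mat2)
  qed
qed

text \<open>The matrices \<open>A\<close> that satisfy the claim for all \<open>B\<close> are closed
  under products. They contain the upper unipotent matrices and w(1), which generate.\<close>

lemma \<psi>_mult:
  assumes A: "A \<in> carrier (SL2 K)" and B: "B \<in> carrier (SL2 K)"
  shows "\<psi> (A ** B) = \<psi> A \<otimes> \<psi> B"
proof -
  let ?P = "\<lambda>A. \<forall>B\<in>carrier (SL2 K). \<psi> (A ** B) = \<psi> A \<otimes> \<psi> B"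
  have cl: "A ** B \<in> carrier (SL2 K)" if AB: "A \<in> carrier (SL2 K)" "B \<in> carrier (SL2 K)" for A B
    using SL2_mult_closed[OF K AB] .
  have mult: "?P (A ** B)" if "A \<in> carrier (SL2 K)" "B \<in> carrier (SL2 K)" "?P A" "?P B" for A B
    using that by (auto simp: matrix_mul_assoc[symmetric] cl \<psi>_closed m_assoc)
  have w: "mat2 0 1 (-1) 0 \<in> carrier (SL2 K)" by (simp add: mat2_SL2)
  have Pw: "?P (mat2 0 1 (-1) 0)"
    using \<psi>_w_mult by (simp add: \<psi>_mat2 x_0)
  have Px: "?P (mat2 1 r 0 1)" if "r \<in> K" for r using \<psi>_x_mult \<psi>_x that by simp
  have "?P A"
  proof (rule SL2_induct[where P = ?P, OF K A Px])
    fix r assume r: "r \<in> K"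
    \<comment> \<open>The third power of w(1) is its inverse; the product is the conjugate of x(-r)
      by w(1), a lower unipotent matrix.\<close>
    have "?P (mat2 0 1 (-1) 0 ** (mat2 1 (-r) 0 1 ** (mat2 0 1 (-1) 0 ** (mat2 0 1 (-1) 0 ** mat2 0 1 (-1) 0))))"
      by (intro mult cl w Pw Px) (use r in \<open>auto simp: mat2_SL2\<close>)
    then show "?P (mat2 1 0 r 1)" by simp
  qed (use mult in blast)+
  then show ?thesis using B by blast
qed

end

section \<open>The Kac--Moody algebra\<close>

locale lie_presentation =
  fixes K :: "complex set" and X :: "'x set" and R :: "('x lie_term \<times> 'x lie_term) set"
  assumes K': "K \<in> {\<real>, UNIV}"
begin

abbreviation "TT \<equiv> lie_terms K X"
abbreviation "cl \<equiv> lie_class K X R"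
abbreviation "PL \<equiv> presented_lie_algebra K X R"

lemma K1: "- 1 \<in> K" "1 \<in> K" "a \<in> K \<Longrightarrow> b \<in> K \<Longrightarrow> a + b \<in> K" "a \<in> K \<Longrightarrow> b \<in> K \<Longrightarrow> a * b \<in> K"
  using K' by auto

lemma lie_eq_terms: "lie_eq K X R s t \<Longrightarrow> s \<in> TT \<and> t \<in> TT"
  by (induction rule: lie_eq.induct) (auto intro!: lie_terms.intros simp: K1)

lemma cl_eqI: "lie_eq K X R s t \<Longrightarrow> cl s = cl t"
  unfolding lie_class_def by (auto intro: lie_eq.trans lie_eq.sym)

lemma cl_self: "t \<in> TT \<Longrightarrow> t \<in> cl t"
  by (simp add: lie_class_def lie_eq.refl)

lemma cl_eq_iff: "t \<in> TT \<Longrightarrow> cl s = cl t \<longleftrightarrow> lie_eq K X R s t"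
  using cl_eqI cl_self by (auto simp: lie_class_def)

lemma cl_mem: "s \<in> cl t \<Longrightarrow> lie_eq K X R t s" by (simp add: lie_class_def)

lemma PL_carrier: "carrier PL = cl ` TT" by (simp add: presented_lie_algebra_def)
lemma PL_zero: "lzero PL = cl Zero" by (simp add: presented_lie_algebra_def)

lemma PL_plus: assumes "s \<in> TT" "t \<in> TT" shows "lplus PL (cl s) (cl t) = cl (Plus s t)"
proof -
  have "cl (Plus s' t') = cl (Plus s t)" if "s' \<in> cl s" "t' \<in> cl t" for s' t'
    by (rule cl_eqI[symmetric]) (intro lie_eq.cong_plus cl_mem that)
  then have "(\<Union>s'\<in>cl s. \<Union>t'\<in>cl t. cl (Plus s' t')) = cl (Plus s t)"
    using cl_self assms by blast
  then show ?thesis by (simp add: presented_lie_algebra_def)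
qed

lemma PL_bracket: assumes "s \<in> TT" "t \<in> TT" shows "lbracket PL (cl s) (cl t) = cl (Bracket s t)"
proof -
  have "cl (Bracket s' t') = cl (Bracket s t)" if "s' \<in> cl s" "t' \<in> cl t" for s' t'
    by (rule cl_eqI[symmetric]) (intro lie_eq.cong_bracket cl_mem that)
  then have "(\<Union>s'\<in>cl s. \<Union>t'\<in>cl t. cl (Bracket s' t')) = cl (Bracket s t)"
    using cl_self assms by blast
  then show ?thesis by (simp add: presented_lie_algebra_def)
qed

lemma PL_scale: assumes "a \<in> K" "t \<in> TT" shows "lscale PL a (cl t) = cl (Scale a t)"
proof -
  have "cl (Scale a t') = cl (Scale a t)" if "t' \<in> cl t" for t'
    by (rule cl_eqI[symmetric]) (intro lie_eq.cong_scale cl_mem that assms)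
  then have "(\<Union>t'\<in>cl t. cl (Scale a t')) = cl (Scale a t)"
    using cl_self assms by blast
  then show ?thesis by (simp add: presented_lie_algebra_def)
qed

lemmas PL_simps = PL_carrier PL_zero PL_plus PL_bracket PL_scale lie_terms.intros

lemma lie_alg_PL: "lie_alg K PL"
proof
  show "K \<in> {\<real>, UNIV}" by (rule K')
  show "lzero PL \<in> carrier PL" by (auto simp: PL_simps)
  show "lplus PL v w \<in> carrier PL" "lbracket PL v w \<in> carrier PL" if "v \<in> carrier PL" "w \<in> carrier PL" for v w
    using that by (auto simp: PL_simps)
  show "lscale PL a v \<in> carrier PL" if "a \<in> K" "v \<in> carrier PL" for a v
    using that by (auto simp: PL_simps)
qed (unfold PL_carrier, (elim imageE, simp add: PL_zero PL_plus PL_bracket PL_scale lie_terms.intros K1 cl_eq_iff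
    lie_eq.plus_assoc lie_eq.plus_commute lie_eq.plus_zero lie_eq.plus_neg
    lie_eq.scale_one lie_eq.scale_mult lie_eq.scale_left lie_eq.scale_right lie_eq.bracket_plus_left
    lie_eq.bracket_plus_right lie_eq.bracket_scale_left lie_eq.bracket_scale_right lie_eq.bracket_self lie_eq.jacobi)+)

sublocale lie_alg K PL by (rule lie_alg_PL)

lemma carrier_induct [consumes 1, case_names gen zero plus scale bracket]:
  assumes v: "v \<in> carrier PL"
    and "\<And>x. x \<in> X \<Longrightarrow> P (cl (Gen x))" "P (lzero PL)"
    and "\<And>v w. v \<in> carrier PL \<Longrightarrow> w \<in> carrier PL \<Longrightarrow> P v \<Longrightarrow> P w \<Longrightarrow> P (lplus PL v w)"
    and "\<And>a v. a \<in> K \<Longrightarrow> v \<in> carrier PL \<Longrightarrow> P v \<Longrightarrow> P (lscale PL a v)"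
    and "\<And>v w. v \<in> carrier PL \<Longrightarrow> w \<in> carrier PL \<Longrightarrow> P v \<Longrightarrow> P w \<Longrightarrow> P (lbracket PL v w)"
  shows "P v"
proof -
  obtain t where t: "t \<in> TT" "v = cl t" using v by (auto simp: PL_carrier)
  have "P (cl t)" using t(1)
  proof induction
    case (Gen x) then show ?case using assms by simp
  next
    case Zero then show ?case using assms by (simp add: PL_zero)
  next
    case (Plus s t)
    then show ?case using assms(4)[of "cl s" "cl t"] by (simp add: PL_plus PL_carrier)
  next
    case (Scale a t)
    then show ?case using assms(5)[of a "cl t"] by (simp add: PL_scale PL_carrier)
  next
    case (Bracket s t)
    then show ?case using assms(6)[of "cl s" "cl t"] by (simp add: PL_bracket PL_carrier)
  qed
  then show ?thesis using t by simp
qed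

lemma gen_closed: "x \<in> X \<Longrightarrow> cl (Gen x) \<in> carrier PL"
  by (auto simp: PL_carrier intro: lie_terms.intros)

lemma aut_eqI_gen:
  assumes \<sigma>: "\<sigma> \<in> lie_auts K PL" and \<tau>: "\<tau> \<in> lie_auts K PL" and eq: "\<And>x. x \<in> X \<Longrightarrow> \<sigma> (cl (Gen x)) = \<tau> (cl (Gen x))"
  shows "\<sigma> = \<tau>"
proof (rule aut_ext[OF \<sigma> \<tau>])
  fix v assume "v \<in> carrier PL"
  then show "\<sigma> v = \<tau> v"
    by (induction rule: carrier_induct)
      (simp_all add: eq aut_zero[OF \<sigma>] aut_zero[OF \<tau>] aut_plus[OF \<sigma>] aut_plus[OF \<tau>] aut_scale[OF \<sigma>] aut_scale[OF \<tau>]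
        aut_br[OF \<sigma>] aut_br[OF \<tau>])
qed

text \<open>The vectors annihilated by some power of \<open>ad x\<close> form a subalgebra, by the
  Leibniz rule, so it is enough that they contain the generators.\<close>

lemma locally_nilpotentI:
  assumes x: "x \<in> carrier PL" and gen: "\<And>y. y \<in> X \<Longrightarrow> \<exists>n. adp n x (cl (Gen y)) = lzero PL"
  shows "locally_nilpotent x"
  unfolding locally_nilpotent_def
proof (intro conjI ballI x)
  fix v assume "v \<in> carrier PL"
  then show "\<exists>n. adp n x v = lzero PL"
  proof (induction rule: carrier_induct)
    case zero show ?case using x by (intro exI[of _ 0]) simp
  next
    case (plus v w)
    then obtain m n where mn: "adp m x v = lzero PL" "adp n x w = lzero PL" by blast
    have "adp (m + n) x v = lzero PL" "adp (m + n) x w = lzero PL"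
      using adp_mono[OF mn(1), of "m + n"] adp_mono[OF mn(2), of "m + n"] x by simp_all
    then have "adp (m + n) x (lplus PL v w) = lzero PL" using plus x by (simp add: adp_plus plus_zero)
    then show ?case by blast
  next
    case (scale a v)
    then obtain n where "adp n x v = lzero PL" by blast
    then have "adp n x (lscale PL a v) = lzero PL" using scale x by (simp add: adp_scale)
    then show ?case by blast
  next
    case (bracket v w)
    then show ?case using adp_br_zero[OF x] by blast
  qed (rule gen)
qed

end

section \<open>Chevalley generators and the rank-one groups acting on them\<close>

locale km =
  fixes K :: "complex set" and D :: "('i, 'l::ab_group_add) root_datum"
  assumes K: "K \<in> {\<real>, UNIV}" and D: "kac_moody_root_datum D"
begin

abbreviation "I \<equiv> rd_index D"
abbreviation "ca \<equiv> rd_cartan D"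
abbreviation "e i \<equiv> chev_e K D i"
abbreviation "f i \<equiv> chev_f K D i"

definition hh :: "('l \<Rightarrow> int) \<Rightarrow> ('i, 'l) km_elt" where "hh h = km_class K D (tH h)"

abbreviation "hi i \<equiv> hh (rd_h D i)"

sublocale lie_presentation K "km_gens D" "km_relations D"
  by unfold_locales (rule K)

abbreviation "L \<equiv> PL"

lemma km_algebra_PL: "km_algebra K D = PL" by (simp add: km_algebra_def)
lemma km_class_cl: "km_class K D = cl" by (simp add: km_class_def)

lemma finite_I: "finite I" and gcm: "generalized_cartan_matrix I ca"
  and hi_dual: "i \<in> I \<Longrightarrow> rd_h D i \<in> dual_lattice"
  and pairing: "i \<in> I \<Longrightarrow> j \<in> I \<Longrightarrow> rd_h D i (rd_c D j) = ca i j"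
  using D by (auto simp: kac_moody_root_datum_def)

lemma ca_diag: "i \<in> I \<Longrightarrow> ca i i = 2"
  and ca_off: "i \<in> I \<Longrightarrow> j \<in> I \<Longrightarrow> i \<noteq> j \<Longrightarrow> ca i j \<le> 0"
  using gcm by (auto simp: generalized_cartan_matrix_def)

lemma gens: "h \<in> dual_lattice \<Longrightarrow> GenH h \<in> km_gens D" "i \<in> I \<Longrightarrow> GenE i \<in> km_gens D" "i \<in> I \<Longrightarrow> GenF i \<in> km_gens D"
  by (auto simp: km_gens_def)

lemma gen_cases:
  assumes "x \<in> km_gens D"
  obtains h where "h \<in> dual_lattice" "x = GenH h" | i where "i \<in> I" "x = GenE i" | i where "i \<in> I" "x = GenF i"
  using assms by (auto simp: km_gens_def)

lemma cl_gens: "cl (tH h) = hh h" "cl (tE i) = e i" "cl (tF i) = f i"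
  by (simp_all add: hh_def chev_e_def chev_f_def km_class_cl)

lemma terms: "h \<in> dual_lattice \<Longrightarrow> tH h \<in> TT" "i \<in> I \<Longrightarrow> tE i \<in> TT" "i \<in> I \<Longrightarrow> tF i \<in> TT"
  by (auto intro!: lie_terms.Gen gens)

lemma gen_carrier [simp]:
  "h \<in> dual_lattice \<Longrightarrow> hh h \<in> carrier L" "i \<in> I \<Longrightarrow> e i \<in> carrier L" "i \<in> I \<Longrightarrow> f i \<in> carrier L"
  using gen_closed gens by (force simp: cl_gens[symmetric])+

lemma rel: "(s, t) \<in> km_relations D \<Longrightarrow> s \<in> TT \<Longrightarrow> t \<in> TT \<Longrightarrow> cl s = cl t"
  by (intro cl_eqI lie_eq.relation)

lemma hh_hh:
  assumes "h \<in> dual_lattice" "h' \<in> dual_lattice" shows "lbracket L (hh h) (hh h') = lzero L"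
proof -
  have "cl (Bracket (tH h) (tH h')) = cl Zero"
    using assms by (intro rel lie_terms.intros gens) (auto simp: km_relations_def)
  then show ?thesis using assms by (simp add: cl_gens[symmetric] PL_bracket PL_zero terms)
qed

lemma hh_e:
  assumes "h \<in> dual_lattice" "i \<in> I" shows "lbracket L (hh h) (e i) = lscale L (of_int (h (rd_c D i))) (e i)"
proof -
  have "cl (Bracket (tH h) (tE i)) = cl (Scale (of_int (h (rd_c D i))) (tE i))"
    using assms by (intro rel lie_terms.intros gens) (auto simp: km_relations_def)
  then show ?thesis using assms by (simp add: cl_gens[symmetric] PL_bracket PL_scale terms)
qed

lemma hh_f:
  assumes "h \<in> dual_lattice" "i \<in> I" shows "lbracket L (hh h) (f i) = lscale L (- of_int (h (rd_c D i))) (f i)"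
proof -
  have "cl (Bracket (tH h) (tF i)) = cl (Scale (- of_int (h (rd_c D i))) (tF i))"
    using assms by (intro rel lie_terms.intros gens) (auto simp: km_relations_def)
  then show ?thesis using assms by (simp add: cl_gens[symmetric] PL_bracket PL_scale terms)
qed

lemma e_f_same:
  assumes "i \<in> I" shows "lbracket L (e i) (f i) = lscale L (-1) (hi i)"
proof -
  have "cl (Bracket (tE i) (tF i)) = cl (Scale (-1) (tH (rd_h D i)))"
    using assms by (intro rel lie_terms.intros gens) (auto simp: km_relations_def hi_dual)
  then show ?thesis using assms by (simp add: cl_gens[symmetric] PL_bracket PL_scale terms hi_dual)
qed

lemma e_f_diff:
  assumes "i \<in> I" "j \<in> I" "i \<noteq> j" shows "lbracket L (e i) (f j) = lzero L"
proof -
  have "cl (Bracket (tE i) (tF j)) = cl Zero"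
    using assms by (intro rel lie_terms.intros gens) (auto simp: km_relations_def)
  then show ?thesis using assms by (simp add: cl_gens[symmetric] PL_bracket PL_zero terms)
qed

lemma cl_bracket_power:
  assumes "s \<in> TT" "t \<in> TT" shows "(Bracket s ^^ n) t \<in> TT \<and> cl ((Bracket s ^^ n) t) = adp n (cl s) (cl t)"
  using assms by (induction n) (auto simp: PL_bracket[symmetric] intro: lie_terms.intros)

lemma serre_e:
  assumes "i \<in> I" "j \<in> I" "i \<noteq> j" shows "adp (nat (1 - ca i j)) (e i) (e j) = lzero L"
proof -
  have "cl ((Bracket (tE i) ^^ nat (1 - ca i j)) (tE j)) = cl Zero"
    using assms cl_bracket_power[of "tE i" "tE j"]
    by (intro rel lie_terms.intros) (auto simp: km_relations_def terms)
  then show ?thesis using assms cl_bracket_power[of "tE i" "tE j"] by (simp add: cl_gens[symmetric] PL_zero terms)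
qed

lemma serre_f:
  assumes "i \<in> I" "j \<in> I" "i \<noteq> j" shows "adp (nat (1 - ca i j)) (f i) (f j) = lzero L"
proof -
  have "cl ((Bracket (tF i) ^^ nat (1 - ca i j)) (tF j)) = cl Zero"
    using assms cl_bracket_power[of "tF i" "tF j"]
    by (intro rel lie_terms.intros) (auto simp: km_relations_def terms)
  then show ?thesis using assms cl_bracket_power[of "tF i" "tF j"] by (simp add: cl_gens[symmetric] PL_zero terms)
qed

lemma f_e_diff: "i \<in> I \<Longrightarrow> j \<in> I \<Longrightarrow> i \<noteq> j \<Longrightarrow> lbracket L (f i) (e j) = lzero L"
  using br_anti[of "f i" "e j"] e_f_diff[of j i] by simp

lemma f_e_same: "i \<in> I \<Longrightarrow> lbracket L (f i) (e i) = hi i"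
  using br_anti[of "f i" "e i"] by (simp add: e_f_same scale_scale scale_one hi_dual)

lemma e_hh: "h \<in> dual_lattice \<Longrightarrow> i \<in> I \<Longrightarrow> lbracket L (e i) (hh h) = lscale L (- of_int (h (rd_c D i))) (e i)"
  using br_anti[of "e i" "hh h"] by (simp add: hh_e scale_scale)

lemma f_hh: "h \<in> dual_lattice \<Longrightarrow> i \<in> I \<Longrightarrow> lbracket L (f i) (hh h) = lscale L (of_int (h (rd_c D i))) (f i)"
  using br_anti[of "f i" "hh h"] by (simp add: hh_f scale_scale)

text \<open>On generators: two brackets kill the Cartan part, three kill \<open>f i\<close>, one
  kills \<open>e i\<close> and the other \<open>f j\<close>, and the Serre relations take care of
  \<open>e j\<close>.\<close>

lemma e_nilpotent: assumes i: "i \<in> I" shows "locally_nilpotent (e i)"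
proof (rule locally_nilpotentI)
  fix y assume "y \<in> km_gens D"
  then show "\<exists>n. adp n (e i) (cl (Gen y)) = lzero L"
  proof (cases rule: gen_cases)
    case (1 h)
    then have "adp 2 (e i) (cl (Gen y)) = lzero L"
      using i by (simp add: cl_gens numeral_2_eq_2 e_hh br_scale_right br_self)
    then show ?thesis by blast
  next
    case (2 j)
    show ?thesis
    proof (cases "i = j")
      case True
      then have "adp 1 (e i) (cl (Gen y)) = lzero L" using i 2 by (simp add: cl_gens br_self)
      then show ?thesis by blast
    next
      case False
      then show ?thesis using serre_e[OF i 2(1)] 2 by (auto simp: cl_gens)
    qed
  next
    case (3 j)
    show ?thesis
    proof (cases "i = j")
      case True
      then have "adp 3 (e i) (cl (Gen y)) = lzero L"
        using i 3 by (simp add: cl_gens numeral_3_eq_3 e_f_same e_hh hi_dual br_scale_right br_self)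
      then show ?thesis by blast
    next
      case False
      then have "adp 1 (e i) (cl (Gen y)) = lzero L" using e_f_diff[OF i 3(1)] 3 by (simp add: cl_gens)
      then show ?thesis by blast
    qed
  qed
qed (use i in simp)

lemma f_nilpotent: assumes i: "i \<in> I" shows "locally_nilpotent (f i)"
proof (rule locally_nilpotentI)
  fix y assume "y \<in> km_gens D"
  then show "\<exists>n. adp n (f i) (cl (Gen y)) = lzero L"
  proof (cases rule: gen_cases)
    case (1 h)
    then have "adp 2 (f i) (cl (Gen y)) = lzero L"
      using i by (simp add: cl_gens numeral_2_eq_2 f_hh br_scale_right br_self)
    then show ?thesis by blast
  next
    case (3 j)
    show ?thesis
    proof (cases "i = j")
      case True
      then have "adp 1 (f i) (cl (Gen y)) = lzero L" using i 3 by (simp add: cl_gens br_self)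
      then show ?thesis by blast
    next
      case False
      then show ?thesis using serre_f[OF i 3(1)] 3 by (auto simp: cl_gens)
    qed
  next
    case (2 j)
    show ?thesis
    proof (cases "i = j")
      case True
      then have "adp 3 (f i) (cl (Gen y)) = lzero L"
        using i 2 by (simp add: cl_gens numeral_3_eq_3 f_e_same f_hh hi_dual br_scale_right br_self)
      then show ?thesis by blast
    next
      case False
      then have "adp 1 (f i) (cl (Gen y)) = lzero L" using f_e_diff[OF i 2(1)] 2 by (simp add: cl_gens)
      then show ?thesis by blast
    qed
  qed
qed (use i in simp)

lemma sl2: assumes i: "i \<in> I" shows "sl2_triple K L (e i) (f i) (hi i)"
  by unfold_locales
    (use i in \<open>simp_all add: e_nilpotent f_nilpotent hi_dual e_f_same hh_e hh_f pairing ca_diag\<close>)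

abbreviation "XX i \<equiv> sl2_triple.X L (e i)"
abbreviation "YY i \<equiv> sl2_triple.Y L (f i)"
abbreviation "WW i \<equiv> sl2_triple.W K L (e i) (f i)"
abbreviation "HH i \<equiv> sl2_triple.H K L (e i) (f i)"

lemma WW_hh:
  assumes i: "i \<in> I" and t: "t \<in> K" "t \<noteq> 0" and h: "h \<in> dual_lattice"
  shows "WW i t (hh h) = lplus L (hh h) (lscale L (- of_int (h (rd_c D i))) (hi i))"
  by (rule sl2_triple.W_weight[OF sl2[OF i] t]) (use i h in \<open>simp_all add: e_hh f_hh\<close>)

lemma nat_serre: "i \<in> I \<Longrightarrow> j \<in> I \<Longrightarrow> i \<noteq> j \<Longrightarrow> nat (1 - ca i j) = Suc (nat (- ca i j))"
  using ca_off[of i j] by simp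

text \<open>For the triple of index i the vector \<open>e j\<close> has lowest weight:
  \<open>f i\<close> kills it and \<open>hi i\<close> acts by \<open>ca i j\<close>. The Serre
  relation ends its string after \<open>- ca i j\<close> steps.\<close>

lemma WW_e:
  assumes i: "i \<in> I" and j: "j \<in> I" "i \<noteq> j" and t: "t \<in> K" "t \<noteq> 0"
  shows "WW i t (e j) = lscale L (t ^ nat (- ca i j) / fact (nat (- ca i j))) (adp (nat (- ca i j)) (e i) (e j))"
proof (rule sl2_triple.W_string[OF sl2[OF i] _ _ _ t])
  show "lbracket L (hi i) (e j) = lscale L (- of_nat (nat (- ca i j))) (e j)"
    using i j ca_off[of i j] by (simp add: hh_e hi_dual pairing)
  show "adp (Suc (nat (- ca i j))) (e i) (e j) = lzero L"
    using serre_e[OF i j] nat_serre[OF i j] by simp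
qed (use i j in \<open>simp_all add: f_e_diff\<close>)

lemma HH_e:
  assumes i: "i \<in> I" and j: "j \<in> I" "i \<noteq> j" and t: "t \<in> K" "t \<noteq> 0"
  shows "HH i t (e j) = lscale L ((1 / t) ^ nat (- ca i j)) (e j)"
proof (rule sl2_triple.H_string[OF sl2[OF i] _ _ _ t])
  show "lbracket L (hi i) (e j) = lscale L (- of_nat (nat (- ca i j))) (e j)"
    using i j ca_off[of i j] by (simp add: hh_e hi_dual pairing)
  show "adp (Suc (nat (- ca i j))) (e i) (e j) = lzero L"
    using serre_e[OF i j] nat_serre[OF i j] by simp
qed (use i j in \<open>simp_all add: f_e_diff\<close>)

lemma WW_swap:
  assumes i: "i \<in> I" and t: "t \<in> K" "t \<noteq> 0"
  shows "WW i t = sl2_triple.W K L (f i) (e i) (1 / t)"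
proof -
  interpret S: sl2_triple K L "e i" "f i" "hi i" by (rule sl2[OF i])
  interpret S': sl2_triple K L "f i" "e i" "lscale L (-1) (hi i)" by (rule S.swap)
  show ?thesis using S.W_swap[OF t] t by (simp add: S'.W_def S'.X_def S'.Y_def S.X_def S.Y_def)
qed

lemma WW_f:
  assumes i: "i \<in> I" and j: "j \<in> I" "i \<noteq> j" and t: "t \<in> K" "t \<noteq> 0"
  shows "WW i t (f j) = lscale L ((1 / t) ^ nat (- ca i j) / fact (nat (- ca i j))) (adp (nat (- ca i j)) (f i) (f j))"
  unfolding WW_swap[OF i t]
proof (rule sl2_triple.W_string[OF sl2_triple.swap[OF sl2[OF i]]])
  show "lbracket L (lscale L (-1) (hi i)) (f j) = lscale L (- of_nat (nat (- ca i j))) (f j)"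
    using i j ca_off[of i j] by (simp add: hh_f hi_dual pairing br_scale_left scale_scale)
  show "adp (Suc (nat (- ca i j))) (f i) (f j) = lzero L"
    using serre_f[OF i j] nat_serre[OF i j] by simp
qed (use i j t in \<open>simp_all add: e_f_diff\<close>)

lemma HH_f:
  assumes i: "i \<in> I" and j: "j \<in> I" "i \<noteq> j" and t: "t \<in> K" "t \<noteq> 0"
  shows "HH i t (f j) = lscale L (t ^ nat (- ca i j)) (f j)"
proof -
  have swap: "sl2_triple K L (f i) (e i) (lscale L (-1) (hi i))" by (rule sl2_triple.swap[OF sl2[OF i]])
  have "HH i t = sl2_triple.H K L (f i) (e i) (1 / t)"
    unfolding sl2_triple.H_def[OF sl2[OF i]] sl2_triple.H_def[OF swap]
    using WW_swap[OF i t] WW_swap[OF i, of "-1"] by simp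
  moreover have "sl2_triple.H K L (f i) (e i) (1 / t) (f j) = lscale L ((1 / (1 / t)) ^ nat (- ca i j)) (f j)"
  proof (rule sl2_triple.H_string[OF swap])
    show "lbracket L (lscale L (-1) (hi i)) (f j) = lscale L (- of_nat (nat (- ca i j))) (f j)"
      using i j ca_off[of i j] by (simp add: hh_f hi_dual pairing br_scale_left scale_scale)
    show "adp (Suc (nat (- ca i j))) (f i) (f j) = lzero L"
      using serre_f[OF i j] nat_serre[OF i j] by simp
  qed (use i j t in \<open>simp_all add: e_f_diff\<close>)
  ultimately show ?thesis by simp
qed

text \<open>The torus element acts on a generator by a power of t whose exponent does not depend on
  t. This uniformity is what makes the action multiplicative in t.\<close>

lemma HH_gen:
  assumes i: "i \<in> I" and x: "x \<in> km_gens D"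
  obtains n :: int where "\<And>t. t \<in> K \<Longrightarrow> t \<noteq> 0 \<Longrightarrow> HH i t (cl (Gen x)) = lscale L (t powi n) (cl (Gen x))"
  using x
proof (cases rule: gen_cases)
  interpret S: sl2_triple K L "e i" "f i" "hi i" by (rule sl2[OF i])
  note WWi = S.W_aut
  {
    case (1 h)
    \<comment> \<open>On the Cartan subalgebra both factors of \<open>HH i t\<close> act as the same
      reflection, so they cancel.\<close>
    have "HH i t (hh h) = hh h" if t: "t \<in> K" "t \<noteq> 0" for t
    proof -
      have W: "WW i t \<in> lie_auts K L" using t by simp
      let ?a = "of_int (h (rd_c D i)) :: complex"
      have Whi: "WW i t (hi i) = lplus L (hi i) (lscale L (- 2) (hi i))"
        using WW_hh[OF i t hi_dual[OF i]] i by (simp add: pairing ca_diag)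
      have "HH i t (hh h) = WW i t (lplus L (hh h) (lscale L (- ?a) (hi i)))"
        using 1 t i WW_hh[OF i, of "-1" h] by (simp add: S.H_apply)
      also have "\<dots> = lplus L (lplus L (hh h) (lscale L (- ?a) (hi i))) (lscale L (- ?a) (lplus L (hi i) (lscale L (- 2) (hi i))))"
        using 1 t i WW_hh[OF i t, of h] by (simp add: aut_plus[OF W] aut_scale[OF W] hi_dual Whi)
      also have "\<dots> = hh h"
      proof (rule eqI_dual)
        fix \<xi> assume \<xi>: "\<xi> \<in> dual"
        show "\<xi> (lplus L (lplus L (hh h) (lscale L (- ?a) (hi i))) (lscale L (- ?a) (lplus L (hi i) (lscale L (- 2) (hi i))))) = \<xi> (hh h)"
          using 1 i hi_dual[OF i] by (simp add: dual_simps[OF \<xi>] algebra_simps)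
      qed (use 1 i hi_dual[OF i] in auto)
      finally show ?thesis .
    qed
    then show ?thesis using 1 by (intro that[of 0]) (simp add: cl_gens scale_one)
  next
    case (2 j)
    show ?thesis
    proof (cases "i = j")
      case True
      have "HH i t (e i) = lscale L (t powi 2) (e i)" if t: "t \<in> K" "t \<noteq> 0" for t
        using t S.W_e[of "-1"] S.W_f[OF t] i by (simp add: S.H_apply scale_one power_int_def)
      then show ?thesis using True 2 by (intro that[of 2]) (simp add: cl_gens)
    next
      case False
      have "(1 / t) ^ nat (- ca i j) = t powi ca i j" for t :: complex
        using ca_off[OF i 2(1) False] by (auto simp: power_int_def inverse_eq_divide)
      then show ?thesis using HH_e[OF i 2(1) False] 2 by (intro that[of "ca i j"]) (simp add: cl_gens)
    qed
  next
    case (3 j)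
    show ?thesis
    proof (cases "i = j")
      case True
      have "HH i t (f i) = lscale L (t powi (-2)) (f i)" if t: "t \<in> K" "t \<noteq> 0" for t
        using t S.W_f[of "-1"] S.W_e[OF t] i by (simp add: S.H_apply scale_one power_int_def inverse_eq_divide power_divide)
      then show ?thesis using True 3 by (intro that[of "-2"]) (simp add: cl_gens)
    next
      case False
      have "t ^ nat (- ca i j) = t powi (- ca i j)" for t :: complex
        using ca_off[OF i 3(1) False] by (auto simp: power_int_def)
      then show ?thesis using HH_f[OF i 3(1) False] 3 by (intro that[of "- ca i j"]) (simp add: cl_gens)
    qed
  }
qed

text \<open>The last of Steinberg's relations. Automorphisms that agree on generators are equal, and
  on a generator the claim is multiplicativity of a power.\<close>

lemma HH_mult:
  assumes i: "i \<in> I" and s: "s \<in> K" "s \<noteq> 0" and t: "t \<in> K" "t \<noteq> 0"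
  shows "HH i (s * t) = HH i s \<otimes>\<^bsub>autG\<^esub> HH i t"
proof -
  interpret S: sl2_triple K L "e i" "f i" "hi i" by (rule sl2[OF i])
  have H: "HH i s \<in> lie_auts K L" "HH i t \<in> lie_auts K L" "HH i (s * t) \<in> lie_auts K L" using s t by auto
  show ?thesis
  proof (rule aut_eqI_gen)
    fix x assume x: "x \<in> km_gens D"
    obtain n where n: "\<And>t. t \<in> K \<Longrightarrow> t \<noteq> 0 \<Longrightarrow> HH i t (cl (Gen x)) = lscale L (t powi n) (cl (Gen x))"
      using HH_gen[OF i x] by blast
    have Kp: "r powi n \<in> K" if "r \<in> K" for r using K that by (auto simp: power_int_def)
    show "HH i (s * t) (cl (Gen x)) = (HH i s \<otimes>\<^bsub>autG\<^esub> HH i t) (cl (Gen x))"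
      using autG_mult_apply[OF H(1,2) gen_closed[OF x]] s t n[of "s * t"] n[of s] n[of t] gen_closed[OF x]
      by (simp add: aut_scale[OF H(1)] Kp scale_scale power_int_mult_distrib mult.commute del: autG_mult)
  qed (use H S.mult_aut in auto)
qed

end

section \<open>Nonvanishing of the Chevalley generators\<close>

text \<open>All defining relations except Serre's, in an arbitrary Lie algebra. In the operator
  algebra below the Serre relations do not come for free.\<close>

locale chevalley_relations = lie_alg K L for K :: "complex set" and L :: "'v lie_algebra" +
  fixes I :: "'i set" and ca :: "'i \<Rightarrow> 'i \<Rightarrow> int" and E F HH :: "'i \<Rightarrow> 'v"
  assumes gcm: "generalized_cartan_matrix I ca"
    and E_closed [simp]: "i \<in> I \<Longrightarrow> E i \<in> carrier L" and F_closed [simp]: "i \<in> I \<Longrightarrow> F i \<in> carrier L"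
    and H_closed [simp]: "i \<in> I \<Longrightarrow> HH i \<in> carrier L"
    and EF_diff: "i \<in> I \<Longrightarrow> j \<in> I \<Longrightarrow> i \<noteq> j \<Longrightarrow> lbracket L (E i) (F j) = lzero L"
    and EF_same: "i \<in> I \<Longrightarrow> lbracket L (E i) (F i) = lscale L (-1) (HH i)"
    and HE: "i \<in> I \<Longrightarrow> j \<in> I \<Longrightarrow> lbracket L (HH i) (E j) = lscale L (of_int (ca i j)) (E j)"
    and HF: "i \<in> I \<Longrightarrow> j \<in> I \<Longrightarrow> lbracket L (HH i) (F j) = lscale L (- of_int (ca i j)) (F j)"
begin

lemma FE_diff: "i \<in> I \<Longrightarrow> j \<in> I \<Longrightarrow> i \<noteq> j \<Longrightarrow> lbracket L (F i) (E j) = lzero L"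
  using br_anti[of "F i" "E j"] EF_diff[of j i] by simp

lemma FE_same: "i \<in> I \<Longrightarrow> lbracket L (F i) (E i) = HH i"
  using br_anti[of "F i" "E i"] by (simp add: EF_same scale_scale scale_one)

lemma swap: "chevalley_relations K L I ca F E (\<lambda>i. lscale L (-1) (HH i))"
  by unfold_locales
    (simp_all add: gcm FE_diff FE_same scale_scale scale_one br_scale_left HE HF)

lemma commute_power:
  assumes "z \<in> carrier L" "x \<in> carrier L" "v \<in> carrier L" "lbracket L z x = lzero L"
  shows "lbracket L z (adp n x v) = adp n x (lbracket L z v)"
  using assms by (induction n) (simp_all add: jacobi_left[of z x] zero_plus)

text \<open>For k = i the vector \<open>E j\<close> has lowest weight, and the coefficient of the
  string vanishes just at the Serre power. For k different from i, \<open>F k\<close> passes through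
  all brackets with \<open>E i\<close> and meets \<open>E j\<close>, which gives zero unless k = j
  and \<open>HH j\<close> otherwise; two brackets with \<open>E i\<close> kill
  \<open>HH j\<close>.\<close>

lemma serre_commute:
  assumes i: "i \<in> I" and j: "j \<in> I" "i \<noteq> j" and k: "k \<in> I"
  shows "lbracket L (F k) (adp (nat (1 - ca i j)) (E i) (E j)) = lzero L"
proof -
  have A: "ca i i = 2" "ca i j \<le> 0" "ca i j = 0 \<longleftrightarrow> ca j i = 0"
    using gcm i j unfolding generalized_cartan_matrix_def by blast+
  define m where "m = nat (- ca i j)"
  have n: "nat (1 - ca i j) = Suc m" using A(2) by (simp add: m_def)
  show ?thesis
  proof (cases "k = i")
    case True
    interpret S: sl2_rel K L "E i" "F i" "HH i"
      by unfold_locales (simp_all add: i EF_same HE HF A)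
    show ?thesis unfolding True n
      by (rule S.f_string_top) (use i j A in \<open>simp_all add: FE_diff HE m_def\<close>)
  next
    case ki: False
    have "lbracket L (F k) (adp (Suc m) (E i) (E j)) = adp (Suc m) (E i) (lbracket L (F k) (E j))"
      by (rule commute_power) (use i j k ki in \<open>simp_all add: FE_diff\<close>)
    also have "\<dots> = lzero L"
    proof (cases "k = j")
      case False
      then show ?thesis using i j k by (simp add: FE_diff del: funpow.simps)
    next
      case True
      have EH: "lbracket L (E i) (HH j) = lscale L (- of_int (ca j i)) (E i)"
        using br_anti[of "E i" "HH j"] i j by (simp add: HE scale_scale)
      show ?thesis
      \<comment> \<open>With \<open>ca i j = 0\<close> only one bracket is left. It vanishes because
        the zeros of a generalized Cartan matrix are symmetric.\<close>
      proof (cases "ca i j = 0")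
        case True
        then show ?thesis using \<open>k = j\<close> i j A EH by (simp add: FE_same m_def scale_zero)
      next
        case False
        then obtain m' where "m = Suc m'" using A(2) by (cases m) (auto simp: m_def)
        moreover have "adp 2 (E i) (HH j) = lzero L"
          using i j EH by (simp add: numeral_2_eq_2 br_scale_right br_self)
        ultimately show ?thesis using \<open>k = j\<close> i j adp_mono[of 2 "E i" "HH j" "Suc m"]
          by (simp add: FE_same del: funpow.simps)
      qed
    qed
    finally show ?thesis by (simp add: n)
  qed
qed

end

section \<open>A module of functions on words\<close>

type_synonym 'w op = "('w \<Rightarrow> complex) \<Rightarrow> 'w \<Rightarrow> complex"

text \<open>The operators are complex linear for either choice of the field; the real case restricts
  only the scalars by which they are multiplied.\<close>

definition op_algebra :: "'w op lie_algebra" where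
  "op_algebra = \<lparr> carrier = {A. \<forall>x y a b. A (\<lambda>w. x * a w + y * b w) = (\<lambda>w. x * A a w + y * A b w)},
     lzero = (\<lambda>a w. 0), lplus = (\<lambda>A B a w. A a w + B a w), lscale = (\<lambda>c A a w. c * A a w),
     lbracket = (\<lambda>A B a w. A (B a) w - B (A a) w) \<rparr>"

lemma op_linear: "A \<in> carrier op_algebra \<Longrightarrow> A (\<lambda>w. x * a w + y * b w) = (\<lambda>w. x * A a w + y * A b w)"
  by (simp add: op_algebra_def)

lemma op_simps [simp]:
  "lzero op_algebra = (\<lambda>a w. 0)" "lplus op_algebra A B = (\<lambda>a w. A a w + B a w)"
  "lscale op_algebra c A = (\<lambda>a w. c * A a w)" "lbracket op_algebra A B = (\<lambda>a w. A (B a) w - B (A a) w)"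
  by (simp_all add: op_algebra_def)

lemma op_add:
  assumes "A \<in> carrier op_algebra"
  shows "A (\<lambda>w. a w + b w) = (\<lambda>w. A a w + A b w)" "A (\<lambda>w. a w - b w) = (\<lambda>w. A a w - A b w)"
    "A (\<lambda>w. x * a w) = (\<lambda>w. x * A a w)" "A (\<lambda>w. 0) = (\<lambda>w. 0)" "A (\<lambda>w. - a w) = (\<lambda>w. - A a w)"
  using op_linear[OF assms, of 1 a 1 b] op_linear[OF assms, of 1 a "-1" b] op_linear[OF assms, of x a 0 a]
    op_linear[OF assms, of 0 a 0 a] op_linear[OF assms, of "-1" a 0 a] by simp_all

lemma op_carrierI: "(\<And>x y a b. A (\<lambda>w. x * a w + y * b w) = (\<lambda>w. x * A a w + y * A b w)) \<Longrightarrow> A \<in> carrier op_algebra"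
  by (simp add: op_algebra_def)

lemma lie_alg_op: assumes "K \<in> {\<real>, UNIV}" shows "lie_alg K op_algebra"
proof
  show "K \<in> {\<real>, UNIV}" by fact
  show "lzero op_algebra \<in> carrier op_algebra" by (simp add: op_carrierI)
  fix A B C :: "'w op" and c d :: complex
  assume A: "A \<in> carrier op_algebra"
  show "lscale op_algebra c A \<in> carrier op_algebra"
    by (rule op_carrierI) (simp add: op_linear[OF A] algebra_simps fun_eq_iff)
  show "lbracket op_algebra A A = lzero op_algebra" by (simp add: fun_eq_iff)
  show "lscale op_algebra 1 A = A" by (simp add: fun_eq_iff)
  show "lplus op_algebra A (lscale op_algebra (- 1) A) = lzero op_algebra" by (simp add: fun_eq_iff)
  show "lplus op_algebra A (lzero op_algebra) = A" by (simp add: fun_eq_iff)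
  show "lscale op_algebra c (lscale op_algebra d A) = lscale op_algebra (c * d) A" by (simp add: fun_eq_iff)
  show "lscale op_algebra (c + d) A = lplus op_algebra (lscale op_algebra c A) (lscale op_algebra d A)"
    by (simp add: fun_eq_iff algebra_simps)
  assume B: "B \<in> carrier op_algebra"
  note AB = op_add[OF A] op_add[OF B]
  show "lplus op_algebra A B \<in> carrier op_algebra" "lbracket op_algebra A B \<in> carrier op_algebra"
    by (rule op_carrierI, simp add: op_linear[OF A] op_linear[OF B] algebra_simps fun_eq_iff)+
  show "lplus op_algebra A B = lplus op_algebra B A" by (simp add: fun_eq_iff)
  show "lscale op_algebra c (lplus op_algebra A B) = lplus op_algebra (lscale op_algebra c A) (lscale op_algebra c B)"
    by (simp add: fun_eq_iff algebra_simps)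
  show "lbracket op_algebra (lscale op_algebra c A) B = lscale op_algebra c (lbracket op_algebra A B)"
    "lbracket op_algebra A (lscale op_algebra c B) = lscale op_algebra c (lbracket op_algebra A B)"
    by (simp_all add: AB fun_eq_iff algebra_simps)
  assume C: "C \<in> carrier op_algebra"
  note ABC = AB op_add[OF C]
  show "lplus op_algebra (lplus op_algebra A B) C = lplus op_algebra A (lplus op_algebra B C)" by (simp add: fun_eq_iff)
  show "lbracket op_algebra (lplus op_algebra A B) C = lplus op_algebra (lbracket op_algebra A C) (lbracket op_algebra B C)"
    "lbracket op_algebra A (lplus op_algebra B C) = lplus op_algebra (lbracket op_algebra A B) (lbracket op_algebra A C)"
    by (simp_all add: ABC fun_eq_iff algebra_simps)
  show "lplus op_algebra (lbracket op_algebra A (lbracket op_algebra B C))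
        (lplus op_algebra (lbracket op_algebra B (lbracket op_algebra C A)) (lbracket op_algebra C (lbracket op_algebra A B))) =
       lzero op_algebra"
    by (simp add: ABC fun_eq_iff algebra_simps)
qed

lemma (in lie_alg) weight_power:
  assumes "z \<in> carrier L" "x \<in> carrier L" "v \<in> carrier L" "a \<in> K" "b \<in> K"
    and "lbracket L z x = lscale L a x" "lbracket L z v = lscale L b v"
  shows "lbracket L z (adp n x v) = lscale L (of_nat n * a + b) (adp n x v)"
proof (induction n)
  case (Suc n)
  have "lbracket L z (adp (Suc n) x v) = lplus L (lscale L a (adp (Suc n) x v)) (lscale L (of_nat n * a + b) (adp (Suc n) x v))"
    using assms Suc by (simp add: jacobi_left[of z x] br_scale_left br_scale_right)
  also have "\<dots> = lscale L (of_nat (Suc n) * a + b) (adp (Suc n) x v)"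
    using assms by (simp add: scale_left[symmetric] algebra_simps)
  finally show ?case .
qed (use assms in simp)

context km begin

context
  fixes c :: 'l
begin

text \<open>
  A module on which every \<open>e\<^sub>i\<close> and \<open>f\<^sub>i\<close> can be seen to act nontrivially: functions on words,
  the dual of the Verma module of highest weight \<open>\<langle>c, -\<rangle>\<close> with the roles of \<open>e\<^sub>i\<close> and \<open>f\<^sub>i\<close>
  exchanged by transposition, so \<open>e\<^sub>i\<close> acts as \<open>Fop i\<close> and \<open>f\<^sub>i\<close> as \<open>Eop i\<close>. The Serre elements in the \<open>f\<^sub>i\<close> act as zero; those in the \<open>e\<^sub>i\<close> act as
  zero on the submodule \<open>V0\<close>.
\<close>

definition weight :: "('l \<Rightarrow> int) \<Rightarrow> 'i list \<Rightarrow> complex" where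
  "weight h w = of_int (h c - (\<Sum>k\<leftarrow>w. h (rd_c D k)))"

text \<open>Transpose of the rule e_i f_j = f_j e_i - delta_ij h_i, where a word stands for the
  corresponding product of f's applied to the highest weight vector. \<open>weight h w\<close> is
  the eigenvalue of h on that vector.\<close>

primrec EE :: "'i \<Rightarrow> 'i list \<Rightarrow> ('i list \<Rightarrow> complex) \<Rightarrow> complex" where
  "EE i [] a = 0"
| "EE i (j # w) a = EE i w (\<lambda>w'. a (j # w')) - (if i = j then weight (rd_h D i) w * a w else 0)"

definition Eop :: "'i \<Rightarrow> 'i list op" where "Eop i = (\<lambda>a w. EE i w a)"
definition Fop :: "'i \<Rightarrow> 'i list op" where "Fop i = (\<lambda>a w. a (i # w))"
definition Hop :: "('l \<Rightarrow> int) \<Rightarrow> 'i list op" where "Hop h = (\<lambda>a w. weight h w * a w)"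

lemma EE_linear: "EE i w (\<lambda>w. x * a w + y * b w) = x * EE i w a + y * EE i w b"
  by (induction w arbitrary: a b) (simp_all add: algebra_simps)

lemma op_closed [simp]: "Eop i \<in> carrier op_algebra" "Fop i \<in> carrier op_algebra" "Hop h \<in> carrier op_algebra"
  by (rule op_carrierI, simp add: Eop_def Fop_def Hop_def EE_linear algebra_simps)+

lemma weight_Cons: "weight h (j # w) = weight h w - of_int (h (rd_c D j))"
  by (simp add: weight_def)

text \<open>The sum evaluates its argument at words with one letter i removed, and these have weight
  larger by \<open>h (rd_c D i)\<close>.\<close>

lemma EE_Hop: "EE i w (Hop h a) = (weight h w + of_int (h (rd_c D i))) * EE i w a"
proof (induction w arbitrary: a)
  case (Cons j w)
  have "(\<lambda>w'. Hop h a (j # w')) = (\<lambda>w'. 1 * Hop h (\<lambda>w. a (j # w)) w' + (- of_int (h (rd_c D j))) * a (j # w'))"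
    by (simp add: Hop_def weight_Cons algebra_simps)
  then have key: "EE i w (\<lambda>w'. Hop h a (j # w')) =
      1 * EE i w (Hop h (\<lambda>w. a (j # w))) + (- of_int (h (rd_c D j))) * EE i w (\<lambda>w. a (j # w))"
    by (simp only: EE_linear)
  show ?case
    by (simp only: EE.simps key Cons.IH weight_Cons) (simp add: Hop_def algebra_simps)
qed simp

interpretation O: lie_alg K op_algebra by (rule lie_alg_op[OF K])

lemma FE_op: "lbracket op_algebra (Fop j) (Eop i) = (if i = j then lscale op_algebra (-1) (Hop (rd_h D i)) else lzero op_algebra)"
  by (auto simp: Fop_def Eop_def Hop_def fun_eq_iff)

lemma HF_op: "lbracket op_algebra (Hop h) (Fop j) = lscale op_algebra (of_int (h (rd_c D j))) (Fop j)"
  by (simp add: Hop_def Fop_def weight_Cons fun_eq_iff algebra_simps)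

lemma HE_op: "lbracket op_algebra (Hop h) (Eop i) = lscale op_algebra (- of_int (h (rd_c D i))) (Eop i)"
  by (simp add: Eop_def EE_Hop fun_eq_iff) (simp add: Hop_def algebra_simps)

lemma chev_op: "chevalley_relations K op_algebra I ca Fop Eop (\<lambda>i. Hop (rd_h D i))"
  by unfold_locales (simp_all add: gcm FE_op HF_op HE_op pairing del: op_simps)

interpretation C: chevalley_relations K op_algebra I ca Fop Eop "\<lambda>i. Hop (rd_h D i)" by (rule chev_op)

definition serF :: "'i \<Rightarrow> 'i \<Rightarrow> 'i list op" where
  "serF i j = (lbracket op_algebra (Fop i) ^^ nat (1 - ca i j)) (Fop j)"
definition serE :: "'i \<Rightarrow> 'i \<Rightarrow> 'i list op" where
  "serE i j = (lbracket op_algebra (Eop i) ^^ nat (1 - ca i j)) (Eop j)"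

lemma ser_closed [simp]: "serF i j \<in> carrier op_algebra" "serE i j \<in> carrier op_algebra"
  unfolding serF_def serE_def by (rule O.adp_closed; simp)+

lemma op_bracket_zeroD: "lbracket op_algebra A B = lzero op_algebra \<Longrightarrow> A (B a) = B (A a)"
  by (simp add: fun_eq_iff)

lemma serF_Eop:
  assumes "i \<in> I" "j \<in> I" "i \<noteq> j" "k \<in> I" shows "serF i j (Eop k a) = Eop k (serF i j a)"
  using op_bracket_zeroD[OF C.serre_commute[OF assms]] unfolding serF_def by simp

lemma serE_Fop:
  assumes "i \<in> I" "j \<in> I" "i \<noteq> j" shows "serE i j (Fop k a) = Fop k (serE i j a)"
proof (cases "k \<in> I")
  case True
  show ?thesis
    using op_bracket_zeroD[OF chevalley_relations.serre_commute[OF C.swap assms True]] unfolding serE_def by simp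
next
  case False
  \<comment> \<open>Words may contain letters outside the index set; for such a letter the operator
    commutes with every \<open>Eop l\<close> that occurs.\<close>
  then have "lbracket op_algebra (Fop k) (Eop l) = lzero op_algebra" if "l \<in> I" for l
    using that FE_op[of k l] by (cases "l = k") (simp_all del: op_simps)
  then have "lbracket op_algebra (Fop k) (serE i j) = lzero op_algebra"
    unfolding serE_def using assms
    by (subst C.commute_power) (simp_all only: op_closed O.adp_zero)
  then show ?thesis by (intro op_bracket_zeroD[symmetric])
qed

lemma op_power_invariant:
  assumes "P A" "P B" "\<And>A B. P A \<Longrightarrow> P B \<Longrightarrow> P (lbracket op_algebra A B)"
  shows "P ((lbracket op_algebra A ^^ n) B)"
  using assms by (induction n) (simp_all del: op_simps)

text \<open>Commuting with \<open>Fop k\<close> allows the first letter of the word to be moved into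
  the argument. At the empty word each \<open>Eop\<close> gives zero, hence so does every iterated
  bracket of them.\<close>

lemma serE_zero:
  assumes "i \<in> I" "j \<in> I" "i \<noteq> j" shows "serE i j a = (\<lambda>w. 0)"
proof
  fix w show "serE i j a w = 0"
  proof (induction w arbitrary: a)
    case Nil
    have "\<forall>b. serE i j b [] = 0"
      unfolding serE_def by (rule op_power_invariant[where P = "\<lambda>A. \<forall>b. A b [] = 0"]) (simp_all add: Eop_def)
    then show ?case by blast
  next
    case (Cons k w)
    have "serE i j a (k # w) = Fop k (serE i j a) w" by (simp add: Fop_def)
    also have "\<dots> = 0" using serE_Fop[OF assms, of k a] Cons.IH[of "Fop k a"] by simp
    finally show ?case .
  qed
qed

text \<open>The largest subspace that is stable under \<open>Fop k\<close> for indices k and killed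
  by the Serre elements in these operators: prefixing a word u means applying the corresponding
  operators first.\<close>

definition V0 :: "('i list \<Rightarrow> complex) set" where
  "V0 = {a. \<forall>u\<in>lists I. \<forall>i\<in>I. \<forall>j\<in>I. i \<noteq> j \<longrightarrow> serF i j (\<lambda>w. a (u @ w)) = (\<lambda>w. 0)}"

lemma V0_D: "a \<in> V0 \<Longrightarrow> u \<in> lists I \<Longrightarrow> i \<in> I \<Longrightarrow> j \<in> I \<Longrightarrow> i \<noteq> j \<Longrightarrow> serF i j (\<lambda>w. a (u @ w)) = (\<lambda>w. 0)"
  by (simp add: V0_def)

lemma V0_lin: "a \<in> V0 \<Longrightarrow> b \<in> V0 \<Longrightarrow> (\<lambda>w. x * a w + y * b w) \<in> V0"
  unfolding V0_def by (auto simp: op_linear[OF ser_closed(1)])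

lemma V0_zero: "(\<lambda>w. 0) \<in> V0"
  unfolding V0_def by (auto simp: op_add[OF ser_closed(1)])

lemma V0_ops: "a \<in> V0 \<Longrightarrow> (\<lambda>w. x * a w) \<in> V0" "a \<in> V0 \<Longrightarrow> b \<in> V0 \<Longrightarrow> (\<lambda>w. a w + b w) \<in> V0"
  "a \<in> V0 \<Longrightarrow> b \<in> V0 \<Longrightarrow> (\<lambda>w. a w - b w) \<in> V0"
  using V0_lin[of a a x 0] V0_lin[of a b 1 1] V0_lin[of a b 1 "-1"] by simp_all

lemma V0_Fop: "a \<in> V0 \<Longrightarrow> k \<in> I \<Longrightarrow> Fop k a \<in> V0"
proof -
  assume a: "a \<in> V0" and k: "k \<in> I"
  have "serF i j (\<lambda>w. Fop k a (u @ w)) = (\<lambda>w. 0)" if "u \<in> lists I" "i \<in> I" "j \<in> I" "i \<noteq> j" for u i j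
    using V0_D[OF a, of "k # u" i j] that k by (simp add: Fop_def)
  then show ?thesis by (simp add: V0_def)
qed

lemma V0_Hop: "a \<in> V0 \<Longrightarrow> Hop h a \<in> V0"
proof -
  assume a: "a \<in> V0"
  have "serF i j (\<lambda>w. Hop h a (u @ w)) = (\<lambda>w. 0)" if u: "u \<in> lists I" "i \<in> I" "j \<in> I" "i \<noteq> j" for u i j
  proof -
    let ?b = "\<lambda>w. a (u @ w)"
    \<comment> \<open>A Serre element is an eigenvector of the bracket with \<open>Hop h\<close>, so
      \<open>Hop h\<close> preserves its kernel. The prefix changes \<open>Hop h\<close> by a scalar
      only.\<close>
    have "\<exists>d. lbracket op_algebra (Hop h) (serF i j) = lscale op_algebra d (serF i j)"
      using O.weight_power[OF op_closed(3) op_closed(2) op_closed(2) _ _ HF_op HF_op] unfolding serF_def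
      by (metis O.K_simps(12))
    then obtain d where d: "lbracket op_algebra (Hop h) (serF i j) = lscale op_algebra d (serF i j)" by blast
    have b0: "serF i j ?b = (\<lambda>w. 0)" by (rule V0_D[OF a u])
    have "serF i j (Hop h ?b) = (\<lambda>w. 0)"
      using fun_cong[OF fun_cong[OF d], of ?b] b0 by (simp add: fun_eq_iff Hop_def)
    moreover have "(\<lambda>w. Hop h a (u @ w)) = (\<lambda>w. 1 * Hop h ?b w + (- of_int (\<Sum>k\<leftarrow>u. h (rd_c D k))) * ?b w)"
      by (simp add: Hop_def weight_def fun_eq_iff algebra_simps)
    ultimately show ?thesis by (simp only: op_linear[OF ser_closed(1)] b0) simp
  qed
  then show ?thesis by (simp add: V0_def)
qed

text \<open>Induction on the prefix. Passing \<open>Eop k\<close> over a letter costs a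
  \<open>Hop\<close> term, which stays in \<open>V0\<close>; with the prefix used up, the Serre
  element commutes with \<open>Eop k\<close>.\<close>

lemma V0_Eop:
  assumes a: "a \<in> V0" and k: "k \<in> I" shows "Eop k a \<in> V0"
proof -
  have "serF i j (\<lambda>w. Eop k a (u @ w)) = (\<lambda>w. 0)" if "u \<in> lists I" "i \<in> I" "j \<in> I" "i \<noteq> j" for u i j
    using a that(1)
  proof (induction u arbitrary: a)
    case Nil
    have "serF i j a = (\<lambda>w. 0)" using V0_D[OF Nil(1), of "[]" i j] that by simp
    then show ?case using serF_Eop[of i j k a] that k by (simp add: op_add[OF op_closed(1)])
  next
    case (Cons l u)
    then have l: "l \<in> I" "u \<in> lists I" by auto
    let ?b = "if k = l then Hop (rd_h D k) a else (\<lambda>w. 0)"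
    have b: "?b \<in> V0" using V0_Hop[OF Cons.prems(1)] V0_zero by simp
    have "(\<lambda>w. Eop k a ((l # u) @ w)) = (\<lambda>w. 1 * Eop k (Fop l a) (u @ w) + (-1) * ?b (u @ w))"
      by (auto simp: Eop_def Fop_def Hop_def fun_eq_iff)
    then have "serF i j (\<lambda>w. Eop k a ((l # u) @ w)) =
        (\<lambda>w. 1 * serF i j (\<lambda>w. Eop k (Fop l a) (u @ w)) w + (-1) * serF i j (\<lambda>w. ?b (u @ w)) w)"
      by (simp only: op_linear[OF ser_closed(1)])
    also have "\<dots> = (\<lambda>w. 0)"
      using Cons.IH[OF V0_Fop[OF Cons.prems(1) l(1)] l(2)] V0_D[OF b l(2) that(2,3,4)] by simp
    finally show ?case .
  qed
  then show ?thesis by (simp add: V0_def)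
qed

primrec gen_op :: "('i, 'l) km_gen \<Rightarrow> 'i list op" where
  "gen_op (GenH h) = Hop h" | "gen_op (GenE i) = Fop i" | "gen_op (GenF i) = Eop i"

primrec term_op :: "('i, 'l) km_gen lie_term \<Rightarrow> 'i list op" where
  "term_op (Gen x) = gen_op x"
| "term_op Zero = lzero op_algebra"
| "term_op (Plus s t) = lplus op_algebra (term_op s) (term_op t)"
| "term_op (Scale a t) = lscale op_algebra a (term_op t)"
| "term_op (Bracket s t) = lbracket op_algebra (term_op s) (term_op t)"

lemma term_op_closed: "term_op t \<in> carrier op_algebra"
proof (induction t)
  case (Gen x) then show ?case by (cases x) simp_all
qed (use lie_alg.closed[OF lie_alg_op[of UNIV]] in \<open>simp_all del: op_simps\<close>)

lemma term_op_V0: "t \<in> TT \<Longrightarrow> a \<in> V0 \<Longrightarrow> term_op t a \<in> V0"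
proof (induction arbitrary: a rule: lie_terms.induct)
  case (Gen x)
  then show ?case by (auto simp: km_gens_def V0_Fop V0_Eop V0_Hop)
qed (simp_all add: V0_zero V0_ops)

lemma term_op_power: "term_op ((Bracket s ^^ n) t) = (lbracket op_algebra (term_op s) ^^ n) (term_op t)"
  by (induction n) (simp_all del: op_simps)

lemma term_op_relation:
  assumes "(s, t) \<in> km_relations D" and a: "a \<in> V0"
  shows "term_op s a = term_op t a"
proof -
  have 1: "term_op (Bracket (tE i) (tF i)) = term_op (Scale (-1) (tH (rd_h D i)))" if "i \<in> I" for i
    using FE_op[of i i] by (simp del: op_simps)
  have 2: "term_op (Bracket (tE i) (tF j)) = term_op Zero" if "i \<noteq> j" for i j
    using FE_op[of i j] that by (simp del: op_simps)
  have 3: "term_op (Bracket (tH h) (tE i)) = term_op (Scale (of_int (h (rd_c D i))) (tE i))" for h i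
    using HF_op by (simp del: op_simps)
  have 4: "term_op (Bracket (tH h) (tF i)) = term_op (Scale (- of_int (h (rd_c D i))) (tF i))" for h i
    using HE_op by (simp del: op_simps)
  have 5: "term_op (Bracket (tH h) (tH h')) = term_op Zero" for h h'
    by (simp add: Hop_def fun_eq_iff)
  have 6: "term_op (tH (\<lambda>x. h x + h' x)) = term_op (Plus (tH h) (tH h'))" for h h'
    by (simp add: Hop_def fun_eq_iff weight_def sum_list_addf algebra_simps)
  have 7: "term_op ((Bracket (tE i) ^^ nat (1 - ca i j)) (tE j)) a = term_op Zero a"
    if "i \<in> I" "j \<in> I" "i \<noteq> j" for i j
    using V0_D[OF a, of "[]" i j] that by (simp add: term_op_power serF_def[symmetric] del: op_simps(4))
  have 8: "term_op ((Bracket (tF i) ^^ nat (1 - ca i j)) (tF j)) a = term_op Zero a"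
    if "i \<in> I" "j \<in> I" "i \<noteq> j" for i j
    using serE_zero[of i j a] that by (simp add: term_op_power serE_def[symmetric] del: op_simps(4))
  show ?thesis
    using assms(1) unfolding km_relations_def
    by (elim UnE CollectE exE conjE) (simp_all only: prod.inject 1 2 3 4 5 6 7 8 simp_thms not_False_eq_True)
qed

text \<open>Equal terms act equally on \<open>V0\<close> only, where the Serre relations hold. The
  congruence for brackets composes operators and so relies on the stability of
  \<open>V0\<close>.\<close>

lemma term_op_sound:
  assumes "lie_eq K (km_gens D) (km_relations D) s t" and "a \<in> V0"
  shows "term_op s a = term_op t a"
  using assms
proof (induction arbitrary: a rule: lie_eq.induct)
  case (relation s t)
  then show ?case by (intro term_op_relation)
next
  case (cong_bracket s s' t t')
  have m: "term_op s a \<in> V0" "term_op t a \<in> V0" "term_op s' a \<in> V0" "term_op t' a \<in> V0"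
    using cong_bracket term_op_V0 lie_eq_terms by blast+
  have "term_op s (term_op t a) = term_op s' (term_op t' a)"
    using cong_bracket.IH(1)[OF m(2)] cong_bracket.IH(2)[OF cong_bracket.prems] by simp
  moreover have "term_op t (term_op s a) = term_op t' (term_op s' a)"
    using cong_bracket.IH(2)[OF m(1)] cong_bracket.IH(1)[OF cong_bracket.prems] by simp
  ultimately show ?case by simp
next
  case (bracket_plus_left s t u)
  show ?case by (simp add: op_add[OF term_op_closed] fun_eq_iff algebra_simps)
next
  case (bracket_plus_right s t u)
  show ?case by (simp add: op_add[OF term_op_closed] fun_eq_iff algebra_simps)
next
  case (bracket_scale_left b s t)
  show ?case by (simp add: op_add[OF term_op_closed] fun_eq_iff algebra_simps)
next
  case (bracket_scale_right b s t)
  show ?case by (simp add: op_add[OF term_op_closed] fun_eq_iff algebra_simps)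
next
  case (jacobi s t u)
  show ?case by (simp add: op_add[OF term_op_closed] fun_eq_iff algebra_simps)
qed (simp_all add: algebra_simps)

definition delta :: "'i list \<Rightarrow> complex" where "delta = (\<lambda>w. if w = [] then 1 else 0)"

text \<open>Each \<open>Fop\<close> kills \<open>delta\<close>, hence so do brackets of such
  operators; a nonempty prefix turns \<open>delta\<close> into zero.\<close>

lemma delta_V0: "delta \<in> V0"
proof -
  have "serF i j (\<lambda>w. delta (u @ w)) = (\<lambda>w. 0)" for i j u
  proof (cases u)
    case Nil
    have "serF i j \<in> carrier op_algebra \<and> serF i j delta = (\<lambda>w. 0)"
      unfolding serF_def
    proof (rule op_power_invariant[where P = "\<lambda>A. A \<in> carrier op_algebra \<and> A delta = (\<lambda>w. 0)"])
      fix A B :: "'i list op"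
      assume "A \<in> carrier op_algebra \<and> A delta = (\<lambda>w. 0)" "B \<in> carrier op_algebra \<and> B delta = (\<lambda>w. 0)"
      then show "lbracket op_algebra A B \<in> carrier op_algebra \<and> lbracket op_algebra A B delta = (\<lambda>w. 0)"
        using O.br_closed[of A B] by (auto simp: op_add)
    next
      have "Fop k delta = (\<lambda>w. 0)" for k by (simp add: Fop_def delta_def)
      then show "Fop i \<in> carrier op_algebra \<and> Fop i delta = (\<lambda>w. 0)" "Fop j \<in> carrier op_algebra \<and> Fop j delta = (\<lambda>w. 0)"
        by simp_all
    qed
    then show ?thesis using Nil by simp
  next
    case (Cons k u')
    then show ?thesis by (simp add: delta_def op_add[OF ser_closed(1)])
  qed
  then show ?thesis by (simp add: V0_def)
qed

end

lemma e_f_nonzero: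
  assumes i: "i \<in> I" shows "e i \<noteq> lzero L" "f i \<noteq> lzero L"
proof -
  \<comment> \<open>With c_i as highest weight, the coroot h_i has the value \<open>ca i i\<close>,
    which is 2, on the empty word. \<open>Eop\<close> therefore does not kill \<open>delta\<close>,
    and \<open>Fop i\<close> recovers a nonzero value at the empty word.\<close>
  let ?c = "rd_c D i"
  let ?d = "delta"
  have Ed: "Eop ?c i ?d [i] = -2"
    using i by (simp add: Eop_def weight_def delta_def pairing ca_diag)
  show "f i \<noteq> lzero L"
  proof
    assume "f i = lzero L"
    then have "lie_eq K (km_gens D) (km_relations D) (tF i) Zero"
      using cl_eq_iff[of Zero "tF i"] by (simp add: cl_gens PL_zero lie_terms.intros)
    then have "term_op ?c (tF i) ?d = term_op ?c Zero ?d" using delta_V0 by (rule term_op_sound)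
    then show False using Ed by simp
  qed
  show "e i \<noteq> lzero L"
  proof
    assume "e i = lzero L"
    then have "lie_eq K (km_gens D) (km_relations D) (tE i) Zero"
      using cl_eq_iff[of Zero "tE i"] by (simp add: cl_gens PL_zero lie_terms.intros)
    then have "term_op ?c (tE i) (Eop ?c i ?d) = term_op ?c Zero (Eop ?c i ?d)"
      using V0_Eop[OF delta_V0 i] by (rule term_op_sound)
    then have "Fop i (Eop ?c i ?d) [] = 0" by simp
    then show False using Ed by (simp add: Fop_def)
  qed
qed

end

section \<open>Real root spaces\<close>

context km begin

abbreviation "\<alpha> \<equiv> simple_root"
abbreviation "RS \<equiv> root_space K D"

lemma RS_iff: "v \<in> RS \<gamma> \<longleftrightarrow> (\<exists>t\<in>TT. homogeneous \<gamma> t \<and> v = cl t)"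
  by (auto simp: root_space_def km_class_cl)

lemma RS_carrier: "v \<in> RS \<gamma> \<Longrightarrow> v \<in> carrier L"
  by (auto simp: RS_iff PL_carrier)

lemma RS_gens: "h \<in> dual_lattice \<Longrightarrow> hh h \<in> RS (\<lambda>_. 0)" "i \<in> I \<Longrightarrow> e i \<in> RS (\<alpha> i)" "i \<in> I \<Longrightarrow> f i \<in> RS (\<lambda>j. - \<alpha> i j)"
  by (auto simp: RS_iff cl_gens[symmetric] intro: homogeneous.intros terms)

lemma RS_zero: "lzero L \<in> RS \<gamma>"
  by (auto simp: RS_iff PL_zero intro: homogeneous.intros lie_terms.intros)

lemma RS_plus: "v \<in> RS \<gamma> \<Longrightarrow> w \<in> RS \<gamma> \<Longrightarrow> lplus L v w \<in> RS \<gamma>"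
  unfolding RS_iff by (metis PL_plus homogeneous.intros(5) lie_terms.Plus)

lemma RS_scale: "a \<in> K \<Longrightarrow> v \<in> RS \<gamma> \<Longrightarrow> lscale L a v \<in> RS \<gamma>"
  unfolding RS_iff by (metis PL_scale homogeneous.intros(6) lie_terms.Scale)

lemma RS_bracket: "v \<in> RS \<gamma> \<Longrightarrow> w \<in> RS \<delta> \<Longrightarrow> lbracket L v w \<in> RS (\<lambda>j. \<gamma> j + \<delta> j)"
  by (force simp: RS_iff PL_bracket intro: homogeneous.intros lie_terms.intros)

lemma RS_power: "x \<in> RS \<gamma> \<Longrightarrow> v \<in> RS \<delta> \<Longrightarrow> adp n x v \<in> RS (\<lambda>j. int n * \<gamma> j + \<delta> j)"
proof (induction n)
  case (Suc n)
  then have "adp (Suc n) x v \<in> RS (\<lambda>j. \<gamma> j + (int n * \<gamma> j + \<delta> j))" by (auto intro: RS_bracket)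
  then show ?case by (simp add: algebra_simps)
qed simp

text \<open>The simple reflection without its restriction to the root lattice, so that it can be
  applied to any degree.\<close>

definition refl_map :: "'i \<Rightarrow> ('i \<Rightarrow> int) \<Rightarrow> 'i \<Rightarrow> int" where
  "refl_map i \<gamma> = \<gamma>(i := \<gamma> i - (\<Sum>j\<in>I. ca i j * \<gamma> j))"

lemma refl_map_add: "refl_map i (\<lambda>j. \<gamma> j + \<delta> j) = (\<lambda>j. refl_map i \<gamma> j + refl_map i \<delta> j)"
  by (auto simp: refl_map_def fun_eq_iff sum.distrib algebra_simps)

lemma refl_map_zero: "refl_map i (\<lambda>_. 0) = (\<lambda>_. 0)"
  by (auto simp: refl_map_def)

lemma refl_map_minus: "refl_map i (\<lambda>j. - \<gamma> j) = (\<lambda>j. - refl_map i \<gamma> j)"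
  by (auto simp: refl_map_def fun_eq_iff sum_negf)

lemma sum_simple_root: "j \<in> I \<Longrightarrow> (\<Sum>k\<in>I. a k * \<alpha> j k) = a j"
  using finite_I by (simp add: simple_root_def if_distrib cong: if_cong)

lemma refl_map_simple: "j \<in> I \<Longrightarrow> refl_map i (\<alpha> j) = (\<lambda>k. - ca i j * \<alpha> i k + \<alpha> j k)"
  by (auto simp: refl_map_def fun_eq_iff sum_simple_root) (auto simp: simple_root_def)

lemma refl_map_involution:
  assumes "i \<in> I" shows "refl_map i (refl_map i \<gamma>) = \<gamma>"
proof -
  let ?s = "\<Sum>j\<in>I. ca i j * \<gamma> j"
  have "(\<Sum>j\<in>I. ca i j * refl_map i \<gamma> j) = (\<Sum>j\<in>I. ca i j * \<gamma> j - (if j = i then ca i i * ?s else 0))"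
    by (rule sum.cong) (auto simp: refl_map_def algebra_simps)
  also have "\<dots> = - ?s" using assms finite_I by (simp add: sum_subtractf ca_diag)
  finally have "(\<Sum>j\<in>I. ca i j * refl_map i \<gamma> j) = - ?s" .
  then show ?thesis by (auto simp: refl_map_def[of i "refl_map i \<gamma>"]) (auto simp: refl_map_def fun_eq_iff)
qed

lemma WW_aut: "i \<in> I \<Longrightarrow> t \<in> K \<Longrightarrow> WW i t \<in> lie_auts K L"
  by (rule sl2_triple.W_aut[OF sl2])

text \<open>An automorphism respects sums, multiples and brackets, and reflections are additive.
  Only generators need work: there the value is an iterated bracket of degree s_i(\<alpha>_j), or of
  the opposite degree.\<close>

lemma WW_RS_term:
  assumes i: "i \<in> I" and t: "t \<in> K" "t \<noteq> 0"
  shows "homogeneous \<gamma> s \<Longrightarrow> s \<in> TT \<Longrightarrow> WW i t (cl s) \<in> RS (refl_map i \<gamma>)"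
proof (induction rule: homogeneous.induct)
  have W: "WW i t \<in> lie_auts K L" by (rule WW_aut[OF i t(1)])
  {
    case (1 h)
    then have h: "h \<in> dual_lattice" by (auto elim: lie_terms.cases simp: km_gens_def)
    have "WW i t (hh h) \<in> RS (\<lambda>_. 0)"
      unfolding WW_hh[OF i t h] using i hi_dual[OF i] h by (intro RS_plus RS_scale RS_gens) simp_all
    then show ?case by (simp add: cl_gens refl_map_zero)
  next
    case (2 j)
    then have j: "j \<in> I" by (auto elim: lie_terms.cases simp: km_gens_def)
    show ?case
    proof (cases "i = j")
      case True
      have "refl_map i (\<alpha> i) = (\<lambda>k. - \<alpha> i k)" using i by (simp add: refl_map_simple ca_diag)
      then show ?thesis using True sl2_triple.W_e[OF sl2[OF i] t] i t RS_gens(3)[OF i]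
        by (simp add: cl_gens RS_scale)
    next
      case False
      have "adp (nat (- ca i j)) (e i) (e j) \<in> RS (\<lambda>k. int (nat (- ca i j)) * \<alpha> i k + \<alpha> j k)"
        by (rule RS_power) (use i j RS_gens in auto)
      then have "adp (nat (- ca i j)) (e i) (e j) \<in> RS (refl_map i (\<alpha> j))"
        using ca_off[OF i j False] j by (simp add: refl_map_simple)
      then show ?thesis using WW_e[OF i j False t] t by (simp add: cl_gens RS_scale)
    qed
  next
    case (3 j)
    then have j: "j \<in> I" by (auto elim: lie_terms.cases simp: km_gens_def)
    show ?case
    proof (cases "i = j")
      case True
      have "refl_map i (\<lambda>k. - \<alpha> i k) = \<alpha> i" using i by (simp add: refl_map_minus refl_map_simple ca_diag)
      then show ?thesis using True sl2_triple.W_f[OF sl2[OF i] t] i t RS_gens(2)[OF i]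
        by (simp add: cl_gens RS_scale)
    next
      case False
      have "adp (nat (- ca i j)) (f i) (f j) \<in> RS (\<lambda>k. int (nat (- ca i j)) * - \<alpha> i k + - \<alpha> j k)"
        by (rule RS_power) (use i j RS_gens in auto)
      then have "adp (nat (- ca i j)) (f i) (f j) \<in> RS (refl_map i (\<lambda>k. - \<alpha> j k))"
        using ca_off[OF i j False] j by (simp add: refl_map_simple refl_map_minus)
      then show ?thesis using WW_f[OF i j False t] t by (simp add: cl_gens RS_scale)
    qed
  next
    case (4 \<gamma>)
    show ?case using aut_zero[OF W] RS_zero by (simp add: PL_zero)
  next
    case (5 \<gamma> s u)
    then have su: "s \<in> TT" "u \<in> TT" by (auto elim: lie_terms.cases)
    then have "WW i t (cl (Plus s u)) = lplus L (WW i t (cl s)) (WW i t (cl u))"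
      using aut_plus[OF W, of "cl s" "cl u"] by (simp add: PL_plus PL_carrier)
    then show ?case using 5 su RS_plus by simp
  next
    case (6 \<gamma> u a)
    then have u: "a \<in> K" "u \<in> TT" by (auto elim: lie_terms.cases)
    then have "WW i t (cl (Scale a u)) = lscale L a (WW i t (cl u))"
      using aut_scale[OF W, of a "cl u"] by (simp add: PL_scale PL_carrier)
    then show ?case using 6 u RS_scale by simp
  next
    case (7 \<gamma> s \<delta> u)
    then have su: "s \<in> TT" "u \<in> TT" by (auto elim: lie_terms.cases)
    then have "WW i t (cl (Bracket s u)) = lbracket L (WW i t (cl s)) (WW i t (cl u))"
      using aut_br[OF W, of "cl s" "cl u"] by (simp add: PL_bracket PL_carrier)
    then show ?case using 7 su RS_bracket by (simp add: refl_map_add)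
  }
qed

lemma WW_RS: "i \<in> I \<Longrightarrow> t \<in> K \<Longrightarrow> t \<noteq> 0 \<Longrightarrow> v \<in> RS \<gamma> \<Longrightarrow> WW i t v \<in> RS (refl_map i \<gamma>)"
  using WW_RS_term by (auto simp: RS_iff[of v])

lemma WW_RS_image:
  assumes i: "i \<in> I" shows "WW i 1 ` RS \<gamma> = RS (refl_map i \<gamma>)"
proof
  show "WW i 1 ` RS \<gamma> \<subseteq> RS (refl_map i \<gamma>)" using WW_RS[OF i, of 1] by auto
  show "RS (refl_map i \<gamma>) \<subseteq> WW i 1 ` RS \<gamma>"
  proof
    fix v assume v: "v \<in> RS (refl_map i \<gamma>)"
    have "WW i (-1) v \<in> RS \<gamma>" using WW_RS[OF i _ _ v, of "-1"] i by (simp add: refl_map_involution)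
    moreover have "v = WW i 1 (WW i (-1) v)"
      using sl2_triple.W_minus[OF sl2[OF i], of 1 v] RS_carrier[OF v] by simp
    ultimately show "v \<in> WW i 1 ` RS \<gamma>" by blast
  qed
qed

subsection \<open>The root spaces of the simple roots\<close>

text \<open>The span of the nested brackets [g_i, [g_j, ...]] together with their degrees. The sign
  s lets one definition serve both the positive and the negative half.\<close>

inductive half :: "('i \<Rightarrow> ('i, 'l) km_elt) \<Rightarrow> int \<Rightarrow> ('i \<Rightarrow> int) \<Rightarrow> ('i, 'l) km_elt \<Rightarrow> bool" for g s where
  "i \<in> I \<Longrightarrow> half g s (\<lambda>j. s * \<alpha> i j) (g i)"
| "i \<in> I \<Longrightarrow> half g s \<gamma> v \<Longrightarrow> half g s (\<lambda>j. s * \<alpha> i j + \<gamma> j) (lbracket L (g i) v)"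
| "half g s \<gamma> (lzero L)"
| "half g s \<gamma> v \<Longrightarrow> half g s \<gamma> w \<Longrightarrow> half g s \<gamma> (lplus L v w)"
| "a \<in> K \<Longrightarrow> half g s \<gamma> v \<Longrightarrow> half g s \<gamma> (lscale L a v)"

inductive borel_part :: "('i \<Rightarrow> ('i, 'l) km_elt) \<Rightarrow> int \<Rightarrow> ('i \<Rightarrow> int) \<Rightarrow> ('i, 'l) km_elt \<Rightarrow> bool" for g s where
  "half g s \<gamma> v \<Longrightarrow> borel_part g s \<gamma> v"
| "h \<in> dual_lattice \<Longrightarrow> borel_part g s (\<lambda>_. 0) (hh h)"
| "borel_part g s \<gamma> v \<Longrightarrow> borel_part g s \<gamma> w \<Longrightarrow> borel_part g s \<gamma> (lplus L v w)"
| "a \<in> K \<Longrightarrow> borel_part g s \<gamma> v \<Longrightarrow> borel_part g s \<gamma> (lscale L a v)"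

definition opposite :: "('i \<Rightarrow> ('i, 'l) km_elt) \<Rightarrow> int \<Rightarrow> ('i \<Rightarrow> ('i, 'l) km_elt) \<Rightarrow> bool" where
  "opposite g s g' \<longleftrightarrow> g = chev_e K D \<and> s = 1 \<and> g' = chev_f K D \<or> g = chev_f K D \<and> s = -1 \<and> g' = chev_e K D"

lemma opposite_facts:
  assumes "opposite g s g'"
  shows "i \<in> I \<Longrightarrow> g i \<in> carrier L" "i \<in> I \<Longrightarrow> g' i \<in> carrier L"
    "i \<in> I \<Longrightarrow> h \<in> dual_lattice \<Longrightarrow> lbracket L (hh h) (g i) = lscale L (of_int (s * h (rd_c D i))) (g i)"
    "i \<in> I \<Longrightarrow> h \<in> dual_lattice \<Longrightarrow> lbracket L (g i) (hh h) = lscale L (- of_int (s * h (rd_c D i))) (g i)"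
    "i \<in> I \<Longrightarrow> j \<in> I \<Longrightarrow> i \<noteq> j \<Longrightarrow> lbracket L (g' i) (g j) = lzero L"
    "i \<in> I \<Longrightarrow> lbracket L (g' i) (g i) = lscale L (of_int s) (hi i)"
  using assms unfolding opposite_def
  by (auto simp: hh_e hh_f e_hh f_hh e_f_diff f_e_diff e_f_same f_e_same scale_one hi_dual)

lemma half_carrier: "half g s \<gamma> v \<Longrightarrow> (\<And>i. i \<in> I \<Longrightarrow> g i \<in> carrier L) \<Longrightarrow> v \<in> carrier L"
  by (induction rule: half.induct) auto

lemma borel_carrier: "borel_part g s \<gamma> v \<Longrightarrow> (\<And>i. i \<in> I \<Longrightarrow> g i \<in> carrier L) \<Longrightarrow> v \<in> carrier L"
  by (induction rule: borel_part.induct) (auto intro: half_carrier)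

lemma borel_zero: "borel_part g s \<gamma> (lzero L)"
  by (intro borel_part.intros half.intros)

lemma half_hh:
  assumes op: "opposite g s g'" and h: "h \<in> dual_lattice"
  shows "half g s \<gamma> v \<Longrightarrow> half g s \<gamma> (lbracket L (hh h) v)"
proof (induction rule: half.induct)
  case (1 i)
  then show ?case using opposite_facts(3)[OF op 1 h] by (auto intro!: half.intros)
next
  case (2 i \<gamma> v)
  have v: "v \<in> carrier L" "g i \<in> carrier L" using half_carrier[OF 2(2)] opposite_facts(1)[OF op] 2 by auto
  have "lbracket L (hh h) (lbracket L (g i) v) =
      lplus L (lscale L (of_int (s * h (rd_c D i))) (lbracket L (g i) v)) (lbracket L (g i) (lbracket L (hh h) v))"
    using jacobi_left[of "hh h" "g i" v] v h 2 opposite_facts(3)[OF op 2(1) h] by (simp add: br_scale_left)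
  moreover have "half g s (\<lambda>j. s * \<alpha> i j + \<gamma> j) \<dots>"
    using 2 by (intro half.intros) auto
  ultimately show ?case by simp
next
  case (4 \<gamma> v w)
  have "v \<in> carrier L" "w \<in> carrier L" using half_carrier 4 opposite_facts(1)[OF op] by blast+
  then show ?case using 4 h by (auto simp: br_plus_right intro: half.intros)
next
  case (5 a \<gamma> v)
  have "v \<in> carrier L" using half_carrier 5 opposite_facts(1)[OF op] by blast
  then show ?case using 5 h by (auto simp: br_scale_right intro: half.intros)
qed (use h in \<open>auto intro: half.intros\<close>)

lemma borel_gen:
  assumes op: "opposite g s g'" and i: "i \<in> I"
  shows "borel_part g s \<gamma> v \<Longrightarrow> borel_part g s (\<lambda>j. s * \<alpha> i j + \<gamma> j) (lbracket L (g i) v)"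
proof (induction rule: borel_part.induct)
  case (1 \<gamma> v)
  then show ?case using i by (intro borel_part.intros half.intros)
next
  case (2 h)
  then show ?case using opposite_facts(4)[OF op i 2] half.intros(1)[OF i, of g s] K_simps(4,12)
    by (auto intro!: borel_part.intros half.intros(5))
next
  case (3 \<gamma> v w)
  have "v \<in> carrier L" "w \<in> carrier L" using borel_carrier 3 opposite_facts(1)[OF op] by blast+
  then show ?case using 3 i opposite_facts(1)[OF op i] by (auto simp: br_plus_right intro: borel_part.intros)
next
  case (4 a \<gamma> v)
  have "v \<in> carrier L" using borel_carrier 4 opposite_facts(1)[OF op] by blast
  then show ?case using 4 i opposite_facts(1)[OF op i] by (auto simp: br_scale_right intro: borel_part.intros)
qed

text \<open>By the Jacobi identity the opposite generator moves inwards through a nested bracket.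
  Each letter of the same index leaves a Cartan element, which acts on the rest; at the innermost
  letter the Cartan element itself remains, so the result may leave the half.\<close>

lemma half_opposite:
  assumes op: "opposite g s g'" and i: "i \<in> I"
  shows "half g s \<gamma> v \<Longrightarrow> borel_part g s (\<lambda>j. - s * \<alpha> i j + \<gamma> j) (lbracket L (g' i) v)"
proof (induction rule: half.induct)
  case (1 j)
  show ?case
  proof (cases "i = j")
    case True
    have "borel_part g s (\<lambda>_. 0) (lscale L (of_int s) (hi i))"
      using hi_dual[OF i] by (intro borel_part.intros) auto
    then show ?thesis using True opposite_facts(6)[OF op i] by simp
  next
    case False
    then show ?thesis using opposite_facts(5)[OF op i 1 False] by (simp add: borel_zero)
  qed
next
  case (2 j \<gamma> v)
  have v: "v \<in> carrier L" "g j \<in> carrier L" "g' i \<in> carrier L"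
    using half_carrier[OF 2(2)] opposite_facts(1,2)[OF op] 2 i by auto
  have J: "lbracket L (g' i) (lbracket L (g j) v) = lplus L (lbracket L (lbracket L (g' i) (g j)) v) (lbracket L (g j) (lbracket L (g' i) v))"
    using v by (intro jacobi_left)
  have "borel_part g s (\<lambda>k. s * \<alpha> j k + (- s * \<alpha> i k + \<gamma> k)) (lbracket L (g j) (lbracket L (g' i) v))"
    by (rule borel_gen[OF op 2(1) 2(3)])
  then have B2: "borel_part g s (\<lambda>k. - s * \<alpha> i k + (s * \<alpha> j k + \<gamma> k)) (lbracket L (g j) (lbracket L (g' i) v))"
    by (simp add: algebra_simps)
  have B1: "borel_part g s (\<lambda>k. - s * \<alpha> i k + (s * \<alpha> j k + \<gamma> k)) (lbracket L (lbracket L (g' i) (g j)) v)"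
  proof (cases "i = j")
    case True
    have "lbracket L (lbracket L (g' i) (g j)) v = lscale L (of_int s) (lbracket L (hi i) v)"
      using True opposite_facts(6)[OF op i] v hi_dual[OF i] by (simp add: br_scale_left)
    moreover have "borel_part g s \<gamma> (lscale L (of_int s) (lbracket L (hi i) v))"
      using half_hh[OF op hi_dual[OF i] 2(2)] by (intro borel_part.intros) auto
    ultimately show ?thesis using True by simp
  next
    case False
    then show ?thesis using opposite_facts(5)[OF op i 2(1) False] v by (simp add: borel_zero)
  qed
  show ?case unfolding J by (rule borel_part.intros(3)[OF B1 B2])
next
  case (3 \<gamma>)
  then show ?case using opposite_facts(2)[OF op i] by (simp add: borel_zero)
next
  case (4 \<gamma> v w)
  have "v \<in> carrier L" "w \<in> carrier L" using half_carrier 4 opposite_facts(1)[OF op] by blast+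
  then show ?case using 4 i opposite_facts(2)[OF op i] by (auto simp: br_plus_right intro: borel_part.intros)
next
  case (5 a \<gamma> v)
  have "v \<in> carrier L" using half_carrier 5 opposite_facts(1)[OF op] by blast
  then show ?case using 5 i opposite_facts(2)[OF op i] by (auto simp: br_scale_right intro: borel_part.intros)
qed

text \<open>Negative half plus Cartan subalgebra plus positive half, degree by degree.\<close>

inductive tri :: "('i \<Rightarrow> int) \<Rightarrow> ('i, 'l) km_elt \<Rightarrow> bool" where
  "borel_part (chev_e K D) 1 \<gamma> v \<Longrightarrow> tri \<gamma> v"
| "borel_part (chev_f K D) (-1) \<gamma> v \<Longrightarrow> tri \<gamma> v"
| "tri \<gamma> v \<Longrightarrow> tri \<gamma> w \<Longrightarrow> tri \<gamma> (lplus L v w)"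
| "a \<in> K \<Longrightarrow> tri \<gamma> v \<Longrightarrow> tri \<gamma> (lscale L a v)"

lemma opposites: "opposite (chev_e K D) 1 (chev_f K D)" "opposite (chev_f K D) (-1) (chev_e K D)"
  by (auto simp: opposite_def)

lemma tri_carrier: "tri \<gamma> v \<Longrightarrow> v \<in> carrier L"
  by (induction rule: tri.induct) (auto intro: borel_carrier)

lemma borel_opposite:
  assumes op: "opposite g s g'" and i: "i \<in> I" and T: "\<And>\<gamma> v. borel_part g s \<gamma> v \<Longrightarrow> tri \<gamma> v"
    and T': "tri (\<lambda>j. - s * \<alpha> i j) (g' i)"
  shows "borel_part g s \<gamma> v \<Longrightarrow> tri (\<lambda>j. - s * \<alpha> i j + \<gamma> j) (lbracket L (g' i) v)"
proof (induction rule: borel_part.induct)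
  case (1 \<gamma> v)
  then show ?case by (intro T half_opposite[OF op i])
next
  case (2 h)
  have "opposite g' (- s) g" using op by (auto simp: opposite_def)
  then have "lbracket L (g' i) (hh h) = lscale L (- of_int (- s * h (rd_c D i))) (g' i)"
    using i 2 by (rule opposite_facts(4))
  then show ?case using tri.intros(4)[OF _ T', of "- of_int (- s * h (rd_c D i))"] by simp
next
  case (3 \<gamma> v w)
  have "v \<in> carrier L" "w \<in> carrier L" using borel_carrier 3 opposite_facts(1)[OF op] by blast+
  then show ?case using 3 i opposite_facts(2)[OF op i] by (auto simp: br_plus_right intro: tri.intros)
next
  case (4 a \<gamma> v)
  have "v \<in> carrier L" using borel_carrier 4 opposite_facts(1)[OF op] by blast
  then show ?case using 4 i opposite_facts(2)[OF op i] by (auto simp: br_scale_right intro: tri.intros)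
qed

lemma tri_e: assumes i: "i \<in> I" shows "tri (\<alpha> i) (e i)"
  using half.intros(1)[OF i, of "chev_e K D" 1] by (intro tri.intros borel_part.intros) simp

lemma tri_f: assumes i: "i \<in> I" shows "tri (\<lambda>j. - \<alpha> i j) (f i)"
  using half.intros(1)[OF i, of "chev_f K D" "-1"] by (intro tri.intros(2) borel_part.intros) simp

lemma tri_bracket_e:
  assumes i: "i \<in> I" shows "tri \<gamma> v \<Longrightarrow> tri (\<lambda>j. \<alpha> i j + \<gamma> j) (lbracket L (e i) v)"
proof (induction rule: tri.induct)
  case (1 \<gamma> v)
  then show ?case using borel_gen[OF opposites(1) i 1] by (intro tri.intros(1)) simp
next
  case (2 \<gamma> v)
  show ?case using borel_opposite[OF opposites(2) i tri.intros(2) _ 2] tri_e[OF i] by simp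
next
  case (3 \<gamma> v w)
  then show ?case using i tri_carrier by (auto simp: br_plus_right intro: tri.intros)
next
  case (4 a \<gamma> v)
  then show ?case using i tri_carrier by (auto simp: br_scale_right intro: tri.intros)
qed

lemma tri_bracket_f:
  assumes i: "i \<in> I" shows "tri \<gamma> v \<Longrightarrow> tri (\<lambda>j. - \<alpha> i j + \<gamma> j) (lbracket L (f i) v)"
proof (induction rule: tri.induct)
  case (2 \<gamma> v)
  then show ?case using borel_gen[OF opposites(2) i 2] by (intro tri.intros(2)) simp
next
  case (1 \<gamma> v)
  show ?case using borel_opposite[OF opposites(1) i tri.intros(1) _ 1] tri_f[OF i] by simp
next
  case (3 \<gamma> v w)
  then show ?case using i tri_carrier by (auto simp: br_plus_right intro: tri.intros)
next
  case (4 a \<gamma> v)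
  then show ?case using i tri_carrier by (auto simp: br_scale_right intro: tri.intros)
qed

lemma borel_hh:
  assumes op: "opposite g s g'" and h: "h \<in> dual_lattice"
  shows "borel_part g s \<gamma> v \<Longrightarrow> borel_part g s \<gamma> (lbracket L (hh h) v)"
proof (induction rule: borel_part.induct)
  case (1 \<gamma> v)
  then show ?case by (intro borel_part.intros half_hh[OF op h])
next
  case (2 h')
  then show ?case using h by (simp add: hh_hh borel_zero)
next
  case (3 \<gamma> v w)
  have "v \<in> carrier L" "w \<in> carrier L" using borel_carrier 3 opposite_facts(1)[OF op] by blast+
  then show ?case using 3 h by (auto simp: br_plus_right intro: borel_part.intros)
next
  case (4 a \<gamma> v)
  have "v \<in> carrier L" using borel_carrier 4 opposite_facts(1)[OF op] by blast
  then show ?case using 4 h by (auto simp: br_scale_right intro: borel_part.intros)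
qed

lemma tri_bracket_hh:
  assumes h: "h \<in> dual_lattice" shows "tri \<gamma> v \<Longrightarrow> tri \<gamma> (lbracket L (hh h) v)"
proof (induction rule: tri.induct)
  case (3 \<gamma> v w)
  then show ?case using h tri_carrier by (auto simp: br_plus_right intro: tri.intros)
next
  case (4 a \<gamma> v)
  then show ?case using h tri_carrier by (auto simp: br_scale_right intro: tri.intros)
qed (use borel_hh[OF opposites(1) h] borel_hh[OF opposites(2) h] in \<open>auto intro: tri.intros\<close>)

text \<open>The triangular decomposition. Stability of \<open>tri\<close> under brackets with a
  given term is carried along because the case of a bracket needs it: the adjoint action of a
  bracket is a commutator.\<close>

lemma homogeneous_tri:
  assumes "homogeneous \<gamma> t" "t \<in> TT"
  shows "tri \<gamma> (cl t) \<and> (\<forall>\<delta> w. tri \<delta> w \<longrightarrow> tri (\<lambda>j. \<gamma> j + \<delta> j) (lbracket L (cl t) w))"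
  using assms
proof (induction rule: homogeneous.induct)
  case (1 h)
  then have h: "h \<in> dual_lattice" by (auto elim: lie_terms.cases simp: km_gens_def)
  show ?case by (simp add: cl_gens tri.intros(1)[OF borel_part.intros(2)[OF h]] tri_bracket_hh[OF h])
next
  case (2 j)
  then have j: "j \<in> I" by (auto elim: lie_terms.cases simp: km_gens_def)
  then show ?case by (simp add: cl_gens tri_e tri_bracket_e)
next
  case (3 j)
  then have j: "j \<in> I" by (auto elim: lie_terms.cases simp: km_gens_def)
  then show ?case using tri_f[OF j] tri_bracket_f[OF j] by (simp add: cl_gens)
next
  case (4 \<gamma>)
  show ?case using tri_carrier by (auto simp: PL_zero[symmetric] intro!: tri.intros(1) borel_zero)
next
  case (5 \<gamma> s u)
  then have su: "s \<in> TT" "u \<in> TT" by (auto elim: lie_terms.cases)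
  then have c: "cl s \<in> carrier L" "cl u \<in> carrier L" by (auto simp: PL_carrier)
  show ?case using 5 su c tri_carrier by (auto simp: PL_plus[symmetric] br_plus_left intro!: tri.intros(3))
next
  case (6 \<gamma> u a)
  then have u: "a \<in> K" "u \<in> TT" by (auto elim: lie_terms.cases)
  then have c: "cl u \<in> carrier L" by (auto simp: PL_carrier)
  show ?case using 6 u c tri_carrier by (auto simp: PL_scale[symmetric] br_scale_left intro!: tri.intros(4))
next
  case (7 \<gamma> s \<delta> u)
  then have su: "s \<in> TT" "u \<in> TT" by (auto elim: lie_terms.cases)
  then have c: "cl s \<in> carrier L" "cl u \<in> carrier L" by (auto simp: PL_carrier)
  have s: "tri \<gamma> (cl s)" "\<And>\<epsilon> w. tri \<epsilon> w \<Longrightarrow> tri (\<lambda>j. \<gamma> j + \<epsilon> j) (lbracket L (cl s) w)"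
    and u: "tri \<delta> (cl u)" "\<And>\<epsilon> w. tri \<epsilon> w \<Longrightarrow> tri (\<lambda>j. \<delta> j + \<epsilon> j) (lbracket L (cl u) w)"
    using 7 su by blast+
  have "tri (\<lambda>j. \<gamma> j + \<delta> j + \<epsilon> j) (lbracket L (lbracket L (cl s) (cl u)) w)" if w: "tri \<epsilon> w" for \<epsilon> w
  proof -
    have wc: "w \<in> carrier L" using tri_carrier[OF w] .
    have eq: "lbracket L (lbracket L (cl s) (cl u)) w =
        lplus L (lbracket L (cl s) (lbracket L (cl u) w)) (lscale L (-1) (lbracket L (cl u) (lbracket L (cl s) w)))"
    proof (rule eqI_dual)
      fix \<xi> assume \<xi>: "\<xi> \<in> dual"
      show "\<xi> (lbracket L (lbracket L (cl s) (cl u)) w) =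
        \<xi> (lplus L (lbracket L (cl s) (lbracket L (cl u) w)) (lscale L (-1) (lbracket L (cl u) (lbracket L (cl s) w))))"
        using dual_jacobi[OF \<xi> c wc] c wc by (simp add: dual_simps[OF \<xi>])
    qed (use c wc in auto)
    have "tri (\<lambda>j. \<gamma> j + (\<delta> j + \<epsilon> j)) (lbracket L (cl s) (lbracket L (cl u) w))"
      "tri (\<lambda>j. \<delta> j + (\<gamma> j + \<epsilon> j)) (lbracket L (cl u) (lbracket L (cl s) w))" using s u w by blast+
    then show ?thesis unfolding eq by (intro tri.intros(3,4)) (simp_all add: algebra_simps)
  qed
  then show ?case using s(2)[OF u(1)] su by (simp add: PL_bracket[symmetric])
qed

section \<open>Heights and the simple root spaces\<close>

definition height :: "('i \<Rightarrow> int) \<Rightarrow> int" where "height \<gamma> = (\<Sum>j\<in>I. \<gamma> j)"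

lemma height_simple: "i \<in> I \<Longrightarrow> height (\<alpha> i) = 1"
  using sum_simple_root[of i "\<lambda>_. 1"] by (simp add: height_def)

lemma height_add: "height (\<lambda>j. \<gamma> j + \<delta> j) = height \<gamma> + height \<delta>" "height (\<lambda>j. - \<gamma> j) = - height \<gamma>"
  by (simp_all add: height_def sum.distrib sum_negf)

lemma simple_root_inject: "\<alpha> i = \<alpha> j \<longleftrightarrow> i = j"
  by (metis simple_root_def zero_neq_one)

text \<open>A bracket with a generator raises the height by one, so height one is reached by
  generators alone. The statement on heights up to 0 is what rules out longer brackets in the
  induction.\<close>

lemma half_e_simple:
  "half (chev_e K D) 1 \<gamma> v \<Longrightarrow> (\<forall>i\<in>I. \<gamma> = \<alpha> i \<longrightarrow> (\<exists>a\<in>K. v = lscale L a (e i))) \<and> (height \<gamma> \<le> 0 \<longrightarrow> v = lzero L)"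
proof (induction rule: half.induct)
  case (1 i)
  then show ?case
    by (auto simp: height_simple simple_root_inject eta_contract_eq intro!: bexI[of _ 1] simp: scale_one)
next
  case (2 i \<gamma> v)
  have *: "lbracket L (e i) v = lzero L" if "height \<gamma> \<le> 0" using 2 that by simp
  have h: "height (\<lambda>j. 1 * \<alpha> i j + \<gamma> j) = 1 + height \<gamma>" using 2 by (simp add: height_add height_simple eta_contract_eq)
  show ?case
  proof (intro conjI ballI impI)
    fix k assume k: "k \<in> I" "(\<lambda>j. 1 * \<alpha> i j + \<gamma> j) = \<alpha> k"
    then have "height \<gamma> \<le> 0" using h height_simple[OF k(1)] by simp
    then show "\<exists>a\<in>K. lbracket L (e i) v = lscale L a (e k)"
      using * k by (intro bexI[of _ 0]) (auto simp: scale_zero)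
  next
    assume "height (\<lambda>j. 1 * \<alpha> i j + \<gamma> j) \<le> 0"
    then show "lbracket L (e i) v = lzero L" using h * by simp
  qed
next
  case (3 \<gamma>)
  show ?case by (auto intro!: bexI[of _ 0] simp: scale_zero)
next
  case (4 \<gamma> v w)
  show ?case
  proof (intro conjI ballI impI)
    fix i assume i: "i \<in> I" "\<gamma> = \<alpha> i"
    then obtain a b where "a \<in> K" "v = lscale L a (e i)" "b \<in> K" "w = lscale L b (e i)" using 4 by blast
    then show "\<exists>a\<in>K. lplus L v w = lscale L a (e i)" using i
      by (intro bexI[of _ "a + b"]) (auto simp: scale_left)
  next
    assume "height \<gamma> \<le> 0" then show "lplus L v w = lzero L" using 4 by (simp add: plus_zero)
  qed
next
  case (5 a \<gamma> v)
  show ?case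
  proof (intro conjI ballI impI)
    fix i assume i: "i \<in> I" "\<gamma> = \<alpha> i"
    then obtain b where "b \<in> K" "v = lscale L b (e i)" using 5 by blast
    then show "\<exists>b\<in>K. lscale L a v = lscale L b (e i)" using i 5
      by (intro bexI[of _ "a * b"]) (auto simp: scale_scale)
  next
    assume "height \<gamma> \<le> 0" then show "lscale L a v = lzero L" using 5 by simp
  qed
qed

lemma half_f_height: "half (chev_f K D) (-1) \<gamma> v \<Longrightarrow> height \<gamma> \<ge> 0 \<longrightarrow> v = lzero L"
proof (induction rule: half.induct)
  case (1 i)
  then show ?case using height_add(2)[of "\<alpha> i"] by (simp add: height_simple)
next
  case (2 i \<gamma> v)
  then show ?case using height_add(1)[of "\<lambda>j. - \<alpha> i j" \<gamma>] height_add(2)[of "\<alpha> i"] by (auto simp: height_simple)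
qed (auto simp: plus_zero)

text \<open>The degree \<alpha>_i has height one. It is therefore missed by the Cartan part, of
  degree zero, and by the negative half, which vanishes in degrees of nonnegative height.\<close>

lemma tri_simple: "tri \<gamma> v \<Longrightarrow> i \<in> I \<Longrightarrow> \<gamma> = \<alpha> i \<Longrightarrow> \<exists>a\<in>K. v = lscale L a (e i)"
proof (induction rule: tri.induct)
  case (3 \<gamma> v w)
  then obtain a b where "a \<in> K" "v = lscale L a (e i)" "b \<in> K" "w = lscale L b (e i)" by blast
  then show ?case using 3 by (intro bexI[of _ "a + b"]) (auto simp: scale_left)
next
  case (4 a \<gamma> v)
  then obtain b where "b \<in> K" "v = lscale L b (e i)" by blast
  then show ?case using 4 by (intro bexI[of _ "a * b"]) (auto simp: scale_scale)
next
  case (1 \<gamma> v)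
  have "(\<lambda>_. 0) \<noteq> \<alpha> i" by (metis simple_root_def zero_neq_one)
  show ?case using 1
  proof (induction rule: borel_part.induct)
    case (1 \<gamma> v)
    then show ?case using half_e_simple by blast
  next
    case (2 h)
    then show ?case using \<open>(\<lambda>_. 0) \<noteq> \<alpha> i\<close> by simp
  next
    case (3 \<gamma> v w)
    then obtain a b where "a \<in> K" "v = lscale L a (e i)" "b \<in> K" "w = lscale L b (e i)" by blast
    then show ?case using 3 by (intro bexI[of _ "a + b"]) (auto simp: scale_left)
  next
    case (4 a \<gamma> v)
    then obtain b where "b \<in> K" "v = lscale L b (e i)" by blast
    then show ?case using 4 by (intro bexI[of _ "a * b"]) (auto simp: scale_scale)
  qed
next
  case (2 \<gamma> v)
  have "(\<lambda>_. 0) \<noteq> \<alpha> i" by (metis simple_root_def zero_neq_one)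
  show ?case using 2
  proof (induction rule: borel_part.induct)
    case (1 \<gamma> v)
    then have "v = lzero L" using half_f_height height_simple[OF 1(2)] by simp
    then show ?case using 1 by (intro bexI[of _ 0]) (auto simp: scale_zero)
  next
    case (2 h)
    then show ?case using \<open>(\<lambda>_. 0) \<noteq> \<alpha> i\<close> by simp
  next
    case (3 \<gamma> v w)
    then obtain a b where "a \<in> K" "v = lscale L a (e i)" "b \<in> K" "w = lscale L b (e i)" by blast
    then show ?case using 3 by (intro bexI[of _ "a + b"]) (auto simp: scale_left)
  next
    case (4 a \<gamma> v)
    then obtain b where "b \<in> K" "v = lscale L b (e i)" by blast
    then show ?case using 4 by (intro bexI[of _ "a * b"]) (auto simp: scale_scale)
  qed
qed

lemma RS_simple: "i \<in> I \<Longrightarrow> v \<in> RS (\<alpha> i) \<Longrightarrow> \<exists>a\<in>K. v = lscale L a (e i)"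
  using homogeneous_tri tri_simple by (auto simp: RS_iff)

subsection \<open>Conjugacy to simple roots\<close>

definition unipotents :: "('i, 'l) km_map set" where
  "unipotents = {XX i r | i r. i \<in> I \<and> r \<in> K} \<union> {YY i r | i r. i \<in> I \<and> r \<in> K}"

text \<open>Formed inside the full automorphism group and without the torus; under the generation
  hypothesis it turns out to be the adjoint group.\<close>

definition UG :: "('i, 'l) km_map set" where "UG = generate autG unipotents"

lemma XX_def: "i \<in> I \<Longrightarrow> XX i r = exp_ad L r (e i)" and YY_def: "i \<in> I \<Longrightarrow> YY i r = exp_ad L r (f i)"
  using sl2_triple.X_def[OF sl2] sl2_triple.Y_def[OF sl2] by auto

lemma unipotents_aut: "unipotents \<subseteq> lie_auts K L"
  using sl2_triple.X_aut[OF sl2] sl2_triple.Y_aut[OF sl2] by (auto simp: unipotents_def)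

lemma subgroup_UG: "subgroup UG autG"
  unfolding UG_def by (rule A.generate_is_subgroup) (simp add: unipotents_aut)

lemma UG_aut: "\<sigma> \<in> UG \<Longrightarrow> \<sigma> \<in> lie_auts K L"
  using subgroup.subset[OF subgroup_UG] by auto

lemma XX_UG: "i \<in> I \<Longrightarrow> r \<in> K \<Longrightarrow> XX i r \<in> UG" and YY_UG: "i \<in> I \<Longrightarrow> r \<in> K \<Longrightarrow> YY i r \<in> UG"
  unfolding UG_def unipotents_def by (auto intro!: generate.incl)

lemma WW_UG: "i \<in> I \<Longrightarrow> t \<in> K \<Longrightarrow> WW i t \<in> UG"
  unfolding sl2_triple.W_def[OF sl2]
  by (intro subgroup.m_closed[OF subgroup_UG] XX_UG YY_UG) auto

lemma refl_lattice: "i \<in> I \<Longrightarrow> \<gamma> \<in> root_lattice D \<Longrightarrow> refl_map i \<gamma> \<in> root_lattice D"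
  by (auto simp: root_lattice_def refl_map_def)

lemma simple_reflection_eq: "\<gamma> \<in> root_lattice D \<Longrightarrow> simple_reflection D i \<gamma> = refl_map i \<gamma>"
  by (simp add: simple_reflection_def refl_map_def)

lemma simple_reflection_Bij:
  assumes i: "i \<in> I" shows "simple_reflection D i \<in> Bij (root_lattice D)"
  unfolding Bij_def
proof (intro IntI CollectI)
  show "simple_reflection D i \<in> extensional (root_lattice D)" by (simp add: simple_reflection_def)
  show "bij_betw (simple_reflection D i) (root_lattice D) (root_lattice D)"
    by (rule bij_betw_byWitness[where f' = "simple_reflection D i"])
      (use i in \<open>auto simp: simple_reflection_eq refl_lattice refl_map_involution\<close>)
qed

lemma simple_reflection_inv:
  assumes i: "i \<in> I" shows "inv\<^bsub>BijGroup (root_lattice D)\<^esub> (simple_reflection D i) = simple_reflection D i"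
proof (rule group.inv_equality[OF group_BijGroup])
  show "simple_reflection D i \<otimes>\<^bsub>BijGroup (root_lattice D)\<^esub> simple_reflection D i = \<one>\<^bsub>BijGroup (root_lattice D)\<^esub>"
    using simple_reflection_Bij[OF i] i
    by (auto simp: BijGroup_def compose_def simple_reflection_eq refl_lattice refl_map_involution intro!: restrict_ext)
qed (use simple_reflection_Bij[OF i] in \<open>auto simp: BijGroup_def\<close>)

text \<open>Every Weyl group element is induced by a product of the lifts \<open>WW i 1\<close>. One
  automorphism serves all degrees at once, so that lifts can be composed; a reflection is its own
  inverse, so inverses of generators need no new lift.\<close>

lemma weyl_lift:
  assumes "w \<in> weyl_group D"
  shows "w \<in> Bij (root_lattice D) \<and> (\<exists>\<sigma>\<in>UG. \<forall>\<gamma>\<in>root_lattice D. \<sigma> ` RS \<gamma> = RS (w \<gamma>))"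
  using assms unfolding weyl_group_def
proof (induction rule: generate.induct)
  case one
  have "\<one>\<^bsub>autG\<^esub> ` RS \<gamma> = RS \<gamma>" for \<gamma>
    using RS_carrier by (force simp: autG_one image_iff)
  moreover have o: "\<one>\<^bsub>BijGroup (root_lattice D)\<^esub> = (\<lambda>\<gamma>\<in>root_lattice D. \<gamma>)" by (simp add: BijGroup_def)
  ultimately show ?case unfolding o using subgroup.one_closed[OF subgroup_UG]
    by (intro conjI id_Bij bexI[of _ "\<one>\<^bsub>autG\<^esub>"] ballI) simp_all
next
  case (incl w)
  then obtain i where i: "i \<in> I" "w = simple_reflection D i" by auto
  then show ?case using WW_UG[OF i(1), of 1] WW_RS_image[OF i(1)] simple_reflection_Bij[OF i(1)]
    by (auto simp: simple_reflection_eq intro!: bexI[of _ "WW i 1"])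
next
  case (inv w)
  then obtain i where i: "i \<in> I" "w = simple_reflection D i" by auto
  then show ?case using WW_UG[OF i(1), of 1] WW_RS_image[OF i(1)] simple_reflection_Bij[OF i(1)] simple_reflection_inv[OF i(1)]
    by (auto simp: simple_reflection_eq intro!: bexI[of _ "WW i 1"])
next
  case (eng w w')
  have B: "w \<in> Bij (root_lattice D)" "w' \<in> Bij (root_lattice D)" using eng.IH by auto
  obtain \<sigma> where s1: "\<sigma> \<in> UG" "\<forall>\<gamma>\<in>root_lattice D. \<sigma> ` RS \<gamma> = RS (w \<gamma>)" using eng.IH(1) by (elim conjE bexE)
  obtain \<sigma>' where s2: "\<sigma>' \<in> UG" "\<forall>\<gamma>\<in>root_lattice D. \<sigma>' ` RS \<gamma> = RS (w' \<gamma>)" using eng.IH(2) by (elim conjE bexE)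
  have "(\<sigma> \<otimes>\<^bsub>autG\<^esub> \<sigma>') ` RS \<gamma> = RS ((w \<otimes>\<^bsub>BijGroup (root_lattice D)\<^esub> w') \<gamma>)" if \<gamma>: "\<gamma> \<in> root_lattice D" for \<gamma>
  proof -
    have w': "w' \<gamma> \<in> root_lattice D" using \<gamma> Bij_imp_funcset[OF B(2)] by auto
    have "(\<sigma> \<otimes>\<^bsub>autG\<^esub> \<sigma>') ` RS \<gamma> = \<sigma> ` \<sigma>' ` RS \<gamma>"
      unfolding image_image
      by (rule image_cong[OF HOL.refl]) (rule autG_mult_apply[OF UG_aut[OF s1(1)] UG_aut[OF s2(1)] RS_carrier])
    also have "\<dots> = RS (w (w' \<gamma>))" using s1(2) s2(2) \<gamma> w' by simp
    finally show ?thesis using B \<gamma> by (simp add: BijGroup_def compose_def)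
  qed
  moreover have "w \<otimes>\<^bsub>BijGroup (root_lattice D)\<^esub> w' \<in> Bij (root_lattice D)" using B by (simp add: BijGroup_def compose_Bij)
  ultimately show ?case using subgroup.m_closed[OF subgroup_UG s1(1) s2(1)]
    by (intro conjI bexI[of _ "\<sigma> \<otimes>\<^bsub>autG\<^esub> \<sigma>'"] ballI)
qed

lemma simple_root_lattice: "i \<in> I \<Longrightarrow> \<alpha> i \<in> root_lattice D"
  by (auto simp: root_lattice_def simple_root_def)

lemma real_root_space:
  assumes "\<gamma> \<in> real_roots D"
  obtains i \<sigma> where "i \<in> I" "\<sigma> \<in> UG" "RS \<gamma> = \<sigma> ` RS (\<alpha> i)"
proof -
  obtain w i where w: "\<gamma> = w (\<alpha> i)" "w \<in> weyl_group D" "i \<in> I" using assms unfolding real_roots_def by blast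
  then obtain \<sigma> where "\<sigma> \<in> UG" "\<forall>\<gamma>\<in>root_lattice D. \<sigma> ` RS \<gamma> = RS (w \<gamma>)"
    using weyl_lift[OF w(2)] by (elim conjE bexE)
  then show ?thesis using that[OF w(3)] simple_root_lattice[OF w(3)] w(1) by simp
qed

lemma real_root_space_nonzero:
  assumes "\<gamma> \<in> real_roots D" shows "\<exists>v\<in>RS \<gamma>. v \<noteq> lzero L"
proof -
  obtain i \<sigma> where i: "i \<in> I" "\<sigma> \<in> UG" "RS \<gamma> = \<sigma> ` RS (\<alpha> i)" by (rule real_root_space[OF assms])
  have \<sigma>: "\<sigma> \<in> lie_auts K L" using UG_aut i by blast
  have "\<sigma> (e i) \<noteq> lzero L"
  proof
    assume "\<sigma> (e i) = lzero L"
    then have "\<sigma> (e i) = \<sigma> (lzero L)" using aut_zero[OF \<sigma>] by simp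
    moreover have "inj_on \<sigma> (carrier L)" using \<sigma> by (auto simp: lie_auts_def Bij_def bij_betw_def)
    ultimately have "e i = lzero L" using i by (auto dest: inj_onD)
    then show False using e_f_nonzero i by blast
  qed
  then show ?thesis using i RS_gens(2)[OF i(1)] by blast
qed

text \<open>The choice is legitimate because every real root space contains a nonzero vector,
  transported from a simple one, and because the prescribed values are consistent: simple roots are
  pairwise distinct and never equal to the negative of one another.\<close>

lemma root_vectors_spec:
  "\<gamma> \<in> real_roots D \<Longrightarrow> root_vectors K D \<gamma> \<in> RS \<gamma> \<and> root_vectors K D \<gamma> \<noteq> lzero L"
  "i \<in> I \<Longrightarrow> root_vectors K D (\<alpha> i) = e i"
  "i \<in> I \<Longrightarrow> root_vectors K D (\<lambda>j. - \<alpha> i j) = f i"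
proof -
  let ?P = "\<lambda>ev. (\<forall>\<gamma>\<in>real_roots D. ev \<gamma> \<in> RS \<gamma> \<and> ev \<gamma> \<noteq> lzero L) \<and>
     (\<forall>i\<in>I. ev (\<alpha> i) = e i \<and> ev (\<lambda>j. - \<alpha> i j) = f i)"
  have "\<exists>ev. ?P ev"
  proof -
    obtain c where c: "\<And>\<gamma>. \<gamma> \<in> real_roots D \<Longrightarrow> c \<gamma> \<in> RS \<gamma> \<and> c \<gamma> \<noteq> lzero L"
      using real_root_space_nonzero by metis
    define ev where "ev \<gamma> = (if \<exists>i\<in>I. \<gamma> = \<alpha> i then e (THE i. \<gamma> = \<alpha> i)
        else if \<exists>i\<in>I. \<gamma> = (\<lambda>j. - \<alpha> i j) then f (THE i. \<gamma> = (\<lambda>j. - \<alpha> i j)) else c \<gamma>)" for \<gamma>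
    have neg_inj: "(\<lambda>k. - \<alpha> i k) = (\<lambda>k. - \<alpha> j k) \<longleftrightarrow> i = j" for i j
      using simple_root_inject[of i j] by (auto simp: fun_eq_iff)
    have neq: "(\<lambda>k. - \<alpha> i k) \<noteq> \<alpha> j" for i j
      by (auto simp: fun_eq_iff simple_root_def intro!: exI[of _ i])
    have 1: "ev (\<alpha> i) = e i" if "i \<in> I" for i using that by (auto simp: ev_def simple_root_inject)
    have 2: "ev (\<lambda>k. - \<alpha> i k) = f i" if "i \<in> I" for i using that by (auto simp: ev_def neg_inj neq)
    have "ev \<gamma> \<in> RS \<gamma> \<and> ev \<gamma> \<noteq> lzero L" if "\<gamma> \<in> real_roots D" for \<gamma>
    proof -
      consider i where "i \<in> I" "\<gamma> = \<alpha> i" | i where "i \<in> I" "\<gamma> = (\<lambda>k. - \<alpha> i k)"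
        | "\<not> (\<exists>i\<in>I. \<gamma> = \<alpha> i)" "\<not> (\<exists>i\<in>I. \<gamma> = (\<lambda>k. - \<alpha> i k))" by blast
      then show ?thesis
      proof cases
        case 1 then show ?thesis using \<open>\<And>i. i \<in> I \<Longrightarrow> ev (\<alpha> i) = e i\<close> RS_gens e_f_nonzero by simp
      next
        case 2 then show ?thesis using \<open>\<And>i. i \<in> I \<Longrightarrow> ev (\<lambda>k. - \<alpha> i k) = f i\<close> RS_gens e_f_nonzero by simp
      next
        case 3 then show ?thesis using c[OF that] by (auto simp: ev_def)
      qed
    qed
    then show ?thesis using 1 2 by blast
  qed
  then have "?P (root_vectors K D)"
    unfolding root_vectors_def km_algebra_PL by (rule someI_ex)
  then show "\<gamma> \<in> real_roots D \<Longrightarrow> root_vectors K D \<gamma> \<in> RS \<gamma> \<and> root_vectors K D \<gamma> \<noteq> lzero L"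
    "i \<in> I \<Longrightarrow> root_vectors K D (\<alpha> i) = e i" "i \<in> I \<Longrightarrow> root_vectors K D (\<lambda>j. - \<alpha> i j) = f i" by blast+
qed

lemma root_subgroup_simple:
  "i \<in> I \<Longrightarrow> root_subgroup K D (\<alpha> i) = {XX i r | r. r \<in> K}"
  "i \<in> I \<Longrightarrow> root_subgroup K D (\<lambda>j. - \<alpha> i j) = {YY i r | r. r \<in> K}"
  by (auto simp: root_subgroup_def root_vectors_spec XX_def YY_def km_algebra_PL)

text \<open>A root vector is the image under some \<open>\<sigma>\<close> in \<open>UG\<close> of a
  multiple of some \<open>e i\<close>. Its exponentials are conjugates under \<open>\<sigma>\<close>
  of elements of the simple root group.\<close>

lemma root_subgroup_UG:
  assumes "\<gamma> \<in> real_roots D" shows "root_subgroup K D \<gamma> \<subseteq> UG"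
proof
  fix g assume "g \<in> root_subgroup K D \<gamma>"
  then obtain r where r: "r \<in> K" "g = exp_ad L r (root_vectors K D \<gamma>)" by (auto simp: root_subgroup_def km_algebra_PL)
  obtain i \<sigma> where i: "i \<in> I" "\<sigma> \<in> UG" "RS \<gamma> = \<sigma> ` RS (\<alpha> i)" by (rule real_root_space[OF assms])
  have \<sigma>: "\<sigma> \<in> lie_auts K L" using UG_aut i by blast
  obtain v where v: "v \<in> RS (\<alpha> i)" "root_vectors K D \<gamma> = \<sigma> v" using root_vectors_spec(1)[OF assms] i by auto
  obtain a where a: "a \<in> K" "v = lscale L a (e i)" using RS_simple[OF i(1) v(1)] by blast
  have "g = \<sigma> \<otimes>\<^bsub>autG\<^esub> exp_ad L r v \<otimes>\<^bsub>autG\<^esub> inv\<^bsub>autG\<^esub> \<sigma>"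
    unfolding r v a using exp_ad_scale_vector(1)[OF r(1) a(1) e_nilpotent[OF i(1)]] by (intro exp_ad_conj(2)[OF \<sigma> r(1), symmetric])
  moreover have "exp_ad L r v = XX i (r * a)"
    unfolding a using exp_ad_scale_vector(2)[OF r(1) a(1) e_nilpotent[OF i(1)]] i by (simp add: XX_def)
  ultimately show "g \<in> UG"
    using i r a by (simp only:) (intro subgroup.m_closed[OF subgroup_UG] subgroup.m_inv_closed[OF subgroup_UG] XX_UG; simp)
qed

lemma simple_real_root: "i \<in> I \<Longrightarrow> \<alpha> i \<in> real_roots D" "i \<in> I \<Longrightarrow> (\<lambda>j. - \<alpha> i j) \<in> real_roots D"
proof -
  assume i: "i \<in> I"
  have "\<one>\<^bsub>BijGroup (root_lattice D)\<^esub> (\<alpha> i) = \<alpha> i" using simple_root_lattice[OF i] by (simp add: BijGroup_def)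
  moreover have "\<one>\<^bsub>BijGroup (root_lattice D)\<^esub> \<in> weyl_group D" unfolding weyl_group_def by (rule generate.one)
  ultimately show "\<alpha> i \<in> real_roots D" using i unfolding real_roots_def by (metis (mono_tags, lifting) mem_Collect_eq)
  have "simple_reflection D i (\<alpha> i) = (\<lambda>j. - \<alpha> i j)"
    using i by (simp add: simple_reflection_eq simple_root_lattice refl_map_simple ca_diag)
  moreover have "simple_reflection D i \<in> weyl_group D" unfolding weyl_group_def using i by (auto intro: generate.incl)
  ultimately show "(\<lambda>j. - \<alpha> i j) \<in> real_roots D" using i unfolding real_roots_def by (metis (mono_tags, lifting) mem_Collect_eq)
qed

end

section \<open>The Kac--Peterson topology\<close>

lemma foldr_word:
  assumes "\<And>m. m < length w \<Longrightarrow> y m = u (w ! m) (x m)"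
  shows "foldr (\<lambda>m g. y m \<otimes>\<^bsub>G\<^esub> g) [0..<length w] \<one>\<^bsub>G\<^esub> = word G u w x"
  using assms
proof (induction w arbitrary: x y)
  case (Cons j w)
  have "[0..<length (j # w)] = 0 # map Suc [0..<length w]" by (simp add: upt_conv_Cons map_Suc_upt del: upt_Suc)
  then have "foldr (\<lambda>m g. y m \<otimes>\<^bsub>G\<^esub> g) [0..<length (j # w)] \<one>\<^bsub>G\<^esub> =
      y 0 \<otimes>\<^bsub>G\<^esub> foldr (\<lambda>m g. y (Suc m) \<otimes>\<^bsub>G\<^esub> g) [0..<length w] \<one>\<^bsub>G\<^esub>"
    by (simp add: foldr_map o_def del: upt_Suc)
  also have "foldr (\<lambda>m g. y (Suc m) \<otimes>\<^bsub>G\<^esub> g) [0..<length w] \<one>\<^bsub>G\<^esub> = word G u w (\<lambda>n. x (Suc n))"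
    by (rule Cons.IH) (use Cons.prems in force)
  also have "y 0 = u j (x 0)" using Cons.prems[of 0] by simp
  finally show ?case by simp
qed simp

lemma foldr_cong_upt:
  "(\<And>m. m < n \<Longrightarrow> y m = z m) \<Longrightarrow>
    foldr (\<lambda>m g. y m \<otimes>\<^bsub>G\<^esub> g) [0..<n] a = foldr (\<lambda>m g. z m \<otimes>\<^bsub>G\<^esub> g) [0..<n] a"
  by (rule foldr_cong) auto

context one_param_words begin

text \<open>
  The homomorphism from \<open>SL(2, K)\<close> is liftable, so Kac--Peterson open sets can be recognized on
  words in one-parameter subgroups. Liftability is local because the big cell has no global
  coordinates.
\<close>

definition liftable :: "'z topology \<Rightarrow> ('z \<Rightarrow> 'a) \<Rightarrow> bool" where
  "liftable Z \<phi> \<longleftrightarrow> (\<forall>z\<in>topspace Z. \<exists>V w \<rho>. openin Z V \<and> z \<in> V \<and> w \<in> lists J \<and>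
     continuous_map (subtopology Z V) euclidean \<rho> \<and> (\<forall>y\<in>V. \<phi> y = word G u w (\<rho> y)))"

lemma liftableI_word:
  assumes "w \<in> lists J" "continuous_map Z euclidean \<rho>" "\<And>z. z \<in> topspace Z \<Longrightarrow> \<phi> z = word G u w (\<rho> z)"
  shows "liftable Z \<phi>"
  unfolding liftable_def
proof
  fix z assume "z \<in> topspace Z"
  with assms show "\<exists>V w \<rho>. openin Z V \<and> z \<in> V \<and> w \<in> lists J \<and>
     continuous_map (subtopology Z V) euclidean \<rho> \<and> (\<forall>y\<in>V. \<phi> y = word G u w (\<rho> y))"
    by (intro exI[of _ "topspace Z"] exI[of _ w] exI[of _ \<rho>]) simp
qed

lemma liftable_one: "liftable Z (\<lambda>_. \<one>)"
  by (rule liftableI_word[of "[]" _ "\<lambda>_ _. 0"]) auto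

lemma liftable_mult:
  assumes "liftable Z \<phi>" "liftable Z \<psi>"
  shows "liftable Z (\<lambda>z. \<phi> z \<otimes> \<psi> z)"
  unfolding liftable_def
proof
  fix z assume z: "z \<in> topspace Z"
  obtain V w \<rho> where 1: "openin Z V" "z \<in> V" "w \<in> lists J" "continuous_map (subtopology Z V) euclidean \<rho>"
    "\<forall>y\<in>V. \<phi> y = word G u w (\<rho> y)" using assms(1) z unfolding liftable_def by meson
  obtain V' w' \<rho>' where 2: "openin Z V'" "z \<in> V'" "w' \<in> lists J" "continuous_map (subtopology Z V') euclidean \<rho>'"
    "\<forall>y\<in>V'. \<psi> y = word G u w' (\<rho>' y)" using assms(2) z unfolding liftable_def by meson
  have c: "continuous_map (subtopology Z (V \<inter> V')) euclidean \<rho>" "continuous_map (subtopology Z (V \<inter> V')) euclidean \<rho>'"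
    using continuous_map_from_subtopology_mono[OF 1(4)] continuous_map_from_subtopology_mono[OF 2(4)] by auto
  have "continuous_map (subtopology Z (V \<inter> V')) (prod_topology euclidean euclidean) (\<lambda>y. (\<rho> y, \<rho>' y))"
    using c by (simp add: continuous_map_paired del: prod_topology_euclidean)
  then have "continuous_map (subtopology Z (V \<inter> V')) euclidean (\<lambda>y. (\<rho> y, \<rho>' y))" by simp
  moreover have "continuous_map euclidean euclidean (\<lambda>p :: (nat \<Rightarrow> real) \<times> (nat \<Rightarrow> real). join (length w) (fst p) (snd p))"
    by (simp, intro continuous_intros)
  ultimately have "continuous_map (subtopology Z (V \<inter> V')) euclidean (\<lambda>y. join (length w) (\<rho> y) (\<rho>' y))"
    using continuous_map_compose[of "subtopology Z (V \<inter> V')" euclidean "\<lambda>y. (\<rho> y, \<rho>' y)" euclidean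
        "\<lambda>p. join (length w) (fst p) (snd p)"] by (simp add: o_def)
  then show "\<exists>V w \<rho>. openin Z V \<and> z \<in> V \<and> w \<in> lists J \<and>
     continuous_map (subtopology Z V) euclidean \<rho> \<and> (\<forall>y\<in>V. \<phi> y \<otimes> \<psi> y = word G u w (\<rho> y))"
    using 1 2 by (intro exI[of _ "V \<inter> V'"] exI[of _ "w @ w'"] exI[of _ "\<lambda>y. join (length w) (\<rho> y) (\<rho>' y)"])
      (simp add: openin_Int word_join)
qed

lemma liftable_compose:
  assumes f: "liftable Z \<phi>" and g: "continuous_map Z' Z g"
  shows "liftable Z' (\<lambda>z. \<phi> (g z))"
  unfolding liftable_def
proof
  fix z assume z: "z \<in> topspace Z'"
  then have "g z \<in> topspace Z" using g by (auto simp: continuous_map_def)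
  then obtain V w \<rho> where 1: "openin Z V" "g z \<in> V" "w \<in> lists J" "continuous_map (subtopology Z V) euclidean \<rho>"
    "\<forall>y\<in>V. \<phi> y = word G u w (\<rho> y)" using f unfolding liftable_def by meson
  let ?V = "{y \<in> topspace Z'. g y \<in> V}"
  have V: "openin Z' ?V" using g 1(1) by (rule openin_continuous_map_preimage)
  have "continuous_map (subtopology Z' ?V) (subtopology Z V) g"
    using g by (auto simp: continuous_map_in_subtopology intro: continuous_map_from_subtopology)
  from continuous_map_compose[OF this 1(4)]
  show "\<exists>V w \<rho>. openin Z' V \<and> z \<in> V \<and> w \<in> lists J \<and>
     continuous_map (subtopology Z' V) euclidean \<rho> \<and> (\<forall>y\<in>V. \<phi> (g y) = word G u w (\<rho> y))"
    using V z 1 by (intro exI[of _ ?V] exI[of _ w] exI[of _ "\<rho> \<circ> g"]) auto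
qed

lemma liftable_local:
  assumes "\<And>z. z \<in> topspace Z \<Longrightarrow> \<exists>V. openin Z V \<and> z \<in> V \<and> liftable (subtopology Z V) \<phi>"
  shows "liftable Z \<phi>"
  unfolding liftable_def
proof
  fix z assume z: "z \<in> topspace Z"
  then obtain V where V: "openin Z V" "z \<in> V" "liftable (subtopology Z V) \<phi>" using assms by blast
  then have "z \<in> topspace (subtopology Z V)" using z by simp
  then obtain V' w \<rho> where 1: "openin (subtopology Z V) V'" "z \<in> V'" "w \<in> lists J"
    "continuous_map (subtopology (subtopology Z V) V') euclidean \<rho>" "\<forall>y\<in>V'. \<phi> y = word G u w (\<rho> y)"
    using V(3) unfolding liftable_def by meson
  have "V' \<subseteq> V" using 1(1) openin_imp_subset by blast
  moreover have "openin Z V'" using 1(1) V(1) openin_trans_full by blast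
  ultimately show "\<exists>V w \<rho>. openin Z V \<and> z \<in> V \<and> w \<in> lists J \<and>
     continuous_map (subtopology Z V) euclidean \<rho> \<and> (\<forall>y\<in>V. \<phi> y = word G u w (\<rho> y))"
    using 1 by (intro exI[of _ V'] exI[of _ w] exI[of _ \<rho>]) (simp add: subtopology_subtopology Int_absorb1)
qed

lemma liftable_cong:
  assumes "liftable Z \<phi>" "\<And>z. z \<in> topspace Z \<Longrightarrow> \<phi> z = \<psi> z" shows "liftable Z \<psi>"
  unfolding liftable_def
proof
  fix z assume "z \<in> topspace Z"
  then obtain V w \<rho> where 1: "openin Z V" "z \<in> V" "w \<in> lists J" "continuous_map (subtopology Z V) euclidean \<rho>"
    "\<forall>y\<in>V. \<phi> y = word G u w (\<rho> y)" using assms(1) unfolding liftable_def by meson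
  then show "\<exists>V w \<rho>. openin Z V \<and> z \<in> V \<and> w \<in> lists J \<and>
     continuous_map (subtopology Z V) euclidean \<rho> \<and> (\<forall>y\<in>V. \<psi> y = word G u w (\<rho> y))"
    using assms(2)[symmetric] openin_subset[OF 1(1)] by (intro exI[of _ V] exI[of _ w] exI[of _ \<rho>]) (simp add: subset_iff)
qed

text \<open>Locally the map factors continuously through one word map, along which \<open>U\<close>
  pulls back to an open set.\<close>

lemma liftable_open:
  assumes \<phi>: "liftable Z \<phi>" and U: "\<And>w. w \<in> lists J \<Longrightarrow> open {x. word G u w x \<in> U}"
  shows "openin Z {z \<in> topspace Z. \<phi> z \<in> U}"
proof (subst openin_subopen, clarify)
  fix z assume z: "z \<in> topspace Z" "\<phi> z \<in> U"
  then obtain V w \<rho> where 1: "openin Z V" "z \<in> V" "w \<in> lists J" "continuous_map (subtopology Z V) euclidean \<rho>"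
    "\<forall>y\<in>V. \<phi> y = word G u w (\<rho> y)" using \<phi> unfolding liftable_def by meson
  let ?V = "{y \<in> topspace (subtopology Z V). \<rho> y \<in> {x. word G u w x \<in> U}}"
  have "openin (subtopology Z V) ?V"
    using U[OF 1(3)] by (intro openin_continuous_map_preimage[OF 1(4)]) simp
  then have "openin Z ?V" using 1(1) openin_trans_full by blast
  moreover have "z \<in> ?V" using z 1 by auto
  moreover have "?V \<subseteq> {z \<in> topspace Z. \<phi> z \<in> U}" using 1(5) by auto
  ultimately show "\<exists>T. openin Z T \<and> z \<in> T \<and> T \<subseteq> {z \<in> topspace Z. \<phi> z \<in> U}" by blast
qed

end

lemma continuous_on_mat2:
  assumes "continuous_on S a" "continuous_on S b" "continuous_on S c" "continuous_on S d"
  shows "continuous_on S (\<lambda>x. mat2 (a x) (b x) (c x) (d x))"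
proof -
  have "continuous_on S (\<lambda>x. mat2 (a x) (b x) (c x) (d x) $ p $ q)" for p q
    using exhaust_2[of p] exhaust_2[of q] assms by auto
  then have "continuous_on S (\<lambda>x. \<chi> p q. mat2 (a x) (b x) (c x) (d x) $ p $ q)"
    by (intro continuous_on_vec_lambda)
  then show ?thesis by (simp add: vec_lambda_eta)
qed

lemma continuous_on_matrix_mult_left:
  fixes A :: "complex ^ 2 ^ 2"
  shows "continuous_on UNIV (\<lambda>M. A ** M)"
  unfolding matrix_matrix_mult_def by (intro continuous_intros)

section \<open>The adjoint group and its rank-one subgroups\<close>

locale km_gen = km K D for K :: "complex set" and D :: "('i, 'l::ab_group_add) root_datum" +
  assumes gen: "generated_by_root_subgroups K D"
begin

abbreviation "G \<equiv> adjoint_km_group K D"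

lemma km_aut_autG: "km_aut K D = autG"
  by (simp add: km_aut_def autG_def km_algebra_PL)

text \<open>The generation hypothesis removes the torus. The remaining root groups lie in
  \<open>UG\<close>, and the simple ones among them generate it.\<close>

lemma carrier_G: "carrier G = UG"
proof -
  let ?R = "\<Union>\<gamma>\<in>real_roots D. root_subgroup K D \<gamma>"
  let ?H = "generate autG (?R \<union> torus K D)"
  have R: "?R \<subseteq> UG" using root_subgroup_UG by blast
  have c: "?R \<union> torus K D \<subseteq> carrier autG"
  proof (rule Un_least)
    show "?R \<subseteq> carrier autG" using subset_trans[OF R] subgroup.subset[OF subgroup_UG] by blast
    show "torus K D \<subseteq> carrier autG"
    proof
      fix \<tau> assume "\<tau> \<in> torus K D"
      then have "\<tau> \<in> carrier (km_aut K D)" unfolding torus_def by simp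
      then show "\<tau> \<in> carrier autG" by (simp only: km_aut_autG)
    qed
  qed
  have H: "carrier G = ?H" by (simp add: adjoint_km_group_def km_aut_autG)
  have G: "G = autG\<lparr>carrier := ?H\<rparr>" by (simp add: adjoint_km_group_def km_aut_autG)
  have "?R \<subseteq> ?H" by (auto intro: generate.incl)
  then have "generate G ?R = generate autG ?R"
    unfolding G by (intro A.generate_consistent A.generate_is_subgroup[OF c])
  then have "carrier G = generate autG ?R" using gen by (simp add: generated_by_root_subgroups_def)
  moreover have "generate autG ?R \<subseteq> UG"
    by (rule A.generate_subgroup_incl[OF R subgroup_UG])
  moreover have "UG \<subseteq> generate autG ?R"
    unfolding UG_def
  proof (rule A.mono_generate)
    show "unipotents \<subseteq> ?R"
      unfolding unipotents_def
    proof (intro Un_least subsetI)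
      fix g assume "g \<in> {XX i r | i r. i \<in> I \<and> r \<in> K}"
      then obtain i where i: "i \<in> I" and "g \<in> {XX i r | r. r \<in> K}" by blast
      then show "g \<in> ?R" using root_subgroup_simple(1)[OF i] simple_real_root(1)[OF i] by (metis UN_I)
    next
      fix g assume "g \<in> {YY i r | i r. i \<in> I \<and> r \<in> K}"
      then obtain i where i: "i \<in> I" and "g \<in> {YY i r | r. r \<in> K}" by blast
      then show "g \<in> ?R" using root_subgroup_simple(2)[OF i] simple_real_root(2)[OF i] by (metis UN_I)
    qed
  qed
  ultimately show ?thesis by blast
qed

lemma mult_G: "(\<otimes>\<^bsub>G\<^esub>) = (\<otimes>\<^bsub>autG\<^esub>)" and one_G: "\<one>\<^bsub>G\<^esub> = \<one>\<^bsub>autG\<^esub>"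
  by (simp_all add: adjoint_km_group_def km_aut_autG)

lemma G_eq: "G = autG\<lparr>carrier := UG\<rparr>"
  using carrier_G by (simp add: adjoint_km_group_def km_aut_autG)

lemma group_G: "group G"
  unfolding G_eq by (rule subgroup.subgroup_is_group[OF subgroup_UG A.is_group])

sublocale G: group G by (rule group_G)

text \<open>The sign in the second family translates between the two conventions: the lower
  triangular matrix with entry s corresponds to the exponential with parameter -s.\<close>

lemma sl2_group_G:
  assumes i: "i \<in> I" shows "sl2_group G K (XX i) (\<lambda>s. YY i (- s))"
proof -
  interpret S: sl2_triple K L "e i" "f i" "hi i" by (rule sl2[OF i])
  have W: "XX i t \<otimes>\<^bsub>autG\<^esub> (YY i (- (- 1 / t)) \<otimes>\<^bsub>autG\<^esub> XX i t) = WW i t" for t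
    by (simp add: S.W_def)
  show ?thesis
  proof (unfold_locales, unfold carrier_G mult_G W)
    show "K \<in> {\<real>, UNIV}" by (rule K)
    show "XX i r \<in> UG" "YY i (- r) \<in> UG" if "r \<in> K" for r using that i XX_UG YY_UG by auto
    show "XX i (r + s) = XX i r \<otimes>\<^bsub>autG\<^esub> XX i s" if "r \<in> K" "s \<in> K" for r s by (rule S.X_add[OF that])
    show "YY i (- (r + s)) = YY i (- r) \<otimes>\<^bsub>autG\<^esub> YY i (- s)" if "r \<in> K" "s \<in> K" for r s
      using S.Y_add[of "- r" "- s"] that by simp
    show "WW i t \<otimes>\<^bsub>autG\<^esub> XX i r = YY i (- (- r / t\<^sup>2)) \<otimes>\<^bsub>autG\<^esub> WW i t" if "t \<in> K" "t \<noteq> 0" "r \<in> K" for t r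
      using S.W_conj_X[OF that] by simp
    fix s t assume st: "s \<in> K" "t \<in> K" "s \<noteq> 0" "t \<noteq> 0"
    have W1: "XX i (-1) \<otimes>\<^bsub>autG\<^esub> (YY i (- 1) \<otimes>\<^bsub>autG\<^esub> XX i (-1)) = WW i (-1)" by (simp add: S.W_def)
    show "WW i (s * t) \<otimes>\<^bsub>autG\<^esub> (XX i (- 1) \<otimes>\<^bsub>autG\<^esub> (YY i (- 1) \<otimes>\<^bsub>autG\<^esub> XX i (- 1))) =
        WW i s \<otimes>\<^bsub>autG\<^esub> (XX i (- 1) \<otimes>\<^bsub>autG\<^esub> (YY i (- 1) \<otimes>\<^bsub>autG\<^esub> XX i (- 1))) \<otimes>\<^bsub>autG\<^esub>
        (WW i t \<otimes>\<^bsub>autG\<^esub> (XX i (- 1) \<otimes>\<^bsub>autG\<^esub> (YY i (- 1) \<otimes>\<^bsub>autG\<^esub> XX i (- 1))))"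
      unfolding W1 using HH_mult[OF i st(1,3,2,4)] by (simp only: S.H_def)
  qed
qed

abbreviation "rho i \<equiv> rank_one_hom K D i"

lemma vector_mat2: "vector [vector [a, b], vector [c, d]] = mat2 a b c d"
  by (simp add: mat2_def)

text \<open>The description by \<open>THE\<close> is met: Bruhat forms give existence, generation by
  unipotent matrices gives uniqueness on SL(2, K), and extensionality fixes the values
  elsewhere.\<close>

lemma rank_one_hom_spec:
  assumes i: "i \<in> I"
  shows "rho i \<in> hom (SL2 K) G" "r \<in> K \<Longrightarrow> rho i (mat2 1 r 0 1) = XX i r" "r \<in> K \<Longrightarrow> rho i (mat2 1 0 r 1) = YY i (- r)"
proof -
  interpret S: sl2_group G K "XX i" "\<lambda>s. YY i (- s)" by (rule sl2_group_G[OF i])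
  let ?P = "\<lambda>\<psi>. \<psi> \<in> hom (SL2 K) G \<and> \<psi> \<in> extensional (carrier (SL2 K)) \<and>
     (\<forall>r\<in>K. \<psi> (mat2 1 r 0 1) = exp_ad L r (e i)) \<and> (\<forall>r\<in>K. \<psi> (mat2 1 0 (- r) 1) = exp_ad L r (f i))"
  have cl: "A ** B \<in> carrier (SL2 K)" if "A \<in> carrier (SL2 K)" "B \<in> carrier (SL2 K)" for A B
    using that SL2_mult_closed[OF K] by blast
  have P: "?P (restrict S.\<psi> (carrier (SL2 K)))"
    using S.\<psi>_mult S.\<psi>_closed S.\<psi>_x S.\<psi>_y cl i
    by (auto simp: hom_def mat2_SL2 XX_def YY_def)
  moreover have "\<psi> = \<psi>'" if p: "?P \<psi>" "?P \<psi>'" for \<psi> \<psi>'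
  proof (rule extensionalityI[of _ "carrier (SL2 K)"])
    fix M assume "M \<in> carrier (SL2 K)"
    then show "\<psi> M = \<psi>' M"
    proof (rule SL2_induct[OF K, of M "\<lambda>M. \<psi> M = \<psi>' M"])
      show "\<psi> (mat2 1 r 0 1) = \<psi>' (mat2 1 r 0 1)" if "r \<in> K" for r using p that by simp
      show "\<psi> (mat2 1 0 r 1) = \<psi>' (mat2 1 0 r 1)" if "r \<in> K" for r
      proof -
        have "\<psi> (mat2 1 0 (- (- r)) 1) = \<psi>' (mat2 1 0 (- (- r)) 1)" using p that K_simps(4)[OF that] by metis
        then show ?thesis by simp
      qed
      show "\<psi> (A ** B) = \<psi>' (A ** B)" if "A \<in> carrier (SL2 K)" "B \<in> carrier (SL2 K)" "\<psi> A = \<psi>' A" "\<psi> B = \<psi>' B" for A B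
        using p that hom_mult[of \<psi> "SL2 K" G A B] hom_mult[of \<psi>' "SL2 K" G A B] by simp
    qed
  qed (use p in auto)
  ultimately have "rho i = restrict S.\<psi> (carrier (SL2 K))"
    unfolding rank_one_hom_def vector_mat2 km_algebra_PL by (intro the_equality) blast+
  then show "rho i \<in> hom (SL2 K) G" "r \<in> K \<Longrightarrow> rho i (mat2 1 r 0 1) = XX i r" "r \<in> K \<Longrightarrow> rho i (mat2 1 0 r 1) = YY i (- r)"
    using P S.\<psi>_x S.\<psi>_y by (auto simp: mat2_SL2)
qed

lemma rho_mult: "i \<in> I \<Longrightarrow> A \<in> carrier (SL2 K) \<Longrightarrow> B \<in> carrier (SL2 K) \<Longrightarrow> rho i (A ** B) = rho i A \<otimes>\<^bsub>G\<^esub> rho i B"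
  using hom_mult[OF rank_one_hom_spec(1), of i A B] by simp

lemma rho_UG: "i \<in> I \<Longrightarrow> A \<in> carrier (SL2 K) \<Longrightarrow> rho i A \<in> UG"
  using hom_in_carrier[OF rank_one_hom_spec(1)] carrier_G by blast

lemma inv_XX: "i \<in> I \<Longrightarrow> r \<in> K \<Longrightarrow> inv\<^bsub>G\<^esub> (XX i r) = XX i (- r)"
  and inv_YY: "i \<in> I \<Longrightarrow> r \<in> K \<Longrightarrow> inv\<^bsub>G\<^esub> (YY i r) = YY i (- r)"
  using sl2_group.x_cancel(1)[OF sl2_group_G] sl2_group.y_cancel(2)[OF sl2_group_G, of i r]
  by (auto intro!: G.inv_equality simp: carrier_G XX_UG YY_UG)

lemma rho_image:
  assumes i: "i \<in> I" shows "rho i ` carrier (SL2 K) = rank_one_subgroup K D i"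
proof
  let ?S = "root_subgroup K D (\<alpha> i) \<union> root_subgroup K D (\<lambda>j. - \<alpha> i j)"
  have S: "?S = {XX i r | r. r \<in> K} \<union> {YY i r | r. r \<in> K}" using root_subgroup_simple[OF i] by simp
  show "rho i ` carrier (SL2 K) \<subseteq> rank_one_subgroup K D i"
  proof clarify
    fix M assume "M \<in> carrier (SL2 K)"
    then show "rho i M \<in> rank_one_subgroup K D i"
    proof (rule SL2_induct[OF K, of M "\<lambda>M. rho i M \<in> rank_one_subgroup K D i"])
      show "rho i (mat2 1 r 0 1) \<in> rank_one_subgroup K D i" if "r \<in> K" for r
        unfolding rank_one_subgroup_def S using rank_one_hom_spec[OF i] that by (auto intro: generate.incl)
      show "rho i (mat2 1 0 r 1) \<in> rank_one_subgroup K D i" if "r \<in> K" for r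
        unfolding rank_one_subgroup_def S using rank_one_hom_spec[OF i] that by (auto intro!: generate.incl)
      show "rho i (A ** B) \<in> rank_one_subgroup K D i"
        if "A \<in> carrier (SL2 K)" "B \<in> carrier (SL2 K)" "rho i A \<in> rank_one_subgroup K D i" "rho i B \<in> rank_one_subgroup K D i" for A B
        using that unfolding rank_one_subgroup_def by (simp add: rho_mult[OF i] generate.eng)
    qed
  qed
  have x: "XX i r \<in> rho i ` carrier (SL2 K)" "YY i r \<in> rho i ` carrier (SL2 K)" if "r \<in> K" for r
  proof -
    show "XX i r \<in> rho i ` carrier (SL2 K)"
      by (rule image_eqI[of _ _ "mat2 1 r 0 1"]) (simp_all add: rank_one_hom_spec(2)[OF i that] that mat2_SL2)
    show "YY i r \<in> rho i ` carrier (SL2 K)"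
      by (rule image_eqI[of _ _ "mat2 1 0 (- r) 1"]) (simp_all add: rank_one_hom_spec(3)[OF i] that mat2_SL2)
  qed
  show "rank_one_subgroup K D i \<subseteq> rho i ` carrier (SL2 K)"
    unfolding rank_one_subgroup_def S
  proof
    fix g assume "g \<in> generate G ({XX i r | r. r \<in> K} \<union> {YY i r | r. r \<in> K})"
    then show "g \<in> rho i ` carrier (SL2 K)"
    proof (induction rule: generate.induct)
      case one
      have "\<one>\<^bsub>G\<^esub> = XX i 0" using sl2_group.x_0[OF sl2_group_G[OF i]] by simp
      then show ?case using x(1)[of 0] by simp
    next
      case (incl h) then show ?case using x by blast
    next
      case (inv h)
      then obtain r where "r \<in> K" "h = XX i r \<or> h = YY i r" by blast
      then show ?case using x[of "- r"] inv_XX[OF i, of r] inv_YY[OF i, of r] by auto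
    next
      case (eng g h)
      then obtain A B where "A \<in> carrier (SL2 K)" "g = rho i A" "B \<in> carrier (SL2 K)" "h = rho i B" by blast
      then show ?case using rho_mult[OF i, of A B] SL2_mult_closed[OF K, of A B] by (metis image_eqI)
    qed
  qed
qed

lemma topspace_SL2: "topspace (SL2_topology K) = carrier (SL2 K)"
  by (simp add: SL2_topology_def)

lemma openin_rank_one:
  assumes i: "i \<in> I"
  shows "openin (rank_one_topology K D i) U \<longleftrightarrow> U \<subseteq> rank_one_subgroup K D i \<and>
    openin (SL2_topology K) {M \<in> carrier (SL2 K). rho i M \<in> U}"
  by (simp add: rank_one_topology_def openin_final_topology topspace_SL2)

lemma topspace_rank_one: "i \<in> I \<Longrightarrow> topspace (rank_one_topology K D i) = rank_one_subgroup K D i"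
  unfolding rank_one_topology_def using rho_image by (intro topspace_final_topology) (auto simp: topspace_SL2)

lemma rho_continuous: "i \<in> I \<Longrightarrow> continuous_map (SL2_topology K) (rank_one_topology K D i) (rho i)"
  unfolding rank_one_topology_def using rho_image by (intro continuous_map_final_topology) (auto simp: topspace_SL2)

lemma SL2_translation_open:
  assumes A: "A \<in> carrier (SL2 K)" and V: "openin (SL2_topology K) V"
  shows "openin (SL2_topology K) {M \<in> carrier (SL2 K). A ** M \<in> V}"
proof -
  obtain V' where V': "open V'" "V = V' \<inter> carrier (SL2 K)" using V by (auto simp: SL2_topology_def openin_subtopology)
  have cl: "A ** M \<in> carrier (SL2 K)" if "M \<in> carrier (SL2 K)" for M
    by (rule SL2_mult_closed[OF K A that])
  have "{M \<in> carrier (SL2 K). A ** M \<in> V} = ((\<lambda>M. A ** M) -` V') \<inter> carrier (SL2 K)"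
    using V' cl by auto
  moreover have "open ((\<lambda>M. A ** M) -` V')" using V'(1) continuous_on_matrix_mult_left by (rule open_vimage)
  ultimately show ?thesis by (auto simp: SL2_topology_def openin_subtopology)
qed

text \<open>The preimage of the image of V is the union of the translates of V by elements of the
  kernel, and translations are continuous.\<close>

lemma rho_open:
  assumes i: "i \<in> I" and V: "openin (SL2_topology K) V"
  shows "openin (rank_one_topology K D i) (rho i ` V)"
proof -
  have Vs: "V \<subseteq> carrier (SL2 K)" using openin_subset[OF V] topspace_SL2 by simp
  let ?N = "{A \<in> carrier (SL2 K). rho i A = \<one>\<^bsub>G\<^esub>}"
  have "{M \<in> carrier (SL2 K). rho i M \<in> rho i ` V} = (\<Union>A\<in>?N. {M \<in> carrier (SL2 K). A ** M \<in> V})"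
  proof
    show "(\<Union>A\<in>?N. {M \<in> carrier (SL2 K). A ** M \<in> V}) \<subseteq> {M \<in> carrier (SL2 K). rho i M \<in> rho i ` V}"
    proof clarify
      fix A M assume A: "A \<in> carrier (SL2 K)" "rho i A = \<one>\<^bsub>G\<^esub>" and M: "M \<in> carrier (SL2 K)" "A ** M \<in> V"
      have "rho i (A ** M) = rho i M" using rho_mult[OF i A(1) M(1)] A(2) rho_UG[OF i M(1)] by (simp add: carrier_G)
      then show "rho i M \<in> rho i ` V" using M(2) by (metis image_eqI)
    qed
    show "{M \<in> carrier (SL2 K). rho i M \<in> rho i ` V} \<subseteq> (\<Union>A\<in>?N. {M \<in> carrier (SL2 K). A ** M \<in> V})"
    proof clarify
      fix M B assume M: "M \<in> carrier (SL2 K)" and B: "B \<in> V" "rho i M = rho i B"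
      have Bc: "B \<in> carrier (SL2 K)" using B Vs by blast
      from M obtain a b c d where M': "M = mat2 a b c d" "a \<in> K" "b \<in> K" "c \<in> K" "d \<in> K" "a * d - b * c = 1" by (rule SL2_cases)
      let ?M' = "mat2 d (- b) (- c) a"
      have Mc: "?M' \<in> carrier (SL2 K)" using M' by (simp add: mat2_SL2 algebra_simps)
      have inv: "?M' ** M = mat 1" "M ** ?M' = mat 1" using M' by (simp_all add: mat2_one algebra_simps)
      let ?A = "B ** ?M'"
      have A: "?A \<in> carrier (SL2 K)" by (rule SL2_mult_closed[OF K Bc Mc])
      have "rho i ?A = rho i (M ** ?M')" using rho_mult[OF i] M Bc Mc B by simp
      also have "\<dots> = \<one>\<^bsub>G\<^esub>" unfolding inv mat2_one using rank_one_hom_spec(2)[OF i, of 0] sl2_group.x_0[OF sl2_group_G[OF i]] by simp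
      finally have "?A \<in> ?N" using A by simp
      moreover have "?A ** M = B" by (simp add: matrix_mul_assoc[symmetric] inv)
      ultimately show "M \<in> (\<Union>A\<in>?N. {M \<in> carrier (SL2 K). A ** M \<in> V})" using M B by auto
    qed
  qed
  moreover have "openin (SL2_topology K) \<dots>"
    by (intro openin_Union ballI) (auto intro: SL2_translation_open[OF _ V])
  ultimately show ?thesis using Vs rho_image[OF i] by (auto simp: openin_rank_one[OF i])
qed

definition units :: "complex set" where "units = (if K = \<real> then {1} else {1, \<i>})"

text \<open>\<open>units\<close> is a basis of the field over the reals. A one-parameter subgroup is
  indexed by a simple root, the sign of the root and a direction in the field.\<close>

definition JJ :: "('i \<times> bool \<times> complex) set" where "JJ = I \<times> UNIV \<times> units"

definition uu :: "'i \<times> bool \<times> complex \<Rightarrow> real \<Rightarrow> ('i, 'l) km_map" where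
  "uu = (\<lambda>(i, s, z) r. (if s then XX i else YY i) (of_real r * z))"

lemma of_real_units: "z \<in> units \<Longrightarrow> of_real r * z \<in> K"
  using K by (auto simp: units_def split: if_splits)

sublocale W: one_param_words G JJ uu
proof
  fix j r s assume "j \<in> JJ"
  then obtain i b z where j: "j = (i, b, z)" "i \<in> I" "z \<in> units" by (auto simp: JJ_def)
  show "uu j r \<in> carrier G" using j of_real_units XX_UG YY_UG by (auto simp: uu_def carrier_G)
  have K: "of_real r * z \<in> K" "of_real s * z \<in> K" using of_real_units j by auto
  show "uu j (r + s) = uu j r \<otimes>\<^bsub>G\<^esub> uu j s"
    using sl2_triple.X_add[OF sl2[OF j(2)] K] sl2_triple.Y_add[OF sl2[OF j(2)] K] j
    by (simp add: uu_def mult_G algebra_simps)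
qed

lemma K_decompose: "\<kappa> \<in> K \<Longrightarrow> K = \<real> \<Longrightarrow> \<kappa> = of_real (Re \<kappa>) * 1"
  by (auto elim: Reals_cases)

lemma unipotent_word:
  assumes i: "i \<in> I"
  shows "\<exists>w\<in>lists JJ. \<exists>c. continuous_on UNIV c \<and> (\<forall>\<kappa>\<in>K. (if s then XX i else YY i) \<kappa> = word G uu w (c \<kappa>))"
proof (cases "K = \<real>")
  case True
  have "(if s then XX i else YY i) \<kappa> = word G uu [(i, s, 1)] ((\<lambda>\<kappa> _. Re \<kappa>) \<kappa>)" if "\<kappa> \<in> K" for \<kappa>
    using K_decompose[OF that True] that i XX_UG[OF i that] YY_UG[OF i that]
    by (simp add: uu_def carrier_G)
  moreover have "continuous_on UNIV (\<lambda>\<kappa> (_::nat). Re \<kappa>)"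
    by (intro continuous_on_coordinatewise_then_product continuous_intros)
  moreover have "[(i, s, 1)] \<in> lists JJ" using i by (simp add: JJ_def units_def)
  ultimately show ?thesis by blast
next
  case False
  then have KU: "K = UNIV" using K by auto
  let ?c = "\<lambda>\<kappa> n. if n = (0::nat) then Re \<kappa> else Im \<kappa>"
  have "(if s then XX i else YY i) \<kappa> = word G uu [(i, s, 1), (i, s, \<i>)] (?c \<kappa>)" for \<kappa>
  proof -
    have k: "\<kappa> = of_real (Re \<kappa>) * 1 + of_real (Im \<kappa>) * \<i>" by (simp add: complex_eq_iff)
    have "XX i \<kappa> = XX i (of_real (Re \<kappa>) * 1) \<otimes>\<^bsub>G\<^esub> XX i (of_real (Im \<kappa>) * \<i>)"
      "YY i \<kappa> = YY i (of_real (Re \<kappa>) * 1) \<otimes>\<^bsub>G\<^esub> YY i (of_real (Im \<kappa>) * \<i>)"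
      unfolding mult_G
      using sl2_triple.X_add[OF sl2[OF i], of "of_real (Re \<kappa>) * 1" "of_real (Im \<kappa>) * \<i>"]
        sl2_triple.Y_add[OF sl2[OF i], of "of_real (Re \<kappa>) * 1" "of_real (Im \<kappa>) * \<i>"] k KU by auto
    moreover have "XX i (of_real (Im \<kappa>) * \<i>) \<in> carrier G" "YY i (of_real (Im \<kappa>) * \<i>) \<in> carrier G"
      unfolding carrier_G by (rule XX_UG[OF i] YY_UG[OF i], simp add: KU)+
    ultimately show ?thesis by (cases s) (simp_all add: uu_def)
  qed
  moreover have "continuous_on UNIV ?c"
  proof (rule continuous_on_coordinatewise_then_product)
    fix n show "continuous_on UNIV (\<lambda>\<kappa>. ?c \<kappa> n)" by (cases "n = 0") (auto intro!: continuous_intros)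
  qed
  moreover have "[(i, s, 1), (i, s, \<i>)] \<in> lists JJ" using i False by (simp add: JJ_def units_def)
  ultimately show ?thesis by blast
qed

lemma liftable_unipotent:
  assumes i: "i \<in> I" and \<kappa>: "continuous_map Z euclidean \<kappa>" "\<And>z. z \<in> topspace Z \<Longrightarrow> \<kappa> z \<in> K"
  shows "W.liftable Z (\<lambda>z. XX i (\<kappa> z))" "W.liftable Z (\<lambda>z. YY i (\<kappa> z))"
proof -
  have "W.liftable Z (\<lambda>z. (if s then XX i else YY i) (\<kappa> z))" for s
  proof -
    obtain w c where w: "w \<in> lists JJ" "continuous_on UNIV c"
      "\<forall>\<kappa>\<in>K. (if s then XX i else YY i) \<kappa> = word G uu w (c \<kappa>)" using unipotent_word[OF i] by blast
    have "continuous_map Z euclidean (c \<circ> \<kappa>)"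
      by (rule continuous_map_compose[OF \<kappa>(1)]) (use w in simp)
    then show ?thesis using w \<kappa>(2) by (intro W.liftableI_word[OF w(1), of Z "c \<circ> \<kappa>"]) (simp_all del: K_simps)
  qed
  from this[of True] this[of False] show "W.liftable Z (\<lambda>z. XX i (\<kappa> z))" "W.liftable Z (\<lambda>z. YY i (\<kappa> z))" by simp_all
qed

lemma liftable_big_cell:
  assumes i: "i \<in> I" and g: "continuous_map Z (SL2_topology K) g" and c: "\<And>z. z \<in> topspace Z \<Longrightarrow> g z $ 2 $ 1 \<noteq> 0"
  shows "W.liftable Z (\<lambda>z. rho i (g z))"
proof -
  have g': "continuous_map Z euclidean g" and gc: "g z \<in> carrier (SL2 K)" if "z \<in> topspace Z" for z
    using g that topspace_SL2 by (auto simp: SL2_topology_def continuous_map_in_subtopology)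
  have gg: "continuous_map Z euclidean g" using g by (auto simp: SL2_topology_def continuous_map_in_subtopology)
  have ent: "continuous_map Z euclidean (\<lambda>z. g z $ p $ q)" for p q
  proof -
    have "continuous_map euclidean euclidean (\<lambda>M :: complex ^ 2 ^ 2. M $ p $ q)" by (simp, intro continuous_intros)
    from continuous_map_compose[OF gg this] show ?thesis by (simp add: o_def)
  qed
  have entK: "g z $ p $ q \<in> K" if "z \<in> topspace Z" for z p q using gc[OF that] by (simp add: SL2_def)
  have quot: "continuous_map Z euclidean (\<lambda>z. (g z $ p $ q - 1) / g z $ 2 $ 1)" for p q
  proof -
    have "continuous_map Z (prod_topology euclidean euclidean) (\<lambda>z. (g z $ p $ q, g z $ 2 $ 1))"
      using ent by (simp add: continuous_map_paired del: prod_topology_euclidean)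
    then have "continuous_map Z (top_of_set {x :: complex \<times> complex. snd x \<noteq> 0}) (\<lambda>z. (g z $ p $ q, g z $ 2 $ 1))"
      using c by (auto simp: continuous_map_in_subtopology)
    moreover have "continuous_map (top_of_set {x :: complex \<times> complex. snd x \<noteq> 0}) euclidean (\<lambda>x. (fst x - 1) / snd x)"
      by (simp, intro continuous_intros) auto
    ultimately show ?thesis using continuous_map_compose[of Z _ "\<lambda>z. (g z $ p $ q, g z $ 2 $ 1)" euclidean "\<lambda>x. (fst x - 1) / snd x"]
      by (simp add: o_def)
  qed
  have neg: "continuous_map Z euclidean (\<lambda>z. - g z $ 2 $ 1)"
  proof -
    have "continuous_map euclidean euclidean (\<lambda>x :: complex. - x)"
      unfolding continuous_map_iff_continuous2 by (intro continuous_intros)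
    from continuous_map_compose[OF ent this] show ?thesis by (simp add: o_def)
  qed
  have "W.liftable Z (\<lambda>z. XX i ((g z $ 1 $ 1 - 1) / g z $ 2 $ 1) \<otimes>\<^bsub>G\<^esub>
      (YY i (- g z $ 2 $ 1) \<otimes>\<^bsub>G\<^esub> XX i ((g z $ 2 $ 2 - 1) / g z $ 2 $ 1)))"
    by (intro W.liftable_mult liftable_unipotent[OF i] quot neg) (auto simp: entK)
  then show ?thesis
  proof (rule W.liftable_cong)
    fix z assume z: "z \<in> topspace Z"
    obtain a b c' d where M: "g z = mat2 a b c' d" "a \<in> K" "b \<in> K" "c' \<in> K" "d \<in> K" "a * d - b * c' = 1"
      using gc[OF z] by (rule SL2_cases)
    have c0: "c' \<noteq> 0" using c[OF z] M by simp
    have "rho i (g z) = rho i (mat2 1 ((a - 1) / c') 0 1 ** (mat2 1 0 c' 1 ** mat2 1 ((d - 1) / c') 0 1))"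
      unfolding M(1) SL2_big_cell[OF M(6) c0] ..
    also have "\<dots> = XX i ((a - 1) / c') \<otimes>\<^bsub>G\<^esub> (YY i (- c') \<otimes>\<^bsub>G\<^esub> XX i ((d - 1) / c'))"
      using M rho_mult[OF i] SL2_mult_closed[OF K] rank_one_hom_spec[OF i]
      by (simp add: mat2_SL2 del: mat2_mult)
    finally show "XX i ((g z $ 1 $ 1 - 1) / g z $ 2 $ 1) \<otimes>\<^bsub>G\<^esub>
      (YY i (- g z $ 2 $ 1) \<otimes>\<^bsub>G\<^esub> XX i ((g z $ 2 $ 2 - 1) / g z $ 2 $ 1)) = rho i (g z)"
      using M by simp
  qed
qed

text \<open>Two translates of the big cell cover SL(2, K). Where the lower left entry vanishes,
  multiplying by a lower unipotent matrix makes it nonzero, since it becomes the upper left entry;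
  the constant factor is then taken back as one more letter.\<close>

lemma liftable_rho:
  assumes i: "i \<in> I" shows "W.liftable (SL2_topology K) (rho i)"
proof (rule W.liftable_local)
  let ?Z = "SL2_topology K"
  fix M0 assume "M0 \<in> topspace ?Z"
  then have M0: "M0 \<in> carrier (SL2 K)" by (simp add: topspace_SL2)
  have op: "openin ?Z {M \<in> carrier (SL2 K). \<kappa> M \<noteq> 0}" if "continuous_on UNIV \<kappa>" for \<kappa> :: "complex ^ 2 ^ 2 \<Rightarrow> complex"
  proof -
    have "open (\<kappa> -` (- {0}))" using that by (intro open_vimage) auto
    then show ?thesis by (auto simp: SL2_topology_def openin_subtopology intro!: exI[of _ "\<kappa> -` (- {0})"])
  qed
  show "\<exists>V. openin ?Z V \<and> M0 \<in> V \<and> W.liftable (subtopology ?Z V) (rho i)"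
  proof (cases "M0 $ 2 $ 1 = 0")
    case False
    let ?V = "{M \<in> carrier (SL2 K). M $ 2 $ 1 \<noteq> 0}"
    have "W.liftable (subtopology ?Z ?V) (\<lambda>M. rho i M)"
      by (rule liftable_big_cell[OF i]) (auto intro: continuous_map_from_subtopology)
    moreover have "openin ?Z ?V" by (rule op) (intro continuous_intros)
    ultimately show ?thesis using M0 False by blast
  next
    case True
    let ?Y = "mat2 1 0 1 1" and ?Y' = "mat2 1 0 (- 1) 1"
    have Y: "?Y \<in> carrier (SL2 K)" "?Y' \<in> carrier (SL2 K)" by (simp_all add: mat2_SL2)
    let ?V = "{M \<in> carrier (SL2 K). (?Y ** M) $ 2 $ 1 \<noteq> 0}"
    have V: "openin ?Z ?V"
      by (rule op) (intro continuous_intros continuous_on_matrix_mult_left)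
    have "continuous_map ?Z ?Z (\<lambda>M. ?Y ** M)"
      using continuous_on_matrix_mult_left SL2_mult_closed[OF K Y(1)]
      by (auto simp: SL2_topology_def continuous_map_in_subtopology intro: continuous_on_subset)
    then have 1: "W.liftable (subtopology ?Z ?V) (\<lambda>M. rho i (?Y ** M))"
      by (intro liftable_big_cell[OF i]) (auto intro: continuous_map_from_subtopology)
    have 2: "W.liftable (subtopology ?Z ?V) (\<lambda>M. YY i 1)"
      by (rule liftable_unipotent[OF i]) auto
    have "W.liftable (subtopology ?Z ?V) (rho i)"
    proof (rule W.liftable_cong[OF W.liftable_mult[OF 2 1]])
      fix M assume "M \<in> topspace (subtopology ?Z ?V)"
      then have M: "M \<in> carrier (SL2 K)" by simp
      have "?Y' ** ?Y = mat 1" by (simp add: mat2_one)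
      then have "?Y' ** (?Y ** M) = M" by (simp add: matrix_mul_assoc)
      then have "rho i M = rho i ?Y' \<otimes>\<^bsub>G\<^esub> rho i (?Y ** M)" using rho_mult[OF i Y(2) SL2_mult_closed[OF K Y(1) M]] by simp
      also have "rho i ?Y' = YY i 1" using rank_one_hom_spec(3)[OF i, of "-1"] by simp
      finally show "YY i 1 \<otimes>\<^bsub>G\<^esub> rho i (?Y ** M) = rho i M" by simp
    qed
    moreover have "(?Y ** M0) $ 2 $ 1 \<noteq> 0"
      using M0 True by (elim SL2_cases) auto
    ultimately show ?thesis using V M0 by blast
  qed
qed

abbreviation "KP \<equiv> kac_peterson_topology K D"

text \<open>A word in one-parameter subgroups factors continuously through the corresponding product
  of rank-one groups, which gives one direction. For the other, the product map on matrices is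
  liftable, and openness of each \<open>rho i\<close> brings open boxes of matrices down to open
  boxes of group elements.\<close>

lemma openin_KP_iff: "openin KP U \<longleftrightarrow> U \<subseteq> carrier G \<and> (\<forall>w\<in>lists JJ. open {x. word G uu w x \<in> U})"
proof -
  let ?P = "\<lambda>is. product_topology (\<lambda>m. rank_one_topology K D (is ! m)) {..<length is}"
  let ?F = "\<lambda>is x. foldr (\<lambda>m g. x m \<otimes>\<^bsub>G\<^esub> g) [0..<length is] \<one>\<^bsub>G\<^esub>"
  have KP: "openin KP U \<longleftrightarrow> U \<subseteq> carrier G \<and> (\<forall>is\<in>lists I. openin (?P is) {x \<in> topspace (?P is). ?F is x \<in> U})"
    by (simp add: kac_peterson_topology_def openin_final_topology)
  show ?thesis
    unfolding KP
  proof (intro conj_cong HOL.refl iffI ballI)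
    fix w assume U: "\<forall>is\<in>lists I. openin (?P is) {x \<in> topspace (?P is). ?F is x \<in> U}" and w: "w \<in> lists JJ"
    define js where "js = map fst w"
    have wJ: "w ! m \<in> JJ" if "m < length w" for m using w nth_mem[OF that] unfolding in_lists_conv_set by blast
    have "fst j \<in> I" if "j \<in> JJ" for j using that by (auto simp: JJ_def)
    then have js: "js \<in> lists I" using w unfolding js_def in_lists_conv_set by auto
    let ?\<Phi> = "\<lambda>x. \<lambda>m\<in>{..<length js}. uu (w ! m) (x m)"
    have comp: "continuous_map euclidean (rank_one_topology K D (js ! m)) (\<lambda>x :: nat \<Rightarrow> real. uu (w ! m) (x m))" if m: "m < length js" for m
    proof -
      obtain i s z where wm: "w ! m = (i, s, z)" "i \<in> I" "z \<in> units"
        using wJ[of m] m by (cases "w ! m") (auto simp: js_def JJ_def)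
      have jm: "js ! m = i" using m wm by (simp add: js_def)
      let ?M = "\<lambda>r :: real. if s then mat2 1 (of_real r * z) 0 1 else mat2 1 0 (- (of_real r * z)) 1"
      have "continuous_on UNIV (\<lambda>x :: nat \<Rightarrow> real. ?M (x m))"
        by (cases s) (auto intro!: continuous_on_mat2 continuous_intros)
      moreover have "?M r \<in> carrier (SL2 K)" for r using of_real_units[OF wm(3), of r] by (auto simp: mat2_SL2)
      ultimately have "continuous_map euclidean (SL2_topology K) (\<lambda>x :: nat \<Rightarrow> real. ?M (x m))"
        by (auto simp: SL2_topology_def continuous_map_in_subtopology)
      from continuous_map_compose[OF this rho_continuous[OF wm(2)]]
      show ?thesis
        unfolding jm using rank_one_hom_spec(2,3)[OF wm(2)] of_real_units[OF wm(3)] wm(1)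
        by (auto simp: o_def uu_def split: if_splits elim!: continuous_map_eq)
    qed
    have \<Phi>: "continuous_map euclidean (?P js) ?\<Phi>"
      unfolding continuous_map_componentwise using comp by auto
    from openin_continuous_map_preimage[OF this, of "{x \<in> topspace (?P js). ?F js x \<in> U}"]
    have "open {x. ?\<Phi> x \<in> {x \<in> topspace (?P js). ?F js x \<in> U}}" using U js by simp
    moreover have "?\<Phi> x \<in> topspace (?P js)" for x
      by (rule subsetD[OF continuous_map_image_subset_topspace[OF \<Phi>] imageI]) simp
    moreover have "?F js (?\<Phi> x) = word G uu w x" for x
      using foldr_word[of w "?\<Phi> x" uu x G] by (simp add: js_def)
    ultimately show "open {x. word G uu w x \<in> U}" by simp
  next
    fix js assume U: "\<forall>w\<in>lists JJ. open {x. word G uu w x \<in> U}" and js: "js \<in> lists I"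
    define n where "n = length js"
    let ?Q = "product_topology (\<lambda>m. SL2_topology K) {..<n}"
    have jsI: "js ! m \<in> I" if "m < n" for m using js that by (auto simp: n_def)
    have lift: "W.liftable ?Q (\<lambda>M. foldr (\<lambda>m g. rho (js ! m) (M m) \<otimes>\<^bsub>G\<^esub> g) ks \<one>\<^bsub>G\<^esub>)" if "set ks \<subseteq> {..<n}" for ks
      using that
    proof (induction ks)
      case Nil then show ?case using W.liftable_one by simp
    next
      case (Cons k ks)
      then have k: "k < n" and ks: "set ks \<subseteq> {..<n}" by auto
      have "W.liftable ?Q (\<lambda>M. rho (js ! k) (M k))"
        by (rule W.liftable_compose[OF liftable_rho[OF jsI[OF k]]]) (use k in \<open>auto intro: continuous_map_product_projection\<close>)
      then show ?case using W.liftable_mult Cons.IH[OF ks] by simp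
    qed
    let ?R = "\<lambda>M. ?F js (\<lambda>m. rho (js ! m) (M m))"
    have S': "openin ?Q {M \<in> topspace ?Q. ?R M \<in> U}"
      using W.liftable_open[OF lift[of "[0..<n]"]] U by (simp add: n_def atLeast0LessThan)
    show "openin (?P js) {x \<in> topspace (?P js). ?F js x \<in> U}"
    proof (subst openin_subopen, clarify)
      fix x assume x: "x \<in> topspace (?P js)" "?F js x \<in> U"
      have xm: "x m \<in> rho (js ! m) ` carrier (SL2 K)" if "m < n" for m
      proof -
        have "x m \<in> topspace (rank_one_topology K D (js ! m))"
          using x(1) that unfolding topspace_product_topology n_def by blast
        then show ?thesis by (simp add: topspace_rank_one[OF jsI[OF that]] rho_image[OF jsI[OF that]])
      qed
      then have "\<forall>m. \<exists>A. m < n \<longrightarrow> A \<in> carrier (SL2 K) \<and> x m = rho (js ! m) A" unfolding image_iff by blast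
      then obtain M0 where M0: "\<And>m. m < n \<Longrightarrow> M0 m \<in> carrier (SL2 K) \<and> x m = rho (js ! m) (M0 m)"
        unfolding choice_iff by blast
      define M where "M = (\<lambda>m\<in>{..<n}. M0 m)"
      have Mt: "M \<in> topspace ?Q" using M0 by (auto simp: M_def topspace_SL2)
      have "?R M = ?F js x" by (rule foldr_cong_upt) (simp add: M0 M_def n_def[symmetric])
      then have "M \<in> {M \<in> topspace ?Q. ?R M \<in> U}" using Mt x by simp
      from product_topology_open_contains_basis[OF S' this]
      obtain V where V: "M \<in> PiE {..<n} V" "\<And>m. openin (SL2_topology K) (V m)" "PiE {..<n} V \<subseteq> {M \<in> topspace ?Q. ?R M \<in> U}"
        by blast
      \<comment> \<open>The chosen matrices represent the factors of x; the image of a box around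
        them is a neighbourhood of x, and every point of it has representatives in the box.\<close>
      let ?B = "PiE {..<length js} (\<lambda>m. rho (js ! m) ` V m)"
      have "openin (?P js) ?B"
        by (rule openin_PiE_gen[THEN iffD2], rule disjI2) (use jsI V(2) rho_open in \<open>auto simp: n_def\<close>)
      moreover have "x \<in> ?B"
      proof (rule PiE_I)
        fix m assume m: "m \<in> {..<length js}"
        then have "M0 m \<in> V m" using PiE_mem[OF V(1), of m] by (simp add: M_def n_def)
        then show "x m \<in> rho (js ! m) ` V m" using M0[of m] m by (simp add: n_def)
      next
        fix m assume "m \<notin> {..<length js}"
        then show "x m = undefined" using x(1) unfolding topspace_product_topology by (rule PiE_arb[rotated])
      qed
      moreover have "?B \<subseteq> {x \<in> topspace (?P js). ?F js x \<in> U}"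
      proof
        fix y assume y: "y \<in> ?B"
        then have "y m \<in> rho (js ! m) ` V m" if "m < n" for m using that PiE_mem[OF y, of m] by (simp add: n_def)
        then have "\<forall>m. \<exists>A. m < n \<longrightarrow> A \<in> V m \<and> y m = rho (js ! m) A" unfolding image_iff by blast
        then obtain N0 where N0: "\<And>m. m < n \<Longrightarrow> N0 m \<in> V m \<and> y m = rho (js ! m) (N0 m)"
          unfolding choice_iff by blast
        define N where "N = (\<lambda>m\<in>{..<n}. N0 m)"
        have "N \<in> PiE {..<n} V" using N0 by (simp add: N_def)
        then have "?R N \<in> U" using V(3) by auto
        moreover have "?R N = ?F js y" by (rule foldr_cong_upt) (simp add: N0 N_def n_def[symmetric])
        moreover have "y \<in> topspace (?P js)" using \<open>openin (?P js) ?B\<close> y openin_subset by blast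
        ultimately show "y \<in> {x \<in> topspace (?P js). ?F js x \<in> U}" by simp
      qed
      ultimately show "\<exists>T. openin (?P js) T \<and> x \<in> T \<and> T \<subseteq> {x \<in> topspace (?P js). ?F js x \<in> U}" by blast
    qed
  qed
qed

subsection \<open>Matrix coefficients\<close>

definition vec :: "'i \<Rightarrow> bool \<Rightarrow> ('i, 'l) km_elt" where "vec i s = (if s then e i else f i)"

lemma uu_exp: "i \<in> I \<Longrightarrow> uu (i, s, z) r = exp_ad L (of_real r * z) (vec i s)"
  by (simp add: uu_def vec_def XX_def YY_def)

lemma vec_nilpotent: "i \<in> I \<Longrightarrow> locally_nilpotent (vec i s)"
  by (simp add: vec_def e_nilpotent f_nilpotent)

lemma aut_dual:
  assumes \<sigma>: "\<sigma> \<in> lie_auts K L" and \<xi>: "\<xi> \<in> dual" shows "(\<lambda>v. \<xi> (\<sigma> v)) \<in> dual"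
  unfolding dual_def
  by (auto simp: aut_plus[OF \<sigma>] aut_scale[OF \<sigma>] aut_closed[OF \<sigma>] dual_plus[OF \<xi>] dual_scale[OF \<xi>])

lemma word_aut: "w \<in> lists JJ \<Longrightarrow> word G uu w x \<in> lie_auts K L"
  using W.word_closed[of w x] UG_aut by (simp add: carrier_G)

text \<open>The last letter acts first on v, so the induction removes letters from the end. The
  number of terms in its exponential depends on v alone, so it contributes a polynomial in its
  parameter with smaller matrix coefficients as coefficients.\<close>

lemma matrix_coefficient_word:
  assumes "\<xi> \<in> dual"
  shows "w \<in> lists JJ \<Longrightarrow> v \<in> carrier L \<Longrightarrow> continuous_on UNIV (\<lambda>x. \<xi> (word G uu w x v))"
proof (induction w arbitrary: v rule: rev_induct)
  case Nil
  then show ?case by (simp add: one_G autG_one)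
next
  case (snoc j w)
  then obtain i s z where j: "j = (i, s, z)" "i \<in> I" "z \<in> units" and w: "w \<in> lists JJ"
    by (auto simp: JJ_def)
  have jJ: "[j] \<in> lists JJ" using snoc.prems by simp
  have x: "vec i s \<in> carrier L" using vec_nilpotent[OF j(2)] by simp
  obtain N where N: "adp N (vec i s) v = lzero L"
    using vec_nilpotent[OF j(2)] snoc.prems(2) unfolding locally_nilpotent_def by blast
  have "\<xi> (word G uu (w @ [j]) x' v) =
      (\<Sum>n<N. (of_real (x' (length w)) * z) ^ n / fact n * \<xi> (word G uu w x' (adp n (vec i s) v)))" for x'
  proof -
    let ?r = "of_real (x' (length w)) * z"
    have r: "?r \<in> K" using of_real_units[OF j(3)] .
    have "word G uu [j] (\<lambda>n. x' (n + length w)) = exp_ad L ?r (vec i s)"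
      using W.u_closed[of j "x' (length w)"] snoc.prems(1) by (simp add: j(1) uu_exp[OF j(2)])
    moreover have "exp_ad L ?r (vec i s) \<in> lie_auts K L" by (rule exp_ad_aut[OF r vec_nilpotent[OF j(2)]])
    ultimately have "word G uu (w @ [j]) x' v = word G uu w x' (exp_ad L ?r (vec i s) v)"
      using W.word_append[OF w jJ, of x'] autG_mult_apply[OF word_aut[OF w] _ snoc.prems(2)] by (simp add: mult_G del: autG_mult)
    then show ?thesis
      using dual_exp_ad[OF aut_dual[OF word_aut[OF w, of x'] assms] r x snoc.prems(2) N] by simp
  qed
  moreover have "continuous_on UNIV (\<lambda>x' :: nat \<Rightarrow> real. \<Sum>n<N. (of_real (x' (length w)) * z) ^ n / fact n * \<xi> (word G uu w x' (adp n (vec i s) v)))"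
    using snoc.IH[OF w] x snoc.prems(2)
    by (intro continuous_intros) auto
  ultimately show ?case by simp
qed

lemma topspace_KP: "topspace KP = carrier G"
proof
  show "topspace KP \<subseteq> carrier G" using openin_KP_iff openin_topspace by blast
  have "openin KP (carrier G)" by (auto simp: openin_KP_iff W.word_closed)
  then show "carrier G \<subseteq> topspace KP" by (rule openin_subset)
qed

lemma matrix_coefficient_continuous:
  assumes \<xi>: "\<xi> \<in> dual" and v: "v \<in> carrier L"
  shows "continuous_map KP euclidean (\<lambda>g. \<xi> (g v))"
  unfolding continuous_map_def
proof (intro conjI allI impI)
  fix S :: "complex set" assume "openin euclidean S"
  then have S: "open S" by simp
  have "open {x. word G uu w x \<in> {g \<in> carrier G. \<xi> (g v) \<in> S}}" if w: "w \<in> lists JJ" for w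
  proof -
    have "open ((\<lambda>x. \<xi> (word G uu w x v)) -` S)"
      by (rule open_vimage[OF S matrix_coefficient_word[OF \<xi> w v]])
    then show ?thesis using W.word_closed[OF w] by (simp add: vimage_def)
  qed
  then show "openin KP {g \<in> topspace KP. \<xi> (g v) \<in> S}" by (auto simp: openin_KP_iff topspace_KP)
qed auto

lemma Hausdorff_KP: "Hausdorff_space KP"
  unfolding Hausdorff_space_def
proof (intro allI impI)
  fix g h assume gh: "g \<in> topspace KP \<and> h \<in> topspace KP \<and> g \<noteq> h"
  then have a: "g \<in> lie_auts K L" "h \<in> lie_auts K L" using UG_aut by (auto simp: topspace_KP carrier_G)
  then obtain v where v: "v \<in> carrier L" "g v \<noteq> h v" using aut_ext gh by blast
  then obtain \<xi> where \<xi>: "\<xi> \<in> dual" "\<xi> (g v) \<noteq> \<xi> (h v)"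
    using eqI_dual[of "g v" "h v"] aut_closed[OF a(1)] aut_closed[OF a(2)] by blast
  then obtain A B where AB: "open A" "open B" "\<xi> (g v) \<in> A" "\<xi> (h v) \<in> B" "A \<inter> B = {}"
    using hausdorff[OF \<xi>(2)] by blast
  have "openin KP {g \<in> topspace KP. \<xi> (g v) \<in> A}" "openin KP {g \<in> topspace KP. \<xi> (g v) \<in> B}"
    by (rule openin_continuous_map_preimage[OF matrix_coefficient_continuous[OF \<xi>(1) v(1)]], simp add: AB)+
  then show "\<exists>U V. openin KP U \<and> openin KP V \<and> g \<in> U \<and> h \<in> V \<and> disjnt U V"
    using gh AB by (intro exI[of _ "{g \<in> topspace KP. \<xi> (g v) \<in> A}"] exI[of _ "{g \<in> topspace KP. \<xi> (g v) \<in> B}"])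
      (auto simp: disjnt_def)
qed

lemma unipotents_cases:
  assumes "g \<in> unipotents"
  obtains i r s where "i \<in> I" "r \<in> K" "g = (if s then XX i else YY i) r"
proof -
  obtain i r where "i \<in> I" "r \<in> K" "g = XX i r \<or> g = YY i r" using assms unfolding unipotents_def by blast
  then show thesis using that[of i r True] that[of i r False] by (elim disjE) simp_all
qed

lemma UG_words: "g \<in> UG \<Longrightarrow> \<exists>w\<in>lists JJ. \<exists>x. g = word G uu w x"
  unfolding UG_def
proof (induction rule: generate.induct)
  case one
  show ?case by (intro bexI[of _ "[]"]) (simp_all add: one_G)
next
  case (incl g)
  then obtain i r s where "i \<in> I" "r \<in> K" "g = (if s then XX i else YY i) r"
    using unipotents_cases by blast
  then show ?case using unipotent_word[of i s] by blast
next
  case (inv g)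
  then obtain i r s where g: "i \<in> I" "r \<in> K" "g = (if s then XX i else YY i) r"
    using unipotents_cases by blast
  then have "g \<in> UG" using XX_UG YY_UG by auto
  then have "inv\<^bsub>autG\<^esub> g = inv\<^bsub>G\<^esub> g" unfolding G_eq by (simp add: A.m_inv_consistent[OF subgroup_UG])
  also have "\<dots> = (if s then XX i else YY i) (- r)" using g inv_XX inv_YY by auto
  finally show ?case using unipotent_word[OF g(1), of s] g(2) by (metis K_simps(4))
next
  case (eng g h)
  then show ?case using W.word_join by (metis mult_G append_in_lists_conv)
qed

sublocale W: one_param_group G JJ uu KP
proof unfold_locales
  show "countable JJ" using finite_I by (auto simp: JJ_def units_def intro: countable_finite)
  show "\<exists>w\<in>lists JJ. \<exists>x. g = word G uu w x" if "g \<in> carrier G" for g using UG_words that carrier_G by simp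
qed (auto simp: openin_KP_iff Hausdorff_KP)

text \<open>The parameter is visible in the image of the coroot, as exp(r ad e_i) sends h_i to h_i -
  2 r e_i. Let \<rho> read it off through a functional that does not vanish on the root vector. The
  subgroup is then the set of all g equal to its own member with parameter \<rho>(g), a closed
  condition since matrix coefficients are continuous.\<close>

lemma closed_one_param:
  assumes "j \<in> JJ" shows "W.closed_one_param j"
proof -
  obtain i s z where j: "j = (i, s, z)" "i \<in> I" "z \<in> units" using assms by (auto simp: JJ_def)
  have z0: "z \<noteq> 0" using j(3) by (auto simp: units_def split: if_splits)
  have xn: "locally_nilpotent (vec i s)" by (rule vec_nilpotent[OF j(2)])
  then have x: "vec i s \<in> carrier L" by simp
  have hic: "hi i \<in> carrier L" using hi_dual j by simp
  define b :: complex where "b = (if s then -2 else 2)"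
  have b: "b \<in> K" "b \<noteq> 0" by (auto simp: b_def)
  have br: "lbracket L (vec i s) (hi i) = lscale L b (vec i s)"
    using j by (simp add: vec_def b_def e_hh f_hh hi_dual pairing ca_diag)
  have "vec i s \<noteq> lzero L" using e_f_nonzero[OF j(2)] by (simp add: vec_def)
  then obtain \<xi> where \<xi>: "\<xi> \<in> dual" "\<xi> (vec i s) \<noteq> 0" using dual_nonzero[OF x] by blast
  \<comment> \<open>Outside the subgroup the quotient may be any complex number; the real part makes
    \<rho> real valued on the whole group.\<close>
  define \<rho> where "\<rho> g = Re ((\<xi> (g (hi i)) - \<xi> (hi i)) / (b * \<xi> (vec i s) * z))" for g
  have \<rho>u: "\<rho> (uu j r) = r" for r
  proof -
    have r: "of_real r * z \<in> K" by (rule of_real_units[OF j(3)])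
    have "uu j r (hi i) = lplus L (hi i) (lscale L (of_real r * z) (lbracket L (vec i s) (hi i)))"
      unfolding j(1) uu_exp[OF j(2)] using r x hic b by (intro exp_ad_2) (simp_all add: br br_scale_right br_self)
    then have "\<xi> (uu j r (hi i)) = \<xi> (hi i) + of_real r * z * (b * \<xi> (vec i s))"
      using r x hic b by (simp add: br dual_simps[OF \<xi>(1)])
    then have "(\<xi> (uu j r (hi i)) - \<xi> (hi i)) / (b * \<xi> (vec i s) * z) = of_real r" using b \<xi> z0 by simp
    then show ?thesis by (simp add: \<rho>_def)
  qed
  have \<rho>c: "continuous_map KP euclideanreal \<rho>"
  proof -
    have "continuous_map euclidean euclideanreal (\<lambda>y. Re ((y - \<xi> (hi i)) / (b * \<xi> (vec i s) * z)))"
      using b \<xi> z0 by (simp, intro continuous_intros) auto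
    from continuous_map_compose[OF matrix_coefficient_continuous[OF \<xi>(1) hic] this]
    show ?thesis by (simp add: o_def \<rho>_def[abs_def])
  qed
  have poly: "continuous_on UNIV (\<lambda>r. \<eta> (uu j r v))" if "\<eta> \<in> dual" "v \<in> carrier L" for \<eta> v
  proof -
    have "continuous_on UNIV (\<lambda>r. (\<lambda>x. \<eta> (word G uu [j] x v)) ((\<lambda>r (_::nat). r) r))"
      by (rule continuous_on_compose2[OF matrix_coefficient_word[OF that(1) _ that(2), of "[j]"]])
        (use assms in \<open>auto intro: continuous_on_coordinatewise_then_product\<close>)
    then show ?thesis using W.u_closed[OF assms] by simp
  qed
  have "closedin KP (range (uu j))"
  proof -
    let ?F = "\<lambda>(\<eta>, v) g. \<eta> (g v) - \<eta> (uu j (\<rho> g) v)"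
    have F: "continuous_map KP euclidean (?F p)" if pD: "p \<in> dual \<times> carrier L" for p
    proof -
      obtain \<eta> v where p: "p = (\<eta>, v)" "\<eta> \<in> dual" "v \<in> carrier L" by (rule SigmaE[OF pD])
      have "continuous_map KP euclidean ((\<lambda>r. \<eta> (uu j r v)) \<circ> \<rho>)"
        by (rule continuous_map_compose[OF \<rho>c]) (simp add: poly[OF p(2,3)])
      then have "continuous_map KP (prod_topology euclidean euclidean) (\<lambda>g. (\<eta> (g v), \<eta> (uu j (\<rho> g) v)))"
        using matrix_coefficient_continuous[OF p(2,3)] by (simp add: continuous_map_paired o_def del: prod_topology_euclidean)
      moreover have "continuous_map (prod_topology euclidean euclidean) euclidean (\<lambda>y :: complex \<times> complex. fst y - snd y)"
        by (simp, intro continuous_intros)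
      ultimately have "continuous_map KP euclidean ((\<lambda>y :: complex \<times> complex. fst y - snd y) \<circ> (\<lambda>g. (\<eta> (g v), \<eta> (uu j (\<rho> g) v))))"
        by (rule continuous_map_compose)
      then show ?thesis by (simp add: p(1) o_def)
    qed
    have "topspace KP - range (uu j) = (\<Union>p\<in>dual \<times> carrier L. {g \<in> topspace KP. ?F p g \<in> - {0}})"
    proof
      show "topspace KP - range (uu j) \<subseteq> (\<Union>p\<in>dual \<times> carrier L. {g \<in> topspace KP. ?F p g \<in> - {0}})"
      proof
        fix g assume g: "g \<in> topspace KP - range (uu j)"
        then have a: "g \<in> lie_auts K L" "uu j (\<rho> g) \<in> lie_auts K L"
          using UG_aut W.u_closed[OF assms] by (auto simp: topspace_KP carrier_G)
        obtain v where v: "v \<in> carrier L" "g v \<noteq> uu j (\<rho> g) v" using aut_ext[OF a] g by blast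
        then obtain \<eta> where "\<eta> \<in> dual" "\<eta> (g v) \<noteq> \<eta> (uu j (\<rho> g) v)"
          using eqI_dual[of "g v" "uu j (\<rho> g) v"] aut_closed[OF a(1)] aut_closed[OF a(2)] by blast
        then show "g \<in> (\<Union>p\<in>dual \<times> carrier L. {g \<in> topspace KP. ?F p g \<in> - {0}})"
          using v g by (intro UN_I[of "(\<eta>, v)"]) auto
      qed
      show "(\<Union>p\<in>dual \<times> carrier L. {g \<in> topspace KP. ?F p g \<in> - {0}}) \<subseteq> topspace KP - range (uu j)"
        using \<rho>u by auto
    qed
    moreover have "openin KP \<dots>"
    proof (intro openin_Union ballI, elim imageE)
      fix S p assume p: "p \<in> dual \<times> carrier L" and S: "S = {g \<in> topspace KP. ?F p g \<in> - {0}}"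
      have "openin euclidean (- {0 :: complex})" by (simp add: open_Compl)
      then show "openin KP S" unfolding S by (rule openin_continuous_map_preimage[OF F[OF p]])
    qed
    moreover have "range (uu j) \<subseteq> topspace KP" using W.u_closed[OF assms] by (auto simp: topspace_KP)
    ultimately show ?thesis by (simp add: closedin_def)
  qed
  then show ?thesis unfolding W.closed_one_param_def using \<rho>c \<rho>u by blast
qed

end

theorem corollary7:
  fixes K1 K2 :: "complex set"
    and D1 :: "('i1, 'l1::ab_group_add) root_datum"
    and D2 :: "('i2, 'l2::ab_group_add) root_datum"
    and \<phi> :: "('i1, 'l1) km_map \<Rightarrow> ('i2, 'l2) km_map"
  assumes "K1 \<in> {\<real>, UNIV}" and "K2 \<in> {\<real>, UNIV}"
    and "kac_moody_root_datum D1" and "kac_moody_root_datum D2"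
    and "generated_by_root_subgroups K1 D1" and "generated_by_root_subgroups K2 D2"
    and "measurable_hom (adjoint_km_group K1 D1) (kac_peterson_topology K1 D1)
           (adjoint_km_group K2 D2) (kac_peterson_topology K2 D2) \<phi>"
  shows "continuous_map (kac_peterson_topology K1 D1) (kac_peterson_topology K2 D2) \<phi>"
proof -
  interpret M1: km_gen K1 D1 using assms by unfold_locales
  interpret M2: km_gen K2 D2 using assms by unfold_locales
  show ?thesis
    by (rule measurable_hom_continuous[OF M1.W.one_param_group_axioms M2.W.one_param_group_axioms
        M1.closed_one_param assms(7)])
qed

end
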